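(* Let $\Bbbk$ be an algebraically closed field of characteristic zero. Let $A=A(\alpha,\beta)$ be a graded down-up algebra over $\Bbbk$ with weights $\deg x=n$, $\deg y=m$ and $\beta\neq 0$, where $m\ge n>1$ and $\gcd(n,m)=1$, and let $\nabla A$ be its Beilinson algebra. Then the dimensions of the Hochschild cohomology groups $\mathrm{HH}^r(\nabla A)$ are as follows: \begin{itemize} \item $\dim_{\Bbbk}\mathrm{HH}^0(\nabla A)=1$; \item $\dim_{\Bbbk}\mathrm{HH}^1(\nabla A)=2$ if $n+m$ is even and $\alpha=0$, and $\dim_{\Bbbk}\mathrm{HH}^1(\nabla A)=1$ if $n+m$ is odd or $\alpha\ne 0$; \item $\dim_{\Bbbk}\mathrm{HH}^2(\nabla A)=\begin{cases} m+5 & \text{if } n=2,\ n+m \text{ is even, and } \alpha=0,\\ m+4 & \text{if } n=2 \text{ and } (n+m \text{ is odd or } \alpha\neq 0),\\ n+m+1 & \text{if } n\ge 3,\ n+m\text{ is even, and }\alpha=0,\\ n+m & \text{if } n\ge 3 \text{ and } (n+m\text{ is odd or }\alpha\ne 0);\end{cases}$ \item $\dim_{\Bbbk}\mathrm{HH}^r(\nabla A)=0$ for $r\ge 3$. \end{itemize}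
   Context: For $\alpha,\beta\in\Bbbk$ and positive integers $n,m$, the graded down-up algebra with weights $(n,m)$ is the graded $\Bbbk$-algebra $A(\alpha,\beta)=\Bbbk\langle x,y\rangle/(x^2y-\beta yx^2-\alpha xyx,\ xy^2-\beta y^2x-\alpha yxy)$ with $\deg x=n$, $\deg y=m$. If $\beta\neq0$ it is a $3$-dimensional noetherian AS-regular algebra with Gorenstein parameter $\ell=2(n+m)$. The Beilinson algebra $\nabla A$ is the algebra of upper triangular $\ell\times\ell$ matrices $(a_{ij})$, $\ell=2(n+m)$, with $a_{ij}\in A_{j-i}$ for $i\le j$ (and $a_{ij}=0$ for $i>j$), with multiplication $(a_{ij})(b_{ij})=\big(\sum_{r}a_{rj}b_{ir}\big)$. For a $\Bbbk$-algebra $B$, $\mathrm{HH}^r(B)=\mathrm{Ext}^r_{B^{\mathrm e}}(B,B)$ with $B^{\mathrm e}=B^{\mathrm{op}}\otimes_{\Bbbk}B$. *)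

theory Defs
  imports
    "HOL-Algebra.QuotRing"
    "HOL-Computational_Algebra.Polynomial"
    "HOL-Library.Poly_Mapping"
    "Jordan_Normal_Form.VS_Connect"
begin

text \<open>
  Associative, not necessarily commutative algebras over a field \<open>'k\<close> (a type of class
  \<^class>\<open>field\<close>) and modules are records of type \<^typ>\<open>('k, 'a) module\<close>.  In records that are
  only modules the components \<open>mult\<close> and \<open>one\<close> carry no meaning.
\<close>

section \<open>Algebras\<close>

text \<open>
  Quotient of an algebra by a two-sided ideal or of a vector space by a subspace; scalars act on
  cosets in the same style in which \<^const>\<open>rcoset_mult\<close> multiplies them.
\<close>

definition quot_algebra :: "('k, 'a) module \<Rightarrow> 'a set \<Rightarrow> ('k, 'a set) module" where
  "quot_algebra A I =
    \<lparr>carrier = carrier (A Quot I), mult = mult (A Quot I), one = one (A Quot I),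
     zero = zero (A Quot I), add = add (A Quot I),
     smult = (\<lambda>c U. \<Union>u\<in>U. I +>\<^bsub>A\<^esub> (c \<odot>\<^bsub>A\<^esub> u))\<rparr>"

definition op_algebra :: "('k, 'a) module \<Rightarrow> ('k, 'a) module" where
  "op_algebra A = A\<lparr>mult := (\<lambda>a b. b \<otimes>\<^bsub>A\<^esub> a)\<rparr>"

text \<open>
  The tensor product over \<open>'k\<close> is the free vector space on pairs modulo the span of the
  bilinearity relations, with the product \<open>(a \<otimes> b)(a' \<otimes> b') = aa' \<otimes> bb'\<close>.
\<close>

definition pair_algebra ::
    "('k::field, 'a) module \<Rightarrow> ('k, 'b) module \<Rightarrow> ('k, ('a \<times> 'b) \<Rightarrow>\<^sub>0 'k) module" where
  "pair_algebra A B =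
    \<lparr>carrier = {f. Poly_Mapping.keys f \<subseteq> carrier A \<times> carrier B},
     mult = (\<lambda>f g. \<Sum>p\<in>Poly_Mapping.keys f. \<Sum>q\<in>Poly_Mapping.keys g.
       Poly_Mapping.single (fst p \<otimes>\<^bsub>A\<^esub> fst q, snd p \<otimes>\<^bsub>B\<^esub> snd q) (Poly_Mapping.lookup f p * Poly_Mapping.lookup g q)),
     one = Poly_Mapping.single (\<one>\<^bsub>A\<^esub>, \<one>\<^bsub>B\<^esub>) 1,
     zero = 0,
     add = (+),
     smult = (\<lambda>c. Poly_Mapping.map ((*) c))\<rparr>"

definition bilinear_relations ::
    "('k::field, 'a) module \<Rightarrow> ('k, 'b) module \<Rightarrow> (('a \<times> 'b) \<Rightarrow>\<^sub>0 'k) set" where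
  "bilinear_relations A B =
    {Poly_Mapping.single (a \<oplus>\<^bsub>A\<^esub> a', b) 1 - Poly_Mapping.single (a, b) 1 - Poly_Mapping.single (a', b) 1
      | a a' b. a \<in> carrier A \<and> a' \<in> carrier A \<and> b \<in> carrier B} \<union>
    {Poly_Mapping.single (a, b \<oplus>\<^bsub>B\<^esub> b') 1 - Poly_Mapping.single (a, b) 1 - Poly_Mapping.single (a, b') 1
      | a b b'. a \<in> carrier A \<and> b \<in> carrier B \<and> b' \<in> carrier B} \<union>
    {Poly_Mapping.single (c \<odot>\<^bsub>A\<^esub> a, b) 1 - Poly_Mapping.single (a, b) c
      | c a b. a \<in> carrier A \<and> b \<in> carrier B} \<union>
    {Poly_Mapping.single (a, c \<odot>\<^bsub>B\<^esub> b) 1 - Poly_Mapping.single (a, b) c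
      | c a b. a \<in> carrier A \<and> b \<in> carrier B}"

definition tensor_algebra ::
    "('k::field, 'a) module \<Rightarrow> ('k, 'b) module \<Rightarrow> ('k, (('a \<times> 'b) \<Rightarrow>\<^sub>0 'k) set) module" where
  "tensor_algebra A B =
    quot_algebra (pair_algebra A B)
      (LinearCombinations.module.span class_ring (pair_algebra A B) (bilinear_relations A B))"

definition enveloping_algebra ::
    "('k::field, 'b) module \<Rightarrow> ('k, (('b \<times> 'b) \<Rightarrow>\<^sub>0 'k) set) module" where
  "enveloping_algebra B = tensor_algebra (op_algebra B) B"


section \<open>Right modules and Ext\<close>

text \<open>
  For a right \<open>R\<close>-module \<open>M\<close>, the term \<open>r \<odot>\<^bsub>M\<^esub> x\<close> denotes the right action \<open>x \<cdot> r\<close>.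
\<close>

locale right_module = R?: ring R + M?: abelian_group M
  for R :: "('r, 's) ring_scheme" (structure) and M :: "('r, 'm, 't) module_scheme" (structure) +
  assumes act_closed: "\<lbrakk>r \<in> carrier R; x \<in> carrier M\<rbrakk> \<Longrightarrow> r \<odot>\<^bsub>M\<^esub> x \<in> carrier M"
    and act_distr_ring: "\<lbrakk>r \<in> carrier R; s \<in> carrier R; x \<in> carrier M\<rbrakk> \<Longrightarrow>
      (r \<oplus>\<^bsub>R\<^esub> s) \<odot>\<^bsub>M\<^esub> x = r \<odot>\<^bsub>M\<^esub> x \<oplus>\<^bsub>M\<^esub> s \<odot>\<^bsub>M\<^esub> x"
    and act_distr_module: "\<lbrakk>r \<in> carrier R; x \<in> carrier M; y \<in> carrier M\<rbrakk> \<Longrightarrow>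
      r \<odot>\<^bsub>M\<^esub> (x \<oplus>\<^bsub>M\<^esub> y) = r \<odot>\<^bsub>M\<^esub> x \<oplus>\<^bsub>M\<^esub> r \<odot>\<^bsub>M\<^esub> y"
    and act_mult: "\<lbrakk>r \<in> carrier R; s \<in> carrier R; x \<in> carrier M\<rbrakk> \<Longrightarrow>
      (r \<otimes>\<^bsub>R\<^esub> s) \<odot>\<^bsub>M\<^esub> x = s \<odot>\<^bsub>M\<^esub> (r \<odot>\<^bsub>M\<^esub> x)"
    and act_one: "x \<in> carrier M \<Longrightarrow> \<one>\<^bsub>R\<^esub> \<odot>\<^bsub>M\<^esub> x = x"

definition free_right_module :: "('r, 's) ring_scheme \<Rightarrow> 'i set \<Rightarrow> ('r, 'i \<Rightarrow> 'r) module" where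
  "free_right_module R X =
    \<lparr>carrier = {f. (\<forall>i\<in>X. f i \<in> carrier R) \<and> (\<forall>i. i \<notin> X \<longrightarrow> f i = \<zero>\<^bsub>R\<^esub>) \<and> finite {i. f i \<noteq> \<zero>\<^bsub>R\<^esub>}},
     mult = (\<lambda>f g i. \<zero>\<^bsub>R\<^esub>),
     one = (\<lambda>i. \<zero>\<^bsub>R\<^esub>),
     zero = (\<lambda>i. \<zero>\<^bsub>R\<^esub>),
     add = (\<lambda>f g i. f i \<oplus>\<^bsub>R\<^esub> g i),
     smult = (\<lambda>r f i. f i \<otimes>\<^bsub>R\<^esub> r)\<rparr>"

text \<open>
  Projective modules are the direct summands of free modules.  Basis sets in the type of the
  elements of \<open>P\<close> suffice: \<open>P\<close> is projective iff the surjection from the free module on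
  \<open>carrier P\<close> splits.
\<close>

definition projective_module :: "('r, 's) ring_scheme \<Rightarrow> ('r, 'p) module \<Rightarrow> bool" where
  "projective_module R P \<longleftrightarrow> right_module R P \<and>
    (\<exists>(X :: 'p set) i p. i \<in> LinearCombinations.module_hom R P (free_right_module R X) \<and>
      p \<in> LinearCombinations.module_hom R (free_right_module R X) P \<and> (\<forall>x\<in>carrier P. p (i x) = x))"

text \<open>
  \<open>\<dots> \<rightarrow> P 2 \<rightarrow> P 1 \<rightarrow> P 0 \<rightarrow> M \<rightarrow> 0\<close> with differentials \<open>d i : P (i + 1) \<rightarrow> P i\<close> and augmentation
  \<open>e : P 0 \<rightarrow> M\<close>.
\<close>

definition projective_resolution ::
    "('r, 's) ring_scheme \<Rightarrow> ('r, 'm) module \<Rightarrow>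
     (nat \<Rightarrow> ('r, 'p) module) \<Rightarrow> (nat \<Rightarrow> 'p \<Rightarrow> 'p) \<Rightarrow> ('p \<Rightarrow> 'm) \<Rightarrow> bool" where
  "projective_resolution R M P d e \<longleftrightarrow>
    (\<forall>i. projective_module R (P i)) \<and>
    (\<forall>i. d i \<in> LinearCombinations.module_hom R (P (Suc i)) (P i)) \<and>
    e \<in> LinearCombinations.module_hom R (P 0) M \<and>
    e ` carrier (P 0) = carrier M \<and>
    d 0 ` carrier (P 1) = {x \<in> carrier (P 0). e x = \<zero>\<^bsub>M\<^esub>} \<and>
    (\<forall>i. d (Suc i) ` carrier (P (Suc (Suc i))) = {x \<in> carrier (P (Suc i)). d i x = \<zero>\<^bsub>P i\<^esub>})"

text \<open>
  For a \<open>'k\<close>-algebra \<open>R\<close>, the \<open>'k\<close>-space of \<open>R\<close>-linear maps; homomorphisms are made undefined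
  outside the carrier so that equal maps are equal functions.
\<close>

definition hom_space ::
    "('k, 'r) module \<Rightarrow> ('r, 'p) module \<Rightarrow> ('r, 'n) module \<Rightarrow> ('k, 'p \<Rightarrow> 'n) module" where
  "hom_space R P N =
    \<lparr>carrier = LinearCombinations.module_hom R P N \<inter> extensional (carrier P),
     mult = (\<lambda>f g. \<lambda>x\<in>carrier P. \<zero>\<^bsub>N\<^esub>),
     one = (\<lambda>x\<in>carrier P. \<zero>\<^bsub>N\<^esub>),
     zero = (\<lambda>x\<in>carrier P. \<zero>\<^bsub>N\<^esub>),
     add = (\<lambda>f g. \<lambda>x\<in>carrier P. f x \<oplus>\<^bsub>N\<^esub> g x),
     smult = (\<lambda>c f. \<lambda>x\<in>carrier P. (c \<odot>\<^bsub>R\<^esub> \<one>\<^bsub>R\<^esub>) \<odot>\<^bsub>N\<^esub> f x)\<rparr>"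

definition hom_diff ::
    "(nat \<Rightarrow> ('r, 'p) module) \<Rightarrow> (nat \<Rightarrow> 'p \<Rightarrow> 'p) \<Rightarrow> nat \<Rightarrow> ('p \<Rightarrow> 'n) \<Rightarrow> ('p \<Rightarrow> 'n)" where
  "hom_diff P d i f = compose (carrier (P (Suc i))) f (d i)"

definition hom_cocycles ::
    "('k, 'r) module \<Rightarrow> (nat \<Rightarrow> ('r, 'p) module) \<Rightarrow> (nat \<Rightarrow> 'p \<Rightarrow> 'p) \<Rightarrow> ('r, 'n) module \<Rightarrow>
     nat \<Rightarrow> ('p \<Rightarrow> 'n) set" where
  "hom_cocycles R P d N i =
    {f \<in> carrier (hom_space R (P i) N). hom_diff P d i f = \<zero>\<^bsub>hom_space R (P (Suc i)) N\<^esub>}"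

definition hom_coboundaries ::
    "('k, 'r) module \<Rightarrow> (nat \<Rightarrow> ('r, 'p) module) \<Rightarrow> (nat \<Rightarrow> 'p \<Rightarrow> 'p) \<Rightarrow> ('r, 'n) module \<Rightarrow>
     nat \<Rightarrow> ('p \<Rightarrow> 'n) set" where
  "hom_coboundaries R P d N i =
    (case i of 0 \<Rightarrow> {\<zero>\<^bsub>hom_space R (P 0) N\<^esub>}
     | Suc j \<Rightarrow> hom_diff P d j ` carrier (hom_space R (P j) N))"

definition hom_cohomology ::
    "('k, 'r) module \<Rightarrow> (nat \<Rightarrow> ('r, 'p) module) \<Rightarrow> (nat \<Rightarrow> 'p \<Rightarrow> 'p) \<Rightarrow> ('r, 'n) module \<Rightarrow>
     nat \<Rightarrow> ('k, ('p \<Rightarrow> 'n) set) module" where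
  "hom_cohomology R P d N i =
    quot_algebra ((hom_space R (P i) N)\<lparr>carrier := hom_cocycles R P d N i\<rparr>)
      (hom_coboundaries R P d N i)"

text \<open>
  \<open>Ext\<close> is computed from a chosen projective resolution of \<open>M\<close>.  The elements of the chosen
  resolution live in \<^typ>\<open>('r + 'm) list \<Rightarrow> 'r\<close>.  This is no restriction: the index type
  \<^typ>\<open>('r + 'm) list\<close> is infinite and at least as large as \<open>R\<close> and \<open>M\<close>, so a free module
  on any subset of it has at most as many elements as there are indices and so has every
  submodule of it.  Hence every right module has a free resolution of this form, and any two
  projective resolutions give isomorphic cohomology.
\<close>

definition Ext ::
    "('k, 'r) module \<Rightarrow> ('r, 'm) module \<Rightarrow> ('r, 'n) module \<Rightarrow> nat \<Rightarrow>
     ('k, ((('r + 'm) list \<Rightarrow> 'r) \<Rightarrow> 'n) set) module" where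
  "Ext R M N i =
    (let (P, d, e) = (SOME (P, d, e). projective_resolution R M P d e)
     in hom_cohomology R P d N i)"


section \<open>Hochschild cohomology\<close>

text \<open>
  \<open>B\<close> as a right module over its enveloping algebra: \<open>b \<cdot> (c \<otimes> d) = c b d\<close>.  The action of a
  coset is the common value of the action of its representatives.
\<close>

definition regular_bimodule ::
    "('k::field, 'b) module \<Rightarrow> ((('b \<times> 'b) \<Rightarrow>\<^sub>0 'k) set, 'b) module" where
  "regular_bimodule B =
    \<lparr>carrier = carrier B, mult = mult B, one = one B, zero = zero B, add = add B,
     smult = (\<lambda>T b. the_elem ((\<lambda>f. \<Oplus>\<^bsub>B\<^esub>p\<in>Poly_Mapping.keys f.
       Poly_Mapping.lookup f p \<odot>\<^bsub>B\<^esub> ((fst p \<otimes>\<^bsub>B\<^esub> b) \<otimes>\<^bsub>B\<^esub> snd p)) ` T))\<rparr>"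

type_synonym ('k, 'b) env = "(('b \<times> 'b) \<Rightarrow>\<^sub>0 'k) set"

definition HH ::
    "nat \<Rightarrow> ('k::field, 'b) module \<Rightarrow>
     ('k, (((('k, 'b) env + 'b) list \<Rightarrow> ('k, 'b) env) \<Rightarrow> 'b) set) module" where
  "HH r B = Ext (enveloping_algebra B) (regular_bimodule B) (regular_bimodule B) r"

text \<open>The dimension is required to be finite: \<^const>\<open>vectorspace.dim\<close> is unspecified otherwise.\<close>

definition has_dim :: "('k::field, 'v) module \<Rightarrow> nat \<Rightarrow> bool" where
  "has_dim V d \<longleftrightarrow> vectorspace (class_ring :: 'k ring) V \<and>
    vectorspace.fin_dim (class_ring :: 'k ring) V \<and> vectorspace.dim (class_ring :: 'k ring) V = d"


section \<open>Graded down-up algebras\<close>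

text \<open>
  The free monoid, written additively so that \<open>'a free_monoid \<Rightarrow>\<^sub>0 'k\<close> with its convolution
  product is the free algebra.
\<close>

datatype 'a free_monoid = Word (letters: "'a list")

instantiation free_monoid :: (type) monoid_add
begin

definition zero_free_monoid :: "'a free_monoid" where
  "0 = Word []"

definition plus_free_monoid :: "'a free_monoid \<Rightarrow> 'a free_monoid \<Rightarrow> 'a free_monoid" where
  "v + w = Word (letters v @ letters w)"

instance
  by standard (simp_all add: zero_free_monoid_def plus_free_monoid_def)

end

definition free_algebra :: "('k::field, 'a free_monoid \<Rightarrow>\<^sub>0 'k) module" where
  "free_algebra =
    \<lparr>carrier = UNIV, mult = (*), one = 1, zero = 0, add = (+),
     smult = (\<lambda>c. Poly_Mapping.map ((*) c))\<rparr>"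

datatype gen = X | Y

definition word_term :: "'k::field \<Rightarrow> gen list \<Rightarrow> gen free_monoid \<Rightarrow>\<^sub>0 'k" where
  "word_term c w = Poly_Mapping.single (Word w) c"

definition down_up_ideal :: "'k::field \<Rightarrow> 'k \<Rightarrow> (gen free_monoid \<Rightarrow>\<^sub>0 'k) set" where
  "down_up_ideal \<alpha> \<beta> = genideal free_algebra
    {word_term 1 [X, X, Y] - word_term \<beta> [Y, X, X] - word_term \<alpha> [X, Y, X],
     word_term 1 [X, Y, Y] - word_term \<beta> [Y, Y, X] - word_term \<alpha> [Y, X, Y]}"

definition down_up_algebra ::
    "'k::field \<Rightarrow> 'k \<Rightarrow> ('k, (gen free_monoid \<Rightarrow>\<^sub>0 'k) set) module" where
  "down_up_algebra \<alpha> \<beta> = quot_algebra free_algebra (down_up_ideal \<alpha> \<beta>)"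

definition weight :: "nat \<Rightarrow> nat \<Rightarrow> gen free_monoid \<Rightarrow> nat" where
  "weight n m w = n * count_list (letters w) X + m * count_list (letters w) Y"

text \<open>The homogeneous component of degree \<open>i\<close> when \<open>deg x = n\<close> and \<open>deg y = m\<close>.\<close>

definition down_up_component ::
    "'k::field \<Rightarrow> 'k \<Rightarrow> nat \<Rightarrow> nat \<Rightarrow> nat \<Rightarrow> (gen free_monoid \<Rightarrow>\<^sub>0 'k) set set" where
  "down_up_component \<alpha> \<beta> n m i =
    (\<lambda>f. down_up_ideal \<alpha> \<beta> +>\<^bsub>free_algebra\<^esub> f) ` {f. \<forall>w\<in>Poly_Mapping.keys f. weight n m w = i}"


section \<open>Beilinson algebras\<close>

text \<open>
  For an algebra \<open>A\<close> with homogeneous components \<open>C 0, C 1, \<dots>\<close>; matrices are functions of a row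
  and a column index in \<open>{1..l}\<close>, extended by zero.  Note the order of the factors in the product.
\<close>

definition beilinson_algebra ::
    "('k, 'a) module \<Rightarrow> (nat \<Rightarrow> 'a set) \<Rightarrow> nat \<Rightarrow> ('k, nat \<Rightarrow> nat \<Rightarrow> 'a) module" where
  "beilinson_algebra A C l =
    \<lparr>carrier = {a. \<forall>i j. if 1 \<le> i \<and> i \<le> j \<and> j \<le> l then a i j \<in> C (j - i) else a i j = \<zero>\<^bsub>A\<^esub>},
     mult = (\<lambda>a b i j. \<Oplus>\<^bsub>A\<^esub>r\<in>{1..l}. a r j \<otimes>\<^bsub>A\<^esub> b i r),
     one = (\<lambda>i j. if 1 \<le> i \<and> i = j \<and> j \<le> l then \<one>\<^bsub>A\<^esub> else \<zero>\<^bsub>A\<^esub>),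
     zero = (\<lambda>i j. \<zero>\<^bsub>A\<^esub>),
     add = (\<lambda>a b i j. a i j \<oplus>\<^bsub>A\<^esub> b i j),
     smult = (\<lambda>c a i j. c \<odot>\<^bsub>A\<^esub> a i j)\<rparr>"

text \<open>\<open>2 (n + m)\<close> is the Gorenstein parameter of the down-up algebra with weights \<open>(n, m)\<close>.\<close>

definition down_up_beilinson ::
    "'k::field \<Rightarrow> 'k \<Rightarrow> nat \<Rightarrow> nat \<Rightarrow> ('k, nat \<Rightarrow> nat \<Rightarrow> (gen free_monoid \<Rightarrow>\<^sub>0 'k) set) module" where
  "down_up_beilinson \<alpha> \<beta> n m =
    beilinson_algebra (down_up_algebra \<alpha> \<beta>) (down_up_component \<alpha> \<beta> n m) (2 * (n + m))"

end

theory Submission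
  imports Defs
begin

text \<open>
  The Beilinson algebra \<open>B\<close> is given by a quiver with vertices \<open>1, \<dots>, 2 (n + m)\<close>, arrows
  \<open>x : i \<rightarrow> i + n\<close> and \<open>y : i \<rightarrow> i + m\<close>, and one relation for each place where a cubic relation of the
  down-up algebra fits.  The bimodules generated by the vertices, the arrows and the relations form a
  projective resolution of \<open>B\<close> of length two, whose differentials are Fox derivatives.  Exactness
  in degrees zero and one holds for every presentation.  The last differential is injective because
  the paths to the left and to the right of a relation have total degree less than \<open>m\<close>, so
  only powers of \<open>x\<close> occur, and the coefficients at such words do not meet the relations.

  As \<open>gcd n m = 1\<close>, a cochain is given by a scalar for each vertex in degree zero and for each
  arrow in degree one, and by two scalars for each relation in degree two; if \<open>n = 2\<close>, the two
  relations of degree \<open>n + 2 m\<close> have the further path \<open>x\<^sup>m\<^sup>+\<^sup>1\<close>, on which no coboundary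
  has a component.  A 1-cochain is a connection on the quiver, and its coboundary only depends on the
  curvatures \<open>c i\<close> of the \<open>n + m\<close> squares with sides \<open>x\<close> and \<open>y\<close>: numbered suitably, the relation \<open>i\<close>
  contributes \<open>- \<beta> (c i + c (\<sigma> i))\<close> and \<open>- \<alpha> c i\<close>, where \<open>\<sigma> i = i + n\<close> modulo \<open>n + m\<close> is a
  single cycle.  Flat connections are determined up to coboundaries by their holonomy around this cycle.
  The operator \<open>1 + \<sigma>\<close> is invertible if \<open>n + m\<close> is odd; if \<open>n + m\<close> is even, its kernel is spanned by the
  alternating function, which matters only when \<open>\<alpha> = 0\<close>.
\<close>

text \<open>\<open>Ext\<close> evaluates an unspecified resolution, picked by \<open>SOME\<close> in
  a prescribed element type. So resolutions have to be compared, chain maps and homotopies included,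
  and the explicit resolution has to be realised inside that type. Dimensions are certified by
  coordinate functionals on cocycles, which pull back along chain maps. No monomial basis of the
  down-up algebra is constructed. Exactness in degree one uses a merely linear section of the
  projection from the free algebra, whose errors fall into the image of the relations. In degree
  two, coefficients at words in one letter suffice: every word occurring in a multiple of a relation
  contains both letters. The bound \<open>m\<close> comes from the size of the quiver: of the
  2(n+m)-1 units of degree between its first and last vertex a relation uses at least 2n+m, which
  leaves at most m-1; the longer relation leaves at most n-1. The two scalars per relation are what
  three words of equal degree leave modulo one relation. The power x^(m+1) has the same degree as
  xyy only for n = 2.\<close>

lemma (in abelian_monoid) finsum_apply:
  assumes "finite T" "\<And>i. i \<in> T \<Longrightarrow> g i \<in> carrier F" "abelian_monoid F"
    and "\<And>f h. f \<in> carrier F \<Longrightarrow> h \<in> carrier F \<Longrightarrow> \<phi> (f \<oplus>\<^bsub>F\<^esub> h) = \<phi> f \<oplus> \<phi> h"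
    and "\<phi> \<zero>\<^bsub>F\<^esub> = \<zero>" and "\<And>f. f \<in> carrier F \<Longrightarrow> \<phi> f \<in> carrier G"
  shows "\<phi> (finsum F g T) = (\<Oplus>i\<in>T. \<phi> (g i))"
proof -
  interpret F: abelian_monoid F by fact
  show ?thesis
    using assms(1,2)
  proof (induction T rule: finite_induct)
    case empty
    then show ?case using assms(5) by simp
  next
    case (insert x T)
    have "finsum F g (insert x T) = g x \<oplus>\<^bsub>F\<^esub> finsum F g T"
      using insert by (intro F.finsum_insert) auto
    moreover have "(\<Oplus>i\<in>insert x T. \<phi> (g i)) = \<phi> (g x) \<oplus> (\<Oplus>i\<in>T. \<phi> (g i))"
      using insert assms(6) by (intro finsum_insert) auto
    ultimately show ?case
      using insert assms(4) by (auto intro!: assms(4) F.finsum_closed)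
  qed
qed

lemma (in abelian_monoid) finsum_single:
  assumes "finite T" "i \<in> T" "f i \<in> carrier G" "\<And>j. j \<in> T \<Longrightarrow> j \<noteq> i \<Longrightarrow> f j = \<zero>"
  shows "(\<Oplus>j\<in>T. f j) = f i"
proof -
  have "(\<Oplus>j\<in>T. f j) = (\<Oplus>j\<in>T. if i = j then f j else \<zero>)"
  proof (intro finsum_cong' refl)
    show "(\<lambda>j. if i = j then f j else \<zero>) \<in> T \<rightarrow> carrier G" using assms by auto
  qed (use assms in auto)
  also have "\<dots> = f i"
    using assms by (subst add.finprod_singleton) (auto, metis zero_closed)
  finally show ?thesis .
qed

section \<open>Right modules\<close>

context right_module
begin

lemma act_zero [simp]: "r \<in> carrier R \<Longrightarrow> r \<odot>\<^bsub>M\<^esub> \<zero>\<^bsub>M\<^esub> = \<zero>\<^bsub>M\<^esub>"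
  by (metis M.add.l_cancel_one' M.zero_closed M.r_zero act_closed act_distr_module)

lemma zero_act [simp]: "x \<in> carrier M \<Longrightarrow> \<zero>\<^bsub>R\<^esub> \<odot>\<^bsub>M\<^esub> x = \<zero>\<^bsub>M\<^esub>"
  by (metis M.add.l_cancel_one' R.zero_closed R.r_zero act_closed act_distr_ring)

lemma act_minus: "\<lbrakk>r \<in> carrier R; x \<in> carrier M\<rbrakk> \<Longrightarrow> r \<odot>\<^bsub>M\<^esub> (\<ominus>\<^bsub>M\<^esub> x) = \<ominus>\<^bsub>M\<^esub> (r \<odot>\<^bsub>M\<^esub> x)"
  by (metis M.add.inv_closed M.minus_equality M.l_neg act_closed act_distr_module act_zero)

lemma act_finsum:
  assumes "finite T" "r \<in> carrier R" "\<And>i. i \<in> T \<Longrightarrow> f i \<in> carrier M"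
  shows "r \<odot>\<^bsub>M\<^esub> (\<Oplus>\<^bsub>M\<^esub>i\<in>T. f i) = (\<Oplus>\<^bsub>M\<^esub>i\<in>T. r \<odot>\<^bsub>M\<^esub> f i)"
  by (rule M.finsum_apply[where F = M]) (use assms in \<open>auto simp: act_distr_module act_closed M.abelian_monoid_axioms\<close>)

end

lemma module_homI:
  assumes "\<And>x. x \<in> carrier M \<Longrightarrow> f x \<in> carrier N"
    and "\<And>x y. x \<in> carrier M \<Longrightarrow> y \<in> carrier M \<Longrightarrow> f (x \<oplus>\<^bsub>M\<^esub> y) = f x \<oplus>\<^bsub>N\<^esub> f y"
    and "\<And>r x. r \<in> carrier R \<Longrightarrow> x \<in> carrier M \<Longrightarrow> f (r \<odot>\<^bsub>M\<^esub> x) = r \<odot>\<^bsub>N\<^esub> f x"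
  shows "f \<in> LinearCombinations.module_hom R M N"
  using assms by (auto simp: LinearCombinations.module_hom_def)

locale right_module_hom = M: right_module R M + N: right_module R N
  for R :: "('r, 's) ring_scheme" and M :: "('r, 'm, 't) module_scheme"
    and N :: "('r, 'n, 'u) module_scheme" +
  fixes f
  assumes hom: "f \<in> LinearCombinations.module_hom R M N"
begin

lemma closed [simp]: "x \<in> carrier M \<Longrightarrow> f x \<in> carrier N"
  using hom by (auto simp: LinearCombinations.module_hom_def)

lemma hom_add: "x \<in> carrier M \<Longrightarrow> y \<in> carrier M \<Longrightarrow> f (x \<oplus>\<^bsub>M\<^esub> y) = f x \<oplus>\<^bsub>N\<^esub> f y"
  using hom by (auto simp: LinearCombinations.module_hom_def)

lemma hom_act: "r \<in> carrier R \<Longrightarrow> x \<in> carrier M \<Longrightarrow> f (r \<odot>\<^bsub>M\<^esub> x) = r \<odot>\<^bsub>N\<^esub> f x"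
  using hom by (auto simp: LinearCombinations.module_hom_def)

lemma hom_zero [simp]: "f \<zero>\<^bsub>M\<^esub> = \<zero>\<^bsub>N\<^esub>"
  by (metis M.M.zero_closed M.M.r_zero N.M.add.l_cancel_one' closed hom_add)

lemma hom_minus: "x \<in> carrier M \<Longrightarrow> f (\<ominus>\<^bsub>M\<^esub> x) = \<ominus>\<^bsub>N\<^esub> f x"
  by (metis M.M.add.inv_closed M.M.l_neg N.M.minus_equality closed hom_add hom_zero)

lemma hom_finsum:
  "finite T \<Longrightarrow> (\<And>i. i \<in> T \<Longrightarrow> g i \<in> carrier M) \<Longrightarrow> f (\<Oplus>\<^bsub>M\<^esub>i\<in>T. g i) = (\<Oplus>\<^bsub>N\<^esub>i\<in>T. f (g i))"
  by (rule N.M.finsum_apply[where F = M]) (auto simp: hom_add M.M.abelian_monoid_axioms)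

end

lemma module_hom_comp:
  assumes "f \<in> LinearCombinations.module_hom R L M" "g \<in> LinearCombinations.module_hom R M N"
  shows "(\<lambda>x. g (f x)) \<in> LinearCombinations.module_hom R L N"
  using assms by (auto simp: LinearCombinations.module_hom_def Pi_def)

lemma module_hom_sub:
  assumes N: "right_module R N" and "f \<in> LinearCombinations.module_hom R M N"
    and "g \<in> LinearCombinations.module_hom R M N"
  shows "(\<lambda>x. f x \<ominus>\<^bsub>N\<^esub> g x) \<in> LinearCombinations.module_hom R M N"
proof -
  interpret N: right_module R N by fact
  show ?thesis
    using assms(2,3)
    by (intro module_homI)
      (auto simp: LinearCombinations.module_hom_def Pi_def a_minus_def N.M.minus_add N.M.a_ac N.act_distr_module N.act_minus)
qed

lemma right_module_subset:
  assumes "right_module R M" and "S \<subseteq> carrier M" "\<zero>\<^bsub>M\<^esub> \<in> S"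
    and "\<And>x y. x \<in> S \<Longrightarrow> y \<in> S \<Longrightarrow> x \<oplus>\<^bsub>M\<^esub> y \<in> S"
    and "\<And>r x. r \<in> carrier R \<Longrightarrow> x \<in> S \<Longrightarrow> r \<odot>\<^bsub>M\<^esub> x \<in> S"
  shows "right_module R (M\<lparr>carrier := S\<rparr>)"
proof -
  interpret right_module R M by fact
  \<comment> \<open>Inverses come from the action of minus one.\<close>
  have neg: "\<exists>y\<in>S. y \<oplus>\<^bsub>M\<^esub> x = \<zero>\<^bsub>M\<^esub>" if "x \<in> S" for x
  proof (intro bexI)
    have x: "x \<in> carrier M" using that assms(2) by auto
    have "(\<ominus>\<^bsub>R\<^esub> \<one>\<^bsub>R\<^esub>) \<odot>\<^bsub>M\<^esub> x \<oplus>\<^bsub>M\<^esub> \<one>\<^bsub>R\<^esub> \<odot>\<^bsub>M\<^esub> x = \<zero>\<^bsub>M\<^esub>"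
      using x by (subst act_distr_ring[symmetric]) (auto simp: R.l_neg)
    then show "(\<ominus>\<^bsub>R\<^esub> \<one>\<^bsub>R\<^esub>) \<odot>\<^bsub>M\<^esub> x \<oplus>\<^bsub>M\<^esub> x = \<zero>\<^bsub>M\<^esub>" using x by (simp add: act_one)
    show "(\<ominus>\<^bsub>R\<^esub> \<one>\<^bsub>R\<^esub>) \<odot>\<^bsub>M\<^esub> x \<in> S" using assms(5) that by auto
  qed
  have ag: "abelian_group (M\<lparr>carrier := S\<rparr>)"
    by (rule abelian_groupI)
      (use assms neg in \<open>auto simp: subset_iff M.a_ac\<close>)
  show ?thesis
  proof (intro right_module.intro right_module_axioms.intro ag)
    show "ring R" by (rule R.ring_axioms)
  qed (use assms in \<open>auto simp: subset_iff act_distr_ring act_distr_module act_mult act_one\<close>)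
qed

section \<open>Modules generated by idempotents\<close>

text \<open>The direct sum of the projective modules \<open>\<epsilon> i R\<close>.\<close>

definition idem_module :: "('r, 's) ring_scheme \<Rightarrow> 'i set \<Rightarrow> ('i \<Rightarrow> 'r) \<Rightarrow> ('r, 'i \<Rightarrow> 'r) module" where
  "idem_module R J \<epsilon> = (free_right_module R J)
     \<lparr>carrier := {f \<in> carrier (free_right_module R J). \<forall>i\<in>J. \<epsilon> i \<otimes>\<^bsub>R\<^esub> f i = f i}\<rparr>"

definition idem_unit :: "('r, 's) ring_scheme \<Rightarrow> ('i \<Rightarrow> 'r) \<Rightarrow> 'i \<Rightarrow> 'i \<Rightarrow> 'r" where
  "idem_unit R \<epsilon> i = (\<lambda>j. if j = i then \<epsilon> i else \<zero>\<^bsub>R\<^esub>)"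

text \<open>The homomorphism determined by images of the generators. The generator of the
  \<open>i\<close>-th summand is \<open>\<epsilon> i\<close>, so it goes to the action of
  \<open>\<epsilon> i\<close> on \<open>\<nu> i\<close>; thus \<open>\<nu>\<close> can be any family
  in the target.\<close>

definition idem_ext :: "('r, 's) ring_scheme \<Rightarrow> ('r, 'n, 't) module_scheme \<Rightarrow> 'i set \<Rightarrow>
    ('i \<Rightarrow> 'n) \<Rightarrow> ('i \<Rightarrow> 'r) \<Rightarrow> 'n" where
  "idem_ext R N J \<nu> f = (\<Oplus>\<^bsub>N\<^esub>i\<in>{i\<in>J. f i \<noteq> \<zero>\<^bsub>R\<^esub>}. f i \<odot>\<^bsub>N\<^esub> \<nu> i)"

lemma idem_module_simps [simp]:
  "zero (idem_module R J \<epsilon>) = (\<lambda>i. \<zero>\<^bsub>R\<^esub>)"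
  "add (idem_module R J \<epsilon>) = (\<lambda>f g i. f i \<oplus>\<^bsub>R\<^esub> g i)"
  "smult (idem_module R J \<epsilon>) = (\<lambda>r f i. f i \<otimes>\<^bsub>R\<^esub> r)"
  by (simp_all add: idem_module_def free_right_module_def)

locale idempotents = ring R for R :: "('r, 's) ring_scheme" (structure) +
  fixes J :: "'i set" and \<epsilon> :: "'i \<Rightarrow> 'r"
  assumes idem_closed [simp]: "i \<in> J \<Longrightarrow> \<epsilon> i \<in> carrier R"
    and idem: "i \<in> J \<Longrightarrow> \<epsilon> i \<otimes> \<epsilon> i = \<epsilon> i"
begin

abbreviation "P \<equiv> idem_module R J \<epsilon>"

lemma idem_carrier:
  "f \<in> carrier P \<longleftrightarrow> (\<forall>i\<in>J. f i \<in> carrier R \<and> \<epsilon> i \<otimes> f i = f i) \<and> (\<forall>i. i \<notin> J \<longrightarrow> f i = \<zero>) \<and>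
     finite {i. f i \<noteq> \<zero>}"
  by (auto simp: idem_module_def free_right_module_def)

lemma idem_carrierD [simp]: "f \<in> carrier P \<Longrightarrow> f i \<in> carrier R"
  by (cases "i \<in> J") (auto simp: idem_carrier)

lemma idem_support: "f \<in> carrier P \<Longrightarrow> finite {i \<in> J. f i \<noteq> \<zero>}"
  by (rule finite_subset[of _ "{i. f i \<noteq> \<zero>}"]) (auto simp: idem_carrier)

lemma free_carrierD: "f \<in> carrier (free_right_module R J) \<Longrightarrow> f i \<in> carrier R"
  by (cases "i \<in> J") (auto simp: free_right_module_def)

lemma right_module_free: "right_module R (free_right_module R J)"
proof -
  have ag: "abelian_group (free_right_module R J)"
  proof (rule abelian_groupI)
    fix x assume x: "x \<in> carrier (free_right_module R J)"
    have "(\<lambda>i. \<ominus> x i) \<in> carrier (free_right_module R J)"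
    proof -
      have c: "\<And>i. x i \<in> carrier R" using x by (auto simp: free_right_module_def)
      have "{i. \<ominus> x i \<noteq> \<zero>} \<subseteq> {i. x i \<noteq> \<zero>}" by auto
      then show ?thesis using x c by (auto simp: free_right_module_def elim: finite_subset)
    qed
    moreover have "(\<lambda>i. \<ominus> x i) \<oplus>\<^bsub>free_right_module R J\<^esub> x = \<zero>\<^bsub>free_right_module R J\<^esub>"
      using free_carrierD[OF x] by (auto simp: free_right_module_def fun_eq_iff l_neg)
    ultimately show "\<exists>y\<in>carrier (free_right_module R J). y \<oplus>\<^bsub>free_right_module R J\<^esub> x = \<zero>\<^bsub>free_right_module R J\<^esub>"
      by blast
  next
    fix x y assume x: "x \<in> carrier (free_right_module R J)" and y: "y \<in> carrier (free_right_module R J)"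
    have "{i. x i \<oplus> y i \<noteq> \<zero>} \<subseteq> {i. x i \<noteq> \<zero>} \<union> {i. y i \<noteq> \<zero>}" by auto
    then have "finite {i. x i \<oplus> y i \<noteq> \<zero>}"
      by (rule finite_subset) (use x y in \<open>auto simp: free_right_module_def\<close>)
    then show "x \<oplus>\<^bsub>free_right_module R J\<^esub> y \<in> carrier (free_right_module R J)"
      using x y by (auto simp: free_right_module_def)
  next
    fix x y z
    assume "x \<in> carrier (free_right_module R J)" "y \<in> carrier (free_right_module R J)"
       "z \<in> carrier (free_right_module R J)"
    then show "x \<oplus>\<^bsub>free_right_module R J\<^esub> y \<oplus>\<^bsub>free_right_module R J\<^esub> z = x \<oplus>\<^bsub>free_right_module R J\<^esub> (y \<oplus>\<^bsub>free_right_module R J\<^esub> z)"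
      using free_carrierD[of x] free_carrierD[of y] free_carrierD[of z]
      by (simp add: free_right_module_def fun_eq_iff a_assoc)
  next
    fix x y
    assume "x \<in> carrier (free_right_module R J)" "y \<in> carrier (free_right_module R J)"
    then show "x \<oplus>\<^bsub>free_right_module R J\<^esub> y = y \<oplus>\<^bsub>free_right_module R J\<^esub> x"
      using free_carrierD[of x] free_carrierD[of y]
      by (simp add: free_right_module_def fun_eq_iff a_comm)
  next
    fix x assume "x \<in> carrier (free_right_module R J)"
    then show "\<zero>\<^bsub>free_right_module R J\<^esub> \<oplus>\<^bsub>free_right_module R J\<^esub> x = x"
      using free_carrierD[of x] by (simp add: free_right_module_def fun_eq_iff)
  qed (auto simp: free_right_module_def fun_eq_iff)
  have c: "\<And>i. x i \<in> carrier R" if "x \<in> carrier (free_right_module R J)" for x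
    using that by (auto simp: free_right_module_def)
  show ?thesis
  proof (intro right_module.intro right_module_axioms.intro ag ring_axioms)
    fix r x assume r: "r \<in> carrier R" and x: "x \<in> carrier (free_right_module R J)"
    have "{i. x i \<otimes> r \<noteq> \<zero>} \<subseteq> {i. x i \<noteq> \<zero>}" using r by auto
    then show "r \<odot>\<^bsub>free_right_module R J\<^esub> x \<in> carrier (free_right_module R J)"
      using x r c[OF x] by (auto simp: free_right_module_def elim: finite_subset)
  next
    fix x assume x: "x \<in> carrier (free_right_module R J)"
    show "\<one> \<odot>\<^bsub>free_right_module R J\<^esub> x = x"
      using c[OF x] by (auto simp: free_right_module_def)
  next
    fix r s x assume "r \<in> carrier R" "s \<in> carrier R" and x: "x \<in> carrier (free_right_module R J)"
    then show "(r \<oplus> s) \<odot>\<^bsub>free_right_module R J\<^esub> x = r \<odot>\<^bsub>free_right_module R J\<^esub> x \<oplus>\<^bsub>free_right_module R J\<^esub> s \<odot>\<^bsub>free_right_module R J\<^esub> x"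
      "r \<otimes> s \<odot>\<^bsub>free_right_module R J\<^esub> x = s \<odot>\<^bsub>free_right_module R J\<^esub> (r \<odot>\<^bsub>free_right_module R J\<^esub> x)"
      using c[OF x] by (auto simp: free_right_module_def fun_eq_iff r_distr m_assoc)
  next
    fix r x y assume "r \<in> carrier R" and x: "x \<in> carrier (free_right_module R J)"
      and y: "y \<in> carrier (free_right_module R J)"
    then show "r \<odot>\<^bsub>free_right_module R J\<^esub> (x \<oplus>\<^bsub>free_right_module R J\<^esub> y) = r \<odot>\<^bsub>free_right_module R J\<^esub> x \<oplus>\<^bsub>free_right_module R J\<^esub> r \<odot>\<^bsub>free_right_module R J\<^esub> y"
      using c[OF x] c[OF y] by (auto simp: free_right_module_def fun_eq_iff l_distr)
  qed
qed

sublocale P: right_module R P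
proof -
  interpret F: right_module R "free_right_module R J" by (rule right_module_free)
  have c: "\<And>i. x i \<in> carrier R" if "x \<in> carrier (free_right_module R J)" for x
    using that by (auto simp: free_right_module_def)
  show "right_module R P"
    unfolding idem_module_def
  proof (rule right_module_subset[OF right_module_free])
    show "\<zero>\<^bsub>free_right_module R J\<^esub> \<in> {f \<in> carrier (free_right_module R J). \<forall>i\<in>J. \<epsilon> i \<otimes> f i = f i}"
      by (auto simp: free_right_module_def)
  next
    fix x y assume *: "x \<in> {f \<in> carrier (free_right_module R J). \<forall>i\<in>J. \<epsilon> i \<otimes> f i = f i}"
      "y \<in> {f \<in> carrier (free_right_module R J). \<forall>i\<in>J. \<epsilon> i \<otimes> f i = f i}"
    have "\<epsilon> i \<otimes> (x \<oplus>\<^bsub>free_right_module R J\<^esub> y) i = (x \<oplus>\<^bsub>free_right_module R J\<^esub> y) i" if "i \<in> J" for i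
      using that * c[of x] c[of y] by (auto simp: free_right_module_def r_distr)
    then show "x \<oplus>\<^bsub>free_right_module R J\<^esub> y \<in> {f \<in> carrier (free_right_module R J). \<forall>i\<in>J. \<epsilon> i \<otimes> f i = f i}"
      using * by auto
  next
    fix r x assume *: "x \<in> {f \<in> carrier (free_right_module R J). \<forall>i\<in>J. \<epsilon> i \<otimes> f i = f i}" and r: "r \<in> carrier R"
    have "\<epsilon> i \<otimes> (r \<odot>\<^bsub>free_right_module R J\<^esub> x) i = (r \<odot>\<^bsub>free_right_module R J\<^esub> x) i" if "i \<in> J" for i
      using that * c[of x] r by (auto simp: free_right_module_def m_assoc[symmetric])
    then show "r \<odot>\<^bsub>free_right_module R J\<^esub> x \<in> {f \<in> carrier (free_right_module R J). \<forall>i\<in>J. \<epsilon> i \<otimes> f i = f i}"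
      using * r by (auto intro: F.act_closed)
  qed auto
qed

lemma unit_closed [simp]: "i \<in> J \<Longrightarrow> idem_unit R \<epsilon> i \<in> carrier P"
  by (auto simp: idem_carrier idem_unit_def idem intro: finite_subset[of _ "{i}"])

lemma finsum_eval:
  assumes "finite T" "\<And>t. t \<in> T \<Longrightarrow> g t \<in> carrier P"
  shows "(\<Oplus>\<^bsub>P\<^esub>t\<in>T. g t) i = (\<Oplus>t\<in>T. g t i)"
  by (rule finsum_apply[where F = P and \<phi> = "\<lambda>f. f i"])
    (use assms in \<open>auto simp: P.M.abelian_monoid_axioms\<close>)

text \<open>Since \<open>\<epsilon> i\<close> fixes \<open>f i\<close> from the left, the
  \<open>i\<close>-th entry is the action of \<open>f i\<close> on the \<open>i\<close>-th
  generator.\<close>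

lemma idem_expansion:
  assumes "f \<in> carrier P"
  shows "f = (\<Oplus>\<^bsub>P\<^esub>i\<in>{i\<in>J. f i \<noteq> \<zero>}. f i \<odot>\<^bsub>P\<^esub> idem_unit R \<epsilon> i)"
proof
  fix j
  note fin = idem_support[OF assms]
  have c: "f i \<odot>\<^bsub>P\<^esub> idem_unit R \<epsilon> i \<in> carrier P" if "i \<in> J" for i
    using that assms by (intro P.act_closed) auto
  have "(\<Oplus>\<^bsub>P\<^esub>i\<in>{i\<in>J. f i \<noteq> \<zero>}. f i \<odot>\<^bsub>P\<^esub> idem_unit R \<epsilon> i) j =
        (\<Oplus>i\<in>{i\<in>J. f i \<noteq> \<zero>}. (f i \<odot>\<^bsub>P\<^esub> idem_unit R \<epsilon> i) j)"
    by (rule finsum_eval[OF fin]) (use c in auto)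
  also have "\<dots> = f j"
  proof (cases "j \<in> J \<and> f j \<noteq> \<zero>")
    case True
    then show ?thesis
      using assms fin by (subst finsum_single[where i = j]) (auto simp: idem_unit_def idem_carrier)
  next
    case False
    then have "f j = \<zero>" using assms by (auto simp: idem_carrier)
    moreover have "(\<Oplus>i\<in>{i\<in>J. f i \<noteq> \<zero>}. (f i \<odot>\<^bsub>P\<^esub> idem_unit R \<epsilon> i) j) = (\<Oplus>i\<in>{i\<in>J. f i \<noteq> \<zero>}. \<zero>)"
      using assms False by (intro finsum_cong') (auto simp: idem_unit_def)
    ultimately show ?thesis by simp
  qed
  finally show "f j = (\<Oplus>\<^bsub>P\<^esub>i\<in>{i\<in>J. f i \<noteq> \<zero>}. f i \<odot>\<^bsub>P\<^esub> idem_unit R \<epsilon> i) j" by simp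
qed

text \<open>Lets the sums belonging to different supports be taken over a common index set, as
  additivity of the extension demands.\<close>

lemma ext_superset:
  assumes "right_module R N" "f \<in> carrier P" "finite T" "T \<subseteq> J" "{i\<in>J. f i \<noteq> \<zero>} \<subseteq> T"
    and \<nu>: "\<And>i. i \<in> J \<Longrightarrow> \<nu> i \<in> carrier N"
  shows "idem_ext R N J \<nu> f = (\<Oplus>\<^bsub>N\<^esub>i\<in>T. f i \<odot>\<^bsub>N\<^esub> \<nu> i)"
proof -
  interpret N: right_module R N by fact
  show ?thesis
    unfolding idem_ext_def
    using assms by (intro N.M.add.finprod_mono_neutral_cong_left) (auto intro!: N.act_closed)
qed

lemma ext_hom:
  assumes N: "right_module R N" and \<nu>: "\<And>i. i \<in> J \<Longrightarrow> \<nu> i \<in> carrier N"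
  shows "idem_ext R N J \<nu> \<in> LinearCombinations.module_hom R P N"
proof -
  interpret N: right_module R N by fact
  have c: "f i \<odot>\<^bsub>N\<^esub> \<nu> i \<in> carrier N" if "f \<in> carrier P" "i \<in> J" for f i
    using that \<nu> by (intro N.act_closed) auto
  show ?thesis
  proof (rule module_homI)
    fix f assume f: "f \<in> carrier P"
    show "idem_ext R N J \<nu> f \<in> carrier N"
      unfolding idem_ext_def using c[OF f] by (intro N.M.finsum_closed) auto
    fix g assume g: "g \<in> carrier P"
    let ?T = "{i\<in>J. f i \<noteq> \<zero>} \<union> {i\<in>J. g i \<noteq> \<zero>}"
    have fin: "finite ?T" using idem_support f g by auto
    have fg: "f \<oplus>\<^bsub>P\<^esub> g \<in> carrier P" using f g by (intro P.M.a_closed)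
    have "idem_ext R N J \<nu> (f \<oplus>\<^bsub>P\<^esub> g) = (\<Oplus>\<^bsub>N\<^esub>i\<in>?T. (f \<oplus>\<^bsub>P\<^esub> g) i \<odot>\<^bsub>N\<^esub> \<nu> i)"
      by (rule ext_superset[OF N fg fin]) (use \<nu> in auto)
    also have "\<dots> = (\<Oplus>\<^bsub>N\<^esub>i\<in>?T. f i \<odot>\<^bsub>N\<^esub> \<nu> i \<oplus>\<^bsub>N\<^esub> g i \<odot>\<^bsub>N\<^esub> \<nu> i)"
      using f g \<nu> c by (intro N.M.finsum_cong') (auto simp: N.act_distr_ring)
    also have "\<dots> = (\<Oplus>\<^bsub>N\<^esub>i\<in>?T. f i \<odot>\<^bsub>N\<^esub> \<nu> i) \<oplus>\<^bsub>N\<^esub> (\<Oplus>\<^bsub>N\<^esub>i\<in>?T. g i \<odot>\<^bsub>N\<^esub> \<nu> i)"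
      using c[OF f] c[OF g] by (intro N.M.finsum_addf) auto
    also have "(\<Oplus>\<^bsub>N\<^esub>i\<in>?T. f i \<odot>\<^bsub>N\<^esub> \<nu> i) = idem_ext R N J \<nu> f"
      by (rule ext_superset[OF N f fin, symmetric]) (use \<nu> in auto)
    also have "(\<Oplus>\<^bsub>N\<^esub>i\<in>?T. g i \<odot>\<^bsub>N\<^esub> \<nu> i) = idem_ext R N J \<nu> g"
      by (rule ext_superset[OF N g fin, symmetric]) (use \<nu> in auto)
    finally show "idem_ext R N J \<nu> (f \<oplus>\<^bsub>P\<^esub> g) = idem_ext R N J \<nu> f \<oplus>\<^bsub>N\<^esub> idem_ext R N J \<nu> g" .
  next
    fix r f assume r: "r \<in> carrier R" and f: "f \<in> carrier P"
    have rf: "r \<odot>\<^bsub>P\<^esub> f \<in> carrier P" using r f by (intro P.act_closed)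
    have "idem_ext R N J \<nu> (r \<odot>\<^bsub>P\<^esub> f) = (\<Oplus>\<^bsub>N\<^esub>i\<in>{i\<in>J. f i \<noteq> \<zero>}. (r \<odot>\<^bsub>P\<^esub> f) i \<odot>\<^bsub>N\<^esub> \<nu> i)"
      by (rule ext_superset[OF N rf idem_support[OF f]]) (use r \<nu> in auto)
    also have "\<dots> = (\<Oplus>\<^bsub>N\<^esub>i\<in>{i\<in>J. f i \<noteq> \<zero>}. r \<odot>\<^bsub>N\<^esub> (f i \<odot>\<^bsub>N\<^esub> \<nu> i))"
      using f r \<nu> c[OF f] by (intro N.M.finsum_cong') (auto simp: N.act_mult N.act_closed)
    also have "\<dots> = r \<odot>\<^bsub>N\<^esub> idem_ext R N J \<nu> f"
      unfolding idem_ext_def using c[OF f] r idem_support[OF f] by (intro N.act_finsum[symmetric]) auto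
    finally show "idem_ext R N J \<nu> (r \<odot>\<^bsub>P\<^esub> f) = r \<odot>\<^bsub>N\<^esub> idem_ext R N J \<nu> f" .
  qed
qed

lemma ext_unit:
  assumes "right_module R N" and "\<And>i. i \<in> J \<Longrightarrow> \<nu> i \<in> carrier N" "i \<in> J"
  shows "idem_ext R N J \<nu> (idem_unit R \<epsilon> i) = \<epsilon> i \<odot>\<^bsub>N\<^esub> \<nu> i"
proof -
  interpret N: right_module R N by fact
  have "idem_ext R N J \<nu> (idem_unit R \<epsilon> i) = (\<Oplus>\<^bsub>N\<^esub>j\<in>{i}. idem_unit R \<epsilon> i j \<odot>\<^bsub>N\<^esub> \<nu> j)"
    by (rule ext_superset[OF assms(1) unit_closed[OF assms(3)]]) (use assms in \<open>auto simp: idem_unit_def\<close>)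
  then show ?thesis using assms by (auto simp: idem_unit_def N.act_closed)
qed

lemma hom_eq_ext:
  assumes N: "right_module R N" and k: "k \<in> LinearCombinations.module_hom R P N" and f: "f \<in> carrier P"
  shows "k f = idem_ext R N J (\<lambda>i. k (idem_unit R \<epsilon> i)) f"
proof -
  interpret N: right_module R N by fact
  interpret k: right_module_hom R P N k
    using k by unfold_locales
  have u: "f i \<odot>\<^bsub>P\<^esub> idem_unit R \<epsilon> i \<in> carrier P" if "i \<in> J" for i
    using that f by (intro P.act_closed) auto
  have "k f = k (\<Oplus>\<^bsub>P\<^esub>i\<in>{i\<in>J. f i \<noteq> \<zero>}. f i \<odot>\<^bsub>P\<^esub> idem_unit R \<epsilon> i)"
    using idem_expansion[OF f] by simp
  also have "\<dots> = (\<Oplus>\<^bsub>N\<^esub>i\<in>{i\<in>J. f i \<noteq> \<zero>}. k (f i \<odot>\<^bsub>P\<^esub> idem_unit R \<epsilon> i))"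
    by (rule k.hom_finsum[OF idem_support[OF f]]) (use u in auto)
  also have "\<dots> = idem_ext R N J (\<lambda>i. k (idem_unit R \<epsilon> i)) f"
    unfolding idem_ext_def using f by (intro N.M.finsum_cong' refl) (auto intro!: N.act_closed k.hom_act simp del: idem_module_simps)
  finally show ?thesis .
qed

lemma hom_eqI:
  assumes N: "right_module R N" and "k \<in> LinearCombinations.module_hom R P N"
    "h \<in> LinearCombinations.module_hom R P N"
    and eq: "\<And>i. i \<in> J \<Longrightarrow> k (idem_unit R \<epsilon> i) = h (idem_unit R \<epsilon> i)" and f: "f \<in> carrier P"
  shows "k f = h f"
proof -
  interpret N: right_module R N by fact
  interpret k: right_module_hom R P N k
    using assms by unfold_locales
  show ?thesis
    unfolding hom_eq_ext[OF N assms(2) f] hom_eq_ext[OF N assms(3) f]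
    unfolding idem_ext_def using f eq
    by (intro N.M.finsum_cong' refl) (auto intro!: N.act_closed k.closed simp flip: eq)
qed

end

text \<open>Makes the extension property of \<open>idem_module\<close> available for the free
  modules in the definition of projectivity.\<close>

lemma free_eq_idem: "ring R \<Longrightarrow> free_right_module R J = idem_module R J (\<lambda>_. \<one>\<^bsub>R\<^esub>)"
proof -
  assume "ring R"
  then interpret ring R .
  have "{f \<in> carrier (free_right_module R J). \<forall>i\<in>J. \<one>\<^bsub>R\<^esub> \<otimes>\<^bsub>R\<^esub> f i = f i} = carrier (free_right_module R J)"
    by (auto simp: free_right_module_def)
  then show ?thesis by (simp add: idem_module_def)
qed

text \<open>Projectivity asks for a basis set inside the element type of the module. An index is
  therefore encoded as an indicator function with the two values \<open>a\<close> and
  \<open>b\<close>. The splitting is the inclusion followed by multiplication of each entry by its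
  idempotent.\<close>

lemma (in idempotents) projective_idem:
  assumes ab: "(a :: 'r) \<noteq> b"
  shows "projective_module R P"
  unfolding projective_module_def
proof (intro conjI exI ballI)
  define \<iota> :: "'i \<Rightarrow> 'i \<Rightarrow> 'r" where "\<iota> i = (\<lambda>j. if j = i then a else b)" for i
  have inj: "inj \<iota>" using ab by (auto simp: inj_def \<iota>_def fun_eq_iff)
  let ?J = "\<iota> ` J"
  let ?F = "free_right_module R ?J"
  let ?i = "\<lambda>f q. if q \<in> ?J then f (inv_into UNIV \<iota> q) else \<zero>"
  let ?p = "\<lambda>g i. if i \<in> J then \<epsilon> i \<otimes> g (\<iota> i) else \<zero>"
  show "right_module R P" by (rule P.right_module_axioms)
  have c: "\<And>i. x i \<in> carrier R" if "x \<in> carrier ?F" for x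
    using that by (auto simp: free_right_module_def) (metis imageE zero_closed)
  have fin1: "finite {q. ?i f q \<noteq> \<zero>}" if "f \<in> carrier P" for f
    by (rule finite_subset[of _ "\<iota> ` {i\<in>J. f i \<noteq> \<zero>}"]) (use idem_support[OF that] inj in auto)
  show "?i \<in> LinearCombinations.module_hom R P ?F"
    by (rule module_homI)
      (use fin1 inj in \<open>auto simp: free_right_module_def fun_eq_iff\<close>)
  have fin2: "finite {i. ?p g i \<noteq> \<zero>}" if "g \<in> carrier ?F" for g
  proof -
    have "finite (\<iota> -` {q. g q \<noteq> \<zero>})"
      using that inj by (intro finite_vimageI) (auto simp: free_right_module_def)
    then show ?thesis by (rule rev_finite_subset) auto
  qed
  show "?p \<in> LinearCombinations.module_hom R ?F P"
  proof (rule module_homI)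
    fix g assume g: "g \<in> carrier ?F"
    show "?p g \<in> carrier P"
      unfolding idem_carrier using fin2[OF g] c[OF g] by (simp add: m_assoc[symmetric] idem)
    fix h assume h: "h \<in> carrier ?F"
    show "?p (g \<oplus>\<^bsub>?F\<^esub> h) = ?p g \<oplus>\<^bsub>P\<^esub> ?p h"
      using c[OF g] c[OF h] by (simp add: fun_eq_iff free_right_module_def r_distr)
  next
    fix r g assume r: "r \<in> carrier R" and g: "g \<in> carrier ?F"
    show "?p (r \<odot>\<^bsub>?F\<^esub> g) = r \<odot>\<^bsub>P\<^esub> ?p g"
      using r c[OF g] by (simp add: fun_eq_iff free_right_module_def m_assoc)
  qed
  show "?p (?i x) = x" if "x \<in> carrier P" for x
    using that inj by (auto simp: fun_eq_iff idem_carrier)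
qed

section \<open>Comparison of projective resolutions\<close>

text \<open>\<open>P\<close> is a retract of a free module, on which lifts are chosen generator by
  generator and then restricted along \<open>i\<close>. Surjectivity of \<open>q\<close> is replaced
  by a condition on images, because the maps to be lifted against are differentials.\<close>

lemma projective_lift:
  fixes R :: "('r, 's) ring_scheme" and P :: "('r, 'p) module"
  assumes P: "projective_module R P" and N: "right_module R N" and N': "right_module R N'"
    and q: "q \<in> LinearCombinations.module_hom R N N'" and h: "h \<in> LinearCombinations.module_hom R P N'"
    and img: "h ` carrier P \<subseteq> q ` carrier N"
  shows "\<exists>g\<in>LinearCombinations.module_hom R P N. \<forall>x\<in>carrier P. q (g x) = h x"
proof -
  interpret N: right_module R N by fact
  interpret N': right_module R N' by fact
  obtain J :: "'p set" and i p where i: "i \<in> LinearCombinations.module_hom R P (free_right_module R J)"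
    and p: "p \<in> LinearCombinations.module_hom R (free_right_module R J) P"
    and pi: "\<And>x. x \<in> carrier P \<Longrightarrow> p (i x) = x"
    using P unfolding projective_module_def by blast
  have fr: "free_right_module R J = idem_module R J (\<lambda>_. \<one>\<^bsub>R\<^esub>)"
    by (rule free_eq_idem) (rule N.R.ring_axioms)
  interpret F: idempotents R J "\<lambda>_. \<one>\<^bsub>R\<^esub>"
    by unfold_locales auto
  have "\<forall>x\<in>J. \<exists>y\<in>carrier N. q y = h (p (idem_unit R (\<lambda>_. \<one>\<^bsub>R\<^esub>) x))"
  proof
    fix x assume "x \<in> J"
    then have "p (idem_unit R (\<lambda>_. \<one>\<^bsub>R\<^esub>) x) \<in> carrier P"
      using p fr by (auto simp: LinearCombinations.module_hom_def Pi_def simp del: idem_module_simps)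
    then show "\<exists>y\<in>carrier N. q y = h (p (idem_unit R (\<lambda>_. \<one>\<^bsub>R\<^esub>) x))"
      using img by (auto simp: image_subset_iff) (metis imageE)
  qed
  then obtain \<nu> where \<nu>: "\<And>x. x \<in> J \<Longrightarrow> \<nu> x \<in> carrier N"
    "\<And>x. x \<in> J \<Longrightarrow> q (\<nu> x) = h (p (idem_unit R (\<lambda>_. \<one>\<^bsub>R\<^esub>) x))"
    by metis
  let ?g = "idem_ext R N J \<nu>"
  have g: "?g \<in> LinearCombinations.module_hom R (free_right_module R J) N"
    unfolding fr by (rule F.ext_hom[OF N \<nu>(1)])
  have eq: "q (?g f) = h (p f)" if f: "f \<in> carrier (free_right_module R J)" for f
  proof (rule F.hom_eqI[OF N'])
    show "(\<lambda>f. q (?g f)) \<in> LinearCombinations.module_hom R (idem_module R J (\<lambda>_. \<one>\<^bsub>R\<^esub>)) N'"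
      using module_hom_comp[OF g q] unfolding fr .
    show "(\<lambda>f. h (p f)) \<in> LinearCombinations.module_hom R (idem_module R J (\<lambda>_. \<one>\<^bsub>R\<^esub>)) N'"
      using module_hom_comp[OF p h] unfolding fr .
  qed (use f fr \<nu> in \<open>auto simp: F.ext_unit[OF N \<nu>(1)] N.act_one\<close>)
  show ?thesis
    by (rule bexI[of _ "\<lambda>x. ?g (i x)"])
      (use eq i pi module_hom_comp[OF i g] in \<open>auto simp: LinearCombinations.module_hom_def Pi_def\<close>)
qed

lemma chain_map_exists:
  assumes P: "projective_resolution R M P d e" and Q: "projective_resolution R M Q d' e'"
    and M: "right_module R M"
  shows "\<exists>f. (\<forall>i. f i \<in> LinearCombinations.module_hom R (P i) (Q i)) \<and>
    (\<forall>x\<in>carrier (P 0). e' (f 0 x) = e x) \<and>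
    (\<forall>i. \<forall>x\<in>carrier (P (Suc i)). d' i (f (Suc i) x) = f i (d i x))"
proof -
  note P = P[unfolded projective_resolution_def] and Q = Q[unfolded projective_resolution_def]
  have QM: "right_module R (Q i)" and PM: "right_module R (P i)" for i
    using P Q by (auto simp: projective_module_def)
  have PP: "projective_module R (P i)" and dh: "d i \<in> LinearCombinations.module_hom R (P (Suc i)) (P i)"
    and dh': "d' i \<in> LinearCombinations.module_hom R (Q (Suc i)) (Q i)"
    and eh: "e \<in> LinearCombinations.module_hom R (P 0) M"
    and eh': "e' \<in> LinearCombinations.module_hom R (Q 0) M" for i
    using P Q by auto
  have d0: "d i x \<in> carrier (P i)" if "x \<in> carrier (P (Suc i))" for i x
    using P that by (auto simp: LinearCombinations.module_hom_def Pi_def)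
  have ker0: "{x \<in> carrier (Q 0). e' x = \<zero>\<^bsub>M\<^esub>} = d' 0 ` carrier (Q 1)"
    and kerS: "\<And>i. {x \<in> carrier (Q (Suc i)). d' i x = \<zero>\<^bsub>Q i\<^esub>} = d' (Suc i) ` carrier (Q (Suc (Suc i)))"
    using Q by auto
  have ed: "e (d 0 x) = \<zero>\<^bsub>M\<^esub>" if "x \<in> carrier (P 1)" for x
    using P that by blast
  have dd: "d i (d (Suc i) x) = \<zero>\<^bsub>P i\<^esub>" if "x \<in> carrier (P (Suc (Suc i)))" for i x
    using P that by blast
  \<comment> \<open>The invariant does not speak of the previous map. It records the consequence of
    commutativity that matters next: the composite with the differential is killed one degree below,
    so exactness provides the lift.\<close>
  define A where "A i f \<longleftrightarrow> f \<in> LinearCombinations.module_hom R (P i) (Q i) \<and>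
     (\<forall>x\<in>carrier (P i). case i of 0 \<Rightarrow> e' (f x) = e x
        | Suc j \<Rightarrow> d j x \<in> carrier (P j) \<longrightarrow> True) \<and>
     (\<forall>x\<in>carrier (P (Suc i)). case i of 0 \<Rightarrow> e' (f (d 0 x)) = \<zero>\<^bsub>M\<^esub> | Suc j \<Rightarrow> d' j (f (d i x)) = \<zero>\<^bsub>Q j\<^esub>)" for i f
  have "\<exists>f. \<forall>i. A i (f i) \<and> (\<forall>x\<in>carrier (P (Suc i)). d' i (f (Suc i) x) = f i (d i x))"
  proof (rule dependent_nat_choice)
    have "e ` carrier (P 0) \<subseteq> e' ` carrier (Q 0)" using P Q by simp
    then obtain f where "f \<in> LinearCombinations.module_hom R (P 0) (Q 0)" "\<forall>x\<in>carrier (P 0). e' (f x) = e x"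
      using projective_lift[OF PP QM M eh' eh] by auto
    then have "A 0 f" using ed d0[of _ 0] by (simp add: A_def)
    then show "\<exists>f. A 0 f" by (intro exI[of _ f])
  next
    fix f i assume f: "A i f"
    let ?h = "\<lambda>x. f (d i x)"
    have h: "?h \<in> LinearCombinations.module_hom R (P (Suc i)) (Q i)"
      by (rule module_hom_comp[OF dh]) (use f in \<open>simp add: A_def\<close>)
    have "?h ` carrier (P (Suc i)) \<subseteq> d' i ` carrier (Q (Suc i))"
    proof (cases i)
      case 0
      then show ?thesis using f h ker0 by (auto simp: A_def LinearCombinations.module_hom_def Pi_def)
    next
      case (Suc j)
      then show ?thesis using f h kerS[of j] by (auto simp: A_def LinearCombinations.module_hom_def Pi_def)
    qed
    then obtain g where g: "g \<in> LinearCombinations.module_hom R (P (Suc i)) (Q (Suc i))"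
      "\<forall>x\<in>carrier (P (Suc i)). d' i (g x) = f (d i x)"
      using projective_lift[OF PP QM QM dh' h] by auto
    interpret f: right_module_hom R "P i" "Q i" f
      using f QM PM by (auto simp: A_def right_module_hom_def right_module_hom_axioms_def)
    have "A (Suc i) g"
      using g d0 dd by (auto simp: A_def)
    then show "\<exists>g. A (Suc i) g \<and> (\<forall>x\<in>carrier (P (Suc i)). d' i (g x) = f (d i x))"
      using g by blast
  qed
  then obtain f where f: "\<And>i. A i (f i)" "\<And>i. \<forall>x\<in>carrier (P (Suc i)). d' i (f (Suc i) x) = f i (d i x)"
    by blast
  have "\<forall>x\<in>carrier (P 0). e' (f 0 x) = e x" using f(1)[of 0] by (auto simp: A_def)
  moreover have "f i \<in> LinearCombinations.module_hom R (P i) (Q i)" for i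
    using f(1)[of i] by (auto simp: A_def)
  ultimately show ?thesis using f(2) by blast
qed

lemma chain_homotopy_exists:
  fixes P :: "nat \<Rightarrow> ('r, 'p) module" and Q :: "nat \<Rightarrow> ('r, 'q) module"
  assumes P: "projective_resolution R M P d e" and Q: "projective_resolution R M Q d' e'"
    and M: "right_module R M"
    and t: "\<And>i. t i \<in> LinearCombinations.module_hom R (P i) (Q i)"
    and t0: "\<And>x. x \<in> carrier (P 0) \<Longrightarrow> e' (t 0 x) = \<zero>\<^bsub>M\<^esub>"
    and tS: "\<And>i x. x \<in> carrier (P (Suc i)) \<Longrightarrow> d' i (t (Suc i) x) = t i (d i x)"
  shows "\<exists>s. (\<forall>i. s i \<in> LinearCombinations.module_hom R (P i) (Q (Suc i))) \<and>
    (\<forall>x\<in>carrier (P 0). t 0 x = d' 0 (s 0 x)) \<and>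
    (\<forall>i. \<forall>x\<in>carrier (P (Suc i)). t (Suc i) x = d' (Suc i) (s (Suc i) x) \<oplus>\<^bsub>Q (Suc i)\<^esub> s i (d i x))"
proof -
  note P = P[unfolded projective_resolution_def] and Q = Q[unfolded projective_resolution_def]
  have QM: "right_module R (Q i)" and PM: "right_module R (P i)" for i
    using P Q by (auto simp: projective_module_def)
  have PP: "projective_module R (P i)" and dh: "d i \<in> LinearCombinations.module_hom R (P (Suc i)) (P i)"
    and dh': "d' i \<in> LinearCombinations.module_hom R (Q (Suc i)) (Q i)" for i
    using P Q by auto
  have dP: "d i x \<in> carrier (P i)" if "x \<in> carrier (P (Suc i))" for i x
    using P that by (auto simp: LinearCombinations.module_hom_def Pi_def)
  have tc: "t i x \<in> carrier (Q i)" if "x \<in> carrier (P i)" for i x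
    using t[of i] that by (auto simp: LinearCombinations.module_hom_def Pi_def)
  have ker0: "{x \<in> carrier (Q 0). e' x = \<zero>\<^bsub>M\<^esub>} = d' 0 ` carrier (Q 1)"
    and kerS: "\<And>i. {x \<in> carrier (Q (Suc i)). d' i x = \<zero>\<^bsub>Q i\<^esub>} = d' (Suc i) ` carrier (Q (Suc (Suc i)))"
    using Q by auto
  have dd: "d i (d (Suc i) x) = \<zero>\<^bsub>P i\<^esub>" if "x \<in> carrier (P (Suc (Suc i)))" for i x
    using P that by blast
  \<comment> \<open>The second half says that the difference between \<open>t\<close> and the
    composite of \<open>s\<close> with the differential is a cycle; it is what the next component of
    the homotopy has to bound.\<close>
  define A where "A i s \<longleftrightarrow> s \<in> LinearCombinations.module_hom R (P i) (Q (Suc i)) \<and>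
     (i = 0 \<longrightarrow> (\<forall>x\<in>carrier (P 0). t 0 x = d' 0 (s x))) \<and>
     (\<forall>x\<in>carrier (P (Suc i)). d' i (t (Suc i) x) = d' i (s (d i x)))" for i s
  have "\<exists>s. \<forall>i. A i (s i) \<and> (\<forall>x\<in>carrier (P (Suc i)). t (Suc i) x = d' (Suc i) (s (Suc i) x) \<oplus>\<^bsub>Q (Suc i)\<^esub> s i (d i x))"
  proof (rule dependent_nat_choice)
    have "t 0 ` carrier (P 0) \<subseteq> d' 0 ` carrier (Q 1)" using ker0 t0 tc by auto
    then obtain s where "s \<in> LinearCombinations.module_hom R (P 0) (Q 1)" "\<forall>x\<in>carrier (P 0). d' 0 (s x) = t 0 x"
      using projective_lift[OF PP[of 0] QM QM dh'[of 0] t[of 0]] by auto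
    then have "A 0 s" using dP[of _ 0] tS[of _ 0] by (simp add: A_def)
    then show "\<exists>s. A 0 s" by (intro exI[of _ s])
  next
    fix s i assume s: "A i s"
    interpret QS: right_module R "Q (Suc i)" by (rule QM)
    interpret dQ: right_module_hom R "Q (Suc i)" "Q i" "d' i"
      using Q QM by (auto simp: right_module_hom_def right_module_hom_axioms_def)
    interpret dQ': right_module_hom R "Q (Suc (Suc i))" "Q (Suc i)" "d' (Suc i)"
      using Q QM by (auto simp: right_module_hom_def right_module_hom_axioms_def)
    interpret s: right_module_hom R "P i" "Q (Suc i)" s
      using s QM PM by (auto simp: A_def right_module_hom_def right_module_hom_axioms_def)
    let ?h = "\<lambda>x. t (Suc i) x \<ominus>\<^bsub>Q (Suc i)\<^esub> s (d i x)"
    have h: "?h \<in> LinearCombinations.module_hom R (P (Suc i)) (Q (Suc i))"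
      by (rule module_hom_sub[OF QM t module_hom_comp[OF dh]]) (use s in \<open>simp add: A_def\<close>)
    have "d' i (?h x) = \<zero>\<^bsub>Q i\<^esub>" if "x \<in> carrier (P (Suc i))" for x
      using that s dP tc by (auto simp: A_def a_minus_def dQ.hom_add dQ.hom_minus dQ.N.M.r_neg)
    then have "?h ` carrier (P (Suc i)) \<subseteq> d' (Suc i) ` carrier (Q (Suc (Suc i)))"
      using kerS[of i] h by (auto simp: LinearCombinations.module_hom_def Pi_def)
    then obtain g where g: "g \<in> LinearCombinations.module_hom R (P (Suc i)) (Q (Suc (Suc i)))"
      "\<And>x. x\<in>carrier (P (Suc i)) \<Longrightarrow> d' (Suc i) (g x) = ?h x"
      using projective_lift[OF PP QM QM dh' h] by auto
    have 1: "t (Suc i) x = d' (Suc i) (g x) \<oplus>\<^bsub>Q (Suc i)\<^esub> s (d i x)" if "x \<in> carrier (P (Suc i))" for x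
      using that tc dP g(2) by (simp add: a_minus_def QS.M.a_assoc QS.M.l_neg)
    have "A (Suc i) g"
      unfolding A_def
    proof (intro conjI ballI)
      fix x assume x: "x \<in> carrier (P (Suc (Suc i)))"
      have "d' (Suc i) (g (d (Suc i) x)) = t (Suc i) (d (Suc i) x)"
        using x dP g(2) dd tc by (simp add: a_minus_def)
      then show "d' (Suc i) (t (Suc (Suc i)) x) = d' (Suc i) (g (d (Suc i) x))"
        using tS[OF x] by simp
    qed (use g in auto)
    then show "\<exists>g. A (Suc i) g \<and> (\<forall>x\<in>carrier (P (Suc i)). t (Suc i) x = d' (Suc i) (g x) \<oplus>\<^bsub>Q (Suc i)\<^esub> s (d i x))"
      using 1 by blast
  qed
  then obtain s where s: "\<And>i. A i (s i)"
    "\<And>i. \<forall>x\<in>carrier (P (Suc i)). t (Suc i) x = d' (Suc i) (s (Suc i) x) \<oplus>\<^bsub>Q (Suc i)\<^esub> s i (d i x)"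
    by blast
  have "\<forall>x\<in>carrier (P 0). t 0 x = d' 0 (s 0 x)" using s(1)[of 0] by (auto simp: A_def)
  moreover have "s i \<in> LinearCombinations.module_hom R (P i) (Q (Suc i))" for i
    using s(1)[of i] by (auto simp: A_def)
  ultimately show ?thesis using s(2) by blast
qed

section \<open>Quotients and dimensions\<close>

lemma quot_algebra_simps:
  "carrier (quot_algebra A I) = (\<lambda>x. I +>\<^bsub>A\<^esub> x) ` carrier A"
  "mult (quot_algebra A I) = rcoset_mult A I"
  "one (quot_algebra A I) = I +>\<^bsub>A\<^esub> \<one>\<^bsub>A\<^esub>"
  "zero (quot_algebra A I) = I"
  "add (quot_algebra A I) = set_add A"
  by (auto simp: quot_algebra_def FactRing_def A_RCOSETS_def' a_r_coset_def')

text \<open>All representatives of a coset yield the same scaled coset, so the union over them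
  collapses.\<close>

lemma quot_algebra_smult:
  assumes "abelian_subgroup I A" and I: "\<And>u. u \<in> I \<Longrightarrow> c \<odot>\<^bsub>A\<^esub> u \<in> I"
    and d: "\<And>x y. x \<in> carrier A \<Longrightarrow> y \<in> carrier A \<Longrightarrow> c \<odot>\<^bsub>A\<^esub> (x \<oplus>\<^bsub>A\<^esub> y) = c \<odot>\<^bsub>A\<^esub> x \<oplus>\<^bsub>A\<^esub> c \<odot>\<^bsub>A\<^esub> y"
    and cl: "\<And>x. x \<in> carrier A \<Longrightarrow> c \<odot>\<^bsub>A\<^esub> x \<in> carrier A" and x: "x \<in> carrier A"
  shows "c \<odot>\<^bsub>quot_algebra A I\<^esub> (I +>\<^bsub>A\<^esub> x) = I +>\<^bsub>A\<^esub> (c \<odot>\<^bsub>A\<^esub> x)"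
proof -
  interpret abelian_subgroup I A by fact
  have eq: "I +>\<^bsub>A\<^esub> (c \<odot>\<^bsub>A\<^esub> u) = I +>\<^bsub>A\<^esub> (c \<odot>\<^bsub>A\<^esub> x)" if u: "u \<in> I +>\<^bsub>A\<^esub> x" for u
  proof -
    obtain h where h: "h \<in> I" "u = h \<oplus>\<^bsub>A\<^esub> x" using u by (auto simp: a_r_coset_def')
    then have "c \<odot>\<^bsub>A\<^esub> u = c \<odot>\<^bsub>A\<^esub> h \<oplus>\<^bsub>A\<^esub> c \<odot>\<^bsub>A\<^esub> x" using d x a_subset by auto
    then have "c \<odot>\<^bsub>A\<^esub> u \<in> I +>\<^bsub>A\<^esub> (c \<odot>\<^bsub>A\<^esub> x)" using I h by (auto simp: a_r_coset_def')
    then show ?thesis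
      using a_repr_independence[OF _ cl[OF x]] a_subgroup by metis
  qed
  have "x \<in> I +>\<^bsub>A\<^esub> x" using x by (rule a_rcos_self)
  then have "(\<Union>u\<in>I +>\<^bsub>A\<^esub> x. I +>\<^bsub>A\<^esub> (c \<odot>\<^bsub>A\<^esub> u)) = I +>\<^bsub>A\<^esub> (c \<odot>\<^bsub>A\<^esub> x)" using eq by blast
  then show ?thesis by (simp add: quot_algebra_def)
qed

lemma quot_algebra_abelian_group:
  assumes "abelian_subgroup I A"
  shows "abelian_group (quot_algebra A I)"
proof -
  interpret abelian_subgroup I A by fact
  interpret F: comm_group "A A_Mod I" by (rule a_factorgroup_is_comm_group)
  show ?thesis
  proof (rule abelian_groupI)
    fix x assume "x \<in> carrier (quot_algebra A I)"
    then show "\<exists>y\<in>carrier (quot_algebra A I). y \<oplus>\<^bsub>quot_algebra A I\<^esub> x = \<zero>\<^bsub>quot_algebra A I\<^esub>"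
      using F.l_inv_ex[of x] by (simp add: quot_algebra_def FactRing_def A_FactGroup_def')
  qed (use F.m_assoc F.m_comm F.m_closed F.one_closed F.l_one in
        \<open>simp_all add: quot_algebra_def FactRing_def A_FactGroup_def'\<close>)
qed

lemma abelian_subgroup_submodule:
  assumes "Module.module (class_ring :: 'k::field ring) (V :: ('k, 'v) module)"
    and "B \<subseteq> carrier V" "\<zero>\<^bsub>V\<^esub> \<in> B"
    and "\<And>x y. x \<in> B \<Longrightarrow> y \<in> B \<Longrightarrow> x \<oplus>\<^bsub>V\<^esub> y \<in> B"
    and "\<And>c x. x \<in> B \<Longrightarrow> c \<odot>\<^bsub>V\<^esub> x \<in> B"
  shows "abelian_subgroup B V"
proof -
  interpret V: Module.module "class_ring :: 'k ring" V by fact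
  have neg: "\<ominus>\<^bsub>V\<^esub> x \<in> B" if "x \<in> B" for x
    using assms(5)[OF that, of "-1"] V.smult_l_minus[of 1 x] V.smult_one[of x] that assms(2)
    by (auto simp: class_ring_simps subset_iff)
  show ?thesis
  proof (intro abelian_subgroupI3 additive_subgroupI V.abelian_group_axioms)
    show "subgroup B (add_monoid V)"
      using assms neg by (intro subgroup.intro) (auto simp: a_inv_def)
  qed
qed

text \<open>\<open>\<Phi>\<close> induces an isomorphism from \<open>Z\<close> modulo
  \<open>B\<close> onto coordinate vectors. The map built below is its inverse, so that finiteness
  and the value of the dimension carry over from \<open>module_vec\<close>.\<close>

lemma has_dim_quotI:
  fixes V :: "('k::field, 'v) module" and \<Phi> :: "'v \<Rightarrow> 'k vec"
  assumes V: "Module.module (class_ring :: 'k ring) V" and Z: "Z \<subseteq> carrier V" "\<zero>\<^bsub>V\<^esub> \<in> Z"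
    and Za: "\<And>x y. x \<in> Z \<Longrightarrow> y \<in> Z \<Longrightarrow> x \<oplus>\<^bsub>V\<^esub> y \<in> Z"
    and Zs: "\<And>c x. x \<in> Z \<Longrightarrow> c \<odot>\<^bsub>V\<^esub> x \<in> Z"
    and \<Phi>a: "\<And>x y. x \<in> Z \<Longrightarrow> y \<in> Z \<Longrightarrow> \<Phi> (x \<oplus>\<^bsub>V\<^esub> y) = \<Phi> x + \<Phi> y"
    and \<Phi>s: "\<And>c x. x \<in> Z \<Longrightarrow> \<Phi> (c \<odot>\<^bsub>V\<^esub> x) = c \<cdot>\<^sub>v \<Phi> x"
    and img: "\<Phi> ` Z = carrier_vec D"
    and ker: "\<And>x. x \<in> Z \<Longrightarrow> \<Phi> x = 0\<^sub>v D \<longleftrightarrow> x \<in> B" and BZ: "B \<subseteq> Z"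
  shows "has_dim (quot_algebra (V\<lparr>carrier := Z\<rparr>) B) D"
proof -
  interpret V: Module.module "class_ring :: 'k ring" V by fact
  define W where "W = V\<lparr>carrier := Z\<rparr>"
  have W: "Module.module (class_ring :: 'k ring) W"
    unfolding W_def
    by (rule V.submodule_is_module) (use V Z Za Zs in \<open>auto simp: LinearCombinations.submodule_def\<close>)
  interpret W: Module.module "class_ring :: 'k ring" W by fact
  have W_simps: "carrier W = Z" "add W = add V" "zero W = zero V" "smult W = smult V"
    by (auto simp: W_def)
  have Vc: "x \<in> Z \<Longrightarrow> x \<in> carrier V" for x using Z by auto
  have \<Phi>c: "\<Phi> x \<in> carrier_vec D" if "x \<in> Z" for x using img that by auto
  have \<Phi>0: "\<Phi> \<zero>\<^bsub>V\<^esub> = 0\<^sub>v D"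
  proof -
    have "0 \<cdot>\<^sub>v v = 0\<^sub>v D" if "v \<in> carrier_vec D" for v :: "'k vec"
      using that by (intro eq_vecI) auto
    then show ?thesis
      using \<Phi>s[OF Z(2), of 0] V.smult_l_null[of "\<zero>\<^bsub>V\<^esub>"] \<Phi>c[OF Z(2)] by (simp add: class_ring_simps)
  qed
  have B_iff: "x \<in> B \<longleftrightarrow> x \<in> Z \<and> \<Phi> x = 0\<^sub>v D" for x using BZ ker by auto
  have v0: "c \<cdot>\<^sub>v 0\<^sub>v D = (0\<^sub>v D :: 'k vec)" for c by (intro eq_vecI) auto
  have B: "abelian_subgroup B W"
    by (rule abelian_subgroup_submodule[OF W])
      (use \<Phi>0 Z \<Phi>a \<Phi>s Za Zs v0 in \<open>auto simp: W_simps B_iff\<close>)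
  interpret B: abelian_subgroup B W by fact
  define Q where "Q = quot_algebra W B"
  have Qs: "c \<odot>\<^bsub>Q\<^esub> (B +>\<^bsub>W\<^esub> x) = B +>\<^bsub>W\<^esub> (c \<odot>\<^bsub>V\<^esub> x)" if "x \<in> Z" for c x
    unfolding Q_def
    by (subst quot_algebra_smult[OF B])
      (use that v0 \<Phi>s Zs Vc in \<open>auto simp: W_simps B_iff V.smult_r_distr class_ring_simps\<close>)
  have Qa: "(B +>\<^bsub>W\<^esub> x) \<oplus>\<^bsub>Q\<^esub> (B +>\<^bsub>W\<^esub> y) = B +>\<^bsub>W\<^esub> (x \<oplus>\<^bsub>V\<^esub> y)" if "x \<in> Z" "y \<in> Z" for x y
    unfolding Q_def quot_algebra_simps using B.a_rcos_sum[of x y] that by (simp add: W_simps)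
  have Qc: "carrier Q = (\<lambda>x. B +>\<^bsub>W\<^esub> x) ` Z"
    unfolding Q_def quot_algebra_simps by (simp add: W_simps)
  have sc: "(a + b) \<odot>\<^bsub>V\<^esub> x = a \<odot>\<^bsub>V\<^esub> x \<oplus>\<^bsub>V\<^esub> b \<odot>\<^bsub>V\<^esub> x" "(a * b) \<odot>\<^bsub>V\<^esub> x = a \<odot>\<^bsub>V\<^esub> (b \<odot>\<^bsub>V\<^esub> x)"
    "1 \<odot>\<^bsub>V\<^esub> x = x" if "x \<in> Z" for a b :: 'k and x
    using V.smult_l_distr[of a b x] V.smult_assoc1[of a b x] V.smult_one[of x] Vc[OF that]
    by (simp_all add: class_ring_simps)
  have Qmod: "Module.module (class_ring :: 'k ring) Q"
  proof (rule Module.moduleI)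
    show "abelian_group Q" unfolding Q_def by (rule quot_algebra_abelian_group[OF B])
  qed (use Zs Za Vc in \<open>auto simp: Qc Qs Qa sc V.smult_r_distr class_ring_simps class_cring.is_cring\<close>)
  have Qvs: "vectorspace (class_ring :: 'k ring) Q"
    using Qmod class_field by (simp add: vectorspace_def)
  have coset_eq: "B +>\<^bsub>W\<^esub> x = B +>\<^bsub>W\<^esub> y \<longleftrightarrow> \<Phi> x = \<Phi> y" if x: "x \<in> Z" and y: "y \<in> Z" for x y
  proof
    assume "B +>\<^bsub>W\<^esub> x = B +>\<^bsub>W\<^esub> y"
    then have "x \<in> B +>\<^bsub>W\<^esub> y" using B.a_rcos_self[of x] x by (simp add: W_simps)
    then obtain b where b: "b \<in> B" "x = b \<oplus>\<^bsub>V\<^esub> y" by (auto simp: a_r_coset_def' W_simps)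
    then have "\<Phi> x = \<Phi> b + \<Phi> y" using BZ y \<Phi>a by auto
    moreover have "\<Phi> b = 0\<^sub>v D" using b BZ ker by auto
    ultimately show "\<Phi> x = \<Phi> y" using \<Phi>c[OF y] by simp
  next
    assume eq: "\<Phi> x = \<Phi> y"
    \<comment> \<open>The difference of \<open>x\<close> and \<open>y\<close>, which lies in the
      kernel of \<open>\<Phi>\<close>.\<close>
    define z where "z = x \<oplus>\<^bsub>V\<^esub> (-1) \<odot>\<^bsub>V\<^esub> y"
    have m1: "(-1) \<odot>\<^bsub>V\<^esub> y \<in> Z" using Zs y by auto
    have z: "z \<in> Z" unfolding z_def using Za Zs x y by auto
    have "\<Phi> z = 0\<^sub>v D" unfolding z_def using \<Phi>a[OF x m1] \<Phi>s[OF y, of "-1"] eq \<Phi>c[OF y] by auto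
    then have zB: "z \<in> B" using ker z by auto
    have "(-1) \<odot>\<^bsub>V\<^esub> y \<oplus>\<^bsub>V\<^esub> 1 \<odot>\<^bsub>V\<^esub> y = \<zero>\<^bsub>V\<^esub>"
      using V.smult_l_distr[of "-1" 1 y] V.smult_l_null[of y] Vc[OF y] by (simp add: class_ring_simps)
    then have "x = z \<oplus>\<^bsub>V\<^esub> y"
      unfolding z_def using Vc[OF x] Vc[OF y] Vc[OF m1] V.smult_one[of y]
      by (simp add: class_ring_simps V.M.a_assoc)
    then have "x \<in> B +>\<^bsub>W\<^esub> y" using zB by (auto simp: a_r_coset_def' W_simps)
    then show "B +>\<^bsub>W\<^esub> x = B +>\<^bsub>W\<^esub> y"
      using W.a_repr_independence[of x B y] y B.a_subgroup by (simp add: W_simps)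
  qed
  define \<phi> where "\<phi> v = (SOME x. x \<in> Z \<and> \<Phi> x = v)" for v
  have \<phi>: "\<phi> v \<in> Z" "\<Phi> (\<phi> v) = v" if "v \<in> carrier_vec D" for v
  proof -
    have "\<exists>x. x \<in> Z \<and> \<Phi> x = v" using that img by (metis imageE)
    then have "\<phi> v \<in> Z \<and> \<Phi> (\<phi> v) = v" unfolding \<phi>_def by (rule someI_ex)
    then show "\<phi> v \<in> Z" "\<Phi> (\<phi> v) = v" by auto
  qed
  \<comment> \<open>By \<open>coset_eq\<close> the coset does not depend on the chosen preimage,
    which makes \<open>T\<close> linear.\<close>
  define T where "T v = B +>\<^bsub>W\<^esub> \<phi> v" for v
  interpret vs: vec_space "TYPE('k)" D .
  have Thom: "T \<in> LinearCombinations.module_hom class_ring (module_vec TYPE('k) D) Q"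
  proof (rule module_homI)
    fix v w assume v: "v \<in> carrier (module_vec TYPE('k) D)" and w: "w \<in> carrier (module_vec TYPE('k) D)"
    then have *: "v \<in> carrier_vec D" "w \<in> carrier_vec D" by (auto simp: module_vec_simps)
    show "T v \<in> carrier Q" using \<phi>[OF *(1)] by (auto simp: T_def Qc)
    show "T (v \<oplus>\<^bsub>module_vec TYPE('k) D\<^esub> w) = T v \<oplus>\<^bsub>Q\<^esub> T w"
    proof -
      have "\<Phi> (\<phi> (v + w)) = \<Phi> (\<phi> v \<oplus>\<^bsub>V\<^esub> \<phi> w)"
        using * by (simp add: \<phi> \<Phi>a)
      then have "B +>\<^bsub>W\<^esub> \<phi> (v + w) = B +>\<^bsub>W\<^esub> (\<phi> v \<oplus>\<^bsub>V\<^esub> \<phi> w)"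
        using * by (subst coset_eq) (auto intro: Za \<phi>)
      then show ?thesis
        using * by (simp add: T_def module_vec_simps Qa \<phi>)
    qed
  next
    fix c v assume "v \<in> carrier (module_vec TYPE('k) D)"
    then have *: "v \<in> carrier_vec D" by (auto simp: module_vec_simps)
    then show "T (c \<odot>\<^bsub>module_vec TYPE('k) D\<^esub> v) = c \<odot>\<^bsub>Q\<^esub> T v"
      using \<phi>[of v] \<phi>[of "c \<cdot>\<^sub>v v"]
      by (simp add: T_def module_vec_simps Qs coset_eq Zs \<Phi>s)
  qed
  interpret T: linear_map "class_ring :: 'k ring" "module_vec TYPE('k) D" Q T
  proof (intro linear_map.intro mod_hom.intro mod_hom_axioms.intro)
    show "vectorspace class_ring (module_vec TYPE('k) D)" by (rule vec_vs)
    show "Module.module class_ring (module_vec TYPE('k) D)" by (rule vec_module)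
  qed (use Qvs Qmod Thom in auto)
  have inj: "inj_on T (carrier (module_vec TYPE('k) D))"
    using \<phi> by (auto simp: inj_on_def T_def module_vec_simps coset_eq)
  have surj: "T ` carrier (module_vec TYPE('k) D) = carrier Q"
  proof
    show "carrier Q \<subseteq> T ` carrier (module_vec TYPE('k) D)"
    proof
      fix q assume "q \<in> carrier Q"
      then obtain x where x: "x \<in> Z" "q = B +>\<^bsub>W\<^esub> x" by (auto simp: Qc)
      then have "q = T (\<Phi> x)" using \<phi>[OF \<Phi>c[OF x(1)]] by (simp add: T_def coset_eq)
      then show "q \<in> T ` carrier (module_vec TYPE('k) D)"
        using \<Phi>c[OF x(1)] by (auto simp: module_vec_simps)
    qed
  qed (auto simp: T_def Qc module_vec_simps \<phi>)
  have "vectorspace.fin_dim class_ring Q"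
    by (rule T.surj_fin_dim[OF _ surj]) (rule vs.fin_dim)
  moreover have "vectorspace.dim class_ring Q = D"
    using T.dim_eq[OF _ inj surj] vs.fin_dim vs.dim_is_n by simp
  ultimately show ?thesis
    using Qvs unfolding has_dim_def Q_def W_def by auto
qed

section \<open>Dimensions of Ext groups\<close>

text \<open>Scalars act on homomorphisms through the multiples of the unit, so the axioms concern
  these alone. Centrality makes a scaled homomorphism linear again.\<close>

locale central_scalars = ring R for R :: "('k::field, 'r) module" (structure) +
  assumes scalar_closed [simp]: "(c :: 'k) \<odot> \<one> \<in> carrier R"
    and scalar_add: "(c + d) \<odot> \<one> = c \<odot> \<one> \<oplus> d \<odot> \<one>"
    and scalar_mult: "(c * d) \<odot> \<one> = (c \<odot> \<one>) \<otimes> (d \<odot> \<one>)"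
    and scalar_one: "1 \<odot> \<one> = \<one>"
    and scalar_central: "r \<in> carrier R \<Longrightarrow> (c \<odot> \<one>) \<otimes> r = r \<otimes> (c \<odot> \<one>)"

lemma hom_space_simps:
  "carrier (hom_space R P N) = LinearCombinations.module_hom R P N \<inter> extensional (carrier P)"
  "zero (hom_space R P N) = (\<lambda>x\<in>carrier P. \<zero>\<^bsub>N\<^esub>)"
  "add (hom_space R P N) = (\<lambda>f g. \<lambda>x\<in>carrier P. f x \<oplus>\<^bsub>N\<^esub> g x)"
  "smult (hom_space R P N) = (\<lambda>c f. \<lambda>x\<in>carrier P. (c \<odot>\<^bsub>R\<^esub> \<one>\<^bsub>R\<^esub>) \<odot>\<^bsub>N\<^esub> f x)"
  by (simp_all add: hom_space_def)

lemma (in central_scalars) hom_space_module: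
  assumes P: "right_module R P" and N: "right_module R N"
  shows "Module.module (class_ring :: 'k ring) (hom_space R P N)"
proof -
  interpret P: right_module R P by fact
  interpret N: right_module R N by fact
  have c: "f x \<in> carrier N" if "f \<in> LinearCombinations.module_hom R P N" "x \<in> carrier P" for f x
    using that by (auto simp: LinearCombinations.module_hom_def)
  have h: "f (x \<oplus>\<^bsub>P\<^esub> y) = f x \<oplus>\<^bsub>N\<^esub> f y" "r \<in> carrier R \<Longrightarrow> f (r \<odot>\<^bsub>P\<^esub> x) = r \<odot>\<^bsub>N\<^esub> f x"
    if "f \<in> LinearCombinations.module_hom R P N" "x \<in> carrier P" "y \<in> carrier P" for f r x y
    using that by (auto simp: LinearCombinations.module_hom_def)
  have addh: "(\<lambda>x\<in>carrier P. f x \<oplus>\<^bsub>N\<^esub> g x) \<in> LinearCombinations.module_hom R P N"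
    if "f \<in> LinearCombinations.module_hom R P N" "g \<in> LinearCombinations.module_hom R P N" for f g
    by (rule module_homI)
      (use that c[OF that(1)] c[OF that(2)] h[OF that(1)] h[OF that(2)] P.act_closed
       in \<open>auto simp: N.M.a_ac N.act_distr_module\<close>)
  have swap: "(a \<odot> \<one>) \<odot>\<^bsub>N\<^esub> (r \<odot>\<^bsub>N\<^esub> x) = r \<odot>\<^bsub>N\<^esub> ((a \<odot> \<one>) \<odot>\<^bsub>N\<^esub> x)"
    if "r \<in> carrier R" "x \<in> carrier N" for a r x
    using that scalar_central[of r a] by (simp flip: N.act_mult)
  have smulth: "(\<lambda>x\<in>carrier P. (a \<odot> \<one>) \<odot>\<^bsub>N\<^esub> f x) \<in> LinearCombinations.module_hom R P N"
    if "f \<in> LinearCombinations.module_hom R P N" for a f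
    by (rule module_homI)
      (use that c[OF that] h[OF that] P.act_closed N.act_closed swap in \<open>auto simp: N.act_distr_module\<close>)
  have zeroh: "(\<lambda>x\<in>carrier P. \<zero>\<^bsub>N\<^esub>) \<in> LinearCombinations.module_hom R P N"
    by (rule module_homI) (auto simp: P.act_closed)
  have ag: "abelian_group (hom_space R P N)"
  proof (rule abelian_groupI)
    fix f assume f: "f \<in> carrier (hom_space R P N)"
    then have f': "f \<in> LinearCombinations.module_hom R P N" by (simp add: hom_space_simps)
    show "\<exists>g\<in>carrier (hom_space R P N). g \<oplus>\<^bsub>hom_space R P N\<^esub> f = \<zero>\<^bsub>hom_space R P N\<^esub>"
    proof
      show "(\<lambda>x\<in>carrier P. (-1 \<odot> \<one>) \<odot>\<^bsub>N\<^esub> f x) \<in> carrier (hom_space R P N)"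
        using smulth[OF f'] by (auto simp: hom_space_simps)
      have "(-1 \<odot> \<one>) \<odot>\<^bsub>N\<^esub> f x \<oplus>\<^bsub>N\<^esub> f x = \<zero>\<^bsub>N\<^esub>" if x: "x \<in> carrier P" for x
      proof -
        have "(-1 \<odot> \<one>) \<odot>\<^bsub>N\<^esub> f x \<oplus>\<^bsub>N\<^esub> (1 \<odot> \<one>) \<odot>\<^bsub>N\<^esub> f x = ((-1 + 1) \<odot> \<one>) \<odot>\<^bsub>N\<^esub> f x"
          unfolding scalar_add using c[OF f' x] by (simp add: N.act_distr_ring)
        moreover have "(0 :: 'k) \<odot> \<one> = \<zero>"
          using scalar_add[of 0 0] scalar_closed[of 0] by (metis add.l_cancel_one' add_0 zero_closed)
        ultimately show ?thesis using c[OF f' x] by (simp add: scalar_one N.act_one)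
      qed
      then show "(\<lambda>x\<in>carrier P. (-1 \<odot> \<one>) \<odot>\<^bsub>N\<^esub> f x) \<oplus>\<^bsub>hom_space R P N\<^esub> f = \<zero>\<^bsub>hom_space R P N\<^esub>"
        by (auto simp: hom_space_simps fun_eq_iff)
    qed
  qed (use addh zeroh c in \<open>auto simp: hom_space_simps fun_eq_iff N.M.a_ac extensional_def\<close>)
  show ?thesis
  proof (rule Module.moduleI[OF class_cring.is_cring ag])
    fix a :: 'k and f assume "f \<in> carrier (hom_space R P N)"
    then show "a \<odot>\<^bsub>hom_space R P N\<^esub> f \<in> carrier (hom_space R P N)"
      using smulth[of f a] by (simp add: hom_space_simps)
  next
    fix a b :: 'k and f assume "f \<in> carrier (hom_space R P N)"
    then have "f \<in> LinearCombinations.module_hom R P N" by (simp add: hom_space_simps)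
    note cf = c[OF this]
    show "(a \<oplus>\<^bsub>class_ring\<^esub> b) \<odot>\<^bsub>hom_space R P N\<^esub> f =
      a \<odot>\<^bsub>hom_space R P N\<^esub> f \<oplus>\<^bsub>hom_space R P N\<^esub> b \<odot>\<^bsub>hom_space R P N\<^esub> f"
      using cf by (simp add: hom_space_simps fun_eq_iff scalar_add N.act_distr_ring)
    show "(a \<otimes>\<^bsub>class_ring\<^esub> b) \<odot>\<^bsub>hom_space R P N\<^esub> f =
      a \<odot>\<^bsub>hom_space R P N\<^esub> (b \<odot>\<^bsub>hom_space R P N\<^esub> f)"
    proof -
      have "(a * b) \<odot> \<one> = (b \<odot> \<one>) \<otimes> (a \<odot> \<one>)" by (simp flip: scalar_mult add: mult.commute)
      then show ?thesis using cf by (simp add: hom_space_simps fun_eq_iff N.act_mult)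
    qed
  next
    fix a :: 'k and f g assume "f \<in> carrier (hom_space R P N)" "g \<in> carrier (hom_space R P N)"
    then show "a \<odot>\<^bsub>hom_space R P N\<^esub> (f \<oplus>\<^bsub>hom_space R P N\<^esub> g) =
      a \<odot>\<^bsub>hom_space R P N\<^esub> f \<oplus>\<^bsub>hom_space R P N\<^esub> a \<odot>\<^bsub>hom_space R P N\<^esub> g"
      using c[of f] c[of g] by (simp add: hom_space_simps fun_eq_iff N.act_distr_module)
  next
    fix f assume f: "f \<in> carrier (hom_space R P N)"
    show "\<one>\<^bsub>class_ring\<^esub> \<odot>\<^bsub>hom_space R P N\<^esub> f = f"
    proof
      fix x
      show "(\<one>\<^bsub>class_ring\<^esub> \<odot>\<^bsub>hom_space R P N\<^esub> f) x = f x"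
        using f c[of f x] by (cases "x \<in> carrier P") (auto simp: hom_space_simps scalar_one N.act_one extensional_def)
    qed
  qed
qed

text \<open>A certificate that the cohomology has dimension \<open>D\<close>. It lives on cocycles
  and not on the quotient, so it can be moved to another resolution by composing with a
  pullback.\<close>

definition cohomology_coords ::
  "('k::field, 'r) module \<Rightarrow> (nat \<Rightarrow> ('r, 'p) module) \<Rightarrow> (nat \<Rightarrow> 'p \<Rightarrow> 'p) \<Rightarrow> ('r, 'n) module \<Rightarrow>
     nat \<Rightarrow> nat \<Rightarrow> (('p \<Rightarrow> 'n) \<Rightarrow> 'k vec) \<Rightarrow> bool" where
  "cohomology_coords R P d N i D \<Phi> \<longleftrightarrow>
    (\<forall>f\<in>hom_cocycles R P d N i. \<forall>g\<in>hom_cocycles R P d N i. \<Phi> (f \<oplus>\<^bsub>hom_space R (P i) N\<^esub> g) = \<Phi> f + \<Phi> g) \<and>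
    (\<forall>f\<in>hom_cocycles R P d N i. \<forall>c. \<Phi> (c \<odot>\<^bsub>hom_space R (P i) N\<^esub> f) = c \<cdot>\<^sub>v \<Phi> f) \<and>
    \<Phi> ` hom_cocycles R P d N i = carrier_vec D \<and>
    (\<forall>f\<in>hom_cocycles R P d N i. \<Phi> f = 0\<^sub>v D \<longleftrightarrow> f \<in> hom_coboundaries R P d N i)"

lemma hom_cocycles_iff:
  "f \<in> hom_cocycles R P d N i \<longleftrightarrow> f \<in> LinearCombinations.module_hom R (P i) N \<and>
     f \<in> extensional (carrier (P i)) \<and> (\<forall>x\<in>carrier (P (Suc i)). f (d i x) = \<zero>\<^bsub>N\<^esub>)"
  by (auto simp: hom_cocycles_def hom_space_simps hom_diff_def compose_def fun_eq_iff restrict_def)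

lemma hom_coboundaries_Suc_iff:
  "f \<in> hom_coboundaries R P d N (Suc i) \<longleftrightarrow> f \<in> extensional (carrier (P (Suc i))) \<and>
     (\<exists>h\<in>LinearCombinations.module_hom R (P i) N \<inter> extensional (carrier (P i)).
        \<forall>x\<in>carrier (P (Suc i)). f x = h (d i x))"
  by (auto simp: hom_coboundaries_def hom_space_simps hom_diff_def compose_def image_iff
        extensional_def fun_eq_iff restrict_def)

lemma hom_coboundaries_0:
  "hom_coboundaries R P d N 0 = {\<lambda>x\<in>carrier (P 0). \<zero>\<^bsub>N\<^esub>}"
  by (auto simp: hom_coboundaries_def hom_space_simps)

lemma (in central_scalars) has_dim_cohomologyI:
  assumes res: "projective_resolution R M P d e" and N: "right_module R N"
    and \<Phi>: "cohomology_coords R P d N i D \<Phi>"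
  shows "has_dim (hom_cohomology R P d N i) D"
proof -
  interpret N: right_module R N by fact
  have PM: "right_module R (P i)" for i
    using res by (auto simp: projective_resolution_def projective_module_def)
  interpret H: Module.module "class_ring :: 'k ring" "hom_space R (P i) N"
    by (rule hom_space_module[OF PM N])
  let ?Z = "hom_cocycles R P d N i"
  have dc: "d j x \<in> carrier (P j)" if "x \<in> carrier (P (Suc j))" for j x
    using res that by (auto simp: projective_resolution_def LinearCombinations.module_hom_def)
  have dd: "d j (d (Suc j) x) = \<zero>\<^bsub>P j\<^esub>" if "x \<in> carrier (P (Suc (Suc j)))" for j x
    using res that unfolding projective_resolution_def by blast
  have dh: "d j \<in> LinearCombinations.module_hom R (P (Suc j)) (P j)" for j
    using res by (auto simp: projective_resolution_def)
  have ZH: "?Z \<subseteq> carrier (hom_space R (P i) N)" by (auto simp: hom_cocycles_def)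
  have Za: "f \<oplus>\<^bsub>hom_space R (P i) N\<^esub> g \<in> ?Z" if "f \<in> ?Z" "g \<in> ?Z" for f g
    using that ZH H.a_closed[of f g] dc unfolding hom_cocycles_iff
    by (auto simp: hom_space_simps subset_iff hom_cocycles_iff)
  have Zs: "c \<odot>\<^bsub>hom_space R (P i) N\<^esub> f \<in> ?Z" if "f \<in> ?Z" for c f
    using that ZH H.smult_closed[of c f] dc unfolding hom_cocycles_iff
    by (auto simp: hom_space_simps subset_iff hom_cocycles_iff class_ring_simps)
  have Z0: "\<zero>\<^bsub>hom_space R (P i) N\<^esub> \<in> ?Z"
    using H.zero_closed dc unfolding hom_cocycles_iff by (auto simp: hom_space_simps)
  have B: "hom_coboundaries R P d N i \<subseteq> ?Z"
  proof (cases i)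
    case 0
    then show ?thesis using Z0 by (simp add: hom_coboundaries_0 hom_space_simps)
  next
    case (Suc j)
    show ?thesis
    proof
      fix f assume "f \<in> hom_coboundaries R P d N i"
      then obtain h where h: "h \<in> LinearCombinations.module_hom R (P j) N"
        "f \<in> extensional (carrier (P i))" "\<And>x. x \<in> carrier (P (Suc j)) \<Longrightarrow> f x = h (d j x)"
        by (auto simp: Suc hom_coboundaries_Suc_iff)
      interpret h: right_module_hom R "P j" N h
        using h PM N by (auto simp: right_module_hom_def right_module_hom_axioms_def)
      have "(\<lambda>x. h (d j x)) \<in> LinearCombinations.module_hom R (P (Suc j)) N"
        by (rule module_hom_comp[OF dh h(1)])
      then have "f \<in> LinearCombinations.module_hom R (P (Suc j)) N"
        using h(3) PM[of "Suc j"] by (auto simp: LinearCombinations.module_hom_def Pi_def right_module.act_closed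
           abelian_group.axioms right_module_def abelian_monoid.a_closed)
      then show "f \<in> ?Z" using h dc dd by (simp add: hom_cocycles_iff Suc)
    qed
  qed
  show ?thesis
    unfolding hom_cohomology_def
    by (rule has_dim_quotI[OF H.module_axioms ZH Z0 Za Zs, where \<Phi> = \<Phi>])
      (use \<Phi> B in \<open>auto simp: cohomology_coords_def\<close>)
qed

lemma restrict_hom:
  assumes "right_module R A" "h \<in> LinearCombinations.module_hom R A N"
  shows "restrict h (carrier A) \<in> LinearCombinations.module_hom R A N"
proof -
  interpret A: right_module R A by fact
  show ?thesis using assms(2) by (auto simp: LinearCombinations.module_hom_def Pi_def A.act_closed)
qed

section \<open>Pullback along chain maps and independence of the resolution\<close>

definition chain_map where
  "chain_map R P d Q d' f \<longleftrightarrow> (\<forall>i. f i \<in> LinearCombinations.module_hom R (P i) (Q i)) \<and>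
    (\<forall>i. \<forall>x\<in>carrier (P (Suc i)). d' i (f (Suc i) x) = f i (d i x))"

lemma pullback_cocycle:
  assumes "chain_map R P d Q d' f" "\<phi> \<in> hom_cocycles R Q d' N i" "\<And>i. right_module R (P i)"
    and "\<And>i x. x \<in> carrier (P (Suc i)) \<Longrightarrow> d i x \<in> carrier (P i)"
  shows "(\<lambda>x\<in>carrier (P i). \<phi> (f i x)) \<in> hom_cocycles R P d N i"
proof -
  have "f (Suc i) x \<in> carrier (Q (Suc i))" if "x \<in> carrier (P (Suc i))" for x
    using assms(1) that by (auto simp: chain_map_def LinearCombinations.module_hom_def Pi_def)
  moreover have "d' i (f (Suc i) x) = f i (d i x)" if "x \<in> carrier (P (Suc i))" for x
    using assms(1) that by (auto simp: chain_map_def)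
  ultimately have "\<phi> (f i (d i x)) = \<zero>\<^bsub>N\<^esub>" if "x \<in> carrier (P (Suc i))" for x
    using assms(2) that by (auto simp: hom_cocycles_iff simp flip: \<open>\<And>x. x \<in> carrier (P (Suc i)) \<Longrightarrow> d' i (f (Suc i) x) = f i (d i x)\<close>)
  moreover have "(\<lambda>x\<in>carrier (P i). \<phi> (f i x)) \<in> LinearCombinations.module_hom R (P i) N"
    by (rule restrict_hom[OF assms(3) module_hom_comp[of "f i" R "P i" "Q i"]])
      (use assms(1,2) in \<open>auto simp: chain_map_def hom_cocycles_iff\<close>)
  ultimately show ?thesis using assms(4) by (auto simp: hom_cocycles_iff)
qed

lemma pullback_coboundary:
  assumes "chain_map R P d Q d' f" "\<phi> \<in> hom_coboundaries R Q d' N i" "\<And>i. right_module R (P i)"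
    and "\<And>i x. x \<in> carrier (P (Suc i)) \<Longrightarrow> d i x \<in> carrier (P i)"
  shows "(\<lambda>x\<in>carrier (P i). \<phi> (f i x)) \<in> hom_coboundaries R P d N i"
proof -
  have fc: "f i x \<in> carrier (Q i)" if "x \<in> carrier (P i)" for i x
    using assms(1) that by (auto simp: chain_map_def LinearCombinations.module_hom_def Pi_def)
  show ?thesis
  proof (cases i)
    case 0
    then show ?thesis using assms(2) fc by (auto simp: hom_coboundaries_0 fun_eq_iff)
  next
    case (Suc j)
    then obtain h where h: "h \<in> LinearCombinations.module_hom R (Q j) N"
      "\<And>x. x \<in> carrier (Q (Suc j)) \<Longrightarrow> \<phi> x = h (d' j x)"
      using assms(2) by (auto simp: hom_coboundaries_Suc_iff)
    have "d' j (f (Suc j) x) = f j (d j x)" if "x \<in> carrier (P (Suc j))" for x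
      using assms(1) that by (auto simp: chain_map_def)
    then have "\<forall>x\<in>carrier (P (Suc j)). \<phi> (f (Suc j) x) = restrict (\<lambda>x. h (f j x)) (carrier (P j)) (d j x)"
      using h fc assms(4) by simp
    moreover have "restrict (\<lambda>x. h (f j x)) (carrier (P j)) \<in> LinearCombinations.module_hom R (P j) N"
      by (rule restrict_hom[OF assms(3) module_hom_comp[of "f j" R "P j" "Q j"]])
        (use assms(1) h in \<open>auto simp: chain_map_def\<close>)
    ultimately show ?thesis
      unfolding Suc hom_coboundaries_Suc_iff
      by (intro conjI bexI[of _ "restrict (\<lambda>x. h (f j x)) (carrier (P j))"]) auto
  qed
qed

lemma coboundary_add:
  assumes N: "right_module R N" and P: "\<And>i. right_module R (P i)"
    and dh: "\<And>i. d i \<in> LinearCombinations.module_hom R (P (Suc i)) (P i)"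
    and f: "f \<in> hom_coboundaries R P d N i" and g: "g \<in> hom_coboundaries R P d N i"
    and k: "k \<in> extensional (carrier (P i))" "\<And>x. x \<in> carrier (P i) \<Longrightarrow> k x = f x \<oplus>\<^bsub>N\<^esub> g x"
  shows "k \<in> hom_coboundaries R P d N i"
proof -
  interpret N: right_module R N by fact
  show ?thesis
  proof (cases i)
    case 0
    then have "k = (\<lambda>x\<in>carrier (P 0). \<zero>\<^bsub>N\<^esub>)"
      using f g k by (intro extensionalityI[of _ "carrier (P 0)"]) (auto simp: hom_coboundaries_0)
    then show ?thesis using 0 by (simp add: hom_coboundaries_0)
  next
    case (Suc j)
    obtain h h' where h: "h \<in> LinearCombinations.module_hom R (P j) N" "\<forall>x\<in>carrier (P i). f x = h (d j x)"
      and h': "h' \<in> LinearCombinations.module_hom R (P j) N" "\<forall>x\<in>carrier (P i). g x = h' (d j x)"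
      using f g unfolding Suc hom_coboundaries_Suc_iff by blast
    interpret Pj: right_module R "P j" by (rule P)
    have "(\<lambda>x. h x \<oplus>\<^bsub>N\<^esub> h' x) \<in> LinearCombinations.module_hom R (P j) N"
    proof (rule module_homI)
      have c: "h x \<in> carrier N" "h' x \<in> carrier N" if "x \<in> carrier (P j)" for x
        using h(1) h'(1) that by (auto simp: LinearCombinations.module_hom_def)
      then show "h x \<oplus>\<^bsub>N\<^esub> h' x \<in> carrier N" if "x \<in> carrier (P j)" for x
        using that by auto
      show "h (x \<oplus>\<^bsub>P j\<^esub> y) \<oplus>\<^bsub>N\<^esub> h' (x \<oplus>\<^bsub>P j\<^esub> y) = h x \<oplus>\<^bsub>N\<^esub> h' x \<oplus>\<^bsub>N\<^esub> (h y \<oplus>\<^bsub>N\<^esub> h' y)"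
        if "x \<in> carrier (P j)" "y \<in> carrier (P j)" for x y
        using h(1) h'(1) that c[OF that(1)] c[OF that(2)]
        by (simp add: LinearCombinations.module_hom_add[OF h(1)] LinearCombinations.module_hom_add[OF h'(1)] N.M.a_ac)
      show "h (r \<odot>\<^bsub>P j\<^esub> x) \<oplus>\<^bsub>N\<^esub> h' (r \<odot>\<^bsub>P j\<^esub> x) = r \<odot>\<^bsub>N\<^esub> (h x \<oplus>\<^bsub>N\<^esub> h' x)"
        if "r \<in> carrier R" "x \<in> carrier (P j)" for r x
        using h(1) h'(1) that c[OF that(2)]
        by (simp add: LinearCombinations.module_hom_smult[OF h(1)] LinearCombinations.module_hom_smult[OF h'(1)] N.act_distr_module)
    qed
    from restrict_hom[OF P this]
    have "restrict (\<lambda>x. h x \<oplus>\<^bsub>N\<^esub> h' x) (carrier (P j)) \<in> LinearCombinations.module_hom R (P j) N" .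
    moreover have "d j x \<in> carrier (P j)" if "x \<in> carrier (P (Suc j))" for x
      using dh[of j] that by (auto simp: LinearCombinations.module_hom_def)
    ultimately show ?thesis
      using k h(2) h'(2) unfolding Suc hom_coboundaries_Suc_iff
      by (intro conjI bexI[of _ "restrict (\<lambda>x. h x \<oplus>\<^bsub>N\<^esub> h' x) (carrier (P j))"]) auto
  qed
qed

text \<open>The identity minus the composite of the two comparison maps is a chain map
  \<open>t\<close> lifting zero, hence null-homotopic. A cocycle kills the part of the homotopy that
  ends with a differential, and the other part is a coboundary.\<close>

lemma pullback_homotopic:
  assumes P: "projective_resolution R M P d e" and Q: "projective_resolution R M Q d' e'"
    and M: "right_module R M" and N: "right_module R N"
    and f: "chain_map R P d Q d' f" "\<And>x. x \<in> carrier (P 0) \<Longrightarrow> e' (f 0 x) = e x"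
    and g: "chain_map R Q d' P d g" "\<And>x. x \<in> carrier (Q 0) \<Longrightarrow> e (g 0 x) = e' x"
    and \<psi>: "\<psi> \<in> hom_cocycles R P d N i"
  shows "\<exists>b\<in>hom_coboundaries R P d N i. \<forall>x\<in>carrier (P i). \<psi> x = \<psi> (g i (f i x)) \<oplus>\<^bsub>N\<^esub> b x"
proof -
  interpret N: right_module R N by fact
  interpret M: right_module R M by fact
  have PM: "right_module R (P i)" and QM: "right_module R (Q i)"
    and dh: "d i \<in> LinearCombinations.module_hom R (P (Suc i)) (P i)"
    and eh: "e \<in> LinearCombinations.module_hom R (P 0) M" for i
    using P Q by (auto simp: projective_resolution_def projective_module_def)
  have fh: "f i \<in> LinearCombinations.module_hom R (P i) (Q i)" and gh: "g i \<in> LinearCombinations.module_hom R (Q i) (P i)" for i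
    using f g by (auto simp: chain_map_def)
  have fc: "f i x \<in> carrier (Q i)" if "x \<in> carrier (P i)" for i x
    using fh[of i] that by (auto simp: LinearCombinations.module_hom_def)
  have gc: "g i x \<in> carrier (P i)" if "x \<in> carrier (Q i)" for i x
    using gh[of i] that by (auto simp: LinearCombinations.module_hom_def)
  have dc: "d i x \<in> carrier (P i)" if "x \<in> carrier (P (Suc i))" for i x
    using dh[of i] that by (auto simp: LinearCombinations.module_hom_def)
  have comm: "d i (g (Suc i) (f (Suc i) x)) = g i (f i (d i x))" if "x \<in> carrier (P (Suc i))" for i x
    using f(1) g(1) that fc[OF that] by (auto simp: chain_map_def)
  define t where "t i x = x \<ominus>\<^bsub>P i\<^esub> g i (f i x)" for i x
  have th: "t i \<in> LinearCombinations.module_hom R (P i) (P i)" for i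
    unfolding t_def
    by (rule module_hom_sub[OF PM _ module_hom_comp[OF fh gh]])
      (auto simp: LinearCombinations.module_hom_def)
  have t0: "e (t 0 x) = \<zero>\<^bsub>M\<^esub>" if "x \<in> carrier (P 0)" for x
  proof -
    interpret e: right_module_hom R "P 0" M e
      using eh PM M by (auto simp: right_module_hom_def right_module_hom_axioms_def)
    show ?thesis using that f(2) g(2) fc[OF that] gc[OF fc[OF that]]
      by (simp add: t_def a_minus_def e.hom_add e.hom_minus M.M.r_neg)
  qed
  have tS: "d i (t (Suc i) x) = t i (d i x)" if x: "x \<in> carrier (P (Suc i))" for i x
  proof -
    interpret d: right_module_hom R "P (Suc i)" "P i" "d i"
      using dh PM by (auto simp: right_module_hom_def right_module_hom_axioms_def)
    show ?thesis using x fc[OF x] gc[OF fc[OF x]] comm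
      by (simp add: t_def a_minus_def d.hom_add d.hom_minus)
  qed
  obtain s where s: "\<And>i. s i \<in> LinearCombinations.module_hom R (P i) (P (Suc i))"
    "\<And>x. x \<in> carrier (P 0) \<Longrightarrow> t 0 x = d 0 (s 0 x)"
    "\<And>i x. x \<in> carrier (P (Suc i)) \<Longrightarrow> t (Suc i) x = d (Suc i) (s (Suc i) x) \<oplus>\<^bsub>P (Suc i)\<^esub> s i (d i x)"
    using chain_homotopy_exists[OF P P M th t0 tS] by blast
  have sc: "s i x \<in> carrier (P (Suc i))" if "x \<in> carrier (P i)" for i x
    using s(1)[of i] that by (auto simp: LinearCombinations.module_hom_def)
  have tc: "t i x \<in> carrier (P i)" if "x \<in> carrier (P i)" for i x
    using th[of i] that by (auto simp: LinearCombinations.module_hom_def)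
  have \<psi>h: "\<psi> \<in> LinearCombinations.module_hom R (P i) N" "\<psi> \<in> extensional (carrier (P i))"
    and \<psi>d: "\<And>x. x \<in> carrier (P (Suc i)) \<Longrightarrow> \<psi> (d i x) = \<zero>\<^bsub>N\<^esub>"
    using \<psi> by (auto simp: hom_cocycles_iff)
  interpret \<psi>: right_module_hom R "P i" N \<psi>
    using \<psi>h PM N by (auto simp: right_module_hom_def right_module_hom_axioms_def)
  have eq: "\<psi> x = \<psi> (g i (f i x)) \<oplus>\<^bsub>N\<^esub> \<psi> (t i x)" if x: "x \<in> carrier (P i)" for x
  proof -
    have "x = g i (f i x) \<oplus>\<^bsub>P i\<^esub> t i x"
      using x gc[OF fc[OF x]] unfolding t_def a_minus_def
      by (metis \<psi>.M.M.a_comm \<psi>.M.M.a_assoc \<psi>.M.M.add.inv_closed \<psi>.M.M.l_neg \<psi>.M.M.r_zero)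
    then show ?thesis using \<psi>.hom_add[OF gc[OF fc[OF x]] tc[OF x]] by simp
  qed
  have "(\<lambda>x\<in>carrier (P i). \<psi> (t i x)) \<in> hom_coboundaries R P d N i"
  proof (cases i)
    case 0
    have "\<psi> (t 0 x) = \<zero>\<^bsub>N\<^esub>" if "x \<in> carrier (P 0)" for x
      using s(2)[OF that] \<psi>d[unfolded 0] sc[OF that] by simp
    then show ?thesis using 0 by (auto simp: hom_coboundaries_0 fun_eq_iff)
  next
    case (Suc j)
    have "\<psi> (t (Suc j) x) = restrict (\<lambda>x. \<psi> (s j x)) (carrier (P j)) (d j x)" if x: "x \<in> carrier (P (Suc j))" for x
      using s(3)[OF x] \<psi>d[unfolded Suc] sc[OF x] sc[OF dc[OF x]] \<psi>.hom_add[unfolded Suc] dc[OF x]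
        dc[OF sc[OF x]] \<psi>.closed[unfolded Suc] by simp
    moreover have "restrict (\<lambda>x. \<psi> (s j x)) (carrier (P j)) \<in> LinearCombinations.module_hom R (P j) N"
      by (rule restrict_hom[OF PM module_hom_comp[OF s(1)]]) (use \<psi>h(1) Suc in simp)
    ultimately show ?thesis
      unfolding Suc hom_coboundaries_Suc_iff
      by (intro conjI bexI[of _ "restrict (\<lambda>x. \<psi> (s j x)) (carrier (P j))"]) auto
  qed
  then show ?thesis using eq by (intro bexI) auto
qed

text \<open>The new coordinates are the old ones composed with pullback along a comparison map from
  \<open>Q\<close> to \<open>P\<close>. They are onto because every cocycle on \<open>Q\<close> is
  cohomologous to one pulled back from \<open>P\<close>, and have the right kernel because a cocycle
  on \<open>P\<close> is cohomologous to its double pullback.\<close>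

lemma cohomology_coords_transfer:
  fixes R :: "('k::field, 'r) module" and N :: "('r, 'n) module"
    and P :: "nat \<Rightarrow> ('r, 'p) module" and Q :: "nat \<Rightarrow> ('r, 'q) module"
  assumes P: "projective_resolution R M P d e" and Q: "projective_resolution R M Q d' e'"
    and M: "right_module R M" and N: "right_module R N"
    and \<Phi>: "cohomology_coords R Q d' N i D \<Phi>"
  shows "\<exists>\<Psi>. cohomology_coords R P d N i D \<Psi>"
proof -
  interpret N: right_module R N by fact
  have PM: "right_module R (P i)" and QM: "right_module R (Q i)"
    and dh: "d i \<in> LinearCombinations.module_hom R (P (Suc i)) (P i)"
    and dh': "d' i \<in> LinearCombinations.module_hom R (Q (Suc i)) (Q i)" for i
    using P Q by (auto simp: projective_resolution_def projective_module_def)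
  have dc: "d i x \<in> carrier (P i)" if "x \<in> carrier (P (Suc i))" for i x
    using dh[of i] that by (auto simp: LinearCombinations.module_hom_def)
  have dc': "d' i x \<in> carrier (Q i)" if "x \<in> carrier (Q (Suc i))" for i x
    using dh'[of i] that by (auto simp: LinearCombinations.module_hom_def)
  obtain f where f: "chain_map R P d Q d' f" "\<And>x. x \<in> carrier (P 0) \<Longrightarrow> e' (f 0 x) = e x"
    using chain_map_exists[OF P Q M] by (auto simp: chain_map_def)
  obtain g where g: "chain_map R Q d' P d g" "\<And>x. x \<in> carrier (Q 0) \<Longrightarrow> e (g 0 x) = e' x"
    using chain_map_exists[OF Q P M] by (auto simp: chain_map_def)
  have fc: "f i x \<in> carrier (Q i)" if "x \<in> carrier (P i)" for i x
    using f that by (auto simp: chain_map_def LinearCombinations.module_hom_def)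
  have gc: "g i x \<in> carrier (P i)" if "x \<in> carrier (Q i)" for i x
    using g that by (auto simp: chain_map_def LinearCombinations.module_hom_def)
  let ?ZP = "hom_cocycles R P d N i" and ?ZQ = "hom_cocycles R Q d' N i"
  define gs where "gs \<psi> = (\<lambda>x\<in>carrier (Q i). \<psi> (g i x))" for \<psi> :: "'p \<Rightarrow> 'n"
  define fs where "fs \<psi> = (\<lambda>x\<in>carrier (P i). \<psi> (f i x))" for \<psi> :: "'q \<Rightarrow> 'n"
  have gsZ: "gs \<psi> \<in> ?ZQ" if "\<psi> \<in> ?ZP" for \<psi>
    unfolding gs_def by (rule pullback_cocycle[OF g(1) that QM dc'])
  have fsZ: "fs \<psi> \<in> ?ZP" if "\<psi> \<in> ?ZQ" for \<psi>
    unfolding fs_def by (rule pullback_cocycle[OF f(1) that PM dc])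
  note \<Phi>' = \<Phi>[unfolded cohomology_coords_def]
  have ZQc: "\<phi> \<in> extensional (carrier (Q i))" "\<And>x. x \<in> carrier (Q i) \<Longrightarrow> \<phi> x \<in> carrier N" if "\<phi> \<in> ?ZQ" for \<phi>
    using that by (auto simp: hom_cocycles_iff LinearCombinations.module_hom_def)
  have BQ: "\<Phi> b = 0\<^sub>v D" "b \<in> ?ZQ" if b: "b \<in> hom_coboundaries R Q d' N i" "\<phi> \<in> ?ZQ" "\<chi> \<in> ?ZQ"
    "\<And>x. x \<in> carrier (Q i) \<Longrightarrow> \<phi> x = \<chi> x \<oplus>\<^bsub>N\<^esub> b x" for b \<phi> \<chi>
  proof -
    interpret QQ: right_module R "Q i" by (rule QM)
    show bZ: "b \<in> ?ZQ"
    proof (cases i)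
      case 0
      then show ?thesis
        using b(1) QQ.M.zero_closed dc'[of _ 0] QM[of 0] right_module.act_closed[OF QM[of 0]]
          abelian_monoid.a_closed[OF abelian_group.axioms(1)[OF right_module.axioms(2)[OF QM[of 0]]]]
        by (auto simp: hom_coboundaries_0 hom_cocycles_iff intro!: module_homI)
    next
      case (Suc j)
      obtain h where h: "h \<in> LinearCombinations.module_hom R (Q j) N"
        "b \<in> extensional (carrier (Q (Suc j)))" "\<And>x. x \<in> carrier (Q (Suc j)) \<Longrightarrow> b x = h (d' j x)"
        using b(1) by (auto simp: Suc hom_coboundaries_Suc_iff)
      interpret h: right_module_hom R "Q j" N h
        using h QM N by (auto simp: right_module_hom_def right_module_hom_axioms_def)
      have "restrict (\<lambda>x. h (d' j x)) (carrier (Q (Suc j))) \<in> LinearCombinations.module_hom R (Q (Suc j)) N"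
        by (rule restrict_hom[OF QM module_hom_comp[OF dh' h(1)]])
      moreover have "restrict (\<lambda>x. h (d' j x)) (carrier (Q (Suc j))) = b"
        using h(2,3) by (intro extensionalityI[of _ "carrier (Q (Suc j))"]) auto
      moreover have "d' j (d' (Suc j) x) = \<zero>\<^bsub>Q j\<^esub>" if "x \<in> carrier (Q (Suc (Suc j)))" for x
        using Q that unfolding projective_resolution_def by blast
      ultimately show ?thesis using h dc' by (simp add: hom_cocycles_iff Suc)
    qed
    show "\<Phi> b = 0\<^sub>v D" using \<Phi>' bZ b(1) by blast
  qed
  show ?thesis
  proof (intro exI[of _ "\<lambda>\<psi>. \<Phi> (gs \<psi>)"], unfold cohomology_coords_def, intro conjI ballI allI)
    fix \<psi> \<chi> assume *: "\<psi> \<in> ?ZP" "\<chi> \<in> ?ZP"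
    have "gs (\<psi> \<oplus>\<^bsub>hom_space R (P i) N\<^esub> \<chi>) = gs \<psi> \<oplus>\<^bsub>hom_space R (Q i) N\<^esub> gs \<chi>"
      using gc by (auto simp: gs_def hom_space_simps fun_eq_iff)
    then show "\<Phi> (gs (\<psi> \<oplus>\<^bsub>hom_space R (P i) N\<^esub> \<chi>)) = \<Phi> (gs \<psi>) + \<Phi> (gs \<chi>)"
      using \<Phi>' gsZ * by simp
  next
    fix \<psi> c assume *: "\<psi> \<in> ?ZP"
    have "gs (c \<odot>\<^bsub>hom_space R (P i) N\<^esub> \<psi>) = c \<odot>\<^bsub>hom_space R (Q i) N\<^esub> gs \<psi>"
      using gc by (auto simp: gs_def hom_space_simps fun_eq_iff)
    then show "\<Phi> (gs (c \<odot>\<^bsub>hom_space R (P i) N\<^esub> \<psi>)) = c \<cdot>\<^sub>v \<Phi> (gs \<psi>)"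
      using \<Phi>' gsZ * by simp
  next
    show "(\<lambda>\<psi>. \<Phi> (gs \<psi>)) ` ?ZP = carrier_vec D"
    proof
      show "(\<lambda>\<psi>. \<Phi> (gs \<psi>)) ` ?ZP \<subseteq> carrier_vec D" using \<Phi>' gsZ by blast
      show "carrier_vec D \<subseteq> (\<lambda>\<psi>. \<Phi> (gs \<psi>)) ` ?ZP"
      proof
        fix v :: "'k vec" assume v: "v \<in> carrier_vec D"
        then obtain \<phi> where \<phi>: "\<phi> \<in> ?ZQ" "v = \<Phi> \<phi>" using \<Phi>' by (metis imageE)
        obtain b where b: "b \<in> hom_coboundaries R Q d' N i"
          "\<And>x. x \<in> carrier (Q i) \<Longrightarrow> \<phi> x = \<phi> (f i (g i x)) \<oplus>\<^bsub>N\<^esub> b x"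
          using pullback_homotopic[OF Q P M N g f \<phi>(1)] by blast
        have b': "\<phi> x = gs (fs \<phi>) x \<oplus>\<^bsub>N\<^esub> b x" if "x \<in> carrier (Q i)" for x
          using b(2)[OF that] that gc by (simp add: gs_def fs_def)
        note B = BQ[OF b(1) \<phi>(1) gsZ[OF fsZ[OF \<phi>(1)]] b']
        have "\<phi> = gs (fs \<phi>) \<oplus>\<^bsub>hom_space R (Q i) N\<^esub> b"
          using b' ZQc[OF \<phi>(1)] by (intro extensionalityI[of _ "carrier (Q i)"]) (auto simp: hom_space_simps)
        then have "\<Phi> \<phi> = \<Phi> (gs (fs \<phi>)) + \<Phi> b"
          using \<Phi>' gsZ[OF fsZ[OF \<phi>(1)]] B(2) by metis
        moreover have "\<Phi> (gs (fs \<phi>)) \<in> carrier_vec D" using \<Phi>' gsZ[OF fsZ[OF \<phi>(1)]] by blast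
        ultimately have "v = \<Phi> (gs (fs \<phi>))" using B(1) \<phi>(2) by simp
        then show "v \<in> (\<lambda>\<psi>. \<Phi> (gs \<psi>)) ` ?ZP" using fsZ[OF \<phi>(1)] by blast
      qed
    qed
  next
    fix \<psi> assume \<psi>: "\<psi> \<in> ?ZP"
    have "\<Phi> (gs \<psi>) = 0\<^sub>v D \<longleftrightarrow> gs \<psi> \<in> hom_coboundaries R Q d' N i" using \<Phi>' gsZ[OF \<psi>] by blast
    also have "\<dots> \<longleftrightarrow> \<psi> \<in> hom_coboundaries R P d N i"
    proof
      assume "\<psi> \<in> hom_coboundaries R P d N i"
      then show "gs \<psi> \<in> hom_coboundaries R Q d' N i"
        unfolding gs_def by (rule pullback_coboundary[OF g(1) _ QM dc'])
    next
      assume "gs \<psi> \<in> hom_coboundaries R Q d' N i"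
      then have 1: "fs (gs \<psi>) \<in> hom_coboundaries R P d N i"
        unfolding fs_def by (rule pullback_coboundary[OF f(1) _ PM dc])
      obtain b where b: "b \<in> hom_coboundaries R P d N i"
        "\<And>x. x \<in> carrier (P i) \<Longrightarrow> \<psi> x = \<psi> (g i (f i x)) \<oplus>\<^bsub>N\<^esub> b x"
        using pullback_homotopic[OF P Q M N f g \<psi>] by blast
      show "\<psi> \<in> hom_coboundaries R P d N i"
        by (rule coboundary_add[OF N PM dh 1 b(1)])
          (use \<psi> b(2) fc in \<open>auto simp: gs_def fs_def hom_cocycles_iff\<close>)
    qed
    finally show "\<Phi> (gs \<psi>) = 0\<^sub>v D \<longleftrightarrow> \<psi> \<in> hom_coboundaries R P d N i" .
  qed
qed

text \<open>The given resolution has exactly the element type fixed in \<open>Ext\<close>; hence the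
  choice there is made from a nonempty collection and yields a genuine resolution, to which the
  coordinates are transferred.\<close>

theorem has_dim_Ext:
  fixes R :: "('k::field, 'r) module" and M :: "('r, 'm) module" and N :: "('r, 'n) module"
    and P :: "nat \<Rightarrow> ('r, ('r + 'm) list \<Rightarrow> 'r) module"
  assumes "central_scalars R" and M: "right_module R M" and N: "right_module R N"
    and P: "projective_resolution R M P d e" and \<Phi>: "cohomology_coords R P d N i D \<Phi>"
  shows "has_dim (Ext R M N i) D"
proof -
  interpret central_scalars R by fact
  obtain Q :: "nat \<Rightarrow> ('r, ('r + 'm) list \<Rightarrow> 'r) module" and d' e'
    where Qeq: "(SOME (P :: nat \<Rightarrow> ('r, ('r + 'm) list \<Rightarrow> 'r) module, d, e). projective_resolution R M P d e) = (Q, d', e')"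
    by (metis prod_cases3)
  have "case (Q, d', e') of (P, d, e) \<Rightarrow> projective_resolution R M P d e"
    unfolding Qeq[symmetric] by (rule someI[of _ "(P, d, e)"]) (use P in simp)
  then have Q: "projective_resolution R M Q d' e'" by simp
  obtain \<Psi> where "cohomology_coords R Q d' N i D \<Psi>"
    using cohomology_coords_transfer[OF Q P M N \<Phi>] by blast
  from has_dim_cohomologyI[OF Q N this] show ?thesis
    unfolding Ext_def Qeq by simp
qed

section \<open>Linear extension along finitely supported functions\<close>

lemma poly_mapping_induct [consumes 1, case_names zero single add]:
  assumes "Poly_Mapping.keys f \<subseteq> S" and "P 0"
    and "\<And>p c. p \<in> S \<Longrightarrow> P (Poly_Mapping.single p c)"
    and "\<And>f g. Poly_Mapping.keys f \<subseteq> S \<Longrightarrow> Poly_Mapping.keys g \<subseteq> S \<Longrightarrow> P f \<Longrightarrow> P g \<Longrightarrow> P (f + g)"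
  shows "P (f :: 'a \<Rightarrow>\<^sub>0 'k::ab_group_add)"
  using assms(1)
proof (induction "card (Poly_Mapping.keys f)" arbitrary: f)
  case 0
  then show ?case using assms(2) by simp
next
  case (Suc n)
  then obtain p where p: "p \<in> Poly_Mapping.keys f" by (metis card.empty ex_in_conv nat.distinct(1))
  define g where "g = f - Poly_Mapping.single p (Poly_Mapping.lookup f p)"
  have kg: "Poly_Mapping.keys g = Poly_Mapping.keys f - {p}"
    by (auto simp: g_def in_keys_iff lookup_minus lookup_single when_def split: if_splits)
  then have "P g" using Suc p by (intro Suc(1)) auto
  moreover have "f = g + Poly_Mapping.single p (Poly_Mapping.lookup f p)" by (simp add: g_def)
  ultimately show ?case using assms(3,4) p Suc(3) kg
    by (metis (no_types, lifting) Diff_subset keys_single subset_trans subsetD empty_subsetI insert_subset)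
qed

text \<open>The value \<open>g p c\<close> belongs to the multiple of the basis element
  \<open>p\<close> by \<open>c\<close>. Passing the coefficient to \<open>g\<close> avoids a scalar
  action on the target.\<close>

definition lin_ext :: "('v, 'r) ring_scheme \<Rightarrow> ('a \<Rightarrow> 'k::zero \<Rightarrow> 'v) \<Rightarrow> ('a \<Rightarrow>\<^sub>0 'k) \<Rightarrow> 'v" where
  "lin_ext V g f = (\<Oplus>\<^bsub>V\<^esub>p\<in>Poly_Mapping.keys f. g p (Poly_Mapping.lookup f p))"

locale linear_extension = abelian_group V for V :: "('v, 'r) ring_scheme" (structure) +
  fixes S :: "'a set" and g :: "'a \<Rightarrow> 'k::field \<Rightarrow> 'v"
  assumes g_closed [simp]: "p \<in> S \<Longrightarrow> g p c \<in> carrier V"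
    and g_add: "p \<in> S \<Longrightarrow> g p (c + d) = g p c \<oplus> g p d"
begin

abbreviation "L \<equiv> lin_ext V g"

lemma g_zero [simp]: "p \<in> S \<Longrightarrow> g p 0 = \<zero>"
  using g_add[of p 0 0] g_closed[of p 0] by (metis add.l_cancel_one' add_0)

lemma lin_ext_superset:
  assumes "Poly_Mapping.keys f \<subseteq> T" "T \<subseteq> S" "finite T"
  shows "L f = (\<Oplus>p\<in>T. g p (Poly_Mapping.lookup f p))"
  unfolding lin_ext_def
  by (rule add.finprod_mono_neutral_cong_left) (use assms in \<open>auto simp: in_keys_iff\<close>)

lemma lin_ext_closed [simp]: "Poly_Mapping.keys f \<subseteq> S \<Longrightarrow> L f \<in> carrier V"
  unfolding lin_ext_def by (rule finsum_closed) auto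

lemma lin_ext_add:
  assumes "Poly_Mapping.keys f \<subseteq> S" "Poly_Mapping.keys h \<subseteq> S"
  shows "L (f + h) = L f \<oplus> L h"
proof -
  let ?T = "Poly_Mapping.keys f \<union> Poly_Mapping.keys h"
  have "L (f + h) = (\<Oplus>p\<in>?T. g p (Poly_Mapping.lookup (f + h) p))"
    by (rule lin_ext_superset) (use assms keys_add[of f h] in auto)
  also have "\<dots> = (\<Oplus>p\<in>?T. g p (Poly_Mapping.lookup f p) \<oplus> g p (Poly_Mapping.lookup h p))"
    using assms by (intro finsum_cong') (auto simp: lookup_add g_add)
  also have "\<dots> = (\<Oplus>p\<in>?T. g p (Poly_Mapping.lookup f p)) \<oplus> (\<Oplus>p\<in>?T. g p (Poly_Mapping.lookup h p))"
    using assms by (intro finsum_addf) auto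
  also have "(\<Oplus>p\<in>?T. g p (Poly_Mapping.lookup f p)) = L f"
    by (rule lin_ext_superset[symmetric]) (use assms in auto)
  also have "(\<Oplus>p\<in>?T. g p (Poly_Mapping.lookup h p)) = L h"
    by (rule lin_ext_superset[symmetric]) (use assms in auto)
  finally show ?thesis .
qed

lemma lin_ext_zero [simp]: "L 0 = \<zero>"
  by (simp add: lin_ext_def)

lemma lin_ext_uminus: "Poly_Mapping.keys f \<subseteq> S \<Longrightarrow> L (- f) = \<ominus> L f"
  using lin_ext_add[of "- f" f] by (simp add: minus_equality)

lemma lin_ext_diff:
  "Poly_Mapping.keys f \<subseteq> S \<Longrightarrow> Poly_Mapping.keys h \<subseteq> S \<Longrightarrow> L (f - h) = L f \<ominus> L h"
  using lin_ext_add[of f "- h"] by (simp add: lin_ext_uminus a_minus_def)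

lemma lin_ext_single [simp]: "p \<in> S \<Longrightarrow> L (Poly_Mapping.single p c) = g p c"
  using lin_ext_superset[of "Poly_Mapping.single p c" "{p}"] by simp

end

lemma abelian_group_transfer:
  assumes "abelian_group A" "carrier B = carrier A" "add B = add A" "zero B = zero A"
  shows "abelian_group B"
proof -
  interpret A: abelian_group A by fact
  show ?thesis
  proof (rule abelian_groupI)
    fix x assume "x \<in> carrier B"
    then show "\<exists>y\<in>carrier B. y \<oplus>\<^bsub>B\<^esub> x = \<zero>\<^bsub>B\<^esub>"
      using assms by (intro bexI[of _ "\<ominus>\<^bsub>A\<^esub> x"]) (simp_all add: A.l_neg)
  qed (use assms in \<open>simp_all add: A.a_ac\<close>)
qed

section \<open>Algebras and tensor products\<close>

locale kalgebra = ring A for A :: "('k::field, 'a) module" (structure) +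
  assumes smult_closed [simp]: "a \<in> carrier A \<Longrightarrow> c \<odot> a \<in> carrier A"
    and smult_add_l: "a \<in> carrier A \<Longrightarrow> (c + d) \<odot> a = c \<odot> a \<oplus> d \<odot> a"
    and smult_add_r: "a \<in> carrier A \<Longrightarrow> b \<in> carrier A \<Longrightarrow> c \<odot> (a \<oplus> b) = c \<odot> a \<oplus> c \<odot> b"
    and smult_assoc: "a \<in> carrier A \<Longrightarrow> (c * d) \<odot> a = c \<odot> (d \<odot> a)"
    and smult_one: "a \<in> carrier A \<Longrightarrow> 1 \<odot> a = a"
    and smult_mult_l: "a \<in> carrier A \<Longrightarrow> b \<in> carrier A \<Longrightarrow> (c \<odot> a) \<otimes> b = c \<odot> (a \<otimes> b)"
    and smult_mult_r: "a \<in> carrier A \<Longrightarrow> b \<in> carrier A \<Longrightarrow> a \<otimes> (c \<odot> b) = c \<odot> (a \<otimes> b)"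
begin

lemma smult_zero_l [simp]: "a \<in> carrier A \<Longrightarrow> 0 \<odot> a = \<zero>"
  by (metis add.l_cancel_one' add_0 smult_add_l smult_closed)

lemma op_simps [simp]:
  "carrier (op_algebra A) = carrier A" "zero (op_algebra A) = \<zero>" "one (op_algebra A) = \<one>"
  "add (op_algebra A) = add A" "smult (op_algebra A) = smult A"
  "mult (op_algebra A) = (\<lambda>a b. b \<otimes> a)"
  by (simp_all add: op_algebra_def)

lemma op_kalgebra: "kalgebra (op_algebra A)"
proof -
  have "abelian_group (op_algebra A)"
    by (rule abelian_group_transfer[OF abelian_group_axioms]) simp_all
  then have "ring (op_algebra A)"
    by (intro ringI monoidI) (auto simp: m_assoc l_distr r_distr)
  then show ?thesis
    by (intro kalgebra.intro kalgebra_axioms.intro)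
      (auto simp: smult_add_l smult_add_r smult_assoc smult_one smult_mult_l smult_mult_r)
qed

end

lemma lookup_smult [simp]: "Poly_Mapping.lookup (Poly_Mapping.map ((*) c) f) p = c * Poly_Mapping.lookup f p"
  for c :: "'k::field"
  by (simp add: map.rep_eq when_def)

lemma keys_smult: "Poly_Mapping.keys (Poly_Mapping.map ((*) c) f) \<subseteq> Poly_Mapping.keys f"
  for c :: "'k::field"
  by (auto simp: in_keys_iff)

lemma smult_single [simp]:
  "Poly_Mapping.map ((*) c) (Poly_Mapping.single p d) = Poly_Mapping.single p (c * d)" for c :: "'k::field"
  by (rule poly_mapping_eqI) (simp add: lookup_single when_def)

lemma smult_zero [simp]: "Poly_Mapping.map ((*) c) 0 = 0" for c :: "'k::field"
  by (rule poly_mapping_eqI) simp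

lemma smult_add: "Poly_Mapping.map ((*) c) (f + g) = Poly_Mapping.map ((*) c) f + Poly_Mapping.map ((*) c) g"
  for c :: "'k::field"
  by (rule poly_mapping_eqI) (simp add: lookup_add algebra_simps)

lemma smult_diff: "Poly_Mapping.map ((*) c) (f - g) = Poly_Mapping.map ((*) c) f - Poly_Mapping.map ((*) c) g"
  for c :: "'k::field"
  by (rule poly_mapping_eqI) (simp add: lookup_minus algebra_simps)

locale tensor = A: kalgebra A + B: kalgebra B
  for A :: "('k::field, 'a) module" and B :: "('k, 'b) module"
begin

abbreviation "S \<equiv> carrier A \<times> carrier B"
abbreviation "T \<equiv> pair_algebra A B"
abbreviation sg where "sg a b c \<equiv> Poly_Mapping.single (a, b) (c::'k)"
definition "I = LinearCombinations.module.span (class_ring :: 'k ring) T (bilinear_relations A B)"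
abbreviation "R \<equiv> tensor_algebra A B"

lemma T_simps [simp]:
  "carrier T = {f. Poly_Mapping.keys f \<subseteq> S}" "one T = sg \<one>\<^bsub>A\<^esub> \<one>\<^bsub>B\<^esub> 1" "zero T = 0" "add T = (+)"
  "smult T = (\<lambda>c. Poly_Mapping.map ((*) c))"
  by (auto simp: pair_algebra_def)

lemma keys_plus: "Poly_Mapping.keys f \<subseteq> S \<Longrightarrow> Poly_Mapping.keys g \<subseteq> S \<Longrightarrow> Poly_Mapping.keys (f + g) \<subseteq> S"
  using keys_add[of f g] by blast

lemma keys_sub: "Poly_Mapping.keys f \<subseteq> S \<Longrightarrow> Poly_Mapping.keys g \<subseteq> S \<Longrightarrow> Poly_Mapping.keys (f - g) \<subseteq> S"
  using keys_diff[of f g] by blast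

lemma keys_smult_S: "Poly_Mapping.keys f \<subseteq> S \<Longrightarrow> Poly_Mapping.keys (Poly_Mapping.map ((*) (c::'k)) f) \<subseteq> S"
  using keys_smult[of c f] by blast

lemma mult_superset:
  assumes "Poly_Mapping.keys f \<subseteq> U" "finite U" "Poly_Mapping.keys g \<subseteq> W" "finite W"
  shows "f \<otimes>\<^bsub>T\<^esub> g = (\<Sum>p\<in>U. \<Sum>q\<in>W.
       Poly_Mapping.single (fst p \<otimes>\<^bsub>A\<^esub> fst q, snd p \<otimes>\<^bsub>B\<^esub> snd q) (Poly_Mapping.lookup f p * Poly_Mapping.lookup g q))"
proof -
  have "f \<otimes>\<^bsub>T\<^esub> g = (\<Sum>p\<in>Poly_Mapping.keys f. \<Sum>q\<in>W.
       Poly_Mapping.single (fst p \<otimes>\<^bsub>A\<^esub> fst q, snd p \<otimes>\<^bsub>B\<^esub> snd q) (Poly_Mapping.lookup f p * Poly_Mapping.lookup g q))"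
    unfolding pair_algebra_def
    by (simp, intro sum.cong refl sum.mono_neutral_left) (use assms in \<open>auto simp: in_keys_iff\<close>)
  also have "\<dots> = (\<Sum>p\<in>U. \<Sum>q\<in>W.
       Poly_Mapping.single (fst p \<otimes>\<^bsub>A\<^esub> fst q, snd p \<otimes>\<^bsub>B\<^esub> snd q) (Poly_Mapping.lookup f p * Poly_Mapping.lookup g q))"
    by (rule sum.mono_neutral_left) (use assms in \<open>auto simp: in_keys_iff\<close>)
  finally show ?thesis .
qed

lemma mult_add_l: "(f + f') \<otimes>\<^bsub>T\<^esub> g = f \<otimes>\<^bsub>T\<^esub> g + f' \<otimes>\<^bsub>T\<^esub> g"
proof -
  let ?U = "Poly_Mapping.keys f \<union> Poly_Mapping.keys f'"
  show ?thesis
    using mult_superset[of "f + f'" ?U g "Poly_Mapping.keys g"] mult_superset[of f ?U g "Poly_Mapping.keys g"]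
      mult_superset[of f' ?U g "Poly_Mapping.keys g"] keys_add[of f f']
    by (simp add: lookup_add distrib_right single_add sum.distrib)
qed

lemma mult_add_r: "g \<otimes>\<^bsub>T\<^esub> (f + f') = g \<otimes>\<^bsub>T\<^esub> f + g \<otimes>\<^bsub>T\<^esub> f'"
proof -
  let ?U = "Poly_Mapping.keys f \<union> Poly_Mapping.keys f'"
  show ?thesis
    using mult_superset[of g "Poly_Mapping.keys g" "f + f'" ?U] mult_superset[of g "Poly_Mapping.keys g" f ?U]
      mult_superset[of g "Poly_Mapping.keys g" f' ?U] keys_add[of f f']
    by (simp add: lookup_add distrib_left single_add sum.distrib)
qed

lemma mult_zero [simp]: "0 \<otimes>\<^bsub>T\<^esub> g = 0" "g \<otimes>\<^bsub>T\<^esub> 0 = 0"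
  by (simp_all add: pair_algebra_def)

lemma mult_diff_l: "(f - f') \<otimes>\<^bsub>T\<^esub> g = f \<otimes>\<^bsub>T\<^esub> g - f' \<otimes>\<^bsub>T\<^esub> g"
  using mult_add_l[of "f - f'" f' g] by (simp add: eq_diff_eq)

lemma mult_diff_r: "g \<otimes>\<^bsub>T\<^esub> (f - f') = g \<otimes>\<^bsub>T\<^esub> f - g \<otimes>\<^bsub>T\<^esub> f'"
  using mult_add_r[of g "f - f'" f'] by (simp add: eq_diff_eq)

lemma mult_single [simp]: "sg a b c \<otimes>\<^bsub>T\<^esub> sg a' b' c' = sg (a \<otimes>\<^bsub>A\<^esub> a') (b \<otimes>\<^bsub>B\<^esub> b') (c * c')"
  by (subst mult_superset[where U = "{(a, b)}" and W = "{(a', b')}"]) auto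

lemma T_mult_closed: "Poly_Mapping.keys f \<subseteq> S \<Longrightarrow> Poly_Mapping.keys g \<subseteq> S \<Longrightarrow> Poly_Mapping.keys (f \<otimes>\<^bsub>T\<^esub> g) \<subseteq> S"
proof (induction f rule: poly_mapping_induct)
  case (single p c)
  from single(2) show ?case
  proof (induction g rule: poly_mapping_induct)
    case (single q d)
    then show ?case using \<open>p \<in> S\<close> by (cases p; cases q) auto
  qed (simp_all add: mult_add_r keys_plus)
qed (simp_all add: mult_add_l keys_plus)

lemma T_assoc:
  assumes "Poly_Mapping.keys f \<subseteq> S" "Poly_Mapping.keys g \<subseteq> S" "Poly_Mapping.keys h \<subseteq> S"
  shows "f \<otimes>\<^bsub>T\<^esub> g \<otimes>\<^bsub>T\<^esub> h = f \<otimes>\<^bsub>T\<^esub> (g \<otimes>\<^bsub>T\<^esub> h)"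
  using assms(1)
proof (induction f rule: poly_mapping_induct)
  case (single p c)
  note p = single
  show ?case
    using assms(2)
  proof (induction g rule: poly_mapping_induct)
    case (single q d)
    note q = single
    show ?case
      using assms(3)
    proof (induction h rule: poly_mapping_induct)
      case (single r e)
      then show ?case using p q by (cases p; cases q; cases r) (auto simp: A.m_assoc B.m_assoc mult.assoc)
    qed (simp_all add: mult_add_r)
  qed (simp_all add: mult_add_l mult_add_r)
qed (simp_all add: mult_add_l)

lemma T_one:
  assumes "Poly_Mapping.keys f \<subseteq> S"
  shows "sg \<one>\<^bsub>A\<^esub> \<one>\<^bsub>B\<^esub> 1 \<otimes>\<^bsub>T\<^esub> f = f" "f \<otimes>\<^bsub>T\<^esub> sg \<one>\<^bsub>A\<^esub> \<one>\<^bsub>B\<^esub> 1 = f"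
  using assms by (induction f rule: poly_mapping_induct) (auto simp: mult_add_l mult_add_r)

lemma T_abelian_group: "abelian_group T"
proof (rule abelian_groupI)
  fix x assume "x \<in> carrier T"
  then show "\<exists>y\<in>carrier T. y \<oplus>\<^bsub>T\<^esub> x = \<zero>\<^bsub>T\<^esub>"
    by (intro bexI[of _ "- x"]) simp_all
qed (simp_all add: add_ac keys_plus)

lemma T_ring: "ring T"
  by (intro ringI T_abelian_group monoidI)
    (auto simp: T_mult_closed T_assoc T_one mult_add_l mult_add_r)

lemma T_module: "Module.module (class_ring :: 'k ring) T"
  by (rule Module.moduleI[OF class_cring.is_cring T_abelian_group])
    (auto simp: class_ring_simps smult_add in_keys_iff algebra_simps lookup_add intro!: poly_mapping_eqI)

sublocale T: ring T by (rule T_ring)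
sublocale TM: Module.module "class_ring :: 'k ring" T by (rule T_module)

lemma rel_closed: "bilinear_relations A B \<subseteq> carrier T"
proof
  fix f assume "f \<in> bilinear_relations A B"
  then show "f \<in> carrier T"
    unfolding bilinear_relations_def by (elim UnE CollectE exE conjE) (simp_all add: keys_sub)
qed

lemma I_submodule: "LinearCombinations.submodule (class_ring :: 'k ring) I T"
  unfolding I_def by (rule TM.span_is_submodule[OF rel_closed])

lemma I_closed:
  "f \<in> I \<Longrightarrow> Poly_Mapping.keys f \<subseteq> S" "f \<in> I \<Longrightarrow> g \<in> I \<Longrightarrow> f + g \<in> I" "0 \<in> I"
  "f \<in> I \<Longrightarrow> Poly_Mapping.map ((*) c) f \<in> I"
  using I_submodule by (auto simp: LinearCombinations.submodule_def class_ring_simps)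

lemma I_subset:
  assumes "bilinear_relations A B \<subseteq> K" "K \<subseteq> carrier T" "0 \<in> K" "\<And>f g. f \<in> K \<Longrightarrow> g \<in> K \<Longrightarrow> f + g \<in> K"
    "\<And>c f. f \<in> K \<Longrightarrow> Poly_Mapping.map ((*) c) f \<in> K"
  shows "I \<subseteq> K"
  unfolding I_def
  by (rule TM.span_is_subset[OF assms(1)])
    (use assms T_module in \<open>auto simp: LinearCombinations.submodule_def\<close>)

lemma rel_in_I:
  assumes "a \<in> carrier A" "b \<in> carrier B"
  shows "a' \<in> carrier A \<Longrightarrow> sg (a \<oplus>\<^bsub>A\<^esub> a') b d - sg a b d - sg a' b d \<in> I"
    "b' \<in> carrier B \<Longrightarrow> sg a (b \<oplus>\<^bsub>B\<^esub> b') d - sg a b d - sg a b' d \<in> I"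
    "sg (c \<odot>\<^bsub>A\<^esub> a) b d - sg a b (d * c) \<in> I"
    "sg a (c \<odot>\<^bsub>B\<^esub> b) d - sg a b (d * c) \<in> I"
proof -
  have *: "Poly_Mapping.map ((*) d) f \<in> I" if "f \<in> bilinear_relations A B" for f
    using TM.in_own_span[OF rel_closed] that by (intro I_closed(4)) (auto simp: I_def)
  show "sg (a \<oplus>\<^bsub>A\<^esub> a') b d - sg a b d - sg a' b d \<in> I" if "a' \<in> carrier A"
    proof -
    have "sg (a \<oplus>\<^bsub>A\<^esub> a') b 1 - sg a b 1 - sg a' b 1 \<in> bilinear_relations A B"
      unfolding bilinear_relations_def using that assms by blast
    from *[OF this] show ?thesis by (simp add: smult_diff)
  qed
  show "sg a (b \<oplus>\<^bsub>B\<^esub> b') d - sg a b d - sg a b' d \<in> I" if "b' \<in> carrier B"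
    proof -
    have "sg a (b \<oplus>\<^bsub>B\<^esub> b') 1 - sg a b 1 - sg a b' 1 \<in> bilinear_relations A B"
      unfolding bilinear_relations_def using that assms by blast
    from *[OF this] show ?thesis by (simp add: smult_diff)
  qed
  show "sg (c \<odot>\<^bsub>A\<^esub> a) b d - sg a b (d * c) \<in> I"
    proof -
    have "sg (c \<odot>\<^bsub>A\<^esub> a) b 1 - sg a b c \<in> bilinear_relations A B"
      unfolding bilinear_relations_def using assms by blast
    from *[OF this] show ?thesis by (simp add: smult_diff)
  qed
  show "sg a (c \<odot>\<^bsub>B\<^esub> b) d - sg a b (d * c) \<in> I"
    proof -
    have "sg a (c \<odot>\<^bsub>B\<^esub> b) 1 - sg a b c \<in> bilinear_relations A B"
      unfolding bilinear_relations_def using assms by blast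
    from *[OF this] show ?thesis by (simp add: smult_diff)
  qed
qed

lemma I_mult_l:
  assumes "Poly_Mapping.keys x \<subseteq> S" "f \<in> I"
  shows "x \<otimes>\<^bsub>T\<^esub> f \<in> I"
proof -
  have "sg p q e \<otimes>\<^bsub>T\<^esub> f \<in> I" if pq: "p \<in> carrier A" "q \<in> carrier B" for p q e
  proof -
    \<comment> \<open>The coefficient \<open>e\<close> is quantified inside the set: a scalar on
      \<open>f\<close> can then be moved to \<open>e\<close>, so the set is closed under
      scaling.\<close>
    have "I \<subseteq> {f \<in> carrier T. \<forall>e. sg p q e \<otimes>\<^bsub>T\<^esub> f \<in> I}"
    proof (rule I_subset)
      show "bilinear_relations A B \<subseteq> {f \<in> carrier T. \<forall>e. sg p q e \<otimes>\<^bsub>T\<^esub> f \<in> I}"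
      proof (intro subsetI CollectI conjI allI)
        fix f e assume f: "f \<in> bilinear_relations A B"
        then show "f \<in> carrier T" using rel_closed by blast
        show "sg p q e \<otimes>\<^bsub>T\<^esub> f \<in> I"
          using f pq unfolding bilinear_relations_def
          by (auto simp: mult_diff_r A.r_distr B.r_distr A.smult_mult_r B.smult_mult_r intro!: rel_in_I)
      qed
      show "Poly_Mapping.map ((*) c) f \<in> {f \<in> carrier T. \<forall>e. sg p q e \<otimes>\<^bsub>T\<^esub> f \<in> I}"
        if f: "f \<in> {f \<in> carrier T. \<forall>e. sg p q e \<otimes>\<^bsub>T\<^esub> f \<in> I}" for c f
      proof -
        have "sg p q e \<otimes>\<^bsub>T\<^esub> Poly_Mapping.map ((*) c) f = sg p q (e * c) \<otimes>\<^bsub>T\<^esub> f" for e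
        proof -
          have "Poly_Mapping.keys f \<subseteq> S" using f by simp
          then show ?thesis
            by (induction f rule: poly_mapping_induct) (auto simp: mult_add_r smult_add mult.assoc)
        qed
        then show ?thesis using f keys_smult[of c f] by auto
      qed
    qed (auto simp: I_closed keys_plus mult_add_r)
    then show ?thesis using assms(2) by auto
  qed
  with assms(1) show ?thesis
    by (induction x rule: poly_mapping_induct) (auto simp: I_closed mult_add_l)
qed

lemma I_mult_r:
  assumes "Poly_Mapping.keys x \<subseteq> S" "f \<in> I"
  shows "f \<otimes>\<^bsub>T\<^esub> x \<in> I"
proof -
  have "f \<otimes>\<^bsub>T\<^esub> sg p q e \<in> I" if pq: "p \<in> carrier A" "q \<in> carrier B" for p q e
  proof -
    have "I \<subseteq> {f \<in> carrier T. \<forall>e. f \<otimes>\<^bsub>T\<^esub> sg p q e \<in> I}"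
    proof (rule I_subset)
      show "bilinear_relations A B \<subseteq> {f \<in> carrier T. \<forall>e. f \<otimes>\<^bsub>T\<^esub> sg p q e \<in> I}"
      proof (intro subsetI CollectI conjI allI)
        fix f e assume f: "f \<in> bilinear_relations A B"
        then show "f \<in> carrier T" using rel_closed by blast
        show "f \<otimes>\<^bsub>T\<^esub> sg p q e \<in> I"
          using f pq unfolding bilinear_relations_def
          by (auto simp: mult_diff_l A.l_distr B.l_distr A.smult_mult_l B.smult_mult_l mult.commute[of _ e] intro!: rel_in_I)
      qed
      show "Poly_Mapping.map ((*) c) f \<in> {f \<in> carrier T. \<forall>e. f \<otimes>\<^bsub>T\<^esub> sg p q e \<in> I}"
        if f: "f \<in> {f \<in> carrier T. \<forall>e. f \<otimes>\<^bsub>T\<^esub> sg p q e \<in> I}" for c f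
      proof -
        have "Poly_Mapping.map ((*) c) f \<otimes>\<^bsub>T\<^esub> sg p q e = f \<otimes>\<^bsub>T\<^esub> sg p q (c * e)" for e
        proof -
          have "Poly_Mapping.keys f \<subseteq> S" using f by simp
          then show ?thesis
            by (induction f rule: poly_mapping_induct) (auto simp: mult_add_l smult_add mult.left_commute mult.assoc)
        qed
        then show ?thesis using f keys_smult[of c f] by auto
      qed
    qed (auto simp: I_closed keys_plus mult_add_l)
    then show ?thesis using assms(2) by auto
  qed
  with assms(1) show ?thesis
    by (induction x rule: poly_mapping_induct) (auto simp: I_closed mult_add_r)
qed

lemma I_subgroup: "abelian_subgroup I T"
  by (rule abelian_subgroup_submodule[OF T_module]) (use I_closed in auto)

sublocale I: ideal I T
proof -
  interpret abelian_subgroup I T by (rule I_subgroup)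
  show "ideal I T"
    by (rule idealI[OF T_ring a_subgroup]) (auto intro: I_mult_l I_mult_r)
qed

lemma R_eq: "R = quot_algebra T I"
  by (simp add: tensor_algebra_def I_def)

sublocale R: ring R
proof -
  have "ring (T Quot I)" by (rule I.quotient_is_ring)
  then interpret Q: ring "T Quot I" .
  have "abelian_group R" unfolding R_eq by (rule quot_algebra_abelian_group[OF I_subgroup])
  then show "ring R"
    by (intro ringI monoidI)
      (use Q.m_assoc Q.m_closed Q.one_closed Q.l_one Q.r_one Q.l_distr Q.r_distr in \<open>auto simp: R_eq quot_algebra_def\<close>)
qed

definition tens where "tens a b = I +>\<^bsub>T\<^esub> sg a b 1"

lemma R_carrier: "carrier R = (\<lambda>f. I +>\<^bsub>T\<^esub> f) ` {f. Poly_Mapping.keys f \<subseteq> S}"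
  by (simp add: R_eq quot_algebra_simps)

lemma coset_eq_iff:
  assumes "Poly_Mapping.keys f \<subseteq> S" "Poly_Mapping.keys g \<subseteq> S"
  shows "I +>\<^bsub>T\<^esub> f = I +>\<^bsub>T\<^esub> g \<longleftrightarrow> f - g \<in> I"
proof
  assume "I +>\<^bsub>T\<^esub> f = I +>\<^bsub>T\<^esub> g"
  then have "f \<in> I +>\<^bsub>T\<^esub> g" using I.a_rcos_self[of f] assms by simp
  then show "f - g \<in> I" by (auto simp: a_r_coset_def')
next
  assume "f - g \<in> I"
  then have "(f - g) + g \<in> I +>\<^bsub>T\<^esub> g" unfolding a_r_coset_def' by fastforce
  then show "I +>\<^bsub>T\<^esub> f = I +>\<^bsub>T\<^esub> g"
    using T.a_repr_independence[of f I g] assms I.a_subgroup by simp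
qed

lemma coset_add: "Poly_Mapping.keys f \<subseteq> S \<Longrightarrow> Poly_Mapping.keys g \<subseteq> S \<Longrightarrow>
  (I +>\<^bsub>T\<^esub> f) \<oplus>\<^bsub>R\<^esub> (I +>\<^bsub>T\<^esub> g) = I +>\<^bsub>T\<^esub> (f + g)"
  using I.a_rcos_sum[of f g] by (simp add: R_eq quot_algebra_simps)

lemma coset_mult: "Poly_Mapping.keys f \<subseteq> S \<Longrightarrow> Poly_Mapping.keys g \<subseteq> S \<Longrightarrow>
  (I +>\<^bsub>T\<^esub> f) \<otimes>\<^bsub>R\<^esub> (I +>\<^bsub>T\<^esub> g) = I +>\<^bsub>T\<^esub> (f \<otimes>\<^bsub>T\<^esub> g)"
  using I.rcoset_mult_add[of f g] by (simp add: R_eq quot_algebra_simps)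

lemma tens_closed [simp]: "a \<in> carrier A \<Longrightarrow> b \<in> carrier B \<Longrightarrow> tens a b \<in> carrier R"
  by (auto simp: R_carrier tens_def)

lemma tens_add_l: "a \<in> carrier A \<Longrightarrow> a' \<in> carrier A \<Longrightarrow> b \<in> carrier B \<Longrightarrow>
  tens (a \<oplus>\<^bsub>A\<^esub> a') b = tens a b \<oplus>\<^bsub>R\<^esub> tens a' b"
  using rel_in_I(1)[of a b a' 1] by (simp add: tens_def coset_add coset_eq_iff keys_plus diff_diff_eq)

lemma tens_add_r: "a \<in> carrier A \<Longrightarrow> b' \<in> carrier B \<Longrightarrow> b \<in> carrier B \<Longrightarrow>
  tens a (b \<oplus>\<^bsub>B\<^esub> b') = tens a b \<oplus>\<^bsub>R\<^esub> tens a b'"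
  using rel_in_I(2)[of a b b' 1] by (simp add: tens_def coset_add coset_eq_iff keys_plus diff_diff_eq)

lemma tens_smult_l: "a \<in> carrier A \<Longrightarrow> b \<in> carrier B \<Longrightarrow> tens (c \<odot>\<^bsub>A\<^esub> a) b = I +>\<^bsub>T\<^esub> sg a b c"
  using rel_in_I(3)[of a b c 1] by (simp add: tens_def coset_eq_iff)

lemma tens_smult_r: "a \<in> carrier A \<Longrightarrow> b \<in> carrier B \<Longrightarrow> tens a (c \<odot>\<^bsub>B\<^esub> b) = tens (c \<odot>\<^bsub>A\<^esub> a) b"
  unfolding tens_smult_l using rel_in_I(4)[of a b c 1] by (simp add: tens_def coset_eq_iff)

lemma tens_mult: "a \<in> carrier A \<Longrightarrow> b \<in> carrier B \<Longrightarrow> a' \<in> carrier A \<Longrightarrow> b' \<in> carrier B \<Longrightarrow>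
  tens a b \<otimes>\<^bsub>R\<^esub> tens a' b' = tens (a \<otimes>\<^bsub>A\<^esub> a') (b \<otimes>\<^bsub>B\<^esub> b')"
  by (simp add: tens_def coset_mult)

lemma tens_one: "\<one>\<^bsub>R\<^esub> = tens \<one>\<^bsub>A\<^esub> \<one>\<^bsub>B\<^esub>"
  by (simp add: tens_def R_eq quot_algebra_simps)

lemma R_zero: "\<zero>\<^bsub>R\<^esub> = I"
  by (simp add: R_eq quot_algebra_simps)

lemma tens_zero [simp]: "a \<in> carrier A \<Longrightarrow> tens a \<zero>\<^bsub>B\<^esub> = \<zero>\<^bsub>R\<^esub>" "b \<in> carrier B \<Longrightarrow> tens \<zero>\<^bsub>A\<^esub> b = \<zero>\<^bsub>R\<^esub>"
  using tens_add_r[of a "\<zero>\<^bsub>B\<^esub>" "\<zero>\<^bsub>B\<^esub>"] tens_add_l[of "\<zero>\<^bsub>A\<^esub>" "\<zero>\<^bsub>A\<^esub>" b]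
    tens_closed[of a "\<zero>\<^bsub>B\<^esub>"] tens_closed[of "\<zero>\<^bsub>A\<^esub>" b]
  by (simp_all del: tens_closed)

lemma tens_induct [consumes 1, case_names tens add]:
  assumes "t \<in> carrier R" and "\<And>a b. a \<in> carrier A \<Longrightarrow> b \<in> carrier B \<Longrightarrow> P (tens a b)"
    and "\<And>s t. s \<in> carrier R \<Longrightarrow> t \<in> carrier R \<Longrightarrow> P s \<Longrightarrow> P t \<Longrightarrow> P (s \<oplus>\<^bsub>R\<^esub> t)"
  shows "P t"
proof -
  obtain f where f: "Poly_Mapping.keys f \<subseteq> S" "t = I +>\<^bsub>T\<^esub> f" using assms(1) by (auto simp: R_carrier)
  have "P (I +>\<^bsub>T\<^esub> f)"
    using f(1)
  proof (induction f rule: poly_mapping_induct)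
    case zero
    have "P (tens \<zero>\<^bsub>A\<^esub> \<zero>\<^bsub>B\<^esub>)" by (rule assms(2)) auto
    moreover have "I +>\<^bsub>T\<^esub> 0 = \<zero>\<^bsub>R\<^esub>" using T.a_coset_join2[of 0 I] I_closed(3) I.a_subgroup by (simp add: R_zero)
    ultimately show ?case by simp
  next
    case (single p c)
    \<comment> \<open>The coefficient is absorbed into the left factor, so pure tensors
      suffice.\<close>
    then show ?case using assms(2)[of "c \<odot>\<^bsub>A\<^esub> fst p" "snd p"] by (cases p) (auto simp: tens_smult_l)
  next
    case (add f g)
    then show ?case using assms(3)[of "I +>\<^bsub>T\<^esub> f" "I +>\<^bsub>T\<^esub> g"] by (simp add: coset_add R_carrier)
  qed
  then show ?thesis using f by simp
qed

lemma R_smult: "Poly_Mapping.keys f \<subseteq> S \<Longrightarrow> c \<odot>\<^bsub>R\<^esub> (I +>\<^bsub>T\<^esub> f) = I +>\<^bsub>T\<^esub> Poly_Mapping.map ((*) c) f"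
  unfolding R_eq
  by (subst quot_algebra_smult[OF I_subgroup]) (simp_all add: I_closed smult_add keys_smult_S)

lemma R_scalar: "c \<odot>\<^bsub>R\<^esub> \<one>\<^bsub>R\<^esub> = tens (c \<odot>\<^bsub>A\<^esub> \<one>\<^bsub>A\<^esub>) \<one>\<^bsub>B\<^esub>"
  unfolding tens_one by (simp add: tens_def R_smult, simp add: tens_smult_l flip: tens_def)

lemma central_scalars_R: "central_scalars R"
proof (intro central_scalars.intro central_scalars_axioms.intro R.ring_axioms)
  fix c d :: 'k and r
  show "c \<odot>\<^bsub>R\<^esub> \<one>\<^bsub>R\<^esub> \<in> carrier R" by (simp add: R_scalar)
  show "(c + d) \<odot>\<^bsub>R\<^esub> \<one>\<^bsub>R\<^esub> = c \<odot>\<^bsub>R\<^esub> \<one>\<^bsub>R\<^esub> \<oplus>\<^bsub>R\<^esub> d \<odot>\<^bsub>R\<^esub> \<one>\<^bsub>R\<^esub>"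
    by (simp add: R_scalar A.smult_add_l tens_add_l)
  show "(c * d) \<odot>\<^bsub>R\<^esub> \<one>\<^bsub>R\<^esub> = (c \<odot>\<^bsub>R\<^esub> \<one>\<^bsub>R\<^esub>) \<otimes>\<^bsub>R\<^esub> (d \<odot>\<^bsub>R\<^esub> \<one>\<^bsub>R\<^esub>)"
    by (simp add: R_scalar A.smult_assoc tens_mult A.smult_mult_l)
  show "1 \<odot>\<^bsub>R\<^esub> \<one>\<^bsub>R\<^esub> = \<one>\<^bsub>R\<^esub>" by (subst R_scalar) (simp add: A.smult_one tens_one)
  show "(c \<odot>\<^bsub>R\<^esub> \<one>\<^bsub>R\<^esub>) \<otimes>\<^bsub>R\<^esub> r = r \<otimes>\<^bsub>R\<^esub> (c \<odot>\<^bsub>R\<^esub> \<one>\<^bsub>R\<^esub>)" if "r \<in> carrier R"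
    using that
    by (induction r rule: tens_induct)
      (auto simp: R_scalar tens_mult A.smult_mult_l A.smult_mult_r R.r_distr R.l_distr)
qed

text \<open>The universal property of the tensor product, in the form in which
  \<open>regular_bimodule\<close> defines its action: the linear extension is constant on each
  coset, so the image of a coset is a singleton and \<open>the_elem\<close> reads it off.\<close>

lemma tensor_lift:
  fixes V :: "('v, 'z) ring_scheme" and g :: "'a \<times> 'b \<Rightarrow> 'k \<Rightarrow> 'v"
  assumes V: "abelian_group V" and cl: "\<And>p c. p \<in> S \<Longrightarrow> g p c \<in> carrier V"
    and ga: "\<And>p c d. p \<in> S \<Longrightarrow> g p (c + d) = g p c \<oplus>\<^bsub>V\<^esub> g p d"
    and gl: "\<And>a a' b c. a \<in> carrier A \<Longrightarrow> a' \<in> carrier A \<Longrightarrow> b \<in> carrier B \<Longrightarrow>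
      g (a \<oplus>\<^bsub>A\<^esub> a', b) c = g (a, b) c \<oplus>\<^bsub>V\<^esub> g (a', b) c"
    and gr: "\<And>a b b' c. a \<in> carrier A \<Longrightarrow> b \<in> carrier B \<Longrightarrow> b' \<in> carrier B \<Longrightarrow>
      g (a, b \<oplus>\<^bsub>B\<^esub> b') c = g (a, b) c \<oplus>\<^bsub>V\<^esub> g (a, b') c"
    and gsl: "\<And>a b c d. a \<in> carrier A \<Longrightarrow> b \<in> carrier B \<Longrightarrow> g (d \<odot>\<^bsub>A\<^esub> a, b) c = g (a, b) (c * d)"
    and gsr: "\<And>a b c d. a \<in> carrier A \<Longrightarrow> b \<in> carrier B \<Longrightarrow> g (a, d \<odot>\<^bsub>B\<^esub> b) c = g (a, b) (c * d)"
  defines "F \<equiv> \<lambda>t. the_elem (lin_ext V g ` t)"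
  shows "t \<in> carrier R \<Longrightarrow> F t \<in> carrier V"
    and "s \<in> carrier R \<Longrightarrow> t \<in> carrier R \<Longrightarrow> F (s \<oplus>\<^bsub>R\<^esub> t) = F s \<oplus>\<^bsub>V\<^esub> F t"
    and "a \<in> carrier A \<Longrightarrow> b \<in> carrier B \<Longrightarrow> F (tens a b) = g (a, b) 1"
proof -
  interpret linear_extension V S g
    using V cl ga by (intro linear_extension.intro linear_extension_axioms.intro) auto
  have "I \<subseteq> {f \<in> carrier T. \<forall>c. L (Poly_Mapping.map ((*) c) f) = \<zero>\<^bsub>V\<^esub>}"
  proof (rule I_subset)
    show "bilinear_relations A B \<subseteq> {f \<in> carrier T. \<forall>c. L (Poly_Mapping.map ((*) c) f) = \<zero>\<^bsub>V\<^esub>}"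
    proof (intro subsetI CollectI conjI allI)
      fix f c assume f: "f \<in> bilinear_relations A B"
      then show "f \<in> carrier T" using rel_closed by blast
      have m: "x \<oplus>\<^bsub>V\<^esub> y \<ominus>\<^bsub>V\<^esub> x \<ominus>\<^bsub>V\<^esub> y = \<zero>\<^bsub>V\<^esub>" if "x \<in> carrier V" "y \<in> carrier V" for x y
        using that by (metis a_minus_def a_comm a_assoc r_neg r_zero add.inv_closed)
      have m': "x \<ominus>\<^bsub>V\<^esub> x = \<zero>\<^bsub>V\<^esub>" if "x \<in> carrier V" for x
        using that by (simp add: a_minus_def r_neg)
      show "L (Poly_Mapping.map ((*) c) f) = \<zero>\<^bsub>V\<^esub>"
        using f unfolding bilinear_relations_def
        by (auto simp: smult_diff lin_ext_diff keys_sub gl gr gsl gsr m m' cl)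
    qed
    have sm: "Poly_Mapping.map ((*) c) (Poly_Mapping.map ((*) d) f) = Poly_Mapping.map ((*) (c * d)) f" for c d :: 'k and f
      by (rule poly_mapping_eqI) (simp add: mult.assoc)
    show "Poly_Mapping.map ((*) c) f \<in> {f \<in> carrier T. \<forall>c. L (Poly_Mapping.map ((*) c) f) = \<zero>\<^bsub>V\<^esub>}"
      if "f \<in> {f \<in> carrier T. \<forall>c. L (Poly_Mapping.map ((*) c) f) = \<zero>\<^bsub>V\<^esub>}" for c f
      using that keys_smult[of c f] by (auto simp: sm)
    have z: "Poly_Mapping.map ((*) c) 0 = 0" for c :: 'k by (rule poly_mapping_eqI) simp
    show "0 \<in> {f \<in> carrier T. \<forall>c. L (Poly_Mapping.map ((*) c) f) = \<zero>\<^bsub>V\<^esub>}" by (simp add: z)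
    show "f + h \<in> {f \<in> carrier T. \<forall>c. L (Poly_Mapping.map ((*) c) f) = \<zero>\<^bsub>V\<^esub>}"
      if "f \<in> {f \<in> carrier T. \<forall>c. L (Poly_Mapping.map ((*) c) f) = \<zero>\<^bsub>V\<^esub>}"
        "h \<in> {f \<in> carrier T. \<forall>c. L (Poly_Mapping.map ((*) c) f) = \<zero>\<^bsub>V\<^esub>}" for f h
      using that by (simp add: smult_add lin_ext_add keys_plus keys_smult_S)
  qed auto
  moreover have "Poly_Mapping.map ((*) 1) f = f" for f :: "('a \<times> 'b) \<Rightarrow>\<^sub>0 'k" by (rule poly_mapping_eqI) simp
  ultimately have LI: "L f = \<zero>\<^bsub>V\<^esub>" if "f \<in> I" for f
    using that by (metis (mono_tags, lifting) mem_Collect_eq subsetD)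
  have F: "F (I +>\<^bsub>T\<^esub> f) = L f" if f: "Poly_Mapping.keys f \<subseteq> S" for f
  proof -
    have "L ` (I +>\<^bsub>T\<^esub> f) = {L f}"
    proof (intro equalityI subsetI)
      fix y assume "y \<in> L ` (I +>\<^bsub>T\<^esub> f)"
      then obtain h where "h \<in> I" "y = L (h + f)" by (auto simp: a_r_coset_def')
      then show "y \<in> {L f}" using f I_closed(1)[of h] LI by (simp add: lin_ext_add)
    next
      fix y assume "y \<in> {L f}"
      then show "y \<in> L ` (I +>\<^bsub>T\<^esub> f)" using I.a_rcos_self[of f] f by auto
    qed
    then show ?thesis by (simp add: F_def)
  qed
  show "t \<in> carrier R \<Longrightarrow> F t \<in> carrier V" by (auto simp: R_carrier F)
  show "s \<in> carrier R \<Longrightarrow> t \<in> carrier R \<Longrightarrow> F (s \<oplus>\<^bsub>R\<^esub> t) = F s \<oplus>\<^bsub>V\<^esub> F t"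
    by (auto simp: R_carrier F coset_add keys_plus lin_ext_add)
  show "a \<in> carrier A \<Longrightarrow> b \<in> carrier B \<Longrightarrow> F (tens a b) = g (a, b) 1"
    by (simp add: tens_def F)
qed

end

section \<open>Enveloping algebras\<close>

locale enveloping = B: kalgebra B for B :: "('k::field, 'b) module"
begin

sublocale tensor "op_algebra B" B
  by (intro tensor.intro B.op_kalgebra B.kalgebra_axioms)

lemma R_env: "R = enveloping_algebra B"
  by (simp add: enveloping_algebra_def)

abbreviation "M \<equiv> regular_bimodule B"

lemma M_simps [simp]: "carrier M = carrier B" "zero M = zero B" "add M = add B"
  by (simp_all add: regular_bimodule_def)

lemma M_act:
  assumes x: "x \<in> carrier B"
  shows "t \<in> carrier R \<Longrightarrow> t \<odot>\<^bsub>M\<^esub> x \<in> carrier B"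
    and "s \<in> carrier R \<Longrightarrow> t \<in> carrier R \<Longrightarrow> (s \<oplus>\<^bsub>R\<^esub> t) \<odot>\<^bsub>M\<^esub> x = s \<odot>\<^bsub>M\<^esub> x \<oplus>\<^bsub>B\<^esub> t \<odot>\<^bsub>M\<^esub> x"
    and "a \<in> carrier B \<Longrightarrow> b \<in> carrier B \<Longrightarrow> tens a b \<odot>\<^bsub>M\<^esub> x = a \<otimes>\<^bsub>B\<^esub> x \<otimes>\<^bsub>B\<^esub> b"
proof -
  let ?g = "\<lambda>p c. c \<odot>\<^bsub>B\<^esub> ((fst p \<otimes>\<^bsub>B\<^esub> x) \<otimes>\<^bsub>B\<^esub> snd p)"
  have M: "t \<odot>\<^bsub>M\<^esub> x = the_elem (lin_ext B ?g ` t)" for t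
    by (simp add: regular_bimodule_def lin_ext_def)
  note lift = tensor_lift[where V = B and g = ?g]
  have *: "abelian_group B" "\<And>p c. p \<in> S \<Longrightarrow> ?g p c \<in> carrier B"
    "\<And>p c d. p \<in> S \<Longrightarrow> ?g p (c + d) = ?g p c \<oplus>\<^bsub>B\<^esub> ?g p d"
    "\<And>a a' b c. a \<in> carrier (op_algebra B) \<Longrightarrow> a' \<in> carrier (op_algebra B) \<Longrightarrow> b \<in> carrier B \<Longrightarrow>
      ?g (a \<oplus>\<^bsub>op_algebra B\<^esub> a', b) c = ?g (a, b) c \<oplus>\<^bsub>B\<^esub> ?g (a', b) c"
    "\<And>a b b' c. a \<in> carrier (op_algebra B) \<Longrightarrow> b \<in> carrier B \<Longrightarrow> b' \<in> carrier B \<Longrightarrow>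
      ?g (a, b \<oplus>\<^bsub>B\<^esub> b') c = ?g (a, b) c \<oplus>\<^bsub>B\<^esub> ?g (a, b') c"
    "\<And>a b c d. a \<in> carrier (op_algebra B) \<Longrightarrow> b \<in> carrier B \<Longrightarrow> ?g (d \<odot>\<^bsub>op_algebra B\<^esub> a, b) c = ?g (a, b) (c * d)"
    "\<And>a b c d. a \<in> carrier (op_algebra B) \<Longrightarrow> b \<in> carrier B \<Longrightarrow> ?g (a, d \<odot>\<^bsub>B\<^esub> b) c = ?g (a, b) (c * d)"
    using x B.abelian_group_axioms
    by (auto simp: B.smult_add_l B.smult_add_r B.l_distr B.r_distr B.smult_mult_l B.smult_mult_r B.smult_assoc)
  show "t \<in> carrier R \<Longrightarrow> t \<odot>\<^bsub>M\<^esub> x \<in> carrier B" unfolding M by (rule lift(1)[OF *])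
  show "s \<in> carrier R \<Longrightarrow> t \<in> carrier R \<Longrightarrow> (s \<oplus>\<^bsub>R\<^esub> t) \<odot>\<^bsub>M\<^esub> x = s \<odot>\<^bsub>M\<^esub> x \<oplus>\<^bsub>B\<^esub> t \<odot>\<^bsub>M\<^esub> x"
    unfolding M by (rule lift(2)[OF *])
  show "a \<in> carrier B \<Longrightarrow> b \<in> carrier B \<Longrightarrow> tens a b \<odot>\<^bsub>M\<^esub> x = a \<otimes>\<^bsub>B\<^esub> x \<otimes>\<^bsub>B\<^esub> b"
    unfolding M using lift(3)[OF *, of a b] x by (simp add: B.smult_one)
qed

sublocale M: right_module R M
proof (intro right_module.intro right_module_axioms.intro R.ring_axioms)
  show "abelian_group M"
    by (rule abelian_group_transfer[OF B.abelian_group_axioms]) simp_all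
  show "t \<odot>\<^bsub>M\<^esub> (x \<oplus>\<^bsub>M\<^esub> y) = t \<odot>\<^bsub>M\<^esub> x \<oplus>\<^bsub>M\<^esub> t \<odot>\<^bsub>M\<^esub> y"
    if "t \<in> carrier R" "x \<in> carrier M" "y \<in> carrier M" for t x y
    using that
    by (induction t rule: tens_induct) (auto simp: M_act B.r_distr B.l_distr B.a_ac)
  show "(r \<otimes>\<^bsub>R\<^esub> s) \<odot>\<^bsub>M\<^esub> x = s \<odot>\<^bsub>M\<^esub> (r \<odot>\<^bsub>M\<^esub> x)"
    if "r \<in> carrier R" "s \<in> carrier R" "x \<in> carrier M" for r s x
    using that(1)
  proof (induction r rule: tens_induct)
    case (tens a b)
    note ab = this
    show ?case
      using that(2)
    proof (induction s rule: tens_induct)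
      case (tens c d)
      then show ?case using ab that(3) by (simp add: M_act tens_mult B.m_assoc)
    next
      case (add s t)
      then show ?case using ab that(3) by (simp add: M_act R.r_distr)
    qed
  next
    case (add r r')
    have d: "s \<odot>\<^bsub>M\<^esub> (y \<oplus>\<^bsub>B\<^esub> z) = s \<odot>\<^bsub>M\<^esub> y \<oplus>\<^bsub>B\<^esub> s \<odot>\<^bsub>M\<^esub> z" if "y \<in> carrier B" "z \<in> carrier B" for y z
      using \<open>s \<in> carrier R\<close> that
      by (induction s rule: tens_induct) (auto simp: M_act B.r_distr B.l_distr B.a_ac)
    show ?case using add that(2,3) by (simp add: M_act R.l_distr d)
  qed
qed (auto simp: M_act tens_one B.m_assoc)

end

section \<open>Down-up algebras\<close>

lemma (in kalgebra) quot_kalgebra: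
  assumes "ideal I A"
  shows "kalgebra (quot_algebra A I)"
proof -
  interpret I: ideal I A by fact
  have sub: "abelian_subgroup I A"
    by (rule abelian_subgroupI3[OF I.is_additive_subgroup abelian_group_axioms])
  interpret Q: ring "A Quot I" by (rule I.quotient_is_ring)
  have "abelian_group (quot_algebra A I)" by (rule quot_algebra_abelian_group[OF sub])
  then have R: "ring (quot_algebra A I)"
    by (intro ringI monoidI)
      (use Q.m_assoc Q.m_closed Q.one_closed Q.l_one Q.r_one Q.l_distr Q.r_distr in \<open>auto simp: quot_algebra_def\<close>)
  \<comment> \<open>Scaling is multiplication by a multiple of the unit, so an ideal is a
    subspace.\<close>
  have c: "c \<odot> u \<in> I" if "u \<in> I" for c u
    using smult_mult_l[of \<one> u c] I.I_l_closed[OF that, of "c \<odot> \<one>"] I.a_subset that by auto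
  have s: "c \<odot>\<^bsub>quot_algebra A I\<^esub> (I +> x) = I +> (c \<odot> x)" if "x \<in> carrier A" for c x
    by (rule quot_algebra_smult[OF sub]) (use that c smult_add_r in auto)
  show ?thesis
    by (intro kalgebra.intro R kalgebra_axioms.intro)
      (auto simp: quot_algebra_simps s I.a_rcos_sum I.rcoset_mult_add smult_add_l smult_add_r smult_assoc
         smult_one smult_mult_l smult_mult_r)
qed

lemma smult_eq_mult: "Poly_Mapping.map ((*) c) f = Poly_Mapping.single 0 c * f"
  for c :: "'k::field" and f :: "'a::monoid_add \<Rightarrow>\<^sub>0 'k"
  using subset_UNIV[of "Poly_Mapping.keys f"]
  by (induction f rule: poly_mapping_induct) (simp_all add: smult_add distrib_left mult_single)

lemma single_zero_commute: "f * Poly_Mapping.single 0 c = Poly_Mapping.single 0 c * f"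
  for c :: "'k::field" and f :: "'a::monoid_add \<Rightarrow>\<^sub>0 'k"
  using subset_UNIV[of "Poly_Mapping.keys f"]
  by (induction f rule: poly_mapping_induct) (simp_all add: distrib_left distrib_right mult_single mult.commute)

lemma free_algebra_simps [simp]:
  "carrier free_algebra = UNIV" "mult free_algebra = (*)" "one free_algebra = 1" "zero free_algebra = 0"
  "add free_algebra = (+)" "smult free_algebra = (\<lambda>c. Poly_Mapping.map ((*) c))"
  by (simp_all add: free_algebra_def)

lemma free_kalgebra: "kalgebra (free_algebra :: ('k::field, 'a free_monoid \<Rightarrow>\<^sub>0 'k) module)"
proof -
  have ag: "abelian_group (free_algebra :: ('k, 'a free_monoid \<Rightarrow>\<^sub>0 'k) module)"
  proof (rule abelian_groupI)
    fix x :: "'a free_monoid \<Rightarrow>\<^sub>0 'k"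
    show "\<exists>y\<in>carrier (free_algebra :: ('k, 'a free_monoid \<Rightarrow>\<^sub>0 'k) module). y \<oplus>\<^bsub>free_algebra :: ('k, _) module\<^esub> x = \<zero>\<^bsub>free_algebra :: ('k, _) module\<^esub>"
      by (intro bexI[of _ "- x"]) simp_all
  qed (simp_all add: add_ac)
  have "ring (free_algebra :: ('k, 'a free_monoid \<Rightarrow>\<^sub>0 'k) module)"
    by (intro ringI monoidI ag) (simp_all add: mult.assoc distrib_left distrib_right)
  moreover have "f * (Poly_Mapping.single 0 c * g) = Poly_Mapping.single 0 c * (f * g)" for c and f g :: "'a free_monoid \<Rightarrow>\<^sub>0 'k"
    by (metis mult.assoc single_zero_commute)
  moreover have "Poly_Mapping.map ((*) (c + d)) f = Poly_Mapping.map ((*) c) f + Poly_Mapping.map ((*) d) f"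
    "Poly_Mapping.map ((*) (c * d)) f = Poly_Mapping.map ((*) c) (Poly_Mapping.map ((*) d) f)"
    "Poly_Mapping.map ((*) 1) f = f"
    for c d and f :: "'a free_monoid \<Rightarrow>\<^sub>0 'k"
    by (rule poly_mapping_eqI, simp add: lookup_add algebra_simps)+
  moreover have "Poly_Mapping.map ((*) c) f * g = Poly_Mapping.map ((*) c) (f * g)" for c and f g :: "'a free_monoid \<Rightarrow>\<^sub>0 'k"
    by (simp add: smult_eq_mult mult.assoc)
  moreover have "f * Poly_Mapping.map ((*) c) g = Poly_Mapping.map ((*) c) (f * g)" for c and f g :: "'a free_monoid \<Rightarrow>\<^sub>0 'k"
    unfolding smult_eq_mult by (metis mult.assoc single_zero_commute)
  ultimately show ?thesis
    by (intro kalgebra.intro kalgebra_axioms.intro) (simp_all add: smult_add)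
qed

section \<open>The down-up algebra as a graded quotient of the free algebra\<close>

locale down_up =
  fixes \<alpha> \<beta> :: "'k :: field_char_0" and n m :: nat
  assumes \<beta>: "\<beta> \<noteq> 0" and n: "n > 1" and m_ge: "m \<ge> n" and coprime: "gcd n m = 1"
begin

lemma nm: "n < m" "2 \<le> n" "3 \<le> m" "\<not> n dvd m"
proof -
  show *: "n < m" "2 \<le> n"
    using n m_ge coprime by (cases "n = m"; simp)+
  then show "3 \<le> m" by simp
  show "\<not> n dvd m" using n coprime by (metis gcd_nat.absorb1 less_irrefl)
qed

abbreviation "F \<equiv> free_algebra :: ('k, gen free_monoid \<Rightarrow>\<^sub>0 'k) module"
abbreviation wd :: "gen list \<Rightarrow> 'k \<Rightarrow> gen free_monoid \<Rightarrow>\<^sub>0 'k" where "wd w c \<equiv> Poly_Mapping.single (Word w) c"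
definition "I = down_up_ideal \<alpha> \<beta>"
abbreviation "A \<equiv> down_up_algebra \<alpha> \<beta>"
definition rel :: "bool \<Rightarrow> gen free_monoid \<Rightarrow>\<^sub>0 'k" where
  "rel b = (if b then wd [X, X, Y] 1 - wd [Y, X, X] \<beta> - wd [X, Y, X] \<alpha>
     else wd [X, Y, Y] 1 - wd [Y, Y, X] \<beta> - wd [Y, X, Y] \<alpha>)"
abbreviation wl :: "gen \<Rightarrow> nat" where "wl a \<equiv> (case a of X \<Rightarrow> n | Y \<Rightarrow> m)"
definition wt :: "gen list \<Rightarrow> nat" where "wt w = (\<Sum>a\<leftarrow>w. wl a)"

sublocale F: kalgebra F by (rule free_kalgebra)

lemma wt_simps [simp]: "wt [] = 0" "wt (a # w) = wl a + wt w" "wt (v @ w) = wt v + wt w"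
  by (simp_all add: wt_def)

lemma weight_wt: "weight n m (Word w) = wt w"
proof (induction w)
  case (Cons a w)
  then show ?case by (cases a) (auto simp: weight_def algebra_simps)
qed (simp add: weight_def)

lemma wd_mult [simp]: "wd u c * wd v d = wd (u @ v) (c * d)"
  by (simp add: mult_single plus_free_monoid_def)

lemma wd_one: "wd [] 1 = 1"
  by (metis single_one zero_free_monoid_def)

lemma free_induct [case_names word add]:
  assumes "\<And>w c. P (wd w c)" "\<And>f g. P f \<Longrightarrow> P g \<Longrightarrow> P (f + g)"
  shows "P f"
  using subset_UNIV[of "Poly_Mapping.keys f"]
proof (induction f rule: poly_mapping_induct)
  case zero
  then show ?case using assms(1)[of "[]" 0] by simp
next
  case (single p c)
  then show ?case using assms(1) by (cases p) simp
qed (use assms in auto)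

lemma I_eq: "I = genideal F (range rel)"
proof -
  have "range rel = {rel True, rel False}" by (auto simp: UNIV_bool)
  then show ?thesis by (simp add: I_def down_up_ideal_def rel_def word_term_def)
qed

lemma I_ideal: "ideal I F"
  unfolding I_eq by (rule F.genideal_ideal) simp

sublocale I: ideal I F by (rule I_ideal)

text \<open>Sums of two-sided multiples of relations by words. Once \<open>J\<close> is seen to be
  an ideal, it contains the generated ideal, and its rules become an induction principle for
  \<open>I\<close>. The scalar sits on the left word only, since scalars are central.\<close>

inductive_set J :: "(gen free_monoid \<Rightarrow>\<^sub>0 'k) set" where
  J0: "0 \<in> J"
| Jr: "wd u c * rel b * wd v 1 \<in> J"
| Ja: "f \<in> J \<Longrightarrow> g \<in> J \<Longrightarrow> f + g \<in> J"

lemma J_mult: "f \<in> J \<Longrightarrow> g * f \<in> J" "f \<in> J \<Longrightarrow> f * g \<in> J"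
proof -
  have l: "wd w d * f \<in> J" if "f \<in> J" for f w d
    using that
  proof induction
    case (Jr u c b v)
    have "wd w d * (wd u c * rel b * wd v 1) = wd (w @ u) (d * c) * rel b * wd v 1"
      by (simp add: mult.assoc[symmetric])
    then show ?case using J.Jr by metis
  qed (auto simp: distrib_left intro: J.intros)
  have r: "f * wd w d \<in> J" if "f \<in> J" for f w d
    using that
  proof induction
    case (Jr u c b v)
    have c: "rel b * wd [] d = wd [] d * rel b"
      using single_zero_commute[of "rel b" d] by (simp add: zero_free_monoid_def)
    have "wd u c * rel b * wd v 1 * wd w d = wd u c * (rel b * wd [] d) * wd (v @ w) 1"
      by (simp add: mult.assoc)
    also have "\<dots> = wd u (c * d) * rel b * wd (v @ w) 1"
      unfolding c by (simp flip: mult.assoc)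
    finally show ?case by (simp only: J.Jr)
  qed (auto simp: distrib_right intro: J.intros)
  show "f \<in> J \<Longrightarrow> g * f \<in> J"
    by (induction g rule: free_induct) (auto simp: distrib_right intro: J.intros l)
  show "f \<in> J \<Longrightarrow> f * g \<in> J"
    by (induction g rule: free_induct) (auto simp: distrib_left intro: J.intros r)
qed

lemma I_subset_J: "I \<subseteq> J"
proof -
  have neg: "- f \<in> J" if "f \<in> J" for f
    using J_mult(1)[OF that, of "- 1"] by simp
  have "subgroup J (add_monoid F)"
  proof (rule subgroup.intro)
    show "inv\<^bsub>add_monoid F\<^esub> x \<in> J" if "x \<in> J" for x
    proof -
      have "\<ominus>\<^bsub>F\<^esub> x = - x" by (rule F.minus_equality) auto
      then show ?thesis using neg[OF that] by (simp add: a_inv_def)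
    qed
  qed (auto intro: J.intros)
  then have "ideal J F"
    by (intro idealI F.ring_axioms) (auto intro: J_mult)
  moreover have "range rel \<subseteq> J"
    using J.Jr[of "[]" 1 _ "[]"] by (auto simp: wd_one)
  ultimately show ?thesis unfolding I_eq by (rule F.genideal_minimal)
qed

lemma I_induct [consumes 1, case_names zero rel add]:
  assumes "f \<in> I" "P 0" "\<And>u c b v. P (wd u c * rel b * wd v 1)" "\<And>f g. P f \<Longrightarrow> P g \<Longrightarrow> P (f + g)"
  shows "P f"
proof -
  have "f \<in> J" using assms(1) I_subset_J by blast
  then show ?thesis by induction (use assms in auto)
qed

lemma I_add: "f \<in> I \<Longrightarrow> g \<in> I \<Longrightarrow> f + g \<in> I"
  using I.a_closed by simp

lemma I_smult: "f \<in> I \<Longrightarrow> Poly_Mapping.map ((*) c) f \<in> I"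
  using I.I_l_closed[of f "Poly_Mapping.single 0 c"] by (simp add: smult_eq_mult)

lemma rel_I: "rel b \<in> I"
  unfolding I_eq by (rule subsetD[OF F.genideal_self]) auto

sublocale A: kalgebra A
  unfolding down_up_algebra_def by (rule F.quot_kalgebra) (use I_ideal in \<open>simp add: I_def\<close>)

lemma A_eq: "A = quot_algebra F I"
  by (simp add: down_up_algebra_def I_def)

definition \<pi> where "\<pi> f = I +>\<^bsub>F\<^esub> f"

lemma A_carrier: "carrier A = range \<pi>"
  by (simp add: A_eq quot_algebra_simps \<pi>_def)

lemma \<pi>_closed [simp]: "\<pi> f \<in> carrier A"
  by (simp add: A_carrier)

lemma \<pi>_add: "\<pi> (f + g) = \<pi> f \<oplus>\<^bsub>A\<^esub> \<pi> g"
  using I.a_rcos_sum[of f g] by (simp add: A_eq quot_algebra_simps \<pi>_def)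

lemma \<pi>_mult: "\<pi> (f * g) = \<pi> f \<otimes>\<^bsub>A\<^esub> \<pi> g"
  using I.rcoset_mult_add[of f g] by (simp add: A_eq quot_algebra_simps \<pi>_def)

lemma \<pi>_one: "\<pi> 1 = \<one>\<^bsub>A\<^esub>"
  by (simp add: A_eq quot_algebra_simps \<pi>_def)

lemma \<pi>_eq_iff: "\<pi> f = \<pi> g \<longleftrightarrow> f - g \<in> I"
proof
  assume "\<pi> f = \<pi> g"
  then have "f \<in> I +>\<^bsub>F\<^esub> g" using I.a_rcos_self[of f] by (simp add: \<pi>_def)
  then show "f - g \<in> I" by (auto simp: a_r_coset_def')
next
  assume "f - g \<in> I"
  then have "(f - g) + g \<in> I +>\<^bsub>F\<^esub> g" unfolding a_r_coset_def' by fastforce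
  then show "\<pi> f = \<pi> g"
    using F.a_repr_independence[of f I g] I.a_subgroup by (simp add: \<pi>_def)
qed

lemma \<pi>_zero [simp]: "\<pi> 0 = \<zero>\<^bsub>A\<^esub>"
  using \<pi>_add[of 0 0] A.add.l_cancel_one'[of "\<pi> 0" "\<pi> 0"] by simp

lemma \<pi>_zero_iff: "\<pi> f = \<zero>\<^bsub>A\<^esub> \<longleftrightarrow> f \<in> I"
  using \<pi>_eq_iff[of f 0] by simp

lemma \<pi>_smult: "\<pi> (Poly_Mapping.map ((*) c) f) = c \<odot>\<^bsub>A\<^esub> \<pi> f"
  using quot_algebra_smult[OF abelian_subgroupI3[OF I.is_additive_subgroup F.abelian_group_axioms], of c f]
  by (simp add: A_eq \<pi>_def I_smult smult_add)

lemma \<pi>_sum: "finite T \<Longrightarrow> \<pi> (\<Sum>r\<in>T. f r) = (\<Oplus>\<^bsub>A\<^esub>r\<in>T. \<pi> (f r))"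
  by (induction T rule: finite_induct) (auto simp: \<pi>_add)

definition hom :: "nat \<Rightarrow> (gen free_monoid \<Rightarrow>\<^sub>0 'k) \<Rightarrow> bool" where
  "hom d f \<longleftrightarrow> (\<forall>w\<in>Poly_Mapping.keys f. weight n m w = d)"

lemma hom_zero [simp]: "hom d 0" by (simp add: hom_def)

lemma hom_wd: "wt w = d \<Longrightarrow> hom d (wd w c)"
  by (simp add: hom_def weight_wt)

lemma hom_one [simp]: "hom 0 1"
  using hom_wd[of "[]" 0 1] by (simp add: wd_one)

lemma hom_add: "hom d f \<Longrightarrow> hom d g \<Longrightarrow> hom d (f + g)"
  unfolding hom_def using keys_add[of f g] by blast

lemma hom_uminus: "hom d f \<Longrightarrow> hom d (- f)"
  by (simp add: hom_def)

lemma hom_smult: "hom d f \<Longrightarrow> hom d (Poly_Mapping.map ((*) c) f)"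
  unfolding hom_def using keys_smult[of c f] by blast

lemma hom_sum: "(\<And>r. r \<in> T \<Longrightarrow> hom d (f r)) \<Longrightarrow> hom d (\<Sum>r\<in>T. f r)"
  by (induction T rule: infinite_finite_induct) (auto intro: hom_add)

lemma weight_plus: "weight n m (v + w) = weight n m v + weight n m w"
  by (cases v; cases w) (simp add: plus_free_monoid_def weight_wt)

lemma hom_mult: "hom d f \<Longrightarrow> hom e g \<Longrightarrow> d + e = k \<Longrightarrow> hom k (f * g)"
  unfolding hom_def using keys_mult[of f g] by (fastforce simp: weight_plus)

lemma hom_induct [consumes 1, case_names zero word add]:
  assumes "hom d f" "P 0" "\<And>w c. wt w = d \<Longrightarrow> P (wd w c)" "\<And>f g. hom d f \<Longrightarrow> hom d g \<Longrightarrow> P f \<Longrightarrow> P g \<Longrightarrow> P (f + g)"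
  shows "P f"
proof -
  have "Poly_Mapping.keys f \<subseteq> {w. weight n m w = d}" using assms(1) by (auto simp: hom_def)
  then show ?thesis
  proof (induction f rule: poly_mapping_induct)
    case (single p c)
    then show ?case using assms(3) by (cases p) (auto simp: weight_wt)
  next
    case (add f g)
    have "hom d f" "hom d g" using add(1,2) by (auto simp: hom_def)
    then show ?case using add(3,4) by (rule assms(4))
  qed (rule assms(2))
qed

abbreviation "C \<equiv> down_up_component \<alpha> \<beta> n m"

lemma C_eq: "C d = \<pi> ` {f. hom d f}"
  by (simp add: down_up_component_def \<pi>_def I_def hom_def)

section \<open>The Beilinson algebra\<close>

definition "\<L> = 2 * (n + m)"
definition "B = down_up_beilinson \<alpha> \<beta> n m"

definition valid :: "nat \<Rightarrow> nat \<Rightarrow> bool" where "valid i j \<longleftrightarrow> 1 \<le> i \<and> i \<le> j \<and> j \<le> \<L>"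

text \<open>Lifts of Beilinson matrices to the free algebra. Products are computed on them, and
  \<open>cls\<close> reduces the entries afterwards.\<close>

definition FM :: "(nat \<Rightarrow> nat \<Rightarrow> gen free_monoid \<Rightarrow>\<^sub>0 'k) set" where
  "FM = {f. \<forall>i j. hom (j - i) (f i j) \<and> (\<not> valid i j \<longrightarrow> f i j = 0)}"

text \<open>The factors stand in the order of the Beilinson product: a path from \<open>i\<close> to
  \<open>r\<close> is the right factor and its continuation to \<open>j\<close> the left
  one.\<close>

definition fmul :: "(nat \<Rightarrow> nat \<Rightarrow> gen free_monoid \<Rightarrow>\<^sub>0 'k) \<Rightarrow> (nat \<Rightarrow> nat \<Rightarrow> gen free_monoid \<Rightarrow>\<^sub>0 'k) \<Rightarrow>
   nat \<Rightarrow> nat \<Rightarrow> gen free_monoid \<Rightarrow>\<^sub>0 'k" where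
  "fmul f g i j = (\<Sum>r\<in>{1..\<L>}. f r j * g i r)"

definition cls where "cls f = (\<lambda>i j. \<pi> (f i j))"

lemma B_carrier: "carrier B = cls ` FM"
proof (intro equalityI subsetI)
  fix a assume "a \<in> carrier B"
  then have a: "\<And>i j. valid i j \<Longrightarrow> a i j \<in> \<pi> ` {f. hom (j - i) f}" "\<And>i j. \<not> valid i j \<Longrightarrow> a i j = \<zero>\<^bsub>A\<^esub>"
    unfolding B_def down_up_beilinson_def beilinson_algebra_def valid_def \<L>_def
    by (auto simp: C_eq split: if_splits)
  have "\<forall>i j. \<exists>f. valid i j \<longrightarrow> hom (j - i) f \<and> a i j = \<pi> f" using a(1) by blast
  then obtain f where f: "\<And>i j. valid i j \<Longrightarrow> hom (j - i) (f i j) \<and> a i j = \<pi> (f i j)" by metis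
  let ?f = "\<lambda>i j. if valid i j then f i j else 0"
  have "?f \<in> FM" "cls ?f = a" using f a(2) by (auto simp: FM_def cls_def fun_eq_iff)
  then show "a \<in> cls ` FM" by blast
next
  fix a assume "a \<in> cls ` FM"
  then show "a \<in> carrier B"
    unfolding B_def down_up_beilinson_def beilinson_algebra_def FM_def valid_def \<L>_def cls_def
    by (auto simp: C_eq)
qed

lemma cls_add: "cls f \<oplus>\<^bsub>B\<^esub> cls g = cls (\<lambda>i j. f i j + g i j)"
  by (simp add: B_def down_up_beilinson_def beilinson_algebra_def cls_def \<pi>_add)

lemma cls_smult: "c \<odot>\<^bsub>B\<^esub> cls f = cls (\<lambda>i j. Poly_Mapping.map ((*) c) (f i j))"
  by (simp add: B_def down_up_beilinson_def beilinson_algebra_def cls_def \<pi>_smult)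

lemma cls_zero: "\<zero>\<^bsub>B\<^esub> = cls (\<lambda>i j. 0)"
  by (simp add: B_def down_up_beilinson_def beilinson_algebra_def cls_def)

lemma cls_one: "\<one>\<^bsub>B\<^esub> = cls (\<lambda>i j. if i = j \<and> valid i j then 1 else 0)"
  by (auto simp: B_def down_up_beilinson_def beilinson_algebra_def cls_def \<pi>_one valid_def \<L>_def fun_eq_iff)

lemma cls_mult: "cls f \<otimes>\<^bsub>B\<^esub> cls g = cls (fmul f g)"
  by (simp add: B_def down_up_beilinson_def beilinson_algebra_def cls_def fmul_def \<pi>_sum \<pi>_mult \<L>_def)

lemma FM_add: "f \<in> FM \<Longrightarrow> g \<in> FM \<Longrightarrow> (\<lambda>i j. f i j + g i j) \<in> FM"
  by (simp add: FM_def hom_add)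

lemma FM_uminus: "f \<in> FM \<Longrightarrow> (\<lambda>i j. - f i j) \<in> FM"
  by (simp add: FM_def hom_uminus)

lemma FM_smult: "f \<in> FM \<Longrightarrow> (\<lambda>i j. Poly_Mapping.map ((*) c) (f i j)) \<in> FM"
  by (simp add: FM_def hom_smult)

lemma FM_one: "(\<lambda>i j. if i = j \<and> valid i j then 1 else 0) \<in> FM"
  by (simp add: FM_def)

lemma FM_zero: "(\<lambda>i j. 0) \<in> FM"
  by (simp add: FM_def)

lemma FM_mult:
  assumes f: "f \<in> FM" and g: "g \<in> FM"
  shows "fmul f g \<in> FM"
proof -
  have *: "hom (j - i) (f r j * g i r) \<and> (\<not> valid i j \<longrightarrow> f r j * g i r = 0)" for i j r
  proof (cases "valid r j \<and> valid i r")
    case True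
    then show ?thesis using f g
      by (auto simp: FM_def valid_def intro!: hom_mult[of "j - r" _ "r - i"])
  next
    case False
    then have "f r j = 0 \<or> g i r = 0" using f g by (auto simp: FM_def)
    then show ?thesis by auto
  qed
  then show ?thesis unfolding FM_def fmul_def by (auto intro!: hom_sum sum.neutral)
qed

lemma fmul_assoc: "fmul (fmul f g) h = fmul f (fmul g h)"
proof (intro ext)
  fix i j
  have "fmul (fmul f g) h i j = (\<Sum>r\<in>{1..\<L>}. \<Sum>s\<in>{1..\<L>}. f s j * g r s * h i r)"
    by (simp add: fmul_def sum_distrib_right)
  also have "\<dots> = (\<Sum>s\<in>{1..\<L>}. \<Sum>r\<in>{1..\<L>}. f s j * g r s * h i r)" by (rule sum.swap)
  also have "\<dots> = fmul f (fmul g h) i j"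
    by (simp add: fmul_def sum_distrib_left mult.assoc)
  finally show "fmul (fmul f g) h i j = fmul f (fmul g h) i j" .
qed

lemma fmul_one:
  assumes "f \<in> FM"
  shows "fmul (\<lambda>i j. if i = j \<and> valid i j then 1 else 0) f = f"
    "fmul f (\<lambda>i j. if i = j \<and> valid i j then 1 else 0) = f"
proof -
  have f: "f i j = 0" if "\<not> valid i j" for i j using assms that by (auto simp: FM_def)
  have v: "valid j j \<longleftrightarrow> j \<in> {1..\<L>}" for j by (auto simp: valid_def)
  have "fmul (\<lambda>i j. if i = j \<and> valid i j then 1 else 0) f i j = (\<Sum>r\<in>{1..\<L>}. if r = j then f i j else 0)" for i j
    unfolding fmul_def by (intro sum.cong) (auto simp: v)
  then show "fmul (\<lambda>i j. if i = j \<and> valid i j then 1 else 0) f = f"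
    using f by (auto simp: fun_eq_iff valid_def)
  have "fmul f (\<lambda>i j. if i = j \<and> valid i j then 1 else 0) i j = (\<Sum>r\<in>{1..\<L>}. if r = i then f i j else 0)" for i j
    unfolding fmul_def by (intro sum.cong) (auto simp: v)
  then show "fmul f (\<lambda>i j. if i = j \<and> valid i j then 1 else 0) = f"
    using f by (auto simp: fun_eq_iff valid_def)
qed

lemma fmul_linear:
  "fmul (\<lambda>i j. f i j + f' i j) g = (\<lambda>i j. fmul f g i j + fmul f' g i j)"
  "fmul g (\<lambda>i j. f i j + f' i j) = (\<lambda>i j. fmul g f i j + fmul g f' i j)"
  "fmul (\<lambda>i j. Poly_Mapping.map ((*) c) (f i j)) g = (\<lambda>i j. Poly_Mapping.map ((*) c) (fmul f g i j))"
  "fmul g (\<lambda>i j. Poly_Mapping.map ((*) c) (f i j)) = (\<lambda>i j. Poly_Mapping.map ((*) c) (fmul g f i j))"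
proof -
  have mc: "Poly_Mapping.map ((*) c) f * g = Poly_Mapping.map ((*) c) (f * g)"
    "f * Poly_Mapping.map ((*) c) g = Poly_Mapping.map ((*) c) (f * g)" for c and f g :: "gen free_monoid \<Rightarrow>\<^sub>0 'k"
    using F.smult_mult_l[of f g c] F.smult_mult_r[of f g c] by simp_all
  have sc: "Poly_Mapping.map ((*) c) (\<Sum>r\<in>T. f r) = (\<Sum>r\<in>T. Poly_Mapping.map ((*) c) (f r))"
    for c T and f :: "nat \<Rightarrow> gen free_monoid \<Rightarrow>\<^sub>0 'k"
    by (induction T rule: infinite_finite_induct) (auto simp: smult_add)
  show "fmul (\<lambda>i j. f i j + f' i j) g = (\<lambda>i j. fmul f g i j + fmul f' g i j)"
    "fmul g (\<lambda>i j. f i j + f' i j) = (\<lambda>i j. fmul g f i j + fmul g f' i j)"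
    "fmul (\<lambda>i j. Poly_Mapping.map ((*) c) (f i j)) g = (\<lambda>i j. Poly_Mapping.map ((*) c) (fmul f g i j))"
    "fmul g (\<lambda>i j. Poly_Mapping.map ((*) c) (f i j)) = (\<lambda>i j. Poly_Mapping.map ((*) c) (fmul g f i j))"
    by (simp_all add: fun_eq_iff fmul_def distrib_left distrib_right sum.distrib mc sc)
qed

lemma B_kalgebra: "kalgebra B"
proof -
  have ag: "abelian_group B"
  proof (rule abelian_groupI)
    fix x assume "x \<in> carrier B"
    then obtain f where f: "f \<in> FM" "x = cls f" by (auto simp: B_carrier)
    show "\<exists>y\<in>carrier B. y \<oplus>\<^bsub>B\<^esub> x = \<zero>\<^bsub>B\<^esub>"
      using f FM_uminus[OF f(1)] by (intro bexI[of _ "cls (\<lambda>i j. - f i j)"]) (auto simp: B_carrier cls_add cls_zero)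
  qed (auto simp: B_carrier cls_add cls_zero add_ac FM_zero intro!: imageI FM_add)
  have "ring B"
  proof (intro ringI monoidI ag)
    fix x y z assume "x \<in> carrier B" "y \<in> carrier B" "z \<in> carrier B"
    then show "(x \<oplus>\<^bsub>B\<^esub> y) \<otimes>\<^bsub>B\<^esub> z = x \<otimes>\<^bsub>B\<^esub> z \<oplus>\<^bsub>B\<^esub> y \<otimes>\<^bsub>B\<^esub> z"
      "z \<otimes>\<^bsub>B\<^esub> (x \<oplus>\<^bsub>B\<^esub> y) = z \<otimes>\<^bsub>B\<^esub> x \<oplus>\<^bsub>B\<^esub> z \<otimes>\<^bsub>B\<^esub> y"
      by (auto simp: B_carrier cls_add cls_mult fmul_linear)
  qed (auto simp: B_carrier cls_mult cls_one fmul_assoc fmul_one FM_one FM_mult)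
  moreover have sa: "Poly_Mapping.map ((*) (c + d)) f = Poly_Mapping.map ((*) c) f + Poly_Mapping.map ((*) d) f"
    "Poly_Mapping.map ((*) (c * d)) f = Poly_Mapping.map ((*) c) (Poly_Mapping.map ((*) d) f)"
    "Poly_Mapping.map ((*) 1) f = f"
    for c d and f :: "gen free_monoid \<Rightarrow>\<^sub>0 'k"
    using F.smult_add_l[of f c d] F.smult_assoc[of f c d] F.smult_one[of f] by simp_all
  ultimately show ?thesis
    by (intro kalgebra.intro kalgebra_axioms.intro)
      (auto simp: B_carrier cls_add cls_smult cls_mult fmul_linear sa smult_add intro: FM_smult)
qed

sublocale B: kalgebra B by (rule B_kalgebra)

sublocale E: enveloping B by (intro enveloping.intro B_kalgebra)

subsection \<open>Matrix units\<close>

text \<open>\<open>Mu i j f\<close> is the path from \<open>i\<close> to \<open>j\<close> given by the homogeneous element \<open>f\<close>; it is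
  forced to vanish if the vertices are out of range.\<close>

definition Mu where "Mu i j f = cls (\<lambda>i' j'. if i' = i \<and> j' = j \<and> valid i j then f else 0)"

lemma Mu_FM: "hom (j - i) f \<Longrightarrow> (\<lambda>i' j'. if i' = i \<and> j' = j \<and> valid i j then f else 0) \<in> FM"
  by (auto simp: FM_def)

lemma Mu_closed [simp]: "hom (j - i) f \<Longrightarrow> Mu i j f \<in> carrier B"
  unfolding Mu_def B_carrier by (intro imageI Mu_FM)

lemma Mu_invalid: "\<not> valid i j \<Longrightarrow> Mu i j f = \<zero>\<^bsub>B\<^esub>"
  by (simp add: Mu_def cls_zero)

lemma Mu_zero [simp]: "Mu i j 0 = \<zero>\<^bsub>B\<^esub>"
  by (simp add: Mu_def cls_zero)

lemma Mu_add: "Mu i j (f + g) = Mu i j f \<oplus>\<^bsub>B\<^esub> Mu i j g"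
  unfolding Mu_def cls_add by (rule arg_cong[of _ _ cls]) (auto simp: fun_eq_iff)

lemma Mu_smult: "Mu i j (Poly_Mapping.map ((*) c) f) = c \<odot>\<^bsub>B\<^esub> Mu i j f"
  unfolding Mu_def cls_smult by (rule arg_cong[of _ _ cls]) (auto simp: fun_eq_iff)

lemma Mu_I: "f \<in> I \<Longrightarrow> Mu i j f = \<zero>\<^bsub>B\<^esub>"
  using \<pi>_zero_iff[of f] by (auto simp: Mu_def cls_zero cls_def fun_eq_iff)

lemma Mu_entry: "Mu i j f i' j' = (if i' = i \<and> j' = j \<and> valid i j then \<pi> f else \<zero>\<^bsub>A\<^esub>)"
  by (auto simp: Mu_def cls_def)

lemma Mu_mult: "Mu r j f \<otimes>\<^bsub>B\<^esub> Mu i s g = (if r = s \<and> valid r j \<and> valid i r then Mu i j (f * g) else \<zero>\<^bsub>B\<^esub>)"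
proof -
  have "fmul (\<lambda>i' j'. if i' = r \<and> j' = j \<and> valid r j then f else 0) (\<lambda>i' j'. if i' = i \<and> j' = s \<and> valid i s then g else 0) i' j'
    = (if r = s \<and> valid r j \<and> valid i r \<and> i' = i \<and> j' = j then f * g else 0)" for i' j'
  proof -
    have "fmul (\<lambda>i' j'. if i' = r \<and> j' = j \<and> valid r j then f else 0) (\<lambda>i' j'. if i' = i \<and> j' = s \<and> valid i s then g else 0) i' j'
      = (\<Sum>t\<in>{1..\<L>}. if t = r then (if r = s \<and> valid r j \<and> valid i r \<and> i' = i \<and> j' = j then f * g else 0) else 0)"
      unfolding fmul_def by (intro sum.cong) auto
    also have "\<dots> = (if r = s \<and> valid r j \<and> valid i r \<and> i' = i \<and> j' = j then f * g else 0)"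
      by (subst sum.delta) (auto simp: valid_def)
    finally show ?thesis .
  qed
  note eq = this
  have "Mu r j f \<otimes>\<^bsub>B\<^esub> Mu i s g = cls (\<lambda>i' j'. if r = s \<and> valid r j \<and> valid i r \<and> i' = i \<and> j' = j then f * g else 0)"
    unfolding Mu_def cls_mult by (intro arg_cong[of _ _ cls] ext eq)
  also have "\<dots> = (if r = s \<and> valid r j \<and> valid i r then Mu i j (f * g) else \<zero>\<^bsub>B\<^esub>)"
  proof (cases "r = s \<and> valid r j \<and> valid i r")
    case True
    then have "valid i j" by (auto simp: valid_def)
    with True show ?thesis by (auto simp: Mu_def)
  next
    case False
    then have "(\<lambda>i' j'. if r = s \<and> valid r j \<and> valid i r \<and> i' = i \<and> j' = j then f * g else 0) = (\<lambda>i j. 0)"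
      by (auto simp: fun_eq_iff)
    then show ?thesis using False by (auto simp: cls_zero)
  qed
  finally show ?thesis .
qed

definition e where "e v = Mu v v 1"

lemma e_closed [simp]: "e v \<in> carrier B"
  by (simp add: e_def)

lemma e_mult: "e u \<otimes>\<^bsub>B\<^esub> e v = (if u = v then e v else \<zero>\<^bsub>B\<^esub>)"
  by (auto simp: e_def Mu_mult Mu_invalid)

lemma Mu_e:
  "hom (j - i) f \<Longrightarrow> Mu i j f \<otimes>\<^bsub>B\<^esub> e v = (if v = i then Mu i j f else \<zero>\<^bsub>B\<^esub>)"
  "hom (j - i) f \<Longrightarrow> e v \<otimes>\<^bsub>B\<^esub> Mu i j f = (if v = j then Mu i j f else \<zero>\<^bsub>B\<^esub>)"
proof -
  have "valid i i" "valid j j" if "valid i j" using that by (auto simp: valid_def)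
  then show "hom (j - i) f \<Longrightarrow> Mu i j f \<otimes>\<^bsub>B\<^esub> e v = (if v = i then Mu i j f else \<zero>\<^bsub>B\<^esub>)"
    "hom (j - i) f \<Longrightarrow> e v \<otimes>\<^bsub>B\<^esub> Mu i j f = (if v = j then Mu i j f else \<zero>\<^bsub>B\<^esub>)"
    by (cases "valid i j"; auto simp: e_def Mu_mult Mu_invalid)+
qed

lemma cls_sum:
  assumes "finite T" "\<And>t. t \<in> T \<Longrightarrow> f t \<in> FM"
  shows "(\<Oplus>\<^bsub>B\<^esub>t\<in>T. cls (f t)) = cls (\<lambda>i j. \<Sum>t\<in>T. f t i j)"
  using assms
proof (induction T rule: finite_induct)
  case empty
  then show ?case by (simp add: cls_zero)
next
  case (insert x T)
  then have "cls (f t) \<in> carrier B" if "t \<in> insert x T" for t using that by (auto simp: B_carrier)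
  then show ?case using insert by (simp add: cls_add Pi_def)
qed

lemma B_expand:
  assumes "f \<in> FM"
  shows "cls f = (\<Oplus>\<^bsub>B\<^esub>p\<in>{1..\<L>} \<times> {1..\<L>}. Mu (fst p) (snd p) (f (fst p) (snd p)))"
proof -
  have h: "hom (j - i) (f i j)" "\<not> valid i j \<Longrightarrow> f i j = 0" for i j using assms by (auto simp: FM_def)
  have "(\<Oplus>\<^bsub>B\<^esub>p\<in>{1..\<L>} \<times> {1..\<L>}. Mu (fst p) (snd p) (f (fst p) (snd p))) =
    cls (\<lambda>i j. \<Sum>p\<in>{1..\<L>} \<times> {1..\<L>}. if i = fst p \<and> j = snd p \<and> valid (fst p) (snd p) then f (fst p) (snd p) else 0)"
    unfolding Mu_def by (rule cls_sum) (auto intro!: Mu_FM h)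
  also have "(\<lambda>i j. \<Sum>p\<in>{1..\<L>} \<times> {1..\<L>}. if i = fst p \<and> j = snd p \<and> valid (fst p) (snd p) then f (fst p) (snd p) else 0) = f"
  proof (intro ext)
    fix i j
    have "(\<Sum>p\<in>{1..\<L>} \<times> {1..\<L>}. if i = fst p \<and> j = snd p \<and> valid (fst p) (snd p) then f (fst p) (snd p) else 0) =
      (\<Sum>p\<in>{1..\<L>} \<times> {1..\<L>}. if p = (i, j) then f i j else 0)"
      using h(2) by (intro sum.cong) auto
    also have "\<dots> = f i j" using h(2)[of i j] by (subst sum.delta) (auto simp: valid_def)
    finally show "(\<Sum>p\<in>{1..\<L>} \<times> {1..\<L>}. if i = fst p \<and> j = snd p \<and> valid (fst p) (snd p) then f (fst p) (snd p) else 0) = f i j" .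
  qed
  finally show ?thesis by simp
qed

lemma B_induct [consumes 1, case_names Mu add]:
  assumes "b \<in> carrier B" and Mu: "\<And>i j f. valid i j \<Longrightarrow> hom (j - i) f \<Longrightarrow> P (Mu i j f)"
    and add: "\<And>a b. a \<in> carrier B \<Longrightarrow> b \<in> carrier B \<Longrightarrow> P a \<Longrightarrow> P b \<Longrightarrow> P (a \<oplus>\<^bsub>B\<^esub> b)"
  shows "P b"
proof -
  obtain f where f: "f \<in> FM" "b = cls f" using assms(1) by (auto simp: B_carrier)
  have h: "hom (j - i) (f i j)" for i j using f(1) by (auto simp: FM_def)
  have v: "valid 1 1" using nm by (auto simp: valid_def \<L>_def)
  have P0: "P \<zero>\<^bsub>B\<^esub>" using Mu[OF v, of 0] by simp
  have PM: "P (Mu i j (f i j))" for i j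
    using Mu[OF _ h, of i j] P0 by (cases "valid i j") (auto simp: Mu_invalid)
  have "P (\<Oplus>\<^bsub>B\<^esub>p\<in>T. Mu (fst p) (snd p) (f (fst p) (snd p)))" if "finite T" for T
    using that
  proof (induction T rule: finite_induct)
    case (insert p T)
    have c: "Mu (fst p) (snd p) (f (fst p) (snd p)) \<in> carrier B" for p by (rule Mu_closed[OF h])
    then show ?case using insert PM by (auto intro!: add B.finsum_closed)
  qed (simp add: P0)
  then show ?thesis using B_expand[OF f(1)] f(2) by simp
qed

end

type_synonym 'k bei = "nat \<Rightarrow> nat \<Rightarrow> (gen free_monoid \<Rightarrow>\<^sub>0 'k) set"
text \<open>The index type that \<open>Ext\<close> prescribes when the ring is the enveloping
  algebra and the module is the Beilinson algebra.\<close>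

type_synonym 'k idx = "(('k, 'k bei) env + 'k bei) list"

context down_up
begin

section \<open>Bimodules over the Beilinson algebra\<close>

text \<open>The two-sided product of \<open>b\<close>, \<open>z\<close> and \<open>c\<close>: a
  right module over the enveloping algebra is a bimodule, and the opposite factor acts from the
  left.\<close>

definition bi :: "(('k, 'k bei) env, 'v) module \<Rightarrow> 'k bei \<Rightarrow> 'v \<Rightarrow> 'k bei \<Rightarrow> 'v" where
  "bi M b z c = E.tens b c \<odot>\<^bsub>M\<^esub> z"

definition scal :: "(('k, 'k bei) env, 'v) module \<Rightarrow> 'k \<Rightarrow> 'v \<Rightarrow> 'v" where
  "scal M c z = bi M (c \<odot>\<^bsub>B\<^esub> \<one>\<^bsub>B\<^esub>) z \<one>\<^bsub>B\<^esub>"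

lemma scal_eq: "scal M c z = (c \<odot>\<^bsub>E.R\<^esub> \<one>\<^bsub>E.R\<^esub>) \<odot>\<^bsub>M\<^esub> z"
  by (simp add: scal_def bi_def E.R_scalar)

lemma bi_closed [simp]:
  assumes "right_module E.R M"
  shows "b \<in> carrier B \<Longrightarrow> c \<in> carrier B \<Longrightarrow> z \<in> carrier M \<Longrightarrow> bi M b z c \<in> carrier M"
  using right_module.act_closed[OF assms] by (simp add: bi_def)

lemma bi_bi:
  assumes "right_module E.R M" "b \<in> carrier B" "c \<in> carrier B" "b' \<in> carrier B" "c' \<in> carrier B" "z \<in> carrier M"
  shows "bi M b (bi M b' z c') c = bi M (b \<otimes>\<^bsub>B\<^esub> b') z (c' \<otimes>\<^bsub>B\<^esub> c)"
  using assms right_module.act_mult[OF assms(1), of "E.tens b' c'" "E.tens b c" z]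
  by (simp add: bi_def E.tens_mult)

lemma bi_add:
  assumes "right_module E.R M" "b \<in> carrier B" "c \<in> carrier B" "y \<in> carrier M" "z \<in> carrier M"
  shows "bi M b (y \<oplus>\<^bsub>M\<^esub> z) c = bi M b y c \<oplus>\<^bsub>M\<^esub> bi M b z c"
  using assms right_module.act_distr_module[OF assms(1)] by (simp add: bi_def)

lemma bi_add_l:
  assumes "right_module E.R M" "b \<in> carrier B" "b' \<in> carrier B" "c \<in> carrier B" "z \<in> carrier M"
  shows "bi M (b \<oplus>\<^bsub>B\<^esub> b') z c = bi M b z c \<oplus>\<^bsub>M\<^esub> bi M b' z c"
  using assms right_module.act_distr_ring[OF assms(1)] E.tens_add_l[of b b' c] by (simp add: bi_def)

lemma bi_add_r:
  assumes "right_module E.R M" "b \<in> carrier B" "c' \<in> carrier B" "c \<in> carrier B" "z \<in> carrier M"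
  shows "bi M b z (c \<oplus>\<^bsub>B\<^esub> c') = bi M b z c \<oplus>\<^bsub>M\<^esub> bi M b z c'"
  using assms right_module.act_distr_ring[OF assms(1)] E.tens_add_r[of b c' c] by (simp add: bi_def)

lemma bi_zero [simp]:
  assumes "right_module E.R M"
  shows "b \<in> carrier B \<Longrightarrow> c \<in> carrier B \<Longrightarrow> bi M b \<zero>\<^bsub>M\<^esub> c = \<zero>\<^bsub>M\<^esub>"
    "c \<in> carrier B \<Longrightarrow> z \<in> carrier M \<Longrightarrow> bi M \<zero>\<^bsub>B\<^esub> z c = \<zero>\<^bsub>M\<^esub>"
    "b \<in> carrier B \<Longrightarrow> z \<in> carrier M \<Longrightarrow> bi M b z \<zero>\<^bsub>B\<^esub> = \<zero>\<^bsub>M\<^esub>"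
  using right_module.act_zero[OF assms] right_module.zero_act[OF assms] E.tens_zero[of b] E.tens_zero[of c]
  by (simp_all add: bi_def)

lemma bi_minus:
  assumes "right_module E.R M" "b \<in> carrier B" "c \<in> carrier B" "z \<in> carrier M"
  shows "bi M b (\<ominus>\<^bsub>M\<^esub> z) c = \<ominus>\<^bsub>M\<^esub> bi M b z c"
  using assms right_module.act_minus[OF assms(1)] by (simp add: bi_def)

lemma bi_diff:
  assumes "right_module E.R M" "b \<in> carrier B" "c \<in> carrier B" "y \<in> carrier M" "z \<in> carrier M"
  shows "bi M b (y \<ominus>\<^bsub>M\<^esub> z) c = bi M b y c \<ominus>\<^bsub>M\<^esub> bi M b z c"
proof -
  interpret M: right_module E.R M by fact
  show ?thesis using assms by (simp add: a_minus_def bi_add bi_minus)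
qed

lemma bi_one:
  assumes "right_module E.R M" "z \<in> carrier M"
  shows "bi M \<one>\<^bsub>B\<^esub> z \<one>\<^bsub>B\<^esub> = z"
  using assms right_module.act_one[OF assms(1), of z] E.tens_one by (simp add: bi_def)

lemma bi_smult:
  assumes "b \<in> carrier B" "c \<in> carrier B"
  shows "bi M b z (k \<odot>\<^bsub>B\<^esub> c) = bi M (k \<odot>\<^bsub>B\<^esub> b) z c"
  using assms E.tens_smult_r[of b c k] by (simp add: bi_def)

lemma scal_bi:
  assumes "right_module E.R M" "b \<in> carrier B" "c \<in> carrier B" "z \<in> carrier M"
  shows "bi M (k \<odot>\<^bsub>B\<^esub> b) z c = scal M k (bi M b z c)" "bi M b (scal M k z) c = scal M k (bi M b z c)"
  using assms by (simp_all add: scal_def bi_bi B.smult_mult_l B.smult_mult_r)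

lemma scal_closed [simp]: "right_module E.R M \<Longrightarrow> z \<in> carrier M \<Longrightarrow> scal M c z \<in> carrier M"
  by (simp add: scal_def)

lemma scal_add: "right_module E.R M \<Longrightarrow> y \<in> carrier M \<Longrightarrow> z \<in> carrier M \<Longrightarrow>
    scal M c (y \<oplus>\<^bsub>M\<^esub> z) = scal M c y \<oplus>\<^bsub>M\<^esub> scal M c z"
  by (simp add: scal_def bi_add)

lemma scal_diff: "right_module E.R M \<Longrightarrow> y \<in> carrier M \<Longrightarrow> z \<in> carrier M \<Longrightarrow>
    scal M c (y \<ominus>\<^bsub>M\<^esub> z) = scal M c y \<ominus>\<^bsub>M\<^esub> scal M c z"
  by (simp add: scal_def bi_diff)

lemma scal_add_l: "right_module E.R M \<Longrightarrow> z \<in> carrier M \<Longrightarrow> scal M (c + d) z = scal M c z \<oplus>\<^bsub>M\<^esub> scal M d z"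
  by (simp add: scal_def bi_add_l B.smult_add_l)

lemma scal_mult: "right_module E.R M \<Longrightarrow> z \<in> carrier M \<Longrightarrow> scal M (c * d) z = scal M c (scal M d z)"
  by (simp add: scal_def bi_bi B.smult_mult_l B.smult_assoc)

lemma scal_one: "right_module E.R M \<Longrightarrow> z \<in> carrier M \<Longrightarrow> scal M 1 z = z"
  by (simp add: scal_def B.smult_one bi_one)

lemma scal_zero [simp]: "right_module E.R M \<Longrightarrow> scal M c \<zero>\<^bsub>M\<^esub> = \<zero>\<^bsub>M\<^esub>"
  "right_module E.R M \<Longrightarrow> z \<in> carrier M \<Longrightarrow> scal M 0 z = \<zero>\<^bsub>M\<^esub>"
  by (simp_all add: scal_def)

lemma hom_bi:
  assumes "f \<in> LinearCombinations.module_hom E.R M N" "b \<in> carrier B" "c \<in> carrier B" "z \<in> carrier M"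
  shows "f (bi M b z c) = bi N b (f z) c"
  using assms by (simp add: bi_def LinearCombinations.module_hom_def)

section \<open>The projective bimodules of the resolution\<close>

definition len :: "nat \<Rightarrow> nat \<Rightarrow> nat" where
  "len k t = (if k = 0 then 0 else if k = 1 then (if even t then n else m)
     else if even t then 2 * n + m else n + 2 * m)"

text \<open>In degree \<open>0\<close> the index \<open>2 * v\<close> stands for the vertex \<open>v\<close>; in degrees \<open>1\<close> and \<open>2\<close> the
  indices \<open>2 * i\<close> and \<open>2 * i + 1\<close> stand for the two arrows resp. relations starting at \<open>i\<close>.\<close>

definition T :: "nat \<Rightarrow> nat set" where
  "T k = {t. k \<le> 2 \<and> (k = 0 \<longrightarrow> even t) \<and> valid (t div 2) (t div 2 + len k t)}"

definition sr :: "nat \<Rightarrow> nat" where "sr t = t div 2"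
definition tg :: "nat \<Rightarrow> nat \<Rightarrow> nat" where "tg k t = t div 2 + len k t"

text \<open>The generators only need distinct names in the prescribed index type; lists of different
  lengths provide them, and \<open>length\<close> recovers the number.\<close>

definition ix :: "nat \<Rightarrow> 'k idx" where "ix t = replicate t (Inl {})"

text \<open>The idempotent whose right ideal is the bimodule generated freely by an element from
  \<open>sr\<close> to \<open>tg\<close>: because of the opposite product the left factor consists
  of paths leaving the target, the right one of paths arriving at the source.\<close>

definition eps :: "nat \<Rightarrow> 'k idx \<Rightarrow> ('k, 'k bei) env" where
  "eps k l = E.tens (e (tg k (length l))) (e (sr (length l)))"

lemma length_ix [simp]: "length (ix t) = t"
  by (simp add: ix_def)

lemma ix_eq_iff [simp]: "ix s = ix t \<longleftrightarrow> s = t"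
  by (metis length_ix)

sublocale P: idempotents E.R "ix ` T k" "eps k" for k
  by unfold_locales (auto simp: eps_def E.tens_mult e_mult)

abbreviation "Pr k \<equiv> idem_module E.R (ix ` T k) (eps k)"

lemma PM: "right_module E.R (Pr k)"
  by (rule P.P.right_module_axioms)

declare idem_module_simps [simp del] One_nat_def [simp del]

text \<open>The value zero outside \<open>T k\<close> lets Fox derivatives be written without range
  conditions, just as \<open>Mu\<close> vanishes out of range.\<close>

definition u :: "nat \<Rightarrow> nat \<Rightarrow> 'k idx \<Rightarrow> ('k, 'k bei) env" where
  "u k t = (if t \<in> T k then idem_unit E.R (eps k) (ix t) else \<zero>\<^bsub>Pr k\<^esub>)"

lemma u_closed [simp]: "u k t \<in> carrier (Pr k)"
  by (simp add: u_def)

lemma bi_apply: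
  "z \<in> carrier (Pr k) \<Longrightarrow> bi (Pr k) b z c l = z l \<otimes>\<^bsub>E.R\<^esub> E.tens b c"
  by (simp add: bi_def idem_module_simps)

lemma u_e: "bi (Pr k) (e (tg k t)) (u k t) (e (sr t)) = u k t"
proof (cases "t \<in> T k")
  case True
  have "bi (Pr k) (e (tg k t)) (u k t) (e (sr t)) l = u k t l" for l
    using True by (subst bi_apply[OF u_closed]) (auto simp: u_def idem_unit_def eps_def E.tens_mult e_mult)
  then show ?thesis by (simp add: fun_eq_iff)
next
  case False
  then show ?thesis using bi_zero(1)[OF PM] by (simp add: u_def)
qed

text \<open>Expanding both factors into matrix units leaves only paths that meet the generator at
  its ends, since \<open>u_e\<close> inserts the two idempotents and these kill all other
  paths.\<close>

lemma P_induct [consumes 1, case_names zero gen add]: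
  assumes "z \<in> carrier (Pr k)" and "Q \<zero>\<^bsub>Pr k\<^esub>"
    and gen: "\<And>t j f i g. t \<in> T k \<Longrightarrow> valid (tg k t) j \<Longrightarrow> hom (j - tg k t) f \<Longrightarrow> valid i (sr t) \<Longrightarrow> hom (sr t - i) g \<Longrightarrow>
       Q (bi (Pr k) (Mu (tg k t) j f) (u k t) (Mu i (sr t) g))"
    and add: "\<And>y z. y \<in> carrier (Pr k) \<Longrightarrow> z \<in> carrier (Pr k) \<Longrightarrow> Q y \<Longrightarrow> Q z \<Longrightarrow> Q (y \<oplus>\<^bsub>Pr k\<^esub> z)"
  shows "Q z"
proof -
  note [simp] = bi_closed[OF PM] bi_zero[OF PM]
  have 1: "Q (bi (Pr k) b (u k t) c)" if t: "t \<in> T k" and b: "b \<in> carrier B" and c: "c \<in> carrier B" for t b c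
    using b
  proof (induction b rule: B_induct)
    case (Mu i' j f)
    show ?case
      using c
    proof (induction c rule: B_induct)
      case (Mu i j' g)
      have "bi (Pr k) (Mu i' j f) (u k t) (Mu i j' g) =
        bi (Pr k) (Mu i' j f) (bi (Pr k) (e (tg k t)) (u k t) (e (sr t))) (Mu i j' g)"
        by (simp add: u_e)
      also have "\<dots> = bi (Pr k) (Mu i' j f \<otimes>\<^bsub>B\<^esub> e (tg k t)) (u k t) (e (sr t) \<otimes>\<^bsub>B\<^esub> Mu i j' g)"
        using Mu \<open>local.hom (j - i') f\<close> by (intro bi_bi[OF PM]) auto
      finally have *: "bi (Pr k) (Mu i' j f) (u k t) (Mu i j' g) =
        bi (Pr k) (Mu i' j f \<otimes>\<^bsub>B\<^esub> e (tg k t)) (u k t) (e (sr t) \<otimes>\<^bsub>B\<^esub> Mu i j' g)" .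
      show ?case
      proof (cases "i' = tg k t \<and> j' = sr t")
        case True
        then show ?thesis using gen[OF t] Mu \<open>local.hom (j - i') f\<close> \<open>valid i' j\<close> by simp
      next
        case False
        then have "bi (Pr k) (Mu i' j f) (u k t) (Mu i j' g) = \<zero>\<^bsub>Pr k\<^esub>"
          unfolding * using Mu \<open>local.hom (j - i') f\<close> by (auto simp: Mu_e)
        then show ?thesis using assms(2) by simp
      qed
    next
      case (add a b)
      then show ?case using assms(4) \<open>local.hom (j - i') f\<close> by (simp add: bi_add_r[OF PM])
    qed
  next
    case (add a b)
    then show ?case using assms(4) c by (simp add: bi_add_l[OF PM])
  qed
  have 2: "Q (r \<odot>\<^bsub>Pr k\<^esub> u k t)" if "t \<in> T k" "r \<in> carrier E.R" for t r
    using that(2)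
  proof (induction r rule: E.tens_induct)
    case (tens a b)
    then show ?case using 1[OF that(1)] by (simp add: bi_def)
  next
    case (add r s)
    then show ?case using assms(4) by (simp add: P.P.act_distr_ring P.P.act_closed)
  qed
  have 3: "Q (\<Oplus>\<^bsub>Pr k\<^esub>l\<in>L. z l \<odot>\<^bsub>Pr k\<^esub> idem_unit E.R (eps k) l)" if "finite L" "L \<subseteq> ix ` T k" for L
    using that
  proof (induction L rule: finite_induct)
    case (insert l L)
    then obtain t where t: "t \<in> T k" "l = ix t" by auto
    have Qt: "Q (z l \<odot>\<^bsub>Pr k\<^esub> idem_unit E.R (eps k) l)"
      using 2[OF t(1), of "z l"] assms(1) t by (simp add: u_def)
    have c: "z l \<odot>\<^bsub>Pr k\<^esub> idem_unit E.R (eps k) l \<in> carrier (Pr k)" if "l \<in> ix ` T k" for l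
      using that assms(1) by (intro P.P.act_closed) auto
    show ?case
      using insert Qt c by (subst P.P.M.finsum_insert) (auto intro!: add P.P.M.finsum_closed)
  qed (use assms(2) in simp)
  show ?thesis
    by (subst P.idem_expansion[OF assms(1)]) (rule 3[OF P.idem_support[OF assms(1)]], auto)
qed

definition vx :: "nat \<Rightarrow> 'k idx \<Rightarrow> ('k, 'k bei) env" where "vx v = u 0 (2 * v)"
definition ax :: "gen \<Rightarrow> nat \<Rightarrow> nat" where "ax a i = (case a of X \<Rightarrow> 2 * i | Y \<Rightarrow> 2 * i + 1)"
definition ua :: "gen \<Rightarrow> nat \<Rightarrow> 'k idx \<Rightarrow> ('k, 'k bei) env" where "ua a i = u 1 (ax a i)"
definition rx :: "bool \<Rightarrow> nat \<Rightarrow> nat" where "rx b i = (if b then 2 * i else 2 * i + 1)"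
definition rw :: "bool \<Rightarrow> nat" where "rw b = (if b then 2 * n + m else n + 2 * m)"

lemma index_simps [simp]:
  "sr (2 * v) = v" "tg 0 (2 * v) = v" "sr (ax a i) = i" "tg 1 (ax a i) = i + wl a"
  "tg (Suc 0) (ax a i) = i + wl a" "sr (rx b i) = i" "tg 2 (rx b i) = i + rw b" "tg (Suc (Suc 0)) (rx b i) = i + rw b"
  by (auto simp: sr_def tg_def len_def ax_def rx_def rw_def split: gen.splits)

lemma T_iff:
  "2 * v \<in> T 0 \<longleftrightarrow> valid v v" "ax a i \<in> T 1 \<longleftrightarrow> valid i (i + wl a)"
  "ax a i \<in> T (Suc 0) \<longleftrightarrow> valid i (i + wl a)" "rx b i \<in> T 2 \<longleftrightarrow> valid i (i + rw b)"
  "rx b i \<in> T (Suc (Suc 0)) \<longleftrightarrow> valid i (i + rw b)"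
  by (auto simp: T_def len_def ax_def rx_def rw_def split: gen.splits)

lemma T_0E: assumes "t \<in> T 0" obtains v where "t = 2 * v" "valid v v"
  using assms by (auto simp: T_def len_def elim!: evenE)

lemma T_1E: assumes "t \<in> T 1" obtains a i where "t = ax a i" "valid i (i + wl a)"
proof (cases "even t")
  case True
  then have "t = ax X (t div 2)" by (simp add: ax_def)
  then show ?thesis using that[of X "t div 2"] assms T_iff(2)[of X "t div 2"] by simp
next
  case False
  then have "t = ax Y (t div 2)" using False odd_pos[of t] by (simp add: ax_def)
  then show ?thesis using that[of Y "t div 2"] assms T_iff(2)[of Y "t div 2"] by simp
qed

lemma T_2E: assumes "t \<in> T 2" obtains b i where "t = rx b i" "valid i (i + rw b)"
proof (cases "even t")
  case True
  then have "t = rx True (t div 2)" by (simp add: rx_def)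
  then show ?thesis using that[of True "t div 2"] assms T_iff(4)[of True "t div 2"] by simp
next
  case False
  then have "t = rx False (t div 2)" using False odd_pos[of t] by (simp add: rx_def)
  then show ?thesis using that[of False "t div 2"] assms T_iff(4)[of False "t div 2"] by simp
qed

lemma T_empty: "k > 2 \<Longrightarrow> T k = {}"
  by (auto simp: T_def)

lemma vx_e: "bi (Pr 0) (e v) (vx v) (e v) = vx v"
  using u_e[of 0 "2 * v"] by (simp add: vx_def)

lemma ua_e: "bi (Pr 1) (e (i + wl a)) (ua a i) (e i) = ua a i"
  using u_e[of 1 "ax a i"] by (simp add: ua_def)

lemma vx_closed [simp]: "vx v \<in> carrier (Pr 0)" and ua_closed [simp]: "ua a i \<in> carrier (Pr 1)"
  by (simp_all add: vx_def ua_def)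

text \<open>The path spelling \<open>w\<close> from \<open>i\<close>. As the product is reversed,
  the last letter of \<open>w\<close> is traversed first.\<close>

definition Mw where "Mw i w = Mu i (i + wt w) (wd w 1)"

lemma Mw_closed [simp]: "Mw i w \<in> carrier B"
  by (simp add: Mw_def hom_wd)

lemma Mw_mult: "Mw (i + wt w) v \<otimes>\<^bsub>B\<^esub> Mw i w = Mw i (v @ w)"
  by (auto simp: Mw_def Mu_mult Mu_invalid valid_def add_ac)

lemma Mw_e: "Mw i w \<otimes>\<^bsub>B\<^esub> e i = Mw i w" "e (i + wt w) \<otimes>\<^bsub>B\<^esub> Mw i w = Mw i w"
  by (simp_all add: Mw_def Mu_e hom_wd)

lemma Mw_Nil: "Mw i [] = e i"
  by (simp add: Mw_def e_def wd_one)

section \<open>Fox derivatives and the differentials\<close>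

text \<open>The universal derivation on words, with values in the bimodule of arrows. The letter
  \<open>a\<close> becomes the generator of the arrow at the vertex reached after
  \<open>w\<close>.\<close>

fun Fox :: "nat \<Rightarrow> gen list \<Rightarrow> 'k idx \<Rightarrow> ('k, 'k bei) env" where
  "Fox i [] = \<zero>\<^bsub>Pr 1\<^esub>"
| "Fox i (a # w) = bi (Pr 1) \<one>\<^bsub>B\<^esub> (ua a (i + wt w)) (Mw i w) \<oplus>\<^bsub>Pr 1\<^esub> bi (Pr 1) (Mw (i + wt w) [a]) (Fox i w) \<one>\<^bsub>B\<^esub>"

lemma Fox_closed [simp]: "Fox i w \<in> carrier (Pr 1)"
  by (induction w) (auto simp: bi_closed[OF PM])

lemma Fox_e: "bi (Pr 1) (e (i + wt w)) (Fox i w) (e i) = Fox i w"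
proof (induction w)
  case (Cons a w)
  have "bi (Pr 1) (e (i + wt (a # w))) (bi (Pr 1) \<one>\<^bsub>B\<^esub> (ua a (i + wt w)) (Mw i w)) (e i) =
    bi (Pr 1) \<one>\<^bsub>B\<^esub> (ua a (i + wt w)) (Mw i w)"
  proof -
    have "bi (Pr 1) (e (i + wt (a # w))) (bi (Pr 1) \<one>\<^bsub>B\<^esub> (ua a (i + wt w)) (Mw i w)) (e i) =
      bi (Pr 1) (e (i + wt w + wl a)) (ua a (i + wt w)) (Mw i w)"
      by (simp add: bi_bi[OF PM] Mw_e add_ac)
    also have "\<dots> = bi (Pr 1) \<one>\<^bsub>B\<^esub> (bi (Pr 1) (e (i + wt w + wl a)) (ua a (i + wt w)) (e (i + wt w))) (Mw i w)"
      by (simp add: bi_bi[OF PM] Mw_e)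
    finally show ?thesis by (simp add: ua_e)
  qed
  moreover have "bi (Pr 1) (e (i + wt (a # w))) (bi (Pr 1) (Mw (i + wt w) [a]) (Fox i w) \<one>\<^bsub>B\<^esub>) (e i) =
    bi (Pr 1) (Mw (i + wt w) [a]) (Fox i w) \<one>\<^bsub>B\<^esub>"
  proof -
    have "bi (Pr 1) (e (i + wt (a # w))) (bi (Pr 1) (Mw (i + wt w) [a]) (Fox i w) \<one>\<^bsub>B\<^esub>) (e i) =
      bi (Pr 1) (Mw (i + wt w) [a]) (Fox i w) (e i)"
      using Mw_e(2)[of "i + wt w" "[a]"] by (simp add: bi_bi[OF PM] add_ac)
    also have "\<dots> = bi (Pr 1) (Mw (i + wt w) [a]) (bi (Pr 1) (e (i + wt w)) (Fox i w) (e i)) \<one>\<^bsub>B\<^esub>"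
      by (simp add: bi_bi[OF PM] Mw_e)
    finally show ?thesis by (simp add: Cons)
  qed
  ultimately show ?case by (simp add: bi_add[OF PM] bi_closed[OF PM] del: wt_simps)
qed (simp add: bi_zero[OF PM])

text \<open>The Leibniz rule; the derivative of \<open>v\<close> is taken from the vertex where
  \<open>w\<close> ends.\<close>

lemma Fox_append:
  "Fox i (v @ w) = bi (Pr 1) \<one>\<^bsub>B\<^esub> (Fox (i + wt w) v) (Mw i w) \<oplus>\<^bsub>Pr 1\<^esub> bi (Pr 1) (Mw (i + wt w) v) (Fox i w) \<one>\<^bsub>B\<^esub>"
proof (induction v)
  case Nil
  have "bi (Pr 1) (e (i + wt w)) (Fox i w) \<one>\<^bsub>B\<^esub> = bi (Pr 1) (e (i + wt w)) (bi (Pr 1) (e (i + wt w)) (Fox i w) (e i)) \<one>\<^bsub>B\<^esub>"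
    by (simp add: Fox_e)
  also have "\<dots> = bi (Pr 1) (e (i + wt w) \<otimes>\<^bsub>B\<^esub> e (i + wt w)) (Fox i w) (e i \<otimes>\<^bsub>B\<^esub> \<one>\<^bsub>B\<^esub>)"
    by (rule bi_bi[OF PM]) auto
  also have "\<dots> = Fox i w" by (simp add: e_mult Fox_e)
  finally show ?case by (simp add: Mw_Nil bi_zero[OF PM])
next
  case (Cons a v)
  have "Fox i ((a # v) @ w) = bi (Pr 1) \<one>\<^bsub>B\<^esub> (ua a (i + (wt v + wt w))) (Mw i (v @ w)) \<oplus>\<^bsub>Pr 1\<^esub>
     bi (Pr 1) (Mw (i + (wt v + wt w)) [a]) (bi (Pr 1) \<one>\<^bsub>B\<^esub> (Fox (i + wt w) v) (Mw i w) \<oplus>\<^bsub>Pr 1\<^esub> bi (Pr 1) (Mw (i + wt w) v) (Fox i w) \<one>\<^bsub>B\<^esub>) \<one>\<^bsub>B\<^esub>"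
    using Cons by simp
  also have "\<dots> = bi (Pr 1) \<one>\<^bsub>B\<^esub> (ua a (i + wt w + wt v)) (Mw (i + wt w) v \<otimes>\<^bsub>B\<^esub> Mw i w) \<oplus>\<^bsub>Pr 1\<^esub>
     (bi (Pr 1) (Mw (i + wt w + wt v) [a]) (Fox (i + wt w) v) (Mw i w) \<oplus>\<^bsub>Pr 1\<^esub>
      bi (Pr 1) (Mw (i + wt w + wt v) [a] \<otimes>\<^bsub>B\<^esub> Mw (i + wt w) v) (Fox i w) \<one>\<^bsub>B\<^esub>)"
    by (simp add: bi_add[OF PM] bi_bi[OF PM] bi_closed[OF PM] Mw_mult add_ac)
  also have "\<dots> = bi (Pr 1) \<one>\<^bsub>B\<^esub> (Fox (i + wt w) (a # v)) (Mw i w) \<oplus>\<^bsub>Pr 1\<^esub> bi (Pr 1) (Mw (i + wt w) (a # v)) (Fox i w) \<one>\<^bsub>B\<^esub>"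
    by (simp add: bi_add[OF PM] bi_bi[OF PM] bi_closed[OF PM] Mw_mult P.P.M.a_assoc)
  finally show ?case .
qed

definition Dx :: "nat \<Rightarrow> (gen free_monoid \<Rightarrow>\<^sub>0 'k) \<Rightarrow> 'k idx \<Rightarrow> ('k, 'k bei) env" where
  "Dx i = lin_ext (Pr 1) (\<lambda>w c. scal (Pr 1) c (Fox i (letters w)))"

sublocale Dx: linear_extension "Pr 1" UNIV "\<lambda>w c. scal (Pr 1) c (Fox i (letters w))" for i
  by unfold_locales (auto simp: scal_closed[OF PM] scal_add_l[OF PM])

lemma Dx_closed [simp]: "Dx i f \<in> carrier (Pr 1)"
  unfolding Dx_def by (rule Dx.lin_ext_closed) auto

lemma Dx_add: "Dx i (f + g) = Dx i f \<oplus>\<^bsub>Pr 1\<^esub> Dx i g"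
  unfolding Dx_def by (rule Dx.lin_ext_add) auto

lemma Dx_diff: "Dx i (f - g) = Dx i f \<ominus>\<^bsub>Pr 1\<^esub> Dx i g"
  unfolding Dx_def by (rule Dx.lin_ext_diff) auto

lemma Dx_zero [simp]: "Dx i 0 = \<zero>\<^bsub>Pr 1\<^esub>"
  unfolding Dx_def by (rule Dx.lin_ext_zero)

lemma Dx_wd: "Dx i (wd w c) = scal (Pr 1) c (Fox i w)"
  unfolding Dx_def by (subst Dx.lin_ext_single) auto

lemma Dx_smult: "Dx i (Poly_Mapping.map ((*) c) f) = scal (Pr 1) c (Dx i f)"
  by (induction f rule: free_induct)
    (auto simp: Dx_wd Dx_add smult_add scal_add[OF PM] scal_mult[OF PM])

text \<open>The Leibniz rule again. Homogeneity determines the vertex at which the two factors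
  meet.\<close>

lemma Dx_mult:
  assumes "hom d f" "hom h g"
  shows "Dx i (f * g) = bi (Pr 1) \<one>\<^bsub>B\<^esub> (Dx (i + h) f) (Mu i (i + h) g) \<oplus>\<^bsub>Pr 1\<^esub>
    bi (Pr 1) (Mu (i + h) (i + h + d) f) (Dx i g) \<one>\<^bsub>B\<^esub>"
proof -
  note [simp] = bi_closed[OF PM] bi_zero[OF PM] bi_add[OF PM] scal_closed[OF PM]
  have wdc: "wd w c = Poly_Mapping.map ((*) c) (wd w 1)" for w and c :: 'k by simp
  have ac: "a \<oplus>\<^bsub>Pr 1\<^esub> b \<oplus>\<^bsub>Pr 1\<^esub> (c \<oplus>\<^bsub>Pr 1\<^esub> d) = a \<oplus>\<^bsub>Pr 1\<^esub> c \<oplus>\<^bsub>Pr 1\<^esub> (b \<oplus>\<^bsub>Pr 1\<^esub> d)"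
    if "a \<in> carrier (Pr 1)" "b \<in> carrier (Pr 1)" "c \<in> carrier (Pr 1)" "d \<in> carrier (Pr 1)" for a b c d
    using that by (simp add: P.P.M.a_ac)
  have word: "Dx i (wd v c * wd w k) = bi (Pr 1) \<one>\<^bsub>B\<^esub> (Dx (i + wt w) (wd v c)) (Mu i (i + wt w) (wd w k)) \<oplus>\<^bsub>Pr 1\<^esub>
    bi (Pr 1) (Mu (i + wt w) (i + wt w + wt v) (wd v c)) (Dx i (wd w k)) \<one>\<^bsub>B\<^esub>" for v c w k
  proof -
    have M: "Mu j (j + wt v) (wd v c) = c \<odot>\<^bsub>B\<^esub> Mw j v" for j v c
      by (subst wdc) (simp only: Mu_smult Mw_def)
    show ?thesis
      unfolding M wd_mult Dx_wd Fox_append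
      by (simp add: scal_bi[OF PM] bi_smult scal_add[OF PM] scal_mult[OF PM]
          scal_mult[OF PM, of _ _ k c, symmetric] mult.commute[of k c])
  qed
  show ?thesis
    using assms(1)
  proof (induction f rule: hom_induct)
    case (word v c)
    note v = word
    show ?case
      using assms(2)
    proof (induction g rule: hom_induct)
      case (word w k)
      then show ?case using v \<open>\<And>v c w k. Dx i (wd v c * wd w k) = _ v c w k\<close> by blast
    next
      case (add f g)
      then show ?case using v
        by (simp add: distrib_left Dx_add Mu_add bi_add_r[OF PM] ac hom_wd)
    qed (simp add: hom_wd v)
  next
    case (add f f')
    then show ?case using assms(2)
      by (simp add: distrib_right Dx_add Mu_add bi_add_l[OF PM] ac)
  qed (simp add: assms)
qed

end

lemma (in abelian_group) telescope:
  "a \<in> carrier G \<Longrightarrow> c \<in> carrier G \<Longrightarrow> d \<in> carrier G \<Longrightarrow> (a \<ominus> c) \<oplus> (d \<ominus> a) = d \<ominus> c"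
proof -
  assume *: "a \<in> carrier G" "c \<in> carrier G" "d \<in> carrier G"
  have "(a \<ominus> c) \<oplus> (d \<ominus> a) = (a \<oplus> \<ominus> a) \<oplus> (d \<oplus> \<ominus> c)"
    using * by (simp add: a_minus_def a_ac)
  then show ?thesis using * by (simp add: r_neg a_minus_def)
qed

lemma (in abelian_group) diff_add_diff:
  "a \<in> carrier G \<Longrightarrow> b \<in> carrier G \<Longrightarrow> c \<in> carrier G \<Longrightarrow> d \<in> carrier G \<Longrightarrow>
    (a \<oplus> b) \<ominus> (c \<oplus> d) = (a \<ominus> c) \<oplus> (b \<ominus> d)"
  by (simp add: a_minus_def minus_add a_ac)

lemma (in abelian_group) add_diff_cancel:
  "x \<in> carrier G \<Longrightarrow> s \<in> carrier G \<Longrightarrow> s \<oplus> (x \<ominus> s) = x"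
  unfolding a_minus_def by (subst a_lcomm) (simp_all add: r_neg)

context down_up
begin

section \<open>The differentials, the augmentation and the vanishing of their composites\<close>

lemma minus_zero_Pr [simp]: "\<ominus>\<^bsub>Pr k\<^esub> \<zero>\<^bsub>Pr k\<^esub> = \<zero>\<^bsub>Pr k\<^esub>"
  by (rule P.P.M.minus_equality) auto

lemma lt_simps [simp]: "even (rx b i) = b" "(if even (ax a i) then X else Y) = a"
  by (auto simp: rx_def ax_def split: gen.splits)

text \<open>The image in degree \<open>k\<close> of a generator of degree \<open>k + 1\<close>. An
  arrow goes to arrow times source minus target times arrow, a relation to its Fox
  derivative.\<close>

definition gg :: "nat \<Rightarrow> nat \<Rightarrow> 'k idx \<Rightarrow> ('k, 'k bei) env" where
  "gg k t = (if k = 0 then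
      (let a = (if even t then X else Y); i = sr t in
        bi (Pr 0) (Mw i [a]) (vx i) \<one>\<^bsub>B\<^esub> \<ominus>\<^bsub>Pr 0\<^esub> bi (Pr 0) \<one>\<^bsub>B\<^esub> (vx (i + wl a)) (Mw i [a]))
    else if k = 1 then Dx (sr t) (rel (even t)) else \<zero>\<^bsub>Pr k\<^esub>)"

definition \<delta> where "\<delta> k = idem_ext E.R (Pr k) (ix ` T (Suc k)) (\<lambda>l. gg k (length l))"

definition aug where "aug = idem_ext E.R E.M (ix ` T 0) (\<lambda>l. e (sr (length l)))"

lemma gg_closed [simp]: "gg k t \<in> carrier (Pr k)"
  by (auto simp: gg_def Let_def bi_closed[OF PM])

lemma \<delta>_hom: "\<delta> k \<in> LinearCombinations.module_hom E.R (Pr (Suc k)) (Pr k)"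
  unfolding \<delta>_def by (rule P.ext_hom[OF PM]) simp

sublocale \<delta>: right_module_hom E.R "Pr (Suc k)" "Pr k" "\<delta> k" for k
  by unfold_locales (rule \<delta>_hom)

lemma aug_hom: "aug \<in> LinearCombinations.module_hom E.R (Pr 0) E.M"
  unfolding aug_def by (rule P.ext_hom[OF E.M.right_module_axioms]) simp

sublocale aug: right_module_hom E.R "Pr 0" E.M aug
  by unfold_locales (rule aug_hom)

lemma hom_rel: "hom (rw b) (rel b)"
  unfolding rel_def rw_def by (auto simp: diff_conv_add_uminus simp del: add_uminus_conv_diff intro!: hom_add hom_uminus hom_wd)

lemma Dx_e: "hom h f \<Longrightarrow> bi (Pr 1) (e (i + h)) (Dx i f) (e i) = Dx i f"
  by (induction f rule: hom_induct)
    (auto simp: bi_zero[OF PM] Dx_wd scal_bi[OF PM] Fox_e Dx_add bi_add[OF PM])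

lemma Dx_invalid: "hom h f \<Longrightarrow> \<not> valid i (i + h) \<Longrightarrow> Dx i f = \<zero>\<^bsub>Pr 1\<^esub>"
proof -
  assume h: "hom h f" and "\<not> valid i (i + h)"
  then have "\<not> valid i i \<or> \<not> valid (i + h) (i + h)" by (auto simp: valid_def)
  then have "e i = \<zero>\<^bsub>B\<^esub> \<or> e (i + h) = \<zero>\<^bsub>B\<^esub>" by (auto simp: e_def Mu_invalid)
  then show ?thesis using Dx_e[OF h, of i] bi_zero[OF PM[of 1]] by auto
qed

lemma \<delta>_bi: "b \<in> carrier B \<Longrightarrow> c \<in> carrier B \<Longrightarrow> z \<in> carrier (Pr (Suc k)) \<Longrightarrow>
    \<delta> k (bi (Pr (Suc k)) b z c) = bi (Pr k) b (\<delta> k z) c"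
  by (rule hom_bi[OF \<delta>_hom])

lemma \<delta>_u: "t \<in> T (Suc k) \<Longrightarrow> \<delta> k (u (Suc k) t) = bi (Pr k) (e (tg (Suc k) t)) (gg k t) (e (sr t))"
  unfolding \<delta>_def u_def
  by (simp, subst P.ext_unit[OF PM]) (auto simp: bi_def eps_def)

lemma Suc_simps: "Suc 0 = 1" "Suc 1 = 2" by auto

lemma \<delta>0_ua: "\<delta> 0 (ua a i) = bi (Pr 0) (Mw i [a]) (vx i) \<one>\<^bsub>B\<^esub> \<ominus>\<^bsub>Pr 0\<^esub> bi (Pr 0) \<one>\<^bsub>B\<^esub> (vx (i + wl a)) (Mw i [a])"
proof (cases "valid i (i + wl a)")
  case True
  then have t: "ax a i \<in> T (Suc 0)" by (simp add: T_iff)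
  have 1: "e (i + wl a) \<otimes>\<^bsub>B\<^esub> Mw i [a] = Mw i [a]" using Mw_e(2)[of i "[a]"] by simp
  have 2: "bi (Pr 0) (Mw i [a]) (vx i) (e i) = bi (Pr 0) (Mw i [a]) (vx i) \<one>\<^bsub>B\<^esub>"
  proof -
    have "bi (Pr 0) (Mw i [a]) (bi (Pr 0) (e i) (vx i) (e i)) (e i) = bi (Pr 0) (Mw i [a]) (bi (Pr 0) (e i) (vx i) (e i)) \<one>\<^bsub>B\<^esub>"
      by (simp add: bi_bi[OF PM] e_mult del: vx_closed) (simp add: bi_bi[OF PM] e_mult)?
    then show ?thesis by (simp add: vx_e)
  qed
  have 3: "bi (Pr 0) (e (i + wl a)) (vx (i + wl a)) (Mw i [a]) = bi (Pr 0) \<one>\<^bsub>B\<^esub> (vx (i + wl a)) (Mw i [a])"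
  proof -
    have "bi (Pr 0) (e (i + wl a)) (bi (Pr 0) (e (i + wl a)) (vx (i + wl a)) (e (i + wl a))) (Mw i [a]) =
      bi (Pr 0) \<one>\<^bsub>B\<^esub> (bi (Pr 0) (e (i + wl a)) (vx (i + wl a)) (e (i + wl a))) (Mw i [a])"
      by (subst (1 2) bi_bi[OF PM]) (simp_all add: e_mult)
    then show ?thesis by (simp add: vx_e)
  qed
  have "\<delta> 0 (ua a i) = bi (Pr 0) (e (i + wl a)) (gg 0 (ax a i)) (e i)"
    using \<delta>_u[OF t] by (simp add: ua_def Suc_simps)
  also have "\<dots> = bi (Pr 0) (Mw i [a]) (vx i) (e i) \<ominus>\<^bsub>Pr 0\<^esub> bi (Pr 0) (e (i + wl a)) (vx (i + wl a)) (Mw i [a])"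
    by (simp add: gg_def Let_def bi_diff[OF PM] bi_closed[OF PM] bi_bi[OF PM] 1 Mw_e)
  finally show ?thesis by (simp add: 2 3)
next
  case False
  then have "Mw i [a] = \<zero>\<^bsub>B\<^esub>" "ua a i = \<zero>\<^bsub>Pr 1\<^esub>"
    by (auto simp: Mw_def Mu_invalid ua_def u_def T_iff)
  then show ?thesis using \<delta>.hom_zero[of 0] by (simp add: bi_zero[OF PM] a_minus_def Suc_simps)
qed

text \<open>The fundamental identity of Fox calculus: in the Leibniz expansion the two terms at the
  intermediate vertex cancel.\<close>

lemma \<delta>0_Fox: "\<delta> 0 (Fox i w) = bi (Pr 0) (Mw i w) (vx i) \<one>\<^bsub>B\<^esub> \<ominus>\<^bsub>Pr 0\<^esub> bi (Pr 0) \<one>\<^bsub>B\<^esub> (vx (i + wt w)) (Mw i w)"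
proof (induction w)
  case Nil
  have "bi (Pr 0) (e i) (bi (Pr 0) (e i) (vx i) (e i)) \<one>\<^bsub>B\<^esub> = bi (Pr 0) \<one>\<^bsub>B\<^esub> (bi (Pr 0) (e i) (vx i) (e i)) (e i)"
    by (subst (1 2) bi_bi[OF PM]) (simp_all add: e_mult)
  then have "bi (Pr 0) (e i) (vx i) \<one>\<^bsub>B\<^esub> = bi (Pr 0) \<one>\<^bsub>B\<^esub> (vx i) (e i)"
    by (simp add: vx_e)
  then show ?case using \<delta>.hom_zero[of 0] by (simp add: Mw_Nil a_minus_def P.P.M.r_neg bi_closed[OF PM] Suc_simps)
next
  case (Cons a w)
  have h: "\<delta> 0 (bi (Pr 1) b z c) = bi (Pr 0) b (\<delta> 0 z) c" if "b \<in> carrier B" "c \<in> carrier B" "z \<in> carrier (Pr 1)" for b z c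
    using \<delta>_bi[of b c z 0] that by (simp add: Suc_simps)
  have "\<delta> 0 (Fox i (a # w)) = bi (Pr 0) \<one>\<^bsub>B\<^esub> (\<delta> 0 (ua a (i + wt w))) (Mw i w) \<oplus>\<^bsub>Pr 0\<^esub>
      bi (Pr 0) (Mw (i + wt w) [a]) (\<delta> 0 (Fox i w)) \<one>\<^bsub>B\<^esub>"
    using \<delta>.hom_add[of _ 0] by (simp add: Suc_simps bi_closed[OF PM] h)
  also have "\<dots> = (bi (Pr 0) (Mw (i + wt w) [a]) (vx (i + wt w)) (Mw i w) \<ominus>\<^bsub>Pr 0\<^esub>
        bi (Pr 0) \<one>\<^bsub>B\<^esub> (vx (i + wt w + wl a)) (Mw (i + wt w) [a] \<otimes>\<^bsub>B\<^esub> Mw i w)) \<oplus>\<^bsub>Pr 0\<^esub>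
      (bi (Pr 0) (Mw (i + wt w) [a] \<otimes>\<^bsub>B\<^esub> Mw i w) (vx i) \<one>\<^bsub>B\<^esub> \<ominus>\<^bsub>Pr 0\<^esub>
        bi (Pr 0) (Mw (i + wt w) [a]) (vx (i + wt w)) (Mw i w))"
    by (simp add: \<delta>0_ua Cons bi_diff[OF PM] bi_closed[OF PM] bi_bi[OF PM])
  also have "\<dots> = bi (Pr 0) (Mw (i + wt w) [a] \<otimes>\<^bsub>B\<^esub> Mw i w) (vx i) \<one>\<^bsub>B\<^esub> \<ominus>\<^bsub>Pr 0\<^esub>
        bi (Pr 0) \<one>\<^bsub>B\<^esub> (vx (i + wt w + wl a)) (Mw (i + wt w) [a] \<otimes>\<^bsub>B\<^esub> Mw i w)"
    by (rule P.P.M.telescope) (simp_all add: bi_closed[OF PM])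
  finally show ?case by (simp add: Mw_mult add_ac)
qed

lemma \<delta>0_Dx: "hom h f \<Longrightarrow> \<delta> 0 (Dx i f) =
  bi (Pr 0) (Mu i (i + h) f) (vx i) \<one>\<^bsub>B\<^esub> \<ominus>\<^bsub>Pr 0\<^esub> bi (Pr 0) \<one>\<^bsub>B\<^esub> (vx (i + h)) (Mu i (i + h) f)"
proof (induction f rule: hom_induct)
  case zero
  then show ?case using \<delta>.hom_zero[of 0] by (simp add: Suc_simps bi_zero[OF PM] a_minus_def)
next
  case (word w c)
  have M: "Mu i (i + wt w) (wd w c) = c \<odot>\<^bsub>B\<^esub> Mw i w"
    using Mu_smult[of i "i + wt w" c "wd w 1"] by (simp add: Mw_def)
  have "\<delta> 0 (Dx i (wd w c)) = scal (Pr 0) c (\<delta> 0 (Fox i w))"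
    using \<delta>_bi[of _ _ _ 0] by (simp add: Dx_wd scal_def Suc_simps)
  then show ?case unfolding word[symmetric] M
    by (simp add: \<delta>0_Fox scal_diff[OF PM] bi_closed[OF PM] bi_smult scal_bi[OF PM])
next
  case (add f g)
  then show ?case using \<delta>.hom_add[of _ 0]
    by (simp add: Dx_add Suc_simps Mu_add bi_add_l[OF PM] bi_add_r[OF PM] P.P.M.diff_add_diff bi_closed[OF PM])
qed

lemma \<delta>1_u: "\<delta> 1 (u 2 (rx b i)) = Dx i (rel b)"
proof (cases "valid i (i + rw b)")
  case True
  then have t: "rx b i \<in> T (Suc 1)" by (simp add: T_iff)
  have "\<delta> 1 (u 2 (rx b i)) = bi (Pr 1) (e (i + rw b)) (Dx i (rel b)) (e i)"
    using \<delta>_u[OF t] by (simp add: gg_def Suc_simps)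
  then show ?thesis by (simp add: Dx_e[OF hom_rel])
next
  case False
  then have "u 2 (rx b i) = \<zero>\<^bsub>Pr 2\<^esub>" by (simp add: u_def T_iff)
  then show ?thesis using \<delta>.hom_zero[of 1] Dx_invalid[OF hom_rel False] by (simp add: Suc_simps)
qed

lemma aug_bi: "b \<in> carrier B \<Longrightarrow> c \<in> carrier B \<Longrightarrow> valid v v \<Longrightarrow> aug (bi (Pr 0) b (vx v) c) = b \<otimes>\<^bsub>B\<^esub> e v \<otimes>\<^bsub>B\<^esub> c"
proof -
  assume *: "b \<in> carrier B" "c \<in> carrier B" "valid v v"
  have "aug (vx v) = eps 0 (ix (2 * v)) \<odot>\<^bsub>E.M\<^esub> e v"
    unfolding aug_def vx_def u_def using *
    by (simp add: T_iff, subst P.ext_unit[OF E.M.right_module_axioms]) (auto simp: T_iff)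
  also have "\<dots> = e v" by (simp add: eps_def E.M_act e_mult)
  finally show ?thesis using * by (simp add: hom_bi[OF aug_hom], simp add: bi_def E.M_act)
qed

lemma P0_induct [consumes 1, case_names zero gen add]:
  assumes "z \<in> carrier (Pr 0)" "Q \<zero>\<^bsub>Pr 0\<^esub>"
    and "\<And>v j f i g. valid v j \<Longrightarrow> hom (j - v) f \<Longrightarrow> valid i v \<Longrightarrow> hom (v - i) g \<Longrightarrow>
       Q (bi (Pr 0) (Mu v j f) (vx v) (Mu i v g))"
    and "\<And>y z. y \<in> carrier (Pr 0) \<Longrightarrow> z \<in> carrier (Pr 0) \<Longrightarrow> Q y \<Longrightarrow> Q z \<Longrightarrow> Q (y \<oplus>\<^bsub>Pr 0\<^esub> z)"
  shows "Q z"
  using assms(1)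
proof (induction z rule: P_induct)
  case (gen t j f i g)
  then obtain v where t: "t = 2 * v" by (auto elim: T_0E)
  then show ?case using assms(3)[of v j f i g] gen by (simp add: vx_def)
qed (use assms in auto)

lemma P1_induct [consumes 1, case_names zero gen add]:
  assumes "z \<in> carrier (Pr 1)" "Q \<zero>\<^bsub>Pr 1\<^esub>"
    and "\<And>a s t f i g. valid s (s + wl a) \<Longrightarrow> valid (s + wl a) t \<Longrightarrow> hom (t - (s + wl a)) f \<Longrightarrow> valid i s \<Longrightarrow> hom (s - i) g \<Longrightarrow>
       Q (bi (Pr 1) (Mu (s + wl a) t f) (ua a s) (Mu i s g))"
    and "\<And>y z. y \<in> carrier (Pr 1) \<Longrightarrow> z \<in> carrier (Pr 1) \<Longrightarrow> Q y \<Longrightarrow> Q z \<Longrightarrow> Q (y \<oplus>\<^bsub>Pr 1\<^esub> z)"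
  shows "Q z"
  using assms(1)
proof (induction z rule: P_induct)
  case (gen t j f i g)
  then obtain a s where t: "t = ax a s" "valid s (s + wl a)" by (auto elim: T_1E)
  then show ?case using assms(3)[of s a j f i g] gen by (simp add: ua_def)
qed (use assms in auto)

lemma P2_induct [consumes 1, case_names zero gen add]:
  assumes "z \<in> carrier (Pr 2)" "Q \<zero>\<^bsub>Pr 2\<^esub>"
    and "\<And>b s t f i g. valid s (s + rw b) \<Longrightarrow> valid (s + rw b) t \<Longrightarrow> hom (t - (s + rw b)) f \<Longrightarrow> valid i s \<Longrightarrow> hom (s - i) g \<Longrightarrow>
       Q (bi (Pr 2) (Mu (s + rw b) t f) (u 2 (rx b s)) (Mu i s g))"
    and "\<And>y z. y \<in> carrier (Pr 2) \<Longrightarrow> z \<in> carrier (Pr 2) \<Longrightarrow> Q y \<Longrightarrow> Q z \<Longrightarrow> Q (y \<oplus>\<^bsub>Pr 2\<^esub> z)"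
  shows "Q z"
  using assms(1)
proof (induction z rule: P_induct)
  case (gen t j f i g)
  then obtain b s where t: "t = rx b s" "valid s (s + rw b)" by (auto elim: T_2E)
  then show ?case using assms(3)[of s b j f i g] gen by simp
qed (use assms in auto)

lemma aug_\<delta>: "z \<in> carrier (Pr 1) \<Longrightarrow> aug (\<delta> 0 z) = \<zero>\<^bsub>B\<^esub>"
proof (induction z rule: P1_induct)
  case zero
  then show ?case using \<delta>.hom_zero[of 0] aug.hom_zero by (simp add: Suc_simps)
next
  case (gen a s t f i g)
  have v: "valid s s" "valid (s + wl a) (s + wl a)" using gen(1) by (auto simp: valid_def)
  have d: "\<delta> 0 (bi (Pr 1) (Mu (s + wl a) t f) (ua a s) (Mu i s g)) =
     bi (Pr 0) (Mu (s + wl a) t f \<otimes>\<^bsub>B\<^esub> Mw s [a]) (vx s) (Mu i s g) \<ominus>\<^bsub>Pr 0\<^esub>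
     bi (Pr 0) (Mu (s + wl a) t f) (vx (s + wl a)) (Mw s [a] \<otimes>\<^bsub>B\<^esub> Mu i s g)"
    using \<delta>_bi[of _ _ _ 0] gen by (simp add: Suc_simps \<delta>0_ua bi_diff[OF PM] bi_closed[OF PM] bi_bi[OF PM])
  have e1: "Mw s [a] \<otimes>\<^bsub>B\<^esub> e s = Mw s [a]" "e (s + wl a) \<otimes>\<^bsub>B\<^esub> Mw s [a] = Mw s [a]"
    using Mw_e[of s "[a]"] by simp_all
  have Ma: "aug (bi (Pr 0) (Mu (s + wl a) t f \<otimes>\<^bsub>B\<^esub> Mw s [a]) (vx s) (Mu i s g)) =
     Mu (s + wl a) t f \<otimes>\<^bsub>B\<^esub> Mw s [a] \<otimes>\<^bsub>B\<^esub> Mu i s g"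
    using gen v by (simp add: aug_bi B.m_assoc e1 Mu_e)
  have Mb: "aug (bi (Pr 0) (Mu (s + wl a) t f) (vx (s + wl a)) (Mw s [a] \<otimes>\<^bsub>B\<^esub> Mu i s g)) =
     Mu (s + wl a) t f \<otimes>\<^bsub>B\<^esub> Mw s [a] \<otimes>\<^bsub>B\<^esub> Mu i s g"
    using gen v by (simp add: aug_bi B.m_assoc[symmetric], simp add: Mu_e B.m_assoc)
  show ?case unfolding d using gen Ma Mb E.M.M.r_neg[of "Mu (s + wl a) t f \<otimes>\<^bsub>B\<^esub> Mw s [a] \<otimes>\<^bsub>B\<^esub> Mu i s g"]
    by (simp add: a_minus_def aug.hom_add aug.hom_minus bi_closed[OF PM])
next
  case (add y z)
  then show ?case using \<delta>.hom_add[of _ 0] \<delta>.closed[of _ 0] aug.hom_add by (simp add: Suc_simps)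
qed

text \<open>By \<open>\<delta>0_Dx\<close> the image of the derivative of a relation consists of two
  terms that contain the relation itself, which is zero in \<open>B\<close>.\<close>

lemma \<delta>\<delta>: "z \<in> carrier (Pr 2) \<Longrightarrow> \<delta> 0 (\<delta> 1 z) = \<zero>\<^bsub>Pr 0\<^esub>"
proof (induction z rule: P2_induct)
  case zero
  then show ?case using \<delta>.hom_zero[of 0] \<delta>.hom_zero[of 1] by (simp add: Suc_simps)
next
  case (gen b s t f i g)
  have "\<delta> 0 (Dx s (rel b)) = \<zero>\<^bsub>Pr 0\<^esub>"
    using \<delta>0_Dx[OF hom_rel, of s b] by (simp add: Mu_I rel_I bi_zero[OF PM] a_minus_def)
  then show ?case using \<delta>_bi[of _ _ _ 0] \<delta>_bi[of _ _ _ 1] gen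
    by (simp add: Suc_simps \<delta>1_u bi_zero[OF PM])
next
  case (add y z)
  then show ?case using \<delta>.hom_add[of _ 0] \<delta>.hom_add[of _ 1] \<delta>.closed[of _ 1] by (simp add: Suc_simps)
qed

section \<open>Exactness\<close>

lemma aug_surj: "aug ` carrier (Pr 0) = carrier B"
proof
  show "carrier B \<subseteq> aug ` carrier (Pr 0)"
  proof
    fix b assume "b \<in> carrier B"
    then show "b \<in> aug ` carrier (Pr 0)"
    proof (induction b rule: B_induct)
      case (Mu i j f)
      then have "valid i i" by (auto simp: valid_def)
      then have "aug (bi (Pr 0) (Mu i j f) (vx i) \<one>\<^bsub>B\<^esub>) = Mu i j f" using Mu by (simp add: aug_bi Mu_e)
      then show ?case using Mu by (metis B.one_closed Mu_closed PM bi_closed imageI vx_closed)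
    next
      case (add a b)
      then obtain y z where "y \<in> carrier (Pr 0)" "z \<in> carrier (Pr 0)" "a = aug y" "b = aug z" by auto
      then show ?case using aug.hom_add[of y z] by (auto intro!: image_eqI[of _ _ "y \<oplus>\<^bsub>Pr 0\<^esub> z"])
    qed
  qed
qed (use aug.closed in auto)

text \<open>A contracting homotopy: for \<open>f\<close> to the left and \<open>g\<close> to the
  right of a vertex, the derivative of \<open>f\<close> multiplied by \<open>g\<close> bounds the
  difference between this element and the one in which \<open>f\<close> has been moved to the
  right.\<close>

lemma exact0:
  assumes "z \<in> carrier (Pr 0)" "aug z = \<zero>\<^bsub>B\<^esub>"
  shows "z \<in> \<delta> 0 ` carrier (Pr 1)"
proof -
  \<comment> \<open>A section of the augmentation, sending \<open>b\<close> to the tensor of one and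
    \<open>b\<close>; the unit is split into the vertices, of which only the target of a path
    survives.\<close>
  define S where "S b = (\<Oplus>\<^bsub>Pr 0\<^esub>w\<in>{1..\<L>}. bi (Pr 0) \<one>\<^bsub>B\<^esub> (vx w) b)" for b
  have Sc: "S b \<in> carrier (Pr 0)" if "b \<in> carrier B" for b
    unfolding S_def using that by (intro P.P.M.finsum_closed) (auto simp: bi_closed[OF PM])
  have Sa: "S (b \<oplus>\<^bsub>B\<^esub> c) = S b \<oplus>\<^bsub>Pr 0\<^esub> S c" if "b \<in> carrier B" "c \<in> carrier B" for b c
    unfolding S_def using that
    by (subst P.P.M.finsum_addf[symmetric]) (auto simp: bi_closed[OF PM] bi_add_r[OF PM] intro!: P.P.M.finsum_cong')
  have S0: "S \<zero>\<^bsub>B\<^esub> = \<zero>\<^bsub>Pr 0\<^esub>" unfolding S_def by (simp add: bi_zero[OF PM])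
  have SMu: "S (Mu i j f) = bi (Pr 0) \<one>\<^bsub>B\<^esub> (vx j) (Mu i j f)" if "valid i j" "hom (j - i) f" for i j f
    unfolding S_def
  proof (rule P.P.M.finsum_single)
    fix w assume "w \<noteq> j"
    have "bi (Pr 0) \<one>\<^bsub>B\<^esub> (vx w) (Mu i j f) = bi (Pr 0) \<one>\<^bsub>B\<^esub> (bi (Pr 0) (e w) (vx w) (e w)) (Mu i j f)"
      by (simp add: vx_e)
    also have "\<dots> = bi (Pr 0) (\<one>\<^bsub>B\<^esub> \<otimes>\<^bsub>B\<^esub> e w) (vx w) (e w \<otimes>\<^bsub>B\<^esub> Mu i j f)"
      using that by (intro bi_bi[OF PM]) auto
    also have "\<dots> = \<zero>\<^bsub>Pr 0\<^esub>" using that \<open>w \<noteq> j\<close> by (simp add: Mu_e bi_zero[OF PM])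
    finally show "bi (Pr 0) \<one>\<^bsub>B\<^esub> (vx w) (Mu i j f) = \<zero>\<^bsub>Pr 0\<^esub>" .
  qed (use that in \<open>auto simp: valid_def bi_closed[OF PM]\<close>)
  have "\<exists>y\<in>carrier (Pr 1). z = S (aug z) \<oplus>\<^bsub>Pr 0\<^esub> \<delta> 0 y"
    using assms(1)
  proof (induction z rule: P0_induct)
    case zero
    show ?case using \<delta>.hom_zero[of 0] by (intro bexI[of _ "\<zero>\<^bsub>Pr 1\<^esub>"]) (simp_all add: S0 Suc_simps)
  next
    case (gen v j f i g)
    have v: "valid v v" "valid i j" "j = v + (j - v)" using gen by (auto simp: valid_def)
    have fg: "hom (j - i) (f * g)" using gen by (intro hom_mult[of "j - v" _ "v - i"]) (auto simp: valid_def)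
    have a: "aug (bi (Pr 0) (Mu v j f) (vx v) (Mu i v g)) = Mu i j (f * g)"
      using gen v by (simp add: aug_bi Mu_e Mu_mult)
    let ?y = "bi (Pr 1) \<one>\<^bsub>B\<^esub> (Dx v f) (Mu i v g)"
    have "\<delta> 0 ?y = bi (Pr 0) \<one>\<^bsub>B\<^esub> (bi (Pr 0) (Mu v j f) (vx v) \<one>\<^bsub>B\<^esub> \<ominus>\<^bsub>Pr 0\<^esub> bi (Pr 0) \<one>\<^bsub>B\<^esub> (vx j) (Mu v j f)) (Mu i v g)"
      using \<delta>_bi[of _ _ _ 0] \<delta>0_Dx[OF gen(2), of v] gen v(3) by (simp add: Suc_simps)
    also have "\<dots> = bi (Pr 0) (Mu v j f) (vx v) (Mu i v g) \<ominus>\<^bsub>Pr 0\<^esub> bi (Pr 0) \<one>\<^bsub>B\<^esub> (vx j) (Mu i j (f * g))"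
      using gen by (simp add: bi_diff[OF PM] bi_closed[OF PM] bi_bi[OF PM] Mu_mult)
    finally have "\<delta> 0 ?y = bi (Pr 0) (Mu v j f) (vx v) (Mu i v g) \<ominus>\<^bsub>Pr 0\<^esub> S (aug (bi (Pr 0) (Mu v j f) (vx v) (Mu i v g)))"
      by (simp add: a SMu[OF v(2) fg])
    then have "bi (Pr 0) (Mu v j f) (vx v) (Mu i v g) = S (aug (bi (Pr 0) (Mu v j f) (vx v) (Mu i v g))) \<oplus>\<^bsub>Pr 0\<^esub> \<delta> 0 ?y"
      using gen a fg Sc[of "Mu i j (f * g)"] by (simp add: bi_closed[OF PM] P.P.M.add_diff_cancel)
    then show ?case using gen by (intro bexI[of _ ?y]) (auto simp: bi_closed[OF PM])
  next
    case (add y z)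
    then obtain y' z' where y': "y' \<in> carrier (Pr 1)" "y = S (aug y) \<oplus>\<^bsub>Pr 0\<^esub> \<delta> 0 y'"
      and z': "z' \<in> carrier (Pr 1)" "z = S (aug z) \<oplus>\<^bsub>Pr 0\<^esub> \<delta> 0 z'" by auto
    have c: "aug y \<in> carrier B" "aug z \<in> carrier B" using add aug.closed by auto
    have "y \<oplus>\<^bsub>Pr 0\<^esub> z = (S (aug y) \<oplus>\<^bsub>Pr 0\<^esub> \<delta> 0 y') \<oplus>\<^bsub>Pr 0\<^esub> (S (aug z) \<oplus>\<^bsub>Pr 0\<^esub> \<delta> 0 z')" using y' z' by simp
    also have "\<dots> = S (aug (y \<oplus>\<^bsub>Pr 0\<^esub> z)) \<oplus>\<^bsub>Pr 0\<^esub> \<delta> 0 (y' \<oplus>\<^bsub>Pr 1\<^esub> z')"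
      using \<delta>.hom_add[of y' 0 z'] \<delta>.closed[of y' 0] \<delta>.closed[of z' 0] y'(1) z'(1) c add(1,2) Sc
      by (simp add: aug.hom_add Sa Suc_simps P.P.M.a_ac)
    finally show ?case using y' z' by (intro bexI[of _ "y' \<oplus>\<^bsub>Pr 1\<^esub> z'"]) auto
  qed
  then obtain y where "y \<in> carrier (Pr 1)" "z = S \<zero>\<^bsub>B\<^esub> \<oplus>\<^bsub>Pr 0\<^esub> \<delta> 0 y" using assms(2) by auto
  then show ?thesis using \<delta>.closed[of y 0] by (auto simp: S0 Suc_simps)
qed

definition "im1 = \<delta> 1 ` carrier (Pr 2)"

lemma im1_closed: "z \<in> im1 \<Longrightarrow> z \<in> carrier (Pr 1)"
  using \<delta>.closed[of _ 1] by (auto simp: im1_def Suc_simps)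

lemma im1_zero: "\<zero>\<^bsub>Pr 1\<^esub> \<in> im1"
  using \<delta>.hom_zero[of 1] by (auto simp: im1_def Suc_simps intro!: image_eqI[of _ _ "\<zero>\<^bsub>Pr 2\<^esub>"])

lemma im1_add: "y \<in> im1 \<Longrightarrow> z \<in> im1 \<Longrightarrow> y \<oplus>\<^bsub>Pr 1\<^esub> z \<in> im1"
proof -
  assume "y \<in> im1" "z \<in> im1"
  then obtain y' z' where "y' \<in> carrier (Pr 2)" "z' \<in> carrier (Pr 2)" "y = \<delta> 1 y'" "z = \<delta> 1 z'"
    by (auto simp: im1_def)
  then show ?thesis using \<delta>.hom_add[of y' 1 z']
    by (auto simp: im1_def Suc_simps intro!: image_eqI[of _ _ "y' \<oplus>\<^bsub>Pr 2\<^esub> z'"])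
qed

lemma im1_bi: "z \<in> im1 \<Longrightarrow> b \<in> carrier B \<Longrightarrow> c \<in> carrier B \<Longrightarrow> bi (Pr 1) b z c \<in> im1"
proof -
  assume *: "z \<in> im1" "b \<in> carrier B" "c \<in> carrier B"
  then obtain z' where "z' \<in> carrier (Pr 2)" "z = \<delta> 1 z'" by (auto simp: im1_def)
  then show ?thesis using \<delta>_bi[of b c z' 1] *
    by (auto simp: im1_def Suc_simps bi_closed[OF PM] intro!: image_eqI[of _ _ "bi (Pr 2) b z' c"])
qed

lemma im1_minus: "z \<in> im1 \<Longrightarrow> \<ominus>\<^bsub>Pr 1\<^esub> z \<in> im1"
proof -
  assume *: "z \<in> im1"
  then obtain z' where "z' \<in> carrier (Pr 2)" "z = \<delta> 1 z'" by (auto simp: im1_def)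
  then show ?thesis using \<delta>.hom_minus[of z' 1]
    by (auto simp: im1_def Suc_simps intro!: image_eqI[of _ _ "\<ominus>\<^bsub>Pr 2\<^esub> z'"])
qed

text \<open>In the Leibniz expansion of a multiple of a relation, every term in which the relation
  stays underived vanishes in \<open>B\<close>. What remains is a two-sided multiple of the
  derivative of the relation.\<close>

lemma Dx_I: "f \<in> I \<Longrightarrow> Dx i f \<in> im1"
proof (induction f rule: I_induct)
  case zero
  then show ?case by (simp add: im1_zero)
next
  case (rel v c b w)
  have G: "Dx j (local.rel b) \<in> im1" for j
    using \<delta>1_u[of b j, symmetric] by (auto simp: im1_def)
  have I: "local.rel b * wd w 1 \<in> I" using I.I_r_closed[OF rel_I[of b], of "wd w 1"] by simp
  have h: "hom (rw b + wt w) (local.rel b * wd w 1)" by (intro hom_mult[OF hom_rel hom_wd]) auto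
  have "Dx i (local.rel b * wd w 1) = bi (Pr 1) \<one>\<^bsub>B\<^esub> (Dx (i + wt w) (local.rel b)) (Mu i (i + wt w) (wd w 1))"
    using Dx_mult[OF hom_rel hom_wd[OF refl], of i b w 1] bi_closed[OF PM]
    by (simp add: Mu_I rel_I bi_zero[OF PM] hom_wd)
  then have 1: "Dx i (local.rel b * wd w 1) \<in> im1" using G by (simp add: im1_bi hom_wd)
  have "Dx i (wd v c * (local.rel b * wd w 1)) =
     bi (Pr 1) (Mu (i + (rw b + wt w)) (i + (rw b + wt w) + wt v) (wd v c)) (Dx i (local.rel b * wd w 1)) \<one>\<^bsub>B\<^esub>"
    using Dx_mult[OF hom_wd[OF refl] h, of i v c] bi_closed[OF PM]
    by (simp add: Mu_I I bi_zero[OF PM] hom_wd)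
  then show ?case using 1 by (simp add: im1_bi hom_wd mult.assoc)
next
  case (add f g)
  then show ?case by (simp add: Dx_add im1_add)
qed

text \<open>\<open>\<sigma>\<close> picks a representative of each class modulo \<open>I\<close>
  linearly. It is the identity minus a linear projection onto \<open>I\<close>, which exists because
  subspaces have complements.\<close>

lemma linear_section:
  obtains \<sigma> where "\<And>f g. \<sigma> (f + g) = \<sigma> f + \<sigma> g"
    "\<And>c f. \<sigma> (Poly_Mapping.map ((*) c) f) = Poly_Mapping.map ((*) c) (\<sigma> f)"
    "\<And>f. f \<in> I \<Longrightarrow> \<sigma> f = 0" "\<And>f. \<sigma> f - f \<in> I"
proof -
  interpret vs: vector_space "\<lambda>(c::'k) (f :: gen free_monoid \<Rightarrow>\<^sub>0 'k). Poly_Mapping.map ((*) c) f"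
    by unfold_locales (auto simp: smult_add intro!: poly_mapping_eqI simp: lookup_add algebra_simps)
  interpret vp: vector_space_pair "\<lambda>(c::'k) (f :: gen free_monoid \<Rightarrow>\<^sub>0 'k). Poly_Mapping.map ((*) c) f"
    "\<lambda>(c::'k) (f :: gen free_monoid \<Rightarrow>\<^sub>0 'k). Poly_Mapping.map ((*) c) f" ..
  have sub: "vs.subspace I"
    unfolding vs.subspace_def using I_add I_smult \<pi>_zero_iff[of 0] by auto
  have "\<exists>g\<in>UNIV. range g \<subseteq> I \<and> Vector_Spaces.linear (\<lambda>c f. Poly_Mapping.map ((*) c) f) (\<lambda>c f. Poly_Mapping.map ((*) c) f) g
      \<and> (\<forall>v\<in>I. g (id v) = v)"
    using vp.linear_exists_left_inverse_on[OF vs.linear_id sub] by (auto simp: inj_on_def)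
  then obtain g where g: "range g \<subseteq> I" "\<And>v. v \<in> I \<Longrightarrow> g v = v"
    "Vector_Spaces.linear (\<lambda>c f. Poly_Mapping.map ((*) c) f) (\<lambda>c f. Poly_Mapping.map ((*) c) f) g"
    by auto
  interpret g: Vector_Spaces.linear "\<lambda>(c::'k) (f :: gen free_monoid \<Rightarrow>\<^sub>0 'k). Poly_Mapping.map ((*) c) f"
    "\<lambda>(c::'k) (f :: gen free_monoid \<Rightarrow>\<^sub>0 'k). Poly_Mapping.map ((*) c) f" g by (rule g)
  have neg: "- f \<in> I" if "f \<in> I" for f
    using I_smult[OF that, of "-1"] that by (metis (no_types) vs.scale_minus_left vs.scale_one)
  show ?thesis
    by (rule that[of "\<lambda>f. f - g f"]) (use g(1,2) neg in \<open>auto simp: g.add g.scale smult_diff\<close>)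
qed

text \<open>The derivation does not descend to \<open>B\<close>, as elements of \<open>I\<close> can
  have nonzero derivatives. Applying it to the representatives given by \<open>\<sigma>\<close>
  yields an additive map \<open>s0\<close> that is a contracting homotopy up to derivatives of
  elements of \<open>I\<close>, and these lie in \<open>im1\<close> by \<open>Dx_I\<close>.\<close>

lemma exact1:
  assumes z: "z \<in> carrier (Pr 1)" and dz: "\<delta> 0 z = \<zero>\<^bsub>Pr 0\<^esub>"
  shows "z \<in> im1"
proof -
  note [simp] = bi_closed[OF PM] bi_zero[OF PM] scal_closed[OF PM]
  obtain \<sigma> where \<sigma>: "\<And>f g. \<sigma> (f + g) = \<sigma> f + \<sigma> g"
    "\<And>c f. \<sigma> (Poly_Mapping.map ((*) c) f) = Poly_Mapping.map ((*) c) (\<sigma> f)"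
    "\<And>f. f \<in> I \<Longrightarrow> \<sigma> f = 0" "\<And>f. \<sigma> f - f \<in> I"
    using linear_section by blast
  have \<sigma>0: "\<sigma> 0 = 0" using \<sigma>(1)[of 0 0] by simp
  \<comment> \<open>\<open>\<sigma>\<close> regarded as a function on cosets; it is well defined
    because it vanishes on \<open>I\<close>.\<close>
  define sc where "sc U = \<sigma> (SOME f. \<pi> f = U)" for U
  have sc: "sc (\<pi> f) = \<sigma> f" for f
  proof -
    have "\<pi> (SOME g. \<pi> g = \<pi> f) = \<pi> f" by (rule someI) simp
    then have "(SOME g. \<pi> g = \<pi> f) - f \<in> I" by (simp add: \<pi>_eq_iff)
    then have "\<sigma> ((SOME g. \<pi> g = \<pi> f) - f) = 0" by (rule \<sigma>(3))
    then show ?thesis using \<sigma>(1)[of "(SOME g. \<pi> g = \<pi> f) - f" f] by (simp add: sc_def)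
  qed
  \<comment> \<open>The derivation on \<open>B\<close> relative to the section, added up over all
    matrix entries.\<close>
  define DB where "DB b = (\<Oplus>\<^bsub>Pr 1\<^esub>p\<in>{1..\<L>} \<times> {1..\<L>}. Dx (fst p) (sc (b (fst p) (snd p))))" for b
  have DB_c [simp]: "DB b \<in> carrier (Pr 1)" for b
    unfolding DB_def by (rule P.P.M.finsum_closed) auto
  have DB_add: "DB (b \<oplus>\<^bsub>B\<^esub> c) = DB b \<oplus>\<^bsub>Pr 1\<^esub> DB c" if bc: "b \<in> carrier B" "c \<in> carrier B" for b c
  proof -
    obtain f g where f: "b = cls f" and g: "c = cls g" using bc by (auto simp: B_carrier)
    show ?thesis unfolding f g cls_add DB_def
      by (subst P.P.M.finsum_addf[symmetric]) (auto simp: cls_def sc \<sigma> Dx_add intro!: P.P.M.finsum_cong')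
  qed
  have DB_smult: "DB (k \<odot>\<^bsub>B\<^esub> b) = scal (Pr 1) k (DB b)" if b: "b \<in> carrier B" for k b
  proof -
    obtain f where f: "b = cls f" using b by (auto simp: B_carrier)
    have "scal (Pr 1) k (DB b) = (\<Oplus>\<^bsub>Pr 1\<^esub>p\<in>{1..\<L>} \<times> {1..\<L>}. scal (Pr 1) k (Dx (fst p) (sc (b (fst p) (snd p)))))"
      unfolding DB_def scal_eq by (rule P.P.act_finsum) (auto simp: E.R_scalar)
    then show ?thesis unfolding f cls_smult
      by (simp add: DB_def cls_def sc \<sigma> Dx_smult)
  qed
  have DB_Mu: "DB (Mu i j f) = Dx i (\<sigma> f)" if v: "valid i j" for i j f
  proof -
    have "DB (Mu i j f) = Dx (fst (i, j)) (sc (Mu i j f (fst (i, j)) (snd (i, j))))"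
      unfolding DB_def
    proof (rule P.P.M.finsum_single)
      fix p assume "p \<noteq> (i, j)"
      then have "Mu i j f (fst p) (snd p) = \<pi> 0" by (cases p) (auto simp: Mu_entry)
      then show "Dx (fst p) (sc (Mu i j f (fst p) (snd p))) = \<zero>\<^bsub>Pr 1\<^esub>" by (simp only: sc \<sigma>0 Dx_zero)
    qed (use v in \<open>auto simp: valid_def\<close>)
    then show ?thesis using v by (simp add: Mu_entry sc)
  qed
  \<comment> \<open>The map on the enveloping algebra that sends the tensor of \<open>b\<close> and
    \<open>c\<close> to the derivative of \<open>b\<close> multiplied by \<open>c\<close>.\<close>
  define H where "H t = the_elem (lin_ext (Pr 1) (\<lambda>p c. scal (Pr 1) c (bi (Pr 1) \<one>\<^bsub>B\<^esub> (DB (fst p)) (snd p))) ` t)" for t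
  have H: "t \<in> carrier E.R \<Longrightarrow> H t \<in> carrier (Pr 1)"
    "s \<in> carrier E.R \<Longrightarrow> t \<in> carrier E.R \<Longrightarrow> H (s \<oplus>\<^bsub>E.R\<^esub> t) = H s \<oplus>\<^bsub>Pr 1\<^esub> H t"
    "b \<in> carrier B \<Longrightarrow> c \<in> carrier B \<Longrightarrow> H (E.tens b c) = bi (Pr 1) \<one>\<^bsub>B\<^esub> (DB b) c" for s t b c
  proof -
    let ?g = "\<lambda>p c. scal (Pr 1) c (bi (Pr 1) \<one>\<^bsub>B\<^esub> (DB (fst p)) (snd p))"
    have 1: "abelian_group (Pr 1)" by (rule P.P.M.abelian_group_axioms)
    have 2: "?g p c \<in> carrier (Pr 1)" if "p \<in> E.S" for p c
      using that by (simp add: mem_Times_iff)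
    have 3: "?g p (c + d) = ?g p c \<oplus>\<^bsub>Pr 1\<^esub> ?g p d" if "p \<in> E.S" for p c d
      using that by (simp add: mem_Times_iff scal_add_l[OF PM])
    have 4: "?g (a \<oplus>\<^bsub>op_algebra B\<^esub> a', b) c = ?g (a, b) c \<oplus>\<^bsub>Pr 1\<^esub> ?g (a', b) c"
      if "a \<in> carrier (op_algebra B)" "a' \<in> carrier (op_algebra B)" "b \<in> carrier B" for a a' b c
      using that by (simp add: DB_add bi_add[OF PM] scal_add[OF PM])
    have 5: "?g (a, b \<oplus>\<^bsub>B\<^esub> b') c = ?g (a, b) c \<oplus>\<^bsub>Pr 1\<^esub> ?g (a, b') c"
      if "a \<in> carrier (op_algebra B)" "b \<in> carrier B" "b' \<in> carrier B" for a b b' c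
      using that by (simp add: bi_add_r[OF PM] scal_add[OF PM])
    have 6: "?g (d \<odot>\<^bsub>op_algebra B\<^esub> a, b) c = ?g (a, b) (c * d)"
      if "a \<in> carrier (op_algebra B)" "b \<in> carrier B" for a b c d
      using that by (simp add: DB_smult scal_bi[OF PM] scal_mult[OF PM])
    have 7: "?g (a, d \<odot>\<^bsub>B\<^esub> b) c = ?g (a, b) (c * d)"
      if "a \<in> carrier (op_algebra B)" "b \<in> carrier B" for a b c d
      using that by (simp add: bi_smult scal_bi[OF PM] scal_mult[OF PM])
    note * = 1 2 3 4 5 6 7
    show "t \<in> carrier E.R \<Longrightarrow> H t \<in> carrier (Pr 1)" unfolding H_def by (rule E.tensor_lift(1)[OF *])
    show "s \<in> carrier E.R \<Longrightarrow> t \<in> carrier E.R \<Longrightarrow> H (s \<oplus>\<^bsub>E.R\<^esub> t) = H s \<oplus>\<^bsub>Pr 1\<^esub> H t"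
      unfolding H_def by (rule E.tensor_lift(2)[OF *])
    show "H (E.tens b c) = bi (Pr 1) \<one>\<^bsub>B\<^esub> (DB b) c" if bc: "b \<in> carrier B" "c \<in> carrier B"
    proof -
      have "H (E.tens b c) = ?g (b, c) 1"
        unfolding H_def by (rule E.tensor_lift(3)[OF *]) (use bc in simp_all)
      also have "\<dots> = bi (Pr 1) \<one>\<^bsub>B\<^esub> (DB b) c"
        using bc by (simp add: scal_one[OF PM])
      finally show ?thesis .
    qed
  qed
  have H0: "H \<zero>\<^bsub>E.R\<^esub> = \<zero>\<^bsub>Pr 1\<^esub>"
    using H(3)[of "\<zero>\<^bsub>B\<^esub>" "\<zero>\<^bsub>B\<^esub>"] E.tens_zero(1)[of "\<zero>\<^bsub>B\<^esub>"] by simp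
  \<comment> \<open>The candidate for the contracting homotopy. Indices \<open>2 * v\<close> are
    those that name vertices in degree zero.\<close>
  define s0 where "s0 f = (\<Oplus>\<^bsub>Pr 1\<^esub>v\<in>{1..\<L>}. H (f (ix (2 * v))))" for f :: "'k idx \<Rightarrow> _"
  have s0_c: "s0 f \<in> carrier (Pr 1)" if "f \<in> carrier (Pr 0)" for f
    unfolding s0_def using that H(1) by (intro P.P.M.finsum_closed) auto
  have s0_add: "s0 (f \<oplus>\<^bsub>Pr 0\<^esub> g) = s0 f \<oplus>\<^bsub>Pr 1\<^esub> s0 g" if "f \<in> carrier (Pr 0)" "g \<in> carrier (Pr 0)" for f g
    unfolding s0_def using that H(1)
    by (subst P.P.M.finsum_addf[symmetric]) (auto simp: idem_module_simps H(2) intro!: P.P.M.finsum_cong')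
  have s0_zero: "s0 \<zero>\<^bsub>Pr 0\<^esub> = \<zero>\<^bsub>Pr 1\<^esub>"
    unfolding s0_def by (simp add: idem_module_simps H0)
  have s0_minus: "s0 (\<ominus>\<^bsub>Pr 0\<^esub> f) = \<ominus>\<^bsub>Pr 1\<^esub> s0 f" if f: "f \<in> carrier (Pr 0)" for f
    using s0_add[of "\<ominus>\<^bsub>Pr 0\<^esub> f" f] f s0_c[OF f] s0_c[of "\<ominus>\<^bsub>Pr 0\<^esub> f"]
    by (simp add: P.P.M.l_neg s0_zero P.P.M.minus_equality)
  have s0_gen: "s0 (bi (Pr 0) b (vx v) c) = bi (Pr 1) \<one>\<^bsub>B\<^esub> (DB (b \<otimes>\<^bsub>B\<^esub> e v)) (e v \<otimes>\<^bsub>B\<^esub> c)"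
    if "valid v v" "b \<in> carrier B" "c \<in> carrier B" for v b c
  proof -
    have "s0 (bi (Pr 0) b (vx v) c) = H (bi (Pr 0) b (vx v) c (ix (2 * v)))"
      unfolding s0_def
    proof (rule P.P.M.finsum_single)
      fix w assume "w \<noteq> v"
      then have "bi (Pr 0) b (vx v) c (ix (2 * w)) = \<zero>\<^bsub>E.R\<^esub>"
        using that by (simp add: bi_apply) (simp add: vx_def u_def T_iff idem_unit_def)
      then show "H (bi (Pr 0) b (vx v) c (ix (2 * w))) = \<zero>\<^bsub>Pr 1\<^esub>" using H0 by simp
    qed (use that in \<open>auto simp: valid_def intro!: H(1) P.idem_carrierD[of _ 0]\<close>)
    also have "bi (Pr 0) b (vx v) c (ix (2 * v)) = E.tens (b \<otimes>\<^bsub>B\<^esub> e v) (e v \<otimes>\<^bsub>B\<^esub> c)"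
      using that by (simp add: bi_apply) (simp add: vx_def u_def T_iff idem_unit_def eps_def E.tens_mult)
    finally show ?thesis using that by (simp add: H(3))
  qed
  have "\<exists>y\<in>im1. s0 (\<delta> 0 z) = z \<oplus>\<^bsub>Pr 1\<^esub> y"
    using z
  proof (induction z rule: P1_induct)
    case zero
    show ?case using \<delta>.hom_zero[of 0] im1_zero by (intro bexI[of _ "\<zero>\<^bsub>Pr 1\<^esub>"]) (simp_all add: Suc_simps s0_zero)
  next
    case (gen a s t f i g)
    define j where "j = s + wl a"
    let ?b = "Mu j t f" and ?c = "Mu i s g"
    have v: "valid s s" "valid j j" "valid s t" "valid s j" using gen by (auto simp: valid_def j_def)
    have hf: "hom (t - j) f" using gen by (simp add: j_def)
    have hfa: "hom (t - s) (f * wd [a] 1)"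
      using gen by (intro hom_mult[OF hf hom_wd[OF refl]]) (auto simp: valid_def j_def)
    have b: "?b \<in> carrier B" and c: "?c \<in> carrier B" using gen hf by auto
    have Mwa: "Mw s [a] = Mu s j (wd [a] 1)" by (simp add: Mw_def j_def)
    have bM: "?b \<otimes>\<^bsub>B\<^esub> Mw s [a] = Mu s t (f * wd [a] 1)"
      using v gen by (simp add: Mwa Mu_mult j_def)
    have Mwe: "Mw s [a] \<otimes>\<^bsub>B\<^esub> e s = Mw s [a]" "e j \<otimes>\<^bsub>B\<^esub> Mw s [a] = Mw s [a]"
      using Mw_e[of s "[a]"] by (simp_all add: j_def)
    have d: "\<delta> 0 (bi (Pr 1) ?b (ua a s) ?c) =
       bi (Pr 0) (Mu s t (f * wd [a] 1)) (vx s) ?c \<ominus>\<^bsub>Pr 0\<^esub> bi (Pr 0) ?b (vx j) (Mw s [a] \<otimes>\<^bsub>B\<^esub> ?c)"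
      using \<delta>_bi[of _ _ _ 0] b c by (simp add: Suc_simps \<delta>0_ua bi_diff[OF PM] bi_bi[OF PM] j_def[symmetric] bM)
    have s1: "s0 (bi (Pr 0) (Mu s t (f * wd [a] 1)) (vx s) ?c) = bi (Pr 1) \<one>\<^bsub>B\<^esub> (Dx s (\<sigma> (f * wd [a] 1))) ?c"
      using s0_gen[OF v(1), of "Mu s t (f * wd [a] 1)" ?c] hfa c gen v by (simp add: Mu_e DB_Mu)
    have s2: "s0 (bi (Pr 0) ?b (vx j) (Mw s [a] \<otimes>\<^bsub>B\<^esub> ?c)) = bi (Pr 1) \<one>\<^bsub>B\<^esub> (Dx j (\<sigma> f)) (Mw s [a] \<otimes>\<^bsub>B\<^esub> ?c)"
      using s0_gen[OF v(2), of ?b "Mw s [a] \<otimes>\<^bsub>B\<^esub> ?c"] hf c gen b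
      by (simp add: Mu_e DB_Mu j_def[symmetric] B.m_assoc[symmetric] Mwe)
    have r: "Dx i (\<sigma> h) = Dx i h \<oplus>\<^bsub>Pr 1\<^esub> Dx i (\<sigma> h - h)" for i h
      using Dx_add[of i h "\<sigma> h - h"] by simp
    have m: "Dx s (f * wd [a] 1) = bi (Pr 1) \<one>\<^bsub>B\<^esub> (Dx j f) (Mw s [a]) \<oplus>\<^bsub>Pr 1\<^esub> bi (Pr 1) ?b (ua a s) \<one>\<^bsub>B\<^esub>"
    proof -
      have jt: "j + (t - j) = t" using gen by (simp add: j_def valid_def)
      have F: "Fox s [a] = ua a s"
      proof -
        have "bi (Pr 1) \<one>\<^bsub>B\<^esub> (ua a s) (e s) = bi (Pr 1) \<one>\<^bsub>B\<^esub> (bi (Pr 1) (e (s + wl a)) (ua a s) (e s)) (e s)"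
          by (simp add: ua_e)
        also have "\<dots> = bi (Pr 1) (\<one>\<^bsub>B\<^esub> \<otimes>\<^bsub>B\<^esub> e (s + wl a)) (ua a s) (e s \<otimes>\<^bsub>B\<^esub> e s)"
          by (rule bi_bi[OF PM]) auto
        also have "\<dots> = ua a s" by (simp add: e_mult ua_e)
        finally show ?thesis by (simp add: Mw_Nil)
      qed
      have "Dx s (wd [a] 1) = ua a s"
        unfolding Dx_wd F by (rule scal_one[OF PM]) simp
      then show ?thesis
        using Dx_mult[OF hf hom_wd[of "[a]" "wl a" 1], of s] by (simp add: j_def[symmetric] jt Mwa)
    qed
    \<comment> \<open>The total error from replacing \<open>f\<close> and its product with the
      letter \<open>a\<close> by their chosen representatives.\<close>
    define y where "y = bi (Pr 1) \<one>\<^bsub>B\<^esub> (Dx s (\<sigma> (f * wd [a] 1) - f * wd [a] 1)) ?c \<ominus>\<^bsub>Pr 1\<^esub>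
       bi (Pr 1) \<one>\<^bsub>B\<^esub> (Dx j (\<sigma> f - f)) (Mw s [a] \<otimes>\<^bsub>B\<^esub> ?c)"
    have y: "y \<in> im1"
      unfolding y_def a_minus_def using c by (intro im1_add im1_minus im1_bi Dx_I \<sigma>(4)) auto
    have "s0 (\<delta> 0 (bi (Pr 1) ?b (ua a s) ?c)) = bi (Pr 1) \<one>\<^bsub>B\<^esub> (Dx s (\<sigma> (f * wd [a] 1))) ?c \<ominus>\<^bsub>Pr 1\<^esub>
       bi (Pr 1) \<one>\<^bsub>B\<^esub> (Dx j (\<sigma> f)) (Mw s [a] \<otimes>\<^bsub>B\<^esub> ?c)"
      unfolding d using s1 s2 b c hfa by (simp add: a_minus_def s0_add s0_minus)
    also have "\<dots> = (bi (Pr 1) \<one>\<^bsub>B\<^esub> (Dx j f) (Mw s [a] \<otimes>\<^bsub>B\<^esub> ?c) \<oplus>\<^bsub>Pr 1\<^esub> bi (Pr 1) ?b (ua a s) ?c \<oplus>\<^bsub>Pr 1\<^esub>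
         bi (Pr 1) \<one>\<^bsub>B\<^esub> (Dx s (\<sigma> (f * wd [a] 1) - f * wd [a] 1)) ?c) \<ominus>\<^bsub>Pr 1\<^esub>
       (bi (Pr 1) \<one>\<^bsub>B\<^esub> (Dx j f) (Mw s [a] \<otimes>\<^bsub>B\<^esub> ?c) \<oplus>\<^bsub>Pr 1\<^esub> bi (Pr 1) \<one>\<^bsub>B\<^esub> (Dx j (\<sigma> f - f)) (Mw s [a] \<otimes>\<^bsub>B\<^esub> ?c))"
      unfolding r[of s "f * wd [a] 1"] r[of j f] m using b c by (simp add: bi_add[OF PM] bi_bi[OF PM])
    also have "\<dots> = bi (Pr 1) ?b (ua a s) ?c \<oplus>\<^bsub>Pr 1\<^esub> y"
    proof -
      have "(p \<oplus>\<^bsub>Pr 1\<^esub> q \<oplus>\<^bsub>Pr 1\<^esub> r) \<ominus>\<^bsub>Pr 1\<^esub> (p \<oplus>\<^bsub>Pr 1\<^esub> w) = q \<oplus>\<^bsub>Pr 1\<^esub> (r \<ominus>\<^bsub>Pr 1\<^esub> w)"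
        if "p \<in> carrier (Pr 1)" "q \<in> carrier (Pr 1)" "r \<in> carrier (Pr 1)" "w \<in> carrier (Pr 1)" for p q r w
      proof -
        have "(p \<oplus>\<^bsub>Pr 1\<^esub> q \<oplus>\<^bsub>Pr 1\<^esub> r) \<ominus>\<^bsub>Pr 1\<^esub> (p \<oplus>\<^bsub>Pr 1\<^esub> w) = (p \<ominus>\<^bsub>Pr 1\<^esub> p) \<oplus>\<^bsub>Pr 1\<^esub> ((q \<oplus>\<^bsub>Pr 1\<^esub> r) \<ominus>\<^bsub>Pr 1\<^esub> w)"
          using that by (simp add: P.P.M.a_assoc P.P.M.diff_add_diff)
        then show ?thesis using that by (simp add: a_minus_def P.P.M.r_neg P.P.M.a_assoc)
      qed
      then show ?thesis unfolding y_def using b c by simp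
    qed
    finally show ?case using y by (auto simp: j_def)
  next
    case (add y z)
    then obtain y' z' where y': "y' \<in> im1" "s0 (\<delta> 0 y) = y \<oplus>\<^bsub>Pr 1\<^esub> y'"
      and z': "z' \<in> im1" "s0 (\<delta> 0 z) = z \<oplus>\<^bsub>Pr 1\<^esub> z'" by auto
    have "s0 (\<delta> 0 (y \<oplus>\<^bsub>Pr 1\<^esub> z)) = s0 (\<delta> 0 y) \<oplus>\<^bsub>Pr 1\<^esub> s0 (\<delta> 0 z)"
      using add \<delta>.hom_add[of y 0 z] \<delta>.closed[of y 0] \<delta>.closed[of z 0] by (simp add: Suc_simps s0_add)
    also have "\<dots> = (y \<oplus>\<^bsub>Pr 1\<^esub> z) \<oplus>\<^bsub>Pr 1\<^esub> (y' \<oplus>\<^bsub>Pr 1\<^esub> z')"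
      using add y' z' im1_closed by (simp add: P.P.M.a_ac)
    finally show ?case using im1_add[OF y'(1) z'(1)] by blast
  qed
  then obtain y where y: "y \<in> im1" "\<zero>\<^bsub>Pr 1\<^esub> = z \<oplus>\<^bsub>Pr 1\<^esub> y" by (auto simp: dz s0_zero)
  then have "\<ominus>\<^bsub>Pr 1\<^esub> y = z" using z im1_closed[OF y(1)] by (intro P.P.M.minus_equality) simp_all
  then show ?thesis using im1_minus[OF y(1)] by simp
qed


section \<open>Coefficient functionals\<close>

definition "pure w \<longleftrightarrow> X \<notin> set w \<or> Y \<notin> set w"

abbreviation co :: "(gen free_monoid \<Rightarrow>\<^sub>0 'k) \<Rightarrow> gen list \<Rightarrow> 'k" where
  "co f w \<equiv> Poly_Mapping.lookup f (Word w)"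

lemma co_wd: "co (wd w c) v = (if w = v then c else 0)"
  by (simp add: lookup_single when_def)

lemma rel_expand: "wd v c * rel b * wd w 1 =
  (if b then wd (v @ [X, X, Y] @ w) c - wd (v @ [Y, X, X] @ w) (c * \<beta>) - wd (v @ [X, Y, X] @ w) (c * \<alpha>)
   else wd (v @ [X, Y, Y] @ w) c - wd (v @ [Y, Y, X] @ w) (c * \<beta>) - wd (v @ [Y, X, Y] @ w) (c * \<alpha>))"
  by (simp add: rel_def left_diff_distrib right_diff_distrib)

text \<open>Each word in a relation contains both letters, and multiplying by further words cannot
  change that.\<close>

lemma co_pure_I: "f \<in> I \<Longrightarrow> pure w \<Longrightarrow> co f w = 0"
  by (induction f rule: I_induct) (auto simp: rel_expand lookup_minus lookup_add co_wd pure_def)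

text \<open>A coefficient read off from a coset. By \<open>co_pure_I\<close> it is independent of
  the representative when \<open>w\<close> is pure.\<close>

definition \<chi> :: "gen list \<Rightarrow> (gen free_monoid \<Rightarrow>\<^sub>0 'k) set \<Rightarrow> 'k" where
  "\<chi> w U = co (SOME f. \<pi> f = U) w"

lemma \<chi>_\<pi>: "pure w \<Longrightarrow> \<chi> w (\<pi> f) = co f w"
proof -
  assume w: "pure w"
  have "\<pi> (SOME g. \<pi> g = \<pi> f) = \<pi> f" by (rule someI) simp
  then have "co ((SOME g. \<pi> g = \<pi> f) - f) w = 0" using w by (intro co_pure_I) (simp add: \<pi>_eq_iff)
  then show ?thesis by (simp add: \<chi>_def lookup_minus)
qed

lemma co_hom: "hom d f \<Longrightarrow> co f w \<noteq> 0 \<Longrightarrow> wt w = d"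
  unfolding hom_def using weight_wt[of w] by (metis in_keys_iff)

text \<open>The coefficient of \<open>v \<otimes> w\<close>, read off at the entries \<open>s \<rightarrow> s + wt v\<close> and
  \<open>s' - wt w \<rightarrow> s'\<close> of the two tensor factors.\<close>

definition \<Theta> :: "nat \<Rightarrow> gen list \<Rightarrow> nat \<Rightarrow> gen list \<Rightarrow> ('k, 'k bei) env \<Rightarrow> 'k" where
  "\<Theta> s v s' w t = the_elem (lin_ext (class_ring :: 'k ring) (\<lambda>p c. c * (\<chi> v (fst p s (s + wt v)) * \<chi> w (snd p (s' - wt w) s'))) ` t)"

lemma \<Theta>:
  assumes v: "pure v" and w: "pure w"
  shows "s \<in> carrier E.R \<Longrightarrow> t \<in> carrier E.R \<Longrightarrow> \<Theta> i v j w (s \<oplus>\<^bsub>E.R\<^esub> t) = \<Theta> i v j w s + \<Theta> i v j w t"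
    and "b \<in> carrier B \<Longrightarrow> c \<in> carrier B \<Longrightarrow> \<Theta> i v j w (E.tens b c) = \<chi> v (b i (i + wt v)) * \<chi> w (c (j - wt w) j)"
proof -
  let ?g = "\<lambda>p c. c * (\<chi> v (fst p i (i + wt v)) * \<chi> w (snd p (j - wt w) j))"
  let ?K = "class_ring :: 'k ring"
  have add: "\<chi> u ((b \<oplus>\<^bsub>B\<^esub> c) i j) = \<chi> u (b i j) + \<chi> u (c i j)"
    if bc: "b \<in> carrier B" "c \<in> carrier B" "pure u" for b c u i j
  proof -
    obtain f g where f: "b = cls f" and g: "c = cls g" using bc by (auto simp: B_carrier)
    show ?thesis unfolding f g cls_add using bc(3) by (simp add: cls_def \<chi>_\<pi> lookup_add)
  qed
  have sm: "\<chi> u ((k \<odot>\<^bsub>B\<^esub> b) i j) = k * \<chi> u (b i j)"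
    if bc: "b \<in> carrier B" "pure u" for b u i j k
  proof -
    obtain f where f: "b = cls f" using bc by (auto simp: B_carrier)
    show ?thesis unfolding f cls_smult using bc(2) by (simp add: cls_def \<chi>_\<pi>)
  qed
  have 1: "abelian_group ?K" by (rule class_ring.abelian_group_axioms)
  have 2: "?g p c \<in> carrier ?K" if "p \<in> E.S" for p c by simp
  have 3: "?g p (c + d) = ?g p c \<oplus>\<^bsub>?K\<^esub> ?g p d" if "p \<in> E.S" for p c d
    by (simp add: algebra_simps)
  have 4: "?g (a \<oplus>\<^bsub>op_algebra B\<^esub> a', b) c = ?g (a, b) c \<oplus>\<^bsub>?K\<^esub> ?g (a', b) c"
    if "a \<in> carrier (op_algebra B)" "a' \<in> carrier (op_algebra B)" "b \<in> carrier B" for a a' b c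
    using that v by (simp add: add algebra_simps)
  have 5: "?g (a, b \<oplus>\<^bsub>B\<^esub> b') c = ?g (a, b) c \<oplus>\<^bsub>?K\<^esub> ?g (a, b') c"
    if "a \<in> carrier (op_algebra B)" "b \<in> carrier B" "b' \<in> carrier B" for a b b' c
    using that w by (simp add: add algebra_simps)
  have 6: "?g (d \<odot>\<^bsub>op_algebra B\<^esub> a, b) c = ?g (a, b) (c * d)"
    if "a \<in> carrier (op_algebra B)" "b \<in> carrier B" for a b c d
    using that v by (simp add: sm)
  have 7: "?g (a, d \<odot>\<^bsub>B\<^esub> b) c = ?g (a, b) (c * d)"
    if "a \<in> carrier (op_algebra B)" "b \<in> carrier B" for a b c d
    using that w by (simp add: sm)
  note * = 1 2 3 4 5 6 7
  show "\<Theta> i v j w (s \<oplus>\<^bsub>E.R\<^esub> t) = \<Theta> i v j w s + \<Theta> i v j w t" if "s \<in> carrier E.R" "t \<in> carrier E.R"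
  proof -
    have "\<Theta> i v j w (s \<oplus>\<^bsub>E.R\<^esub> t) = \<Theta> i v j w s \<oplus>\<^bsub>?K\<^esub> \<Theta> i v j w t"
      unfolding \<Theta>_def by (rule E.tensor_lift(2)[OF *]) (use that in simp_all)
    then show ?thesis by simp
  qed
  show "\<Theta> i v j w (E.tens b c) = \<chi> v (b i (i + wt v)) * \<chi> w (c (j - wt w) j)" if "b \<in> carrier B" "c \<in> carrier B"
  proof -
    have "\<Theta> i v j w (E.tens b c) = ?g (b, c) 1"
      unfolding \<Theta>_def by (rule E.tensor_lift(3)[OF *]) (use that in simp_all)
    then show ?thesis by simp
  qed
qed

definition \<theta> where "\<theta> k t v w z = \<Theta> (tg k t) v (sr t) w (z (ix t))"

lemma \<theta>_add: "pure v \<Longrightarrow> pure w \<Longrightarrow> y \<in> carrier (Pr k) \<Longrightarrow> z \<in> carrier (Pr k) \<Longrightarrow>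
    \<theta> k t v w (y \<oplus>\<^bsub>Pr k\<^esub> z) = \<theta> k t v w y + \<theta> k t v w z"
  by (simp add: \<theta>_def idem_module_simps \<Theta>)

lemma \<theta>_zero [simp]: "pure v \<Longrightarrow> pure w \<Longrightarrow> \<theta> k t v w \<zero>\<^bsub>Pr k\<^esub> = 0"
  using \<theta>_add[of v w "\<zero>\<^bsub>Pr k\<^esub>" k "\<zero>\<^bsub>Pr k\<^esub>" t] by simp

lemma \<theta>_minus: "pure v \<Longrightarrow> pure w \<Longrightarrow> z \<in> carrier (Pr k) \<Longrightarrow> \<theta> k t v w (\<ominus>\<^bsub>Pr k\<^esub> z) = - \<theta> k t v w z"
  using \<theta>_add[of v w "\<ominus>\<^bsub>Pr k\<^esub> z" k z t] by (simp add: P.P.M.l_neg eq_neg_iff_add_eq_0)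

lemma \<theta>_diff: "pure v \<Longrightarrow> pure w \<Longrightarrow> y \<in> carrier (Pr k) \<Longrightarrow> z \<in> carrier (Pr k) \<Longrightarrow>
    \<theta> k t v w (y \<ominus>\<^bsub>Pr k\<^esub> z) = \<theta> k t v w y - \<theta> k t v w z"
  by (simp add: a_minus_def \<theta>_add \<theta>_minus)

lemma \<theta>_gen:
  assumes v: "pure v" and w: "pure w" and t': "t' \<in> T k" and f: "hom (j - tg k t') f" and g: "hom (sr t' - i) g"
    and vf: "valid (tg k t') j" and vg: "valid i (sr t')"
  shows "\<theta> k t v w (bi (Pr k) (Mu (tg k t') j f) (u k t') (Mu i (sr t') g)) = (if t = t' then co f v * co g w else 0)"
proof -
  have z: "bi (Pr k) (Mu (tg k t') j f) (u k t') (Mu i (sr t') g) (ix t) =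
    (if t = t' then E.tens (Mu (tg k t') j f) (Mu i (sr t') g) else \<zero>\<^bsub>E.R\<^esub>)"
    using t' f g by (subst bi_apply[OF u_closed]) (auto simp: u_def idem_unit_def eps_def E.tens_mult Mu_e)
  have T0: "\<Theta> a v b w \<zero>\<^bsub>E.R\<^esub> = 0" for a b
    using \<Theta>(1)[OF v w, of "\<zero>\<^bsub>E.R\<^esub>" "\<zero>\<^bsub>E.R\<^esub>" a b] by simp
  have c0: "\<chi> u \<zero>\<^bsub>A\<^esub> = 0" if "pure u" for u using \<chi>_\<pi>[OF that, of 0] by simp
  have 1: "\<chi> v (Mu (tg k t') j f (tg k t') (tg k t' + wt v)) = co f v"
  proof (cases "j = tg k t' + wt v")
    case False
    have "co f v = 0"
    proof (rule ccontr)
      assume "co f v \<noteq> 0"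
      from co_hom[OF f this] show False using False vf by (simp add: valid_def)
    qed
    then show ?thesis using False by (simp add: Mu_entry c0 v)
  qed (use vf v in \<open>simp add: Mu_entry \<chi>_\<pi>\<close>)
  have 2: "\<chi> w (Mu i (sr t') g (sr t' - wt w) (sr t')) = co g w"
  proof (cases "i = sr t' - wt w")
    case False
    have "co g w = 0"
    proof (rule ccontr)
      assume "co g w \<noteq> 0"
      from co_hom[OF g this] show False using False vg by (simp add: valid_def)
    qed
    then show ?thesis using False by (simp add: Mu_entry c0 w)
  qed (use vg w in \<open>simp add: Mu_entry \<chi>_\<pi>\<close>)
  show ?thesis
    unfolding \<theta>_def z using f g T0 1 2 by (auto simp: \<Theta>(2)[OF v w])
qed

lemma \<theta>_ua:
  assumes "pure v" "pure w" and f: "hom (t - (s + wl a)) f" and g: "hom (s - i) g" and "valid (s + wl a) t" "valid i s"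
  shows "\<theta> 1 (ax a' j) v w (bi (Pr 1) (Mu (s + wl a) t f) (ua a s) (Mu i s g)) =
    (if a' = a \<and> j = s then co f v * co g w else 0)"
proof -
  have "ax a' j = ax a s \<longleftrightarrow> a' = a \<and> j = s"
    by (auto simp: ax_def split: gen.splits) presburger+
  moreover have "valid s (s + wl a)" using assms by (auto simp: valid_def)
  ultimately show ?thesis
    using \<theta>_gen[of v w "ax a s" 1 t f i g "ax a' j"] assms by (simp add: ua_def T_iff)
qed

lemma \<theta>_u2:
  assumes "pure v" "pure w" and f: "hom (t - (s + rw b)) f" and g: "hom (s - i) g" and "valid (s + rw b) t" "valid i s"
  shows "\<theta> 2 (rx b' j) v w (bi (Pr 2) (Mu (s + rw b) t f) (u 2 (rx b s)) (Mu i s g)) =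
    (if b' = b \<and> j = s then co f v * co g w else 0)"
proof -
  have "rx b' j = rx b s \<longleftrightarrow> b' = b \<and> j = s"
    by (auto simp: rx_def) presburger+
  moreover have "valid s (s + rw b)" using assms by (auto simp: valid_def)
  ultimately show ?thesis
    using \<theta>_gen[of v w "rx b s" 2 t f i g "rx b' j"] assms by (simp add: T_iff)
qed

text \<open>Each of the three letters in turn becomes the generator; the letters before it join the
  left factor and those after it the right factor.\<close>

lemma \<theta>_Fox3:
  assumes p: "pure v" "pure w" and f: "hom (t - (s + wt [a, b, c])) f" and g: "hom (s - i) g"
    and vf: "valid (s + wt [a, b, c]) t" and vg: "valid i s"
  shows "\<theta> 1 (ax a' j) v w (bi (Pr 1) (Mu (s + wt [a, b, c]) t f) (Fox s [a, b, c]) (Mu i s g)) =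
    (if a' = a \<and> j = s + wl c + wl b then co f v * co (wd [b, c] 1 * g) w else 0) +
    (if a' = b \<and> j = s + wl c then co (f * wd [a] 1) v * co (wd [c] 1 * g) w else 0) +
    (if a' = c \<and> j = s then co (f * wd [a, b] 1) v * co g w else 0)"
proof -
  let ?f = "Mu (s + wt [a, b, c]) t f" and ?g = "Mu i s g"
  have V: "valid s (s + wl c)" "valid (s + wl c) (s + wl c + wl b)" "valid (s + wl c + wl b) (s + wl c + wl b + wl a)"
    "valid (s + wl c) t" "valid (s + wl c + wl b) t" "valid i (s + wl c)" "valid i (s + wl c + wl b)" "valid s s"
    "valid s (s + wl b + wl c)"
    using vf vg by (auto simp: valid_def)
  have d: "t - (s + wl c) = (t - (s + wt [a, b, c])) + (wl a + wl b)"
     "t - (s + wl c + wl b) = (t - (s + wt [a, b, c])) + wl a"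
     "s + wl c - i = wl c + (s - i)" "s + wl c + wl b - i = (wl b + wl c) + (s - i)"
    using vf vg by (auto simp: valid_def)
  have hf: "hom (t - (s + wl c + wl b)) (f * wd [a] 1)" "hom (t - (s + wl c)) (f * wd [a, b] 1)"
    unfolding d by (rule hom_mult[OF f hom_wd]; simp)+
  have hg: "hom (s + wl c - i) (wd [c] 1 * g)" "hom (s + wl c + wl b - i) (wd [b, c] 1 * g)"
    unfolding d by (rule hom_mult[OF hom_wd g]; simp)+
  have "Fox s [a, b, c] = bi (Pr 1) \<one>\<^bsub>B\<^esub> (ua a (s + (wl b + wl c))) (Mw s [b, c]) \<oplus>\<^bsub>Pr 1\<^esub>
    (bi (Pr 1) (Mw (s + (wl b + wl c)) [a]) (ua b (s + wl c)) (Mw s [c]) \<oplus>\<^bsub>Pr 1\<^esub>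
     bi (Pr 1) (Mw (s + (wl b + wl c)) [a] \<otimes>\<^bsub>B\<^esub> Mw (s + wl c) [b]) (ua c s) (e s))"
    by (simp add: bi_add[OF PM] bi_closed[OF PM] bi_bi[OF PM] bi_zero[OF PM] Mw_Nil)
  then have "bi (Pr 1) ?f (Fox s [a, b, c]) ?g =
     bi (Pr 1) ?f (ua a (s + (wl b + wl c))) (Mw s [b, c] \<otimes>\<^bsub>B\<^esub> ?g) \<oplus>\<^bsub>Pr 1\<^esub>
     (bi (Pr 1) (?f \<otimes>\<^bsub>B\<^esub> Mw (s + (wl b + wl c)) [a]) (ua b (s + wl c)) (Mw s [c] \<otimes>\<^bsub>B\<^esub> ?g) \<oplus>\<^bsub>Pr 1\<^esub>
     bi (Pr 1) (?f \<otimes>\<^bsub>B\<^esub> (Mw (s + (wl b + wl c)) [a] \<otimes>\<^bsub>B\<^esub> Mw (s + wl c) [b])) (ua c s) (e s \<otimes>\<^bsub>B\<^esub> ?g))"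
    using f g by (simp add: bi_add[OF PM] bi_closed[OF PM] bi_bi[OF PM] del: wt_simps)
  also have "Mw s [b, c] \<otimes>\<^bsub>B\<^esub> ?g = Mu i (s + wl c + wl b) (wd [b, c] 1 * g)"
    using V by (simp add: Mw_def Mu_mult vg add_ac)
  also have "Mw s [c] \<otimes>\<^bsub>B\<^esub> ?g = Mu i (s + wl c) (wd [c] 1 * g)"
    using V by (simp add: Mw_def Mu_mult vg)
  also have "?f \<otimes>\<^bsub>B\<^esub> Mw (s + (wl b + wl c)) [a] = Mu (s + wl c + wl b) t (f * wd [a] 1)"
    using V vf by (simp add: Mw_def Mu_mult add_ac)
  also have "Mw (s + (wl b + wl c)) [a] \<otimes>\<^bsub>B\<^esub> Mw (s + wl c) [b] = Mu (s + wl c) (s + wl c + wl b + wl a) (wd [a, b] 1)"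
    using V by (simp add: Mw_def Mu_mult add_ac)
  also have "?f \<otimes>\<^bsub>B\<^esub> Mu (s + wl c) (s + wl c + wl b + wl a) (wd [a, b] 1) = Mu (s + wl c) t (f * wd [a, b] 1)"
    using V vf by (simp add: Mu_mult add_ac valid_def)
  also have "e s \<otimes>\<^bsub>B\<^esub> ?g = ?g" using g by (simp add: Mu_e)
  finally have E: "bi (Pr 1) ?f (Fox s [a, b, c]) ?g =
     bi (Pr 1) (Mu (s + wl c + wl b + wl a) t f) (ua a (s + wl c + wl b)) (Mu i (s + wl c + wl b) (wd [b, c] 1 * g)) \<oplus>\<^bsub>Pr 1\<^esub>
     (bi (Pr 1) (Mu (s + wl c + wl b) t (f * wd [a] 1)) (ua b (s + wl c)) (Mu i (s + wl c) (wd [c] 1 * g)) \<oplus>\<^bsub>Pr 1\<^esub>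
     bi (Pr 1) (Mu (s + wl c) t (f * wd [a, b] 1)) (ua c s) ?g)"
    by (simp add: add_ac)
  have f': "hom (t - (s + wl c + wl b + wl a)) f" using f by (simp add: add_ac)
  have vf': "valid (s + wl c + wl b + wl a) t" using vf by (simp add: add_ac)
  show ?thesis
    unfolding E using f' hf hg g p V vf' vg
    by (simp add: \<theta>_add bi_closed[OF PM] \<theta>_ua del: wt_simps)
qed

lemma \<theta>_Fox3':
  assumes "wt [a, b, c] = r" "pure v" "pure w" "hom (t - (s + r)) f" "hom (s - i) g" "valid (s + r) t" "valid i s"
  shows "\<theta> 1 (ax a' j) v w (bi (Pr 1) (Mu (s + r) t f) (Fox s [a, b, c]) (Mu i s g)) =
    (if a' = a \<and> j = s + wl c + wl b then co f v * co (wd [b, c] 1 * g) w else 0) +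
    (if a' = b \<and> j = s + wl c then co (f * wd [a] 1) v * co (wd [c] 1 * g) w else 0) +
    (if a' = c \<and> j = s then co (f * wd [a, b] 1) v * co g w else 0)"
  using assms(2-) unfolding assms(1)[symmetric] by (rule \<theta>_Fox3)

lemma co_mult_r: "co (f * wd v 1) (w @ v) = co f w"
  by (induction f rule: free_induct) (auto simp: co_wd lookup_add distrib_right)

lemma co_mult_l: "co (wd v 1 * f) (v @ w) = co f w"
  by (induction f rule: free_induct) (auto simp: co_wd lookup_add distrib_left)

lemma co_mult_0: "(\<And>u. w \<noteq> u @ v) \<Longrightarrow> co (f * wd v 1) w = 0" "(\<And>u. w \<noteq> v @ u) \<Longrightarrow> co (wd v 1 * f) w = 0"
proof -
  show "co (f * wd v 1) w = 0" if "\<And>u. w \<noteq> u @ v"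
    by (induction f rule: free_induct) (use that[symmetric] in \<open>auto simp: co_wd lookup_add distrib_right\<close>)
  show "co (wd v 1 * f) w = 0" if "\<And>u. w \<noteq> v @ u"
    by (induction f rule: free_induct) (use that[symmetric] in \<open>auto simp: co_wd lookup_add distrib_left\<close>)
qed

abbreviation Xp :: "nat \<Rightarrow> gen list" where "Xp p \<equiv> replicate p X"

lemma Xp_eq: "Xp p = Xp q \<longleftrightarrow> p = q"
  by (metis length_replicate)

lemma pure_simps [simp]: "pure (Xp p)" "pure []" "pure [Y, Y]"
  by (auto simp: pure_def)

lemma co_Xp:
  "co (f * wd [X] 1) (Xp p) = (if p \<ge> 1 then co f (Xp (p - 1)) else 0)"
  "co (f * wd [X, X] 1) (Xp p) = (if p \<ge> 2 then co f (Xp (p - 2)) else 0)"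
  "co (wd [X] 1 * f) (Xp p) = (if p \<ge> 1 then co f (Xp (p - 1)) else 0)"
  "co (wd [X, X] 1 * f) (Xp p) = (if p \<ge> 2 then co f (Xp (p - 2)) else 0)"
proof -
  have eq: "Xp p = Xp (p - k) @ Xp k" "Xp p = Xp k @ Xp (p - k)" if "k \<le> p" for k
    using that by (simp_all flip: replicate_add)
  have 0: "Xp p \<noteq> u @ v" "Xp p \<noteq> v @ u" if "p < length v" for u v
    using that by (metis length_append length_replicate not_add_less1 not_add_less2)+
  have X: "Xp 1 = [X]" "Xp 2 = [X, X]" by (simp_all add: numeral_2_eq_2 One_nat_def)
  show "co (f * wd [X] 1) (Xp p) = (if p \<ge> 1 then co f (Xp (p - 1)) else 0)"
  proof (cases "p \<ge> 1")
    case True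
    then show ?thesis using co_mult_r[of f "[X]" "Xp (p - 1)"] eq(1)[OF True] X by simp
  next
    case False
    then have "co (f * wd [X] 1) (Xp p) = 0" by (intro co_mult_0 0) simp
    then show ?thesis using False by simp
  qed
  show "co (f * wd [X, X] 1) (Xp p) = (if p \<ge> 2 then co f (Xp (p - 2)) else 0)"
  proof (cases "p \<ge> 2")
    case True
    then show ?thesis using co_mult_r[of f "[X, X]" "Xp (p - 2)"] eq(1)[OF True] X by simp
  next
    case False
    then have "co (f * wd [X, X] 1) (Xp p) = 0" by (intro co_mult_0 0) simp
    then show ?thesis using False by simp
  qed
  show "co (wd [X] 1 * f) (Xp p) = (if p \<ge> 1 then co f (Xp (p - 1)) else 0)"
  proof (cases "p \<ge> 1")
    case True
    then show ?thesis using co_mult_l[of "[X]" f "Xp (p - 1)"] eq(2)[OF True] X by simp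
  next
    case False
    then have "co (wd [X] 1 * f) (Xp p) = 0" by (intro co_mult_0 0) simp
    then show ?thesis using False by simp
  qed
  show "co (wd [X, X] 1 * f) (Xp p) = (if p \<ge> 2 then co f (Xp (p - 2)) else 0)"
  proof (cases "p \<ge> 2")
    case True
    then show ?thesis using co_mult_l[of "[X, X]" f "Xp (p - 2)"] eq(2)[OF True] X by simp
  next
    case False
    then have "co (wd [X, X] 1 * f) (Xp p) = 0" by (intro co_mult_0 0) simp
    then show ?thesis using False by simp
  qed
qed

lemma co_Y_Xp: "Y \<in> set v \<Longrightarrow> co (f * wd v 1) (Xp p) = 0" "Y \<in> set v \<Longrightarrow> co (wd v 1 * f) (Xp p) = 0"
proof -
  assume Y: "Y \<in> set v"
  have "Xp p \<noteq> u @ v" "Xp p \<noteq> v @ u" for u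
    using Y by (metis Un_iff gen.distinct(1) in_set_replicate set_append)+
  then show "co (f * wd v 1) (Xp p) = 0" "co (wd v 1 * f) (Xp p) = 0" by (auto intro: co_mult_0)
qed

lemma co_YY:
  "co (f * wd [Y, Y] 1) [Y, Y] = co f []" "co (f * wd [X] 1) [Y, Y] = 0" "co (f * wd [X, Y] 1) [Y, Y] = 0"
  "co (f * wd [Y, X] 1) [Y, Y] = 0" "co (f * wd [X, X] 1) [Y, Y] = 0"
  using co_mult_r[of f "[Y, Y]" "[]"]
  by (auto intro!: co_mult_0 simp: append_eq_Cons_conv Cons_eq_append_conv)

lemma co_Nil: "v \<noteq> [] \<Longrightarrow> co (wd v 1 * f) [] = 0"
  by (auto intro!: co_mult_0)

section \<open>Injectivity of the last differential\<close>

lemma bi_rel: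
  assumes "b \<in> carrier B" "c \<in> carrier B"
  shows "bi (Pr 1) b (Dx s (rel q)) c = (if q then
      bi (Pr 1) b (Fox s [X, X, Y]) c \<ominus>\<^bsub>Pr 1\<^esub> scal (Pr 1) \<beta> (bi (Pr 1) b (Fox s [Y, X, X]) c) \<ominus>\<^bsub>Pr 1\<^esub> scal (Pr 1) \<alpha> (bi (Pr 1) b (Fox s [X, Y, X]) c)
    else bi (Pr 1) b (Fox s [X, Y, Y]) c \<ominus>\<^bsub>Pr 1\<^esub> scal (Pr 1) \<beta> (bi (Pr 1) b (Fox s [Y, Y, X]) c) \<ominus>\<^bsub>Pr 1\<^esub> scal (Pr 1) \<alpha> (bi (Pr 1) b (Fox s [Y, X, Y]) c))"
  using assms by (simp add: rel_def Dx_diff Dx_wd bi_diff[OF PM] scal_bi[OF PM] scal_one[OF PM] bi_closed[OF PM]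
     scal_closed[OF PM] del: Fox.simps)

lemma \<theta>_scal:
  assumes p: "pure v" "pure w" and z: "z \<in> carrier (Pr k)"
  shows "\<theta> k t v w (scal (Pr k) c z) = c * \<theta> k t v w z"
  using z
proof (induction z rule: P_induct)
  case (gen t' j f i g)
  have "scal (Pr k) c (bi (Pr k) (Mu (tg k t') j f) (u k t') (Mu i (sr t') g)) =
     bi (Pr k) (Mu (tg k t') j (Poly_Mapping.map ((*) c) f)) (u k t') (Mu i (sr t') g)"
    using gen by (simp add: Mu_smult scal_bi[OF PM])
  then show ?case using gen p by (simp add: \<theta>_gen hom_smult)
next
  case (add y z)
  then show ?case using p by (simp add: scal_add[OF PM] \<theta>_add scal_closed[OF PM] algebra_simps)
qed (use p in \<open>simp add: scal_zero[OF PM]\<close>)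

lemma \<theta>_bi_rel:
  assumes p: "pure v" "pure w" and f: "hom (t - (s + rw q)) f" and g: "hom (s - i) g"
    and vf: "valid (s + rw q) t" and vg: "valid i s"
  shows "\<theta> 1 k v w (bi (Pr 1) (Mu (s + rw q) t f) (Dx s (rel q)) (Mu i s g)) =
    (let z = (\<lambda>a b c. \<theta> 1 k v w (bi (Pr 1) (Mu (s + wt [a, b, c]) t f) (Fox s [a, b, c]) (Mu i s g)))
     in if q then z X X Y - \<beta> * z Y X X - \<alpha> * z X Y X else z X Y Y - \<beta> * z Y Y X - \<alpha> * z Y X Y)"
proof -
  have b: "Mu (s + rw q) t f \<in> carrier B" "Mu i s g \<in> carrier B" using f g by auto
  have "s + wt [X, X, Y] = s + rw True" "s + wt [Y, X, X] = s + rw True" "s + wt [X, Y, X] = s + rw True"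
    "s + wt [X, Y, Y] = s + rw False" "s + wt [Y, Y, X] = s + rw False" "s + wt [Y, X, Y] = s + rw False"
    by (simp_all add: rw_def)
  then show ?thesis
    unfolding bi_rel[OF b] Let_def using p b
    by (cases q) (simp_all add: \<theta>_diff \<theta>_scal bi_closed[OF PM] scal_closed[OF PM] a_minus_def[symmetric] del: Fox.simps wt_simps)
qed

text \<open>With powers of x on both sides of an arrow y, only words with a single y contribute,
  hence only the relation \<open>rel True\<close>. Its words xxy, xyx and yxx move two, one or no
  letters x to the left and the remaining ones to the right. The coefficients of \<open>z\<close> in
  the last two terms carry smaller powers of x on the right than the first.\<close>

lemma identity1:
  assumes "z \<in> carrier (Pr 2)"
  shows "\<theta> 1 (ax Y j) (Xp p) (Xp q) (\<delta> 1 z) =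
    (if p \<ge> 2 then \<theta> 2 (rx True j) (Xp (p - 2)) (Xp q) z else 0)
    - \<alpha> * (if p \<ge> 1 \<and> q \<ge> 1 then \<theta> 2 (rx True (j - n)) (Xp (p - 1)) (Xp (q - 1)) z else 0)
    - \<beta> * (if q \<ge> 2 then \<theta> 2 (rx True (j - 2 * n)) (Xp p) (Xp (q - 2)) z else 0)"
  using assms
proof (induction z rule: P2_induct)
  case zero
  then show ?case using \<delta>.hom_zero[of 1] by (simp add: Suc_simps)
next
  case (gen b s t f i g)
  have s: "1 \<le> s" "valid i s" using gen by (auto simp: valid_def)
  have W: "wt [X, X, Y] = rw True" "wt [Y, X, X] = rw True" "wt [X, Y, X] = rw True"
    "wt [X, Y, Y] = rw False" "wt [Y, Y, X] = rw False" "wt [Y, X, Y] = rw False"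
    by (simp_all add: rw_def)
  have d: "\<delta> 1 (bi (Pr 2) (Mu (s + rw b) t f) (u 2 (rx b s)) (Mu i s g)) =
     bi (Pr 1) (Mu (s + rw b) t f) (Dx s (rel b)) (Mu i s g)"
    using \<delta>_bi[of _ _ _ 1] gen by (simp add: Suc_simps \<delta>1_u)
  have js: "j - n = s \<longleftrightarrow> j = s + n" "j - 2 * n = s \<longleftrightarrow> j = s + n + n" "s - n \<noteq> s" "s - 2 * n \<noteq> s"
    "s - n * 2 \<noteq> s" "n \<noteq> 0"
    using s nm by auto
  show ?case
    unfolding d \<theta>_bi_rel[OF pure_simps(1) pure_simps(1) gen(3,5,2,4)] Let_def
    unfolding W using gen
    by (cases b)
      (simp_all add: \<theta>_Fox3' W \<theta>_u2 js co_Xp co_Y_Xp del: wt_simps Fox.simps)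
next
  case (add y z)
  have D: "\<theta> 1 (ax Y j) (Xp p) (Xp q) (\<delta> 1 (y \<oplus>\<^bsub>Pr 2\<^esub> z)) =
    \<theta> 1 (ax Y j) (Xp p) (Xp q) (\<delta> 1 y) + \<theta> 1 (ax Y j) (Xp p) (Xp q) (\<delta> 1 z)"
    using add(1,2) \<delta>.hom_add[of y 1 z] \<delta>.closed[of y 1] \<delta>.closed[of z 1]
    by (simp add: Suc_simps \<theta>_add)
  show ?case unfolding D add(3,4) using add(1,2) by (simp add: \<theta>_add algebra_simps)
qed

text \<open>The word yyx is the only one whose derivative can have yy to the left of an arrow x and
  nothing to the right; it occurs in \<open>rel False\<close> with coefficient - \<beta>.\<close>

lemma identity2:
  assumes "z \<in> carrier (Pr 2)"
  shows "\<theta> 1 (ax X j) [Y, Y] [] (\<delta> 1 z) = - \<beta> * \<theta> 2 (rx False j) [] [] z"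
  using assms
proof (induction z rule: P2_induct)
  case zero
  then show ?case using \<delta>.hom_zero[of 1] by (simp add: Suc_simps)
next
  case (gen b s t f i g)
  have W: "wt [X, X, Y] = rw True" "wt [Y, X, X] = rw True" "wt [X, Y, X] = rw True"
    "wt [X, Y, Y] = rw False" "wt [Y, Y, X] = rw False" "wt [Y, X, Y] = rw False"
    by (simp_all add: rw_def)
  have d: "\<delta> 1 (bi (Pr 2) (Mu (s + rw b) t f) (u 2 (rx b s)) (Mu i s g)) =
     bi (Pr 1) (Mu (s + rw b) t f) (Dx s (rel b)) (Mu i s g)"
    using \<delta>_bi[of _ _ _ 1] gen by (simp add: Suc_simps \<delta>1_u)
  show ?case
    unfolding d \<theta>_bi_rel[OF pure_simps(3) pure_simps(2) gen(3,5,2,4)] Let_def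
    unfolding W using gen
    by (cases b)
      (simp_all add: \<theta>_Fox3' W \<theta>_u2 co_YY co_Nil del: wt_simps Fox.simps)
next
  case (add y z)
  then show ?case using \<delta>.hom_add[of y 1 z] \<delta>.closed[of y 1] \<delta>.closed[of z 1]
    by (simp add: Suc_simps \<theta>_add algebra_simps)
qed

lemma wt_ge_m: "Y \<in> set w \<Longrightarrow> m \<le> wt w"
  by (induction w) auto

lemma wt_Xp [simp]: "wt (Xp p) = p * n"
  by (induction p) auto

text \<open>A single y already weighs \<open>m\<close>, so below degree \<open>m\<close> only powers
  of x occur.\<close>

lemma hom_small:
  assumes f: "hom d f" and d: "d < m"
  shows "n dvd d \<Longrightarrow> f = wd (Xp (d div n)) (co f (Xp (d div n)))" "\<not> n dvd d \<Longrightarrow> f = 0"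
proof -
  have *: "w = Xp (d div n) \<and> n dvd d" if "co f w \<noteq> 0" for w
  proof -
    have w: "wt w = d" using co_hom[OF f that] .
    then have "Y \<notin> set w" using wt_ge_m[of w] d by auto
    then have "w = Xp (length w)" by (metis gen.exhaust replicate_eqI)
    moreover from this have "d = length w * n" using w wt_Xp by metis
    ultimately show ?thesis using nm by simp
  qed
  show "f = wd (Xp (d div n)) (co f (Xp (d div n)))" if "n dvd d"
  proof (rule poly_mapping_eqI)
    fix w
    show "Poly_Mapping.lookup f w = Poly_Mapping.lookup (wd (Xp (d div n)) (co f (Xp (d div n)))) w"
      using *[of "letters w"] by (cases w) (auto simp: co_wd)
  qed
  show "f = 0" if "\<not> n dvd d"
  proof (rule poly_mapping_eqI)
    fix w
    show "Poly_Mapping.lookup f w = Poly_Mapping.lookup 0 w"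
      using *[of "letters w"] that by (cases w) auto
  qed
qed

definition bas where "bas = (\<lambda>(b, i, k, l). bi (Pr 2) (Mw (i + rw b) (Xp k)) (u 2 (rx b i)) (Mw (i - l * n) (Xp l)))"
text \<open>The last condition reflects the room in the quiver: next to a relation of degree n + 2m
  fewer than \<open>n\<close> units of degree are left, too few for even one arrow x.\<close>

definition "Q = {(b, i, k, l). valid i (i + rw b) \<and> i + rw b + k * n \<le> \<L> \<and> l * n < i \<and> (\<not> b \<longrightarrow> k = 0 \<and> l = 0)}"

lemma finite_Q: "finite Q"
proof (rule finite_subset)
  show "Q \<subseteq> UNIV \<times> {..\<L>} \<times> {..\<L>} \<times> {..\<L>}"
  proof
    fix q assume "q \<in> Q"
    then obtain b i k l where q: "q = (b, i, k, l)" "valid i (i + rw b)" "i + rw b + k * n \<le> \<L>" "l * n < i"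
      by (auto simp: Q_def)
    have kl: "k \<le> k * n" "l \<le> l * n" using nm by simp_all
    have "i \<le> \<L>" using q(2) by (simp add: valid_def)
    moreover have "k \<le> \<L>" "l \<le> \<L>" using q(3,4) kl \<open>i \<le> \<L>\<close> by linarith+
    ultimately have "k \<le> \<L>" "l \<le> \<L>" "i \<le> \<L>" by auto
    then show "q \<in> UNIV \<times> {..\<L>} \<times> {..\<L>} \<times> {..\<L>}" using q by simp
  qed
qed auto

lemma bas_closed [simp]: "bas q \<in> carrier (Pr 2)"
  by (auto simp: bas_def bi_closed[OF PM] split: prod.splits)

text \<open>The coordinate functionals with respect to \<open>bas\<close>.\<close>

definition \<phi> where "\<phi> = (\<lambda>(b, i, k, l) z. \<theta> 2 (rx b i) (Xp k) (Xp l) z)"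

lemma P2_expand:
  assumes "z \<in> carrier (Pr 2)"
  shows "z = (\<Oplus>\<^bsub>Pr 2\<^esub>q\<in>Q. scal (Pr 2) (\<phi> q z) (bas q))"
  using assms
proof (induction z rule: P2_induct)
  case zero
  have "(\<Oplus>\<^bsub>Pr 2\<^esub>q\<in>Q. scal (Pr 2) (\<phi> q \<zero>\<^bsub>Pr 2\<^esub>) (bas q)) = (\<Oplus>\<^bsub>Pr 2\<^esub>q\<in>Q. \<zero>\<^bsub>Pr 2\<^esub>)"
    by (intro P.P.M.finsum_cong') (auto simp: \<phi>_def scal_zero[OF PM] split: prod.splits)
  then show ?case by simp
next
  case (gen b s t f i g)
  have v: "1 \<le> s" "s + rw b \<le> t" "t \<le> \<L>" "1 \<le> i" "i \<le> s" using gen by (auto simp: valid_def)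
  let ?z = "bi (Pr 2) (Mu (s + rw b) t f) (u 2 (rx b s)) (Mu i s g)"
  have \<phi>z: "\<phi> (b', i', k, l) ?z = (if b' = b \<and> i' = s then co f (Xp k) * co g (Xp l) else 0)" for b' i' k l
    unfolding \<phi>_def using gen by (simp add: \<theta>_u2)
  \<comment> \<open>Here the number 2(n+m) of vertices enters: a generator occupies
    \<open>rw b\<close> of the at most 2(n+m)-1 units of degree between the ends of the
    path.\<close>
  have lt: "t - (s + rw b) < m" "s - i < m" "\<not> b \<Longrightarrow> t - (s + rw b) < n" "\<not> b \<Longrightarrow> s - i < n"
    using v nm by (cases b; auto simp: rw_def \<L>_def)+
  show ?case
  proof (cases "n dvd (t - (s + rw b)) \<and> n dvd (s - i)")
    case False
    then have "f = 0 \<or> g = 0" using hom_small(2)[OF gen(3) lt(1)] hom_small(2)[OF gen(5) lt(2)] by auto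
    then have "?z = \<zero>\<^bsub>Pr 2\<^esub>" "\<phi> q ?z = 0" for q
      using gen by (cases q; auto simp: bi_zero[OF PM] \<phi>z)+
    then show ?thesis
      using scal_zero(2)[OF PM] by simp
  next
    case True
    define k l where "k = (t - (s + rw b)) div n" and "l = (s - i) div n"
    have kl: "t = s + rw b + k * n" "i = s - l * n" "l * n \<le> s - i" "l * n < s"
      using True v nm unfolding k_def l_def by auto
    have f: "f = wd (Xp k) (co f (Xp k))" and g: "g = wd (Xp l) (co g (Xp l))"
      using hom_small(1)[OF gen(3) lt(1)] hom_small(1)[OF gen(5) lt(2)] True unfolding k_def l_def by auto
    have q: "(b, s, k, l) \<in> Q"
    proof -
      have "\<not> b \<longrightarrow> k = 0 \<and> l = 0" using lt(3,4) by (simp add: k_def l_def)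
      moreover have "s + rw b + k * n \<le> \<L>" using kl(1) v(3) by simp
      ultimately show ?thesis using gen(1) kl(4) by (simp add: Q_def)
    qed
    have Mf: "Mu (s + rw b) t f = co f (Xp k) \<odot>\<^bsub>B\<^esub> Mw (s + rw b) (Xp k)"
      by (subst f) (use Mu_smult[of "s + rw b" t "co f (Xp k)" "wd (Xp k) 1"] kl in \<open>simp add: Mw_def\<close>)
    have Mg: "Mu i s g = co g (Xp l) \<odot>\<^bsub>B\<^esub> Mw (s - l * n) (Xp l)"
      by (subst g) (use Mu_smult[of i s "co g (Xp l)" "wd (Xp l) 1"] kl in \<open>simp add: Mw_def\<close>)
    have z: "?z = scal (Pr 2) (co f (Xp k) * co g (Xp l)) (bas (b, s, k, l))"
      unfolding Mf Mg bas_def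
      by (simp add: bi_smult scal_bi[OF PM] scal_mult[OF PM, symmetric] bi_closed[OF PM] mult.commute)
    have co_f: "co f (Xp k') = (if k' = k then co f (Xp k) else 0)" for k'
    proof -
      have "co f (Xp k') = co (wd (Xp k) (co f (Xp k))) (Xp k')" using f by simp
      also have "\<dots> = (if k' = k then co f (Xp k) else 0)" by (simp only: co_wd Xp_eq eq_commute[of k])
      finally show ?thesis .
    qed
    have co_g: "co g (Xp l') = (if l' = l then co g (Xp l) else 0)" for l'
    proof -
      have "co g (Xp l') = co (wd (Xp l) (co g (Xp l))) (Xp l')" using g by simp
      also have "\<dots> = (if l' = l then co g (Xp l) else 0)" by (simp only: co_wd Xp_eq eq_commute[of l])
      finally show ?thesis .
    qed
    have "(\<Oplus>\<^bsub>Pr 2\<^esub>q\<in>Q. scal (Pr 2) (\<phi> q ?z) (bas q)) = scal (Pr 2) (\<phi> (b, s, k, l) ?z) (bas (b, s, k, l))"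
    proof (rule P.P.M.finsum_single[OF finite_Q q])
      fix q assume "q \<noteq> (b, s, k, l)"
      moreover obtain b' s' k' l' where q: "q = (b', s', k', l')" by (cases q)
      ultimately have "\<phi> q ?z = 0" using co_f[of k'] co_g[of l'] by (auto simp: \<phi>z)
      then show "scal (Pr 2) (\<phi> q ?z) (bas q) = \<zero>\<^bsub>Pr 2\<^esub>" using scal_zero(2)[OF PM] by simp
    qed (simp add: scal_closed[OF PM])
    then show ?thesis by (simp add: \<phi>z flip: z)
  qed
next
  case (add y z)
  have "(\<Oplus>\<^bsub>Pr 2\<^esub>q\<in>Q. scal (Pr 2) (\<phi> q (y \<oplus>\<^bsub>Pr 2\<^esub> z)) (bas q)) =
    (\<Oplus>\<^bsub>Pr 2\<^esub>q\<in>Q. scal (Pr 2) (\<phi> q y) (bas q) \<oplus>\<^bsub>Pr 2\<^esub> scal (Pr 2) (\<phi> q z) (bas q))"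
  proof (intro P.P.M.finsum_cong' refl)
    fix q
    have "\<phi> q (y \<oplus>\<^bsub>Pr 2\<^esub> z) = \<phi> q y + \<phi> q z"
      using add by (cases q) (simp add: \<phi>_def \<theta>_add)
    then show "scal (Pr 2) (\<phi> q (y \<oplus>\<^bsub>Pr 2\<^esub> z)) (bas q) = scal (Pr 2) (\<phi> q y) (bas q) \<oplus>\<^bsub>Pr 2\<^esub> scal (Pr 2) (\<phi> q z) (bas q)"
      by (simp add: scal_add_l[OF PM])
  qed (auto simp: scal_closed[OF PM])
  also have "\<dots> = (\<Oplus>\<^bsub>Pr 2\<^esub>q\<in>Q. scal (Pr 2) (\<phi> q y) (bas q)) \<oplus>\<^bsub>Pr 2\<^esub> (\<Oplus>\<^bsub>Pr 2\<^esub>q\<in>Q. scal (Pr 2) (\<phi> q z) (bas q))"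
    by (rule P.P.M.finsum_addf) (auto simp: scal_closed[OF PM])
  finally show ?case using add by simp
qed

text \<open>For the relations \<open>rel True\<close> the identities are triangular in the power of
  x on the right, with leading coefficient one. For \<open>rel False\<close> a single identity
  suffices, and its coefficient - \<beta> is invertible.\<close>

lemma exact2:
  assumes z: "z \<in> carrier (Pr 2)" and dz: "\<delta> 1 z = \<zero>\<^bsub>Pr 1\<^esub>"
  shows "z = \<zero>\<^bsub>Pr 2\<^esub>"
proof -
  have T: "\<theta> 2 (rx True i) (Xp k) (Xp l) z = 0" for i k l
  \<comment> \<open>\<open>identity1\<close> is applied with \<open>p = k + 2\<close>, which makes
    its first term the wanted coefficient and reduces the others to smaller
    \<open>l\<close>.\<close>
  proof (induction l arbitrary: i k rule: less_induct)
    case (less l)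
    have A: "(if k + 2 \<ge> 1 \<and> l \<ge> 1 then \<theta> 2 (rx True (i - n)) (Xp (k + 2 - 1)) (Xp (l - 1)) z else 0) = 0"
      using less[of "l - 1" "i - n" "k + 2 - 1"] by simp
    have B: "(if l \<ge> 2 then \<theta> 2 (rx True (i - 2 * n)) (Xp (k + 2)) (Xp (l - 2)) z else 0) = 0"
      using less[of "l - 2" "i - 2 * n" "k + 2"] by simp
    have "0 = (if k + 2 \<ge> 2 then \<theta> 2 (rx True i) (Xp (k + 2 - 2)) (Xp l) z else 0) - \<alpha> * 0 - \<beta> * 0"
      using identity1[OF z, of i "k + 2" l] unfolding dz A B by (simp only: \<theta>_zero pure_simps)
    then show ?case by simp
  qed
  have F: "\<theta> 2 (rx False i) [] [] z = 0" for i
    using identity2[OF z, of i] \<beta> by (simp add: dz)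
  have "\<phi> q z = 0" if qQ: "q \<in> Q" for q
  proof -
    obtain b i k l where "q = (b, i, k, l)" "\<not> b \<longrightarrow> k = 0 \<and> l = 0" using qQ by (auto simp: Q_def)
    then show ?thesis using T[of i k l] F[of i] by (cases b) (simp_all add: \<phi>_def)
  qed
  then have "(\<Oplus>\<^bsub>Pr 2\<^esub>q\<in>Q. scal (Pr 2) (\<phi> q z) (bas q)) = (\<Oplus>\<^bsub>Pr 2\<^esub>q\<in>Q. \<zero>\<^bsub>Pr 2\<^esub>)"
    by (intro P.P.M.finsum_cong') (auto simp: scal_zero(2)[OF PM])
  then show ?thesis using P2_expand[OF z] by simp
qed

lemma Pr_trivial: "k > 2 \<Longrightarrow> carrier (Pr k) = {\<zero>\<^bsub>Pr k\<^esub>}"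
proof -
  assume "k > 2"
  then have T: "T k = {}" by (rule T_empty)
  have "x = \<zero>\<^bsub>Pr k\<^esub>" if "x \<in> carrier (Pr k)" for x
  proof
    fix l
    show "x l = (\<zero>\<^bsub>Pr k\<^esub>) l" using that T unfolding P.idem_carrier idem_module_simps by simp
  qed
  then show ?thesis using P.P.M.zero_closed[of k] by auto
qed

theorem resolution: "projective_resolution E.R E.M Pr \<delta> aug"
  unfolding projective_resolution_def
proof (intro conjI allI)
  show "projective_module E.R (Pr i)" for i
    \<comment> \<open>Any two distinct elements of the element type will do as labels.\<close>
    by (rule P.projective_idem[of "{}" UNIV]) simp
  show "\<delta> i \<in> LinearCombinations.module_hom E.R (Pr (Suc i)) (Pr i)" for i by (rule \<delta>_hom)
  show "aug \<in> LinearCombinations.module_hom E.R (Pr 0) E.M" by (rule aug_hom)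
  show "aug ` carrier (Pr 0) = carrier E.M" using aug_surj by simp
  show "\<delta> 0 ` carrier (Pr 1) = {x \<in> carrier (Pr 0). aug x = \<zero>\<^bsub>E.M\<^esub>}"
    using exact0 aug_\<delta> \<delta>.closed[of _ 0] by (auto simp: Suc_simps)
  fix i
  show "\<delta> (Suc i) ` carrier (Pr (Suc (Suc i))) = {x \<in> carrier (Pr (Suc i)). \<delta> i x = \<zero>\<^bsub>Pr i\<^esub>}"
  proof (cases "i = 0")
    case True
    then show ?thesis using exact1 \<delta>\<delta> \<delta>.closed[of _ 1] by (auto simp: Suc_simps im1_def)
  next
    case False
    then have 1: "\<delta> (Suc i) ` carrier (Pr (Suc (Suc i))) = {\<zero>\<^bsub>Pr (Suc i)\<^esub>}"
      using \<delta>.hom_zero[of "Suc i"] by (subst Pr_trivial) auto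
    have "x = \<zero>\<^bsub>Pr (Suc i)\<^esub>" if "x \<in> carrier (Pr (Suc i))" "\<delta> i x = \<zero>\<^bsub>Pr i\<^esub>" for x
    proof (cases "i = 1")
      case True
      then show ?thesis using exact2[of x] that by (simp add: Suc_simps)
    next
      case False
      then show ?thesis using Pr_trivial[of "Suc i"] that \<open>i \<noteq> 0\<close> by simp
    qed
    then show ?thesis unfolding 1 using \<delta>.hom_zero[of i] by auto
  qed
qed


section \<open>Cochains with values in the Beilinson algebra\<close>

text \<open>Linear functionals on the free algebra that descend to the down-up algebra.\<close>

definition lf :: "((gen free_monoid \<Rightarrow>\<^sub>0 'k) \<Rightarrow> 'k) \<Rightarrow> bool" where
  "lf \<xi> \<longleftrightarrow> (\<forall>f g. \<xi> (f + g) = \<xi> f + \<xi> g) \<and> (\<forall>c f. \<xi> (Poly_Mapping.map ((*) c) f) = c * \<xi> f) \<and> (\<forall>f\<in>I. \<xi> f = 0)"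

definition fnl where "fnl \<xi> U = \<xi> (SOME f. \<pi> f = U)"

lemma fnl_\<pi>: "lf \<xi> \<Longrightarrow> fnl \<xi> (\<pi> f) = \<xi> f"
proof -
  assume \<xi>: "lf \<xi>"
  have "\<pi> (SOME g. \<pi> g = \<pi> f) = \<pi> f" by (rule someI) simp
  then have "\<xi> ((SOME g. \<pi> g = \<pi> f) - f) = 0" using \<xi> by (auto simp: lf_def \<pi>_eq_iff)
  moreover have "\<xi> (SOME g. \<pi> g = \<pi> f) = \<xi> ((SOME g. \<pi> g = \<pi> f) - f) + \<xi> f"
    using \<xi> unfolding lf_def by (metis diff_add_cancel)
  ultimately show ?thesis by (simp add: fnl_def)
qed

abbreviation "Hom k \<equiv> LinearCombinations.module_hom E.R (Pr k) E.M"
abbreviation "HS k \<equiv> hom_space E.R (Pr k) E.M"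

definition coord where "coord \<xi> k t f = fnl \<xi> (f (u k t) (sr t) (tg k t))"

lemma T_valid: "t \<in> T k \<Longrightarrow> valid (sr t) (tg k t)" "tg k t - sr t = len k t"
  by (auto simp: T_def sr_def tg_def)

text \<open>A bimodule map respects the two idempotents that fix a generator. Its value there is
  therefore concentrated in one matrix entry, which is represented by a homogeneous element.\<close>

lemma hom_val:
  assumes f: "f \<in> Hom k" and t: "t \<in> T k"
  obtains h where "hom (len k t) h" "f (u k t) = Mu (sr t) (tg k t) h" "f (u k t) (sr t) (tg k t) = \<pi> h"
proof -
  have v: "valid (sr t) (tg k t)" by (rule T_valid(1)[OF t])
  have c: "f (u k t) \<in> carrier B" using f by (auto simp: LinearCombinations.module_hom_def)
  then obtain F where F: "F \<in> FM" "f (u k t) = cls F" by (auto simp: B_carrier)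
  have "f (u k t) = f (bi (Pr k) (e (tg k t)) (u k t) (e (sr t)))" by (simp add: u_e)
  also have "\<dots> = e (tg k t) \<otimes>\<^bsub>B\<^esub> f (u k t) \<otimes>\<^bsub>B\<^esub> e (sr t)"
    using hom_bi[OF f, of "e (tg k t)" "e (sr t)" "u k t"] c by (simp add: bi_def E.M_act)
  finally have eq: "f (u k t) = e (tg k t) \<otimes>\<^bsub>B\<^esub> cls F \<otimes>\<^bsub>B\<^esub> e (sr t)" using F by simp
  have h: "hom (len k t) (F (sr t) (tg k t))"
    using F(1) T_valid(2)[of k t] by (simp add: FM_def) metis
  have "e (tg k t) \<otimes>\<^bsub>B\<^esub> b \<otimes>\<^bsub>B\<^esub> e (sr t) = Mu (sr t) (tg k t) g" if "b = cls F" "g = F (sr t) (tg k t)" "F \<in> FM" for b F g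
  proof -
    have hF: "hom (j - i) (F i j)" for i j using that(3) by (auto simp: FM_def)
    have Mc: "Mu i j (F i j) \<in> carrier B" for i j by (rule Mu_closed[OF hF])
    have "e (tg k t) \<otimes>\<^bsub>B\<^esub> b \<otimes>\<^bsub>B\<^esub> e (sr t) =
      (\<Oplus>\<^bsub>B\<^esub>p\<in>{1..\<L>} \<times> {1..\<L>}. e (tg k t) \<otimes>\<^bsub>B\<^esub> Mu (fst p) (snd p) (F (fst p) (snd p)) \<otimes>\<^bsub>B\<^esub> e (sr t))"
      unfolding that(1) B_expand[OF that(3)] using Mc
      by (simp add: B.finsum_rdistr B.finsum_ldistr Pi_def)
    also have "\<dots> = e (tg k t) \<otimes>\<^bsub>B\<^esub> Mu (fst (sr t, tg k t)) (snd (sr t, tg k t)) (F (fst (sr t, tg k t)) (snd (sr t, tg k t))) \<otimes>\<^bsub>B\<^esub> e (sr t)"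
    proof (rule B.finsum_single)
      fix p assume "p \<noteq> (sr t, tg k t)"
      then have "fst p \<noteq> sr t \<or> snd p \<noteq> tg k t" by (cases p) auto
      then show "e (tg k t) \<otimes>\<^bsub>B\<^esub> Mu (fst p) (snd p) (F (fst p) (snd p)) \<otimes>\<^bsub>B\<^esub> e (sr t) = \<zero>\<^bsub>B\<^esub>"
        using Mc hF by (auto simp: Mu_e)
    qed (use v Mc in \<open>auto simp: valid_def\<close>)
    also have "\<dots> = Mu (sr t) (tg k t) g" using hF that(2) by (simp add: Mu_e)
    finally show ?thesis .
  qed
  from this[OF refl refl F(1)] eq have M: "f (u k t) = Mu (sr t) (tg k t) (F (sr t) (tg k t))" by simp
  show ?thesis by (rule that[OF h M]) (use v in \<open>simp add: M Mu_entry\<close>)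
qed

lemma coord_val:
  assumes "f (u k t) = Mu (sr t) (tg k t) h" "t \<in> T k" "lf \<xi>"
  shows "coord \<xi> k t f = \<xi> h"
  using assms T_valid(1)[of t k] by (simp add: coord_def Mu_entry fnl_\<pi>)

lemma scalar_act: "b \<in> carrier B \<Longrightarrow> (c \<odot>\<^bsub>E.R\<^esub> \<one>\<^bsub>E.R\<^esub>) \<odot>\<^bsub>E.M\<^esub> b = c \<odot>\<^bsub>B\<^esub> b"
  by (simp add: E.R_scalar E.M_act B.smult_mult_l)

lemma coord_add:
  assumes f: "f \<in> Hom k" and g: "g \<in> Hom k" and t: "t \<in> T k" and \<xi>: "lf \<xi>"
  shows "coord \<xi> k t (f \<oplus>\<^bsub>HS k\<^esub> g) = coord \<xi> k t f + coord \<xi> k t g"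
proof -
  obtain h h' where h: "f (u k t) = Mu (sr t) (tg k t) h" "g (u k t) = Mu (sr t) (tg k t) h'"
    using hom_val[OF f t] hom_val[OF g t] by metis
  then have "(f \<oplus>\<^bsub>HS k\<^esub> g) (u k t) = Mu (sr t) (tg k t) (h + h')"
    by (simp add: hom_space_simps Mu_add)
  then show ?thesis using h t \<xi> by (simp add: coord_val) (simp add: lf_def)
qed

lemma coord_smult:
  assumes f: "f \<in> Hom k" and t: "t \<in> T k" and \<xi>: "lf \<xi>"
  shows "coord \<xi> k t (c \<odot>\<^bsub>HS k\<^esub> f) = c * coord \<xi> k t f"
proof -
  obtain h where h: "hom (len k t) h" "f (u k t) = Mu (sr t) (tg k t) h" using hom_val[OF f t] by metis
  have "Mu (sr t) (tg k t) h \<in> carrier B" using h(1) T_valid(2)[of k t] by (intro Mu_closed) simp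
  then have "(c \<odot>\<^bsub>HS k\<^esub> f) (u k t) = Mu (sr t) (tg k t) (Poly_Mapping.map ((*) c) h)"
    using h by (simp add: hom_space_simps Mu_smult scalar_act)
  then show ?thesis using h t \<xi> by (simp add: coord_val) (simp add: lf_def)
qed

definition mk where
  "mk k \<eta> = restrict (idem_ext E.R E.M (ix ` T k) (\<lambda>l. Mu (sr (length l)) (tg k (length l)) (\<eta> (length l)))) (carrier (Pr k))"

lemma mk:
  assumes \<eta>: "\<And>t. t \<in> T k \<Longrightarrow> hom (len k t) (\<eta> t)"
  shows "mk k \<eta> \<in> Hom k" "mk k \<eta> \<in> extensional (carrier (Pr k))"
    "t \<in> T k \<Longrightarrow> mk k \<eta> (u k t) = Mu (sr t) (tg k t) (\<eta> t)"
proof -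
  have c: "Mu (sr t) (tg k t) (\<eta> t) \<in> carrier B" if "t \<in> T k" for t
    using \<eta>[OF that] T_valid(2)[of k t] by (intro Mu_closed) simp
  show "mk k \<eta> \<in> Hom k"
    unfolding mk_def by (rule restrict_hom[OF PM P.ext_hom[OF E.M.right_module_axioms]]) (use c in auto)
  show "mk k \<eta> \<in> extensional (carrier (Pr k))" by (simp add: mk_def)
  show "mk k \<eta> (u k t) = Mu (sr t) (tg k t) (\<eta> t)" if t: "t \<in> T k"
  proof -
    have "mk k \<eta> (u k t) = idem_ext E.R E.M (ix ` T k) (\<lambda>l. Mu (sr (length l)) (tg k (length l)) (\<eta> (length l))) (idem_unit E.R (eps k) (ix t))"
      using t u_closed[of k t] by (simp add: mk_def u_def)
    also have "\<dots> = eps k (ix t) \<odot>\<^bsub>E.M\<^esub> Mu (sr t) (tg k t) (\<eta> t)"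
      using c t by (subst P.ext_unit[OF E.M.right_module_axioms]) auto
    also have "\<dots> = Mu (sr t) (tg k t) (\<eta> t)"
      using c[OF t] \<eta>[OF t] T_valid(2)[of k t] by (simp add: eps_def E.M_act Mu_e)
    finally show ?thesis .
  qed
qed

lemma Hom_eqI:
  assumes f: "f \<in> Hom k" and g: "g \<in> Hom k" and eq: "\<And>t. t \<in> T k \<Longrightarrow> f (u k t) = g (u k t)" and x: "x \<in> carrier (Pr k)"
  shows "f x = g x"
  by (rule P.hom_eqI[OF E.M.right_module_axioms f g _ x]) (use eq in \<open>auto simp: u_def\<close>)

lemma zero_Hom: "(\<lambda>x. \<zero>\<^bsub>B\<^esub>) \<in> Hom k"
  using E.M.act_zero by (intro module_homI) auto

lemma cocycle_iff:
  assumes f: "f \<in> Hom k" "f \<in> extensional (carrier (Pr k))"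
  shows "f \<in> hom_cocycles E.R Pr \<delta> E.M k \<longleftrightarrow> (\<forall>t\<in>T (Suc k). f (\<delta> k (u (Suc k) t)) = \<zero>\<^bsub>B\<^esub>)"
proof
  assume "\<forall>t\<in>T (Suc k). f (\<delta> k (u (Suc k) t)) = \<zero>\<^bsub>B\<^esub>"
  then have "f (\<delta> k x) = \<zero>\<^bsub>B\<^esub>" if "x \<in> carrier (Pr (Suc k))" for x
    using Hom_eqI[OF module_hom_comp[OF \<delta>_hom f(1)] zero_Hom _ that] by blast
  then show "f \<in> hom_cocycles E.R Pr \<delta> E.M k" using f by (simp add: hom_cocycles_iff)
qed (simp add: hom_cocycles_iff)

lemma coboundary_iff:
  assumes f: "f \<in> Hom (Suc k)" "f \<in> extensional (carrier (Pr (Suc k)))"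
  shows "f \<in> hom_coboundaries E.R Pr \<delta> E.M (Suc k) \<longleftrightarrow>
    (\<exists>h\<in>Hom k. \<forall>t\<in>T (Suc k). f (u (Suc k) t) = h (\<delta> k (u (Suc k) t)))"
proof
  assume "f \<in> hom_coboundaries E.R Pr \<delta> E.M (Suc k)"
  then show "\<exists>h\<in>Hom k. \<forall>t\<in>T (Suc k). f (u (Suc k) t) = h (\<delta> k (u (Suc k) t))"
    by (auto simp: hom_coboundaries_Suc_iff)
next
  assume "\<exists>h\<in>Hom k. \<forall>t\<in>T (Suc k). f (u (Suc k) t) = h (\<delta> k (u (Suc k) t))"
  then obtain h where h: "h \<in> Hom k" "\<And>t. t \<in> T (Suc k) \<Longrightarrow> f (u (Suc k) t) = h (\<delta> k (u (Suc k) t))" by auto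
  have "f x = h (\<delta> k x)" if "x \<in> carrier (Pr (Suc k))" for x
    using Hom_eqI[OF f(1) module_hom_comp[OF \<delta>_hom h(1)] h(2) that] by simp
  then show "f \<in> hom_coboundaries E.R Pr \<delta> E.M (Suc k)"
    unfolding hom_coboundaries_Suc_iff using f(2) restrict_hom[OF PM h(1)] \<delta>.closed
    by (intro conjI bexI[of _ "restrict h (carrier (Pr k))"]) auto
qed

text \<open>Combines the explicit resolution with \<open>has_dim_Ext\<close>; after this each degree
  is linear algebra with the scalars of cochains.\<close>

lemma coordsI:
  assumes add: "\<And>f g j. j < D \<Longrightarrow> f \<in> Hom k \<Longrightarrow> g \<in> Hom k \<Longrightarrow> \<psi> j (f \<oplus>\<^bsub>HS k\<^esub> g) = \<psi> j f + \<psi> j g"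
    and sm: "\<And>f c j. j < D \<Longrightarrow> f \<in> Hom k \<Longrightarrow> \<psi> j (c \<odot>\<^bsub>HS k\<^esub> f) = c * \<psi> j f"
    and surj: "\<And>v. \<exists>f\<in>hom_cocycles E.R Pr \<delta> E.M k. \<forall>j<D. \<psi> j f = v j"
    and ker: "\<And>f. f \<in> hom_cocycles E.R Pr \<delta> E.M k \<Longrightarrow> (\<forall>j<D. \<psi> j f = 0) \<longleftrightarrow> f \<in> hom_coboundaries E.R Pr \<delta> E.M k"
  shows "has_dim (HH k B) D"
proof -
  let ?Z = "hom_cocycles E.R Pr \<delta> E.M k"
  let ?\<Phi> = "\<lambda>f. vec D (\<lambda>j. \<psi> j f)"
  have ZH: "f \<in> Hom k" if "f \<in> ?Z" for f using that by (simp add: hom_cocycles_iff)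
  have "cohomology_coords E.R Pr \<delta> E.M k D ?\<Phi>"
    unfolding cohomology_coords_def
  proof (intro conjI ballI allI)
    fix f g assume "f \<in> ?Z" "g \<in> ?Z"
    then show "?\<Phi> (f \<oplus>\<^bsub>HS k\<^esub> g) = ?\<Phi> f + ?\<Phi> g" using ZH by (intro eq_vecI) (auto simp: add)
  next
    fix f c assume "f \<in> ?Z"
    then show "?\<Phi> (c \<odot>\<^bsub>HS k\<^esub> f) = c \<cdot>\<^sub>v ?\<Phi> f" using ZH by (intro eq_vecI) (auto simp: sm)
  next
    show "?\<Phi> ` ?Z = carrier_vec D"
    proof
      show "carrier_vec D \<subseteq> ?\<Phi> ` ?Z"
      proof
        fix v :: "'k vec" assume v: "v \<in> carrier_vec D"
        obtain f where f: "f \<in> ?Z" "\<forall>j<D. \<psi> j f = v $ j" using surj[of "\<lambda>j. v $ j"] by blast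
        then have "v = ?\<Phi> f" using v by (intro eq_vecI) auto
        then show "v \<in> ?\<Phi> ` ?Z" using f(1) by blast
      qed
    qed auto
  next
    fix f assume f: "f \<in> ?Z"
    have "?\<Phi> f = 0\<^sub>v D \<longleftrightarrow> (\<forall>j<D. \<psi> j f = 0)"
      by (auto simp: vec_eq_iff)
    then show "?\<Phi> f = 0\<^sub>v D \<longleftrightarrow> f \<in> hom_coboundaries E.R Pr \<delta> E.M k" using ker[OF f] by simp
  qed
  from has_dim_Ext[OF E.central_scalars_R E.M.right_module_axioms E.M.right_module_axioms resolution this]
  show ?thesis by (simp add: HH_def E.R_env)
qed

section \<open>Homogeneous components in low degrees\<close>

lemma wt_count: "wt w = n * count_list w X + m * count_list w Y"
  using weight_wt[of w] by (simp add: weight_def)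

lemma length_count: "length w = count_list w X + count_list w Y"
proof (induction w)
  case (Cons a w)
  then show ?case by (cases a) auto
qed simp

lemma count3:
  assumes "length w = 3"
  obtains a b c where "w = [a, b, c]"
  using assms by (auto simp: length_Suc_conv numeral_3_eq_3)

lemma wt_n: "wt w = n \<Longrightarrow> w = [X]"
proof -
  assume w: "wt w = n"
  have "Y \<notin> set w" using wt_ge_m[of w] w nm by auto
  then have *: "w = Xp (length w)" by (metis gen.exhaust replicate_eqI)
  then have "length w * n = n" using w wt_Xp by metis
  then have "length w = 1" using nm by simp
  then show ?thesis using * by (metis replicate_0 replicate_Suc One_nat_def)
qed

text \<open>As \<open>n\<close> does not divide \<open>m\<close>, a letter y must occur, and two of
  them would be too heavy.\<close>

lemma wt_m: "wt w = m \<Longrightarrow> w = [Y]"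
proof -
  assume w: "wt w = m"
  let ?p = "count_list w X" and ?q = "count_list w Y"
  have eq: "n * ?p + m * ?q = m" using w by (simp add: wt_count)
  have "?q \<noteq> 0" using eq nm(4) by (metis add.right_neutral dvd_triv_left mult_0_right)
  moreover have "?q \<le> 1"
  proof (rule ccontr)
    assume "\<not> ?q \<le> 1"
    then have "m * 2 \<le> m * ?q" by (intro mult_le_mono2) auto
    then show False using eq nm by linarith
  qed
  ultimately have q: "?q = 1" by linarith
  then have p: "?p = 0" using eq nm by simp
  have "length w = 1" using p q length_count[of w] by simp
  then obtain a where "w = [a]" by (auto simp: length_Suc_conv One_nat_def)
  then show ?thesis using q by (cases a) auto
qed

text \<open>A Diophantine equation for the number of letters y. More than two are too heavy, and the
  other wrong numbers would make \<open>n\<close> divide \<open>m\<close>, with one exception: in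
  degree n + 2m, having none makes \<open>n\<close> divide 2m, hence \<open>n = 2\<close> by
  coprimality.\<close>

lemma wt_rel: "wt w = rw b \<Longrightarrow> (if b then w \<in> {[X, X, Y], [X, Y, X], [Y, X, X]}
    else w \<in> {[X, Y, Y], [Y, X, Y], [Y, Y, X]} \<or> n = 2 \<and> w = Xp (m + 1))"
proof -
  assume w: "wt w = rw b"
  let ?p = "count_list w X" and ?q = "count_list w Y"
  show ?thesis
  proof (cases b)
    case True
    have eq: "n * ?p + m * ?q = 2 * n + m" using w True by (simp add: wt_count rw_def)
    have "?q \<noteq> 0"
    proof
      assume "?q = 0"
      then have "n * ?p = n * 2 + m" using eq by simp
      then have "n dvd m" by (metis dvd_add_right_iff dvd_triv_left)
      then show False using nm by simp
    qed
    moreover have "?q \<noteq> 2"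
    proof
      assume "?q = 2"
      then have "n * ?p + m = n * 2" using eq by simp
      then have "n dvd m" by (metis dvd_add_right_iff dvd_triv_left)
      then show False using nm by simp
    qed
    moreover have "?q \<le> 2"
    proof (rule ccontr)
      assume "\<not> ?q \<le> 2"
      then have "m * 3 \<le> m * ?q" by (intro mult_le_mono2) auto
      then show False using eq nm by linarith
    qed
    ultimately have q: "?q = 1" by linarith
    then have p: "?p = 2" using eq nm by simp
    have "length w = 3" using p q length_count[of w] by simp
    then obtain a b c where "w = [a, b, c]" by (rule count3)
    then show ?thesis using True p q by (cases a; cases b; cases c) auto
  next
    case False
    have eq: "n * ?p + m * ?q = n + 2 * m" using w False by (simp add: wt_count rw_def)
    have "?q \<noteq> 1"
    proof
      assume "?q = 1"
      then have "n * ?p = n * 1 + m" using eq by simp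
      then have "n dvd m" by (metis dvd_add_right_iff dvd_triv_left)
      then show False using nm by simp
    qed
    moreover have "?q \<le> 2"
    proof (rule ccontr)
      assume "\<not> ?q \<le> 2"
      then have "m * 3 \<le> m * ?q" by (intro mult_le_mono2) auto
      then show False using eq nm by linarith
    qed
    ultimately consider "?q = 0" | "?q = 2" by linarith
    then show ?thesis
    proof cases
      case 1
      then have p: "n * ?p = n * 1 + 2 * m" using eq by simp
      then have "n dvd 2 * m" by (metis dvd_add_right_iff dvd_triv_left)
      then have "n dvd 2" using coprime by (metis coprime_dvd_mult_left_iff coprime_iff_gcd_eq_1)
      then have n2: "n = 2" using nm by (auto dest: dvd_imp_le)
      then have "?p = m + 1" using p by simp
      then have "length w = m + 1" using 1 length_count[of w] by simp
      moreover have "Y \<notin> set w" using 1 by (simp add: count_list_0_iff)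
      then have "w = Xp (length w)" by (metis gen.exhaust replicate_eqI)
      ultimately show ?thesis using False n2 by simp
    next
      case 2
      then have p: "?p = 1" using eq nm by simp
      have "length w = 3" using p 2 length_count[of w] by simp
      then obtain a b c where "w = [a, b, c]" by (rule count3)
      then show ?thesis using False p 2 by (cases a; cases b; cases c) auto
    qed
  qed
qed

lemma hom_eqI: "hom d f \<Longrightarrow> hom d g \<Longrightarrow> (\<And>w. wt w = d \<Longrightarrow> co f w = co g w) \<Longrightarrow> f = g"
proof (rule poly_mapping_eqI)
  fix w :: "gen free_monoid" assume *: "hom d f" "hom d g" "\<And>w. wt w = d \<Longrightarrow> co f w = co g w"
  obtain v where v: "w = Word v" by (cases w)
  show "Poly_Mapping.lookup f w = Poly_Mapping.lookup g w"
    unfolding v using * co_hom[OF *(1), of v] co_hom[OF *(2), of v] by (cases "wt v = d") metis+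
qed

lemma hom_letter: "hom (wl a) h \<Longrightarrow> h = wd [a] (co h [a])"
  by (rule hom_eqI[of "wl a"]) (auto intro!: hom_wd simp: co_wd split: gen.splits dest: wt_n wt_m)

lemma hom_0: "hom 0 h \<Longrightarrow> h = wd [] (co h [])"
proof (rule hom_eqI[of 0])
  fix w :: "gen list" assume "wt w = 0"
  then have "w = []" using nm by (cases w) (auto split: gen.splits)
  then show "co h w = co (wd [] (co h [])) w" by (simp add: co_wd)
qed (auto intro: hom_wd)

text \<open>The coordinates of a relation with respect to the basis \<open>yxx\<close>, \<open>xyx\<close> (or \<open>yyx\<close>, \<open>yxy\<close>
  and, if \<open>n = 2\<close>, the power of \<open>x\<close>); \<open>xxy\<close> and \<open>xyy\<close> are eliminated by the relations.\<close>

definition qa where "qa b h = (if b then co h [Y, X, X] + \<beta> * co h [X, X, Y] else co h [Y, Y, X] + \<beta> * co h [X, Y, Y])"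
definition qb where "qb b h = (if b then co h [X, Y, X] + \<alpha> * co h [X, X, Y] else co h [Y, X, Y] + \<alpha> * co h [X, Y, Y])"
definition qe where "qe h = co h (Xp (m + 1))"

lemma three_append:
  "v @ a # b # c # w = [a', b', c'] \<longleftrightarrow> v = [] \<and> w = [] \<and> a = a' \<and> b = b' \<and> c = c'"
  by (auto simp: append_eq_Cons_conv)

lemma lf_co: "pure w \<Longrightarrow> lf (\<lambda>h. co h w)"
  by (auto simp: lf_def lookup_add co_pure_I)

lemma q_add: "qa b (f + g) = qa b f + qa b g" "qb b (f + g) = qb b f + qb b g"
  by (simp_all add: qa_def qb_def lookup_add algebra_simps)

text \<open>A relation multiplied by a nonempty word has words of length above three only, so just
  the relations themselves meet these coefficients. On them the leading word cancels against the
  word weighted by \<beta> or by \<alpha>.\<close>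

lemma q_ideal: "f \<in> I \<Longrightarrow> qa b f = 0 \<and> qb b f = 0"
proof (induction f rule: I_induct)
  case zero
  show ?case by (simp add: qa_def qb_def)
next
  case (rel u c b' v)
  show ?case
    unfolding rel_expand by (cases b; cases b') (auto simp: qa_def qb_def lookup_minus co_wd three_append)
next
  case (add f g)
  then show ?case by (simp add: q_add)
qed

lemma lf_q: "lf (qa b)" "lf (qb b)" "lf qe"
proof -
  show "lf (qa b)" "lf (qb b)"
    unfolding lf_def using q_add q_ideal by (auto simp: qa_def qb_def algebra_simps)
  show "lf qe" unfolding qe_def by (rule lf_co) simp
qed

text \<open>The guard keeps the result homogeneous: x^(m+1) has degree n + 2m only for
  \<open>n = 2\<close>.\<close>

definition nf where
  "nf b p q r = (if b then wd [Y, X, X] p + wd [X, Y, X] q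
     else wd [Y, Y, X] p + wd [Y, X, Y] q + (if n = 2 then wd (Xp (m + 1)) r else 0))"

lemma hom_nf: "hom (rw b) (nf b p q r)"
proof -
  have 1: "hom (rw True) (wd [Y, X, X] p + wd [X, Y, X] q)" "hom (rw False) (wd [Y, Y, X] p + wd [Y, X, Y] q)"
    by (intro hom_add hom_wd; simp add: rw_def)+
  have 2: "hom (rw False) (if n = 2 then wd (Xp (m + 1)) r else 0)"
  proof (cases "n = 2")
    case True
    then have "wt (Xp (m + 1)) = rw False" unfolding wt_Xp rw_def by simp
    from hom_wd[OF this] show ?thesis unfolding if_P[OF True] .
  qed simp
  show ?thesis
    by (cases b; simp only: nf_def if_True if_False 1 hom_add[OF 1(2) 2])
qed

lemma Xp_ne: "Xp (m + 1) \<noteq> Y # w" "Xp (m + 1) \<noteq> a # Y # w" "Y # w \<noteq> Xp (m + 1)" "a # Y # w \<noteq> Xp (m + 1)"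
  "Xp (m + 1) \<noteq> [a, b, Y]" "[a, b, Y] \<noteq> Xp (m + 1)"
proof -
  have "Y \<notin> set (Xp (m + 1))" by simp
  then show "Xp (m + 1) \<noteq> Y # w" "Xp (m + 1) \<noteq> a # Y # w" "Y # w \<noteq> Xp (m + 1)" "a # Y # w \<noteq> Xp (m + 1)"
    "Xp (m + 1) \<noteq> [a, b, Y]" "[a, b, Y] \<noteq> Xp (m + 1)" by (metis list.set_intros)+
qed

lemma q_nf: "qa b (nf b p q r) = p" "qb b (nf b p q r) = q" "n = 2 \<Longrightarrow> qe (nf False p q r) = r"
  unfolding qa_def qb_def qe_def nf_def using Xp_ne
  by (auto simp: lookup_add co_wd simp del: replicate_Suc)

lemma Mu_nf:
  assumes h: "hom (rw b) h"
  shows "Mu i j h = Mu i j (nf b (qa b h) (qb b h) (qe h))"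
proof -
  \<comment> \<open>The coefficient of the word that is eliminated; this multiple of the relation
    accounts for the difference between \<open>h\<close> and its normal form.\<close>
  define c where "c = (if b then co h [X, X, Y] else co h [X, Y, Y])"
  have "h = nf b (qa b h) (qb b h) (qe h) + Poly_Mapping.map ((*) c) (rel b)"
  proof (rule hom_eqI[OF h])
    show "hom (rw b) (nf b (qa b h) (qb b h) (qe h) + Poly_Mapping.map ((*) c) (rel b))"
      by (intro hom_add hom_nf hom_smult hom_rel)
    fix w assume "wt w = rw b"
    from wt_rel[OF this] show "co h w = co (nf b (qa b h) (qb b h) (qe h) + Poly_Mapping.map ((*) c) (rel b)) w"
      unfolding qa_def qb_def qe_def nf_def rel_def c_def using Xp_ne
      by (cases b) (auto simp: lookup_add lookup_minus co_wd simp del: replicate_Suc)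
  qed
  then have "Mu i j h = Mu i j (nf b (qa b h) (qb b h) (qe h) + Poly_Mapping.map ((*) c) (rel b))" by simp
  also have "\<dots> = Mu i j (nf b (qa b h) (qb b h) (qe h)) \<oplus>\<^bsub>B\<^esub> \<zero>\<^bsub>B\<^esub>"
    unfolding Mu_add using Mu_I[OF I_smult[OF rel_I]] by simp
  finally have eq: "Mu i j h = Mu i j (nf b (qa b h) (qb b h) (qe h)) \<oplus>\<^bsub>B\<^esub> \<zero>\<^bsub>B\<^esub>" .
  have "x = y" if "x = y \<oplus>\<^bsub>B\<^esub> \<zero>\<^bsub>B\<^esub>" "y \<in> carrier B" for x y using that by simp
  show ?thesis
  \<comment> \<open>Membership in the carrier is available in the first case only; in the other one
    zero is cancelled on representatives.\<close>
  proof (cases "valid i j \<and> j - i = rw b")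
    case True
    then show ?thesis using eq hom_nf[of b] by (simp add: hom_nf)
  next
    case False
    have "y \<oplus>\<^bsub>B\<^esub> \<zero>\<^bsub>B\<^esub> = y" if "y = cls F" for y F
      using that by (simp add: cls_zero cls_add)
    then show ?thesis using eq unfolding Mu_def by metis
  qed
qed

section \<open>Scalars of cochains and of their coboundaries\<close>

lemma len_simps: "len 0 t = 0" "len 1 (ax a i) = wl a" "len 2 (rx b i) = rw b"
  by (auto simp: len_def ax_def rx_def rw_def split: gen.splits)

definition c0 where "c0 v = coord (\<lambda>h. co h []) 0 (2 * v)"
definition c1 where "c1 a i = coord (\<lambda>h. co h [a]) 1 (ax a i)"

lemma pure1 [simp]: "pure [a]"
  by (cases a) (auto simp: pure_def)

lemma Hom0_val:
  assumes f: "f \<in> Hom 0" and v: "valid v v"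
  shows "f (vx v) = Mu v v (wd [] (c0 v f))"
proof -
  have t: "2 * v \<in> T 0" using v by (simp add: T_iff)
  obtain h where h: "hom (len 0 (2 * v)) h" "f (u 0 (2 * v)) = Mu (sr (2 * v)) (tg 0 (2 * v)) h"
    using hom_val[OF f t] by metis
  have "c0 v f = co h []" unfolding c0_def by (rule coord_val) (use h t in \<open>auto intro: lf_co\<close>)
  then show ?thesis using h hom_0[of h] by (simp add: vx_def len_simps)
qed

lemma Hom1_val:
  assumes f: "f \<in> Hom 1" and v: "valid i (i + wl a)"
  shows "f (ua a i) = Mu i (i + wl a) (wd [a] (c1 a i f))"
proof -
  have t: "ax a i \<in> T 1" using v by (simp add: T_iff)
  obtain h where h: "hom (len 1 (ax a i)) h" "f (u 1 (ax a i)) = Mu (sr (ax a i)) (tg 1 (ax a i)) h"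
    using hom_val[OF f t] by metis
  have "c1 a i f = co h [a]" unfolding c1_def by (rule coord_val) (use h t in \<open>auto intro: lf_co\<close>)
  then show ?thesis using h hom_letter[of a h] by (simp add: ua_def len_simps)
qed

lemma Hom0_\<delta>:
  assumes f: "f \<in> Hom 0" and v: "valid i (i + wl a)"
  shows "f (\<delta> 0 (ua a i)) = Mu i (i + wl a) (wd [a] (c0 i f - c0 (i + wl a) f))"
proof -
  interpret f: right_module_hom E.R "Pr 0" E.M f using f by unfold_locales
  have v': "valid i i" "valid (i + wl a) (i + wl a)" using v by (auto simp: valid_def)
  have b: "f (bi (Pr 0) x z y) = x \<otimes>\<^bsub>B\<^esub> f z \<otimes>\<^bsub>B\<^esub> y" if "x \<in> carrier B" "y \<in> carrier B" "z \<in> carrier (Pr 0)" for x y z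
    using hom_bi[OF f that] f.closed[OF that(3)] that by (simp add: bi_def E.M_act)
  have 1: "f (bi (Pr 0) (Mw i [a]) (vx i) \<one>\<^bsub>B\<^esub>) = Mu i (i + wl a) (wd [a] (c0 i f))"
    using v v' by (simp add: b Hom0_val[OF f] Mw_def Mu_mult hom_wd)
  have 2: "f (bi (Pr 0) \<one>\<^bsub>B\<^esub> (vx (i + wl a)) (Mw i [a])) = Mu i (i + wl a) (wd [a] (c0 (i + wl a) f))"
    using v v' by (simp add: b Hom0_val[OF f] Mw_def Mu_mult hom_wd)
  have "f (\<delta> 0 (ua a i)) \<oplus>\<^bsub>B\<^esub> Mu i (i + wl a) (wd [a] (c0 (i + wl a) f)) = Mu i (i + wl a) (wd [a] (c0 i f))"
  proof -
    let ?x = "bi (Pr 0) (Mw i [a]) (vx i) \<one>\<^bsub>B\<^esub>" and ?y = "bi (Pr 0) \<one>\<^bsub>B\<^esub> (vx (i + wl a)) (Mw i [a])"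
    have c: "?x \<in> carrier (Pr 0)" "?y \<in> carrier (Pr 0)" by (simp_all add: bi_closed[OF PM])
    have "(?x \<ominus>\<^bsub>Pr 0\<^esub> ?y) \<oplus>\<^bsub>Pr 0\<^esub> ?y = ?x" using c by (simp add: a_minus_def P.P.M.a_assoc P.P.M.l_neg)
    then have "f (?x \<ominus>\<^bsub>Pr 0\<^esub> ?y) \<oplus>\<^bsub>B\<^esub> f ?y = f ?x"
      using f.hom_add[of "?x \<ominus>\<^bsub>Pr 0\<^esub> ?y" ?y] c by simp
    then show ?thesis unfolding \<delta>0_ua 1 2 .
  qed
  moreover have "Mu i (i + wl a) (wd [a] (c0 i f - c0 (i + wl a) f)) \<oplus>\<^bsub>B\<^esub> Mu i (i + wl a) (wd [a] (c0 (i + wl a) f)) =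
    Mu i (i + wl a) (wd [a] (c0 i f))"
    unfolding Mu_add[symmetric] by (simp flip: single_add)
  moreover have "f (\<delta> 0 (ua a i)) \<in> carrier B" using \<delta>.closed[of "ua a i" 0] f.closed by (simp add: Suc_simps)
  moreover have "Mu i (i + wl a) (wd [a] c) \<in> carrier B" for c by (rule Mu_closed) (simp add: hom_wd)
  ultimately show ?thesis using E.M.M.add.right_cancel by (metis E.M_simps(1,3))
qed

lemma Hom1_Fox:
  assumes f: "f \<in> Hom 1" and v: "valid s (s + wt [a, b, c])"
  shows "f (Fox s [a, b, c]) = Mu s (s + wt [a, b, c]) (wd [a, b, c] (c1 a (s + wl b + wl c) f + c1 b (s + wl c) f + c1 c s f))"
proof -
  interpret f: right_module_hom E.R "Pr 1" E.M f using f by unfold_locales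
  have V: "valid s (s + wl c)" "valid (s + wl c) (s + wl c + wl b)" "valid (s + wl c + wl b) (s + wl c + wl b + wl a)" "valid s s"
     "valid s (s + wl c + wl b)" "valid (s + wl c) (s + wl c + wl b + wl a)" "valid s (s + wl c + wl b + wl a)"
     "valid (s + (wl b + wl c)) (s + (wl b + wl c) + wl a)" "s + (wl b + wl c) = s + wl c + wl b"
    using v by (auto simp: valid_def add_ac)
  have bh: "f (bi (Pr 1) x z y) = x \<otimes>\<^bsub>B\<^esub> f z \<otimes>\<^bsub>B\<^esub> y" if "x \<in> carrier B" "y \<in> carrier B" "z \<in> carrier (Pr 1)" for x y z
    using hom_bi[OF f that] f.closed[OF that(3)] that by (simp add: bi_def E.M_act)
  have "Fox s [a, b, c] = bi (Pr 1) \<one>\<^bsub>B\<^esub> (ua a (s + wl c + wl b)) (Mw s [b, c]) \<oplus>\<^bsub>Pr 1\<^esub>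
    (bi (Pr 1) (Mw (s + wl c + wl b) [a]) (ua b (s + wl c)) (Mw s [c]) \<oplus>\<^bsub>Pr 1\<^esub>
     bi (Pr 1) (Mw (s + wl c + wl b) [a] \<otimes>\<^bsub>B\<^esub> Mw (s + wl c) [b]) (ua c s) (e s))"
    by (simp add: bi_add[OF PM] bi_closed[OF PM] bi_bi[OF PM] bi_zero[OF PM] Mw_Nil V(9))
  then have "f (Fox s [a, b, c]) = f (bi (Pr 1) \<one>\<^bsub>B\<^esub> (ua a (s + wl c + wl b)) (Mw s [b, c])) \<oplus>\<^bsub>B\<^esub>
    (f (bi (Pr 1) (Mw (s + wl c + wl b) [a]) (ua b (s + wl c)) (Mw s [c])) \<oplus>\<^bsub>B\<^esub>
     f (bi (Pr 1) (Mw (s + wl c + wl b) [a] \<otimes>\<^bsub>B\<^esub> Mw (s + wl c) [b]) (ua c s) (e s)))"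
    using f.hom_add by (simp add: bi_closed[OF PM] del: Fox.simps)
  also have "f (bi (Pr 1) \<one>\<^bsub>B\<^esub> (ua a (s + wl c + wl b)) (Mw s [b, c])) =
     Mu s (s + wl c + wl b + wl a) (wd [a, b, c] (c1 a (s + wl c + wl b) f))"
    using V by (simp add: bh Hom1_val[OF f] hom_wd) (simp add: Mw_def Mu_mult add_ac)
  also have "f (bi (Pr 1) (Mw (s + wl c + wl b) [a]) (ua b (s + wl c)) (Mw s [c])) =
     Mu s (s + wl c + wl b + wl a) (wd [a, b, c] (c1 b (s + wl c) f))"
    using V by (simp add: bh Hom1_val[OF f] hom_wd) (simp add: Mw_def Mu_mult)
  also have "f (bi (Pr 1) (Mw (s + wl c + wl b) [a] \<otimes>\<^bsub>B\<^esub> Mw (s + wl c) [b]) (ua c s) (e s)) =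
     Mu s (s + wl c + wl b + wl a) (wd [a, b, c] (c1 c s f))"
    using V by (simp add: bh Hom1_val[OF f] hom_wd) (simp add: Mw_def Mu_mult Mu_e hom_wd)
  finally show ?thesis
    unfolding Mu_add[symmetric] single_add[symmetric] by (simp add: add_ac)
qed

text \<open>The sum of a 1-cochain along the path that spells the word from \<open>s\<close>, last
  letter first.\<close>

definition S where "S f s a b c = c1 a (s + wl b + wl c) f + c1 b (s + wl c) f + c1 c s f"

lemma Hom1_\<delta>:
  assumes f: "f \<in> Hom 1" and v: "valid s (s + rw b)"
  shows "f (\<delta> 1 (u 2 (rx b s))) = Mu s (s + rw b) (if b then
      wd [X, X, Y] (S f s X X Y) - wd [Y, X, X] (\<beta> * S f s Y X X) - wd [X, Y, X] (\<alpha> * S f s X Y X)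
    else wd [X, Y, Y] (S f s X Y Y) - wd [Y, Y, X] (\<beta> * S f s Y Y X) - wd [Y, X, Y] (\<alpha> * S f s Y X Y))"
proof -
  interpret f: right_module_hom E.R "Pr 1" E.M f using f by unfold_locales
  have W: "wt [X, X, Y] = rw True" "wt [Y, X, X] = rw True" "wt [X, Y, X] = rw True"
    "wt [X, Y, Y] = rw False" "wt [Y, Y, X] = rw False" "wt [Y, X, Y] = rw False"
    by (simp_all add: rw_def)
  have sc: "f (scal (Pr 1) k z) = k \<odot>\<^bsub>B\<^esub> f z" if "z \<in> carrier (Pr 1)" for k z
    using f.hom_act[of "k \<odot>\<^bsub>E.R\<^esub> \<one>\<^bsub>E.R\<^esub>" z] scalar_act[of "f z" k] that f.closed[OF that] by (simp add: scal_eq E.R_scalar)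
  have df: "f (y \<ominus>\<^bsub>Pr 1\<^esub> z) = f y \<ominus>\<^bsub>E.M\<^esub> f z" if "y \<in> carrier (Pr 1)" "z \<in> carrier (Pr 1)" for y z
    using that by (simp only: a_minus_def f.hom_add P.P.M.a_inv_closed f.hom_minus)
  have D: "Mu i j f \<ominus>\<^bsub>E.M\<^esub> Mu i j g = Mu i j (f - g)" if "hom (j - i) f" "hom (j - i) g" for i j f g
  proof -
    have 1: "Mu i j (f - g) \<oplus>\<^bsub>B\<^esub> Mu i j g = Mu i j f" unfolding Mu_add[symmetric] by simp
    have "hom (j - i) (f - g)" using that hom_add[OF that(1) hom_uminus[OF that(2)]] by simp
    then have 2: "Mu i j (f - g) \<in> carrier E.M" "Mu i j g \<in> carrier E.M" using that by simp_all
    have "(Mu i j (f - g) \<oplus>\<^bsub>E.M\<^esub> Mu i j g) \<ominus>\<^bsub>E.M\<^esub> Mu i j g = Mu i j (f - g)"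
      using 2 by (simp only: a_minus_def E.M.M.a_assoc E.M.M.r_neg E.M.M.r_zero E.M.M.a_inv_closed)
    then show ?thesis using 1 by simp
  qed
  have scM: "k \<odot>\<^bsub>B\<^esub> Mu i j (wd w c) = Mu i j (wd w (k * c))" for k i j w c
    using Mu_smult[of i j k "wd w c"] by simp
  have E1: "f (Fox s [a, b', c]) = Mu s (s + rw b) (wd [a, b', c] (S f s a b' c))" if "wt [a, b', c] = rw b" for a b' c
    using Hom1_Fox[OF f, of s a b' c] v unfolding that S_def by simp
  have hw: "hom (s + rw b - s) (wd w c)" if "wt w = rw b" for w c using that by (simp add: hom_wd)
  have hd: "hom d (f - g)" if "hom d f" "hom d g" for d f g
    using hom_add[OF that(1) hom_uminus[OF that(2)]] by simp
  have R: "f (\<delta> 1 (u 2 (rx b s))) = (if b then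
      f (Fox s [X, X, Y]) \<ominus>\<^bsub>E.M\<^esub> \<beta> \<odot>\<^bsub>B\<^esub> f (Fox s [Y, X, X]) \<ominus>\<^bsub>E.M\<^esub> \<alpha> \<odot>\<^bsub>B\<^esub> f (Fox s [X, Y, X])
    else f (Fox s [X, Y, Y]) \<ominus>\<^bsub>E.M\<^esub> \<beta> \<odot>\<^bsub>B\<^esub> f (Fox s [Y, Y, X]) \<ominus>\<^bsub>E.M\<^esub> \<alpha> \<odot>\<^bsub>B\<^esub> f (Fox s [Y, X, Y]))"
    unfolding \<delta>1_u rel_def
    by (simp add: Dx_diff Dx_wd df sc scal_closed[OF PM] scal_one[OF PM] del: Fox.simps)
  show ?thesis
  proof (cases b)
    case True
    then show ?thesis unfolding R using E1 W hw by (simp add: scM D hd del: wt_simps Fox.simps)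
  next
    case False
    then show ?thesis unfolding R using E1 W hw by (simp add: scM D hd del: wt_simps Fox.simps)
  qed
qed

end

section \<open>Difference equations on a cycle\<close>

locale cycle =
  fixes n N :: nat
  assumes N: "0 < N" and coprime: "coprime n N"
begin

definition \<sigma> where "\<sigma> j = (j + n) mod N"
text \<open>The element reached from 0 after \<open>k\<close> steps of
  \<open>\<sigma>\<close>.\<close>

definition \<tau> where "\<tau> k = k * n mod N"

lemma \<sigma>_less [simp]: "\<sigma> j < N" and \<tau>_less [simp]: "\<tau> k < N"
  using N by (simp_all add: \<sigma>_def \<tau>_def)

lemma \<tau>_0 [simp]: "\<tau> 0 = 0" and \<tau>_N [simp]: "\<tau> N = 0" and \<tau>_Suc: "\<tau> (Suc k) = \<sigma> (\<tau> k)"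
  by (simp_all add: \<tau>_def \<sigma>_def mod_simps add.commute)

text \<open>Two equal values would make \<open>N\<close> divide \<open>(j - i) * n\<close>, and
  hence \<open>j - i\<close>. This is where the steps are seen to form a single cycle.\<close>

lemma \<tau>_bij: "bij_betw \<tau> {..<N} {..<N}"
proof -
  have "\<tau> i \<noteq> \<tau> j" if "i < j" "j < N" for i j
  proof
    assume "\<tau> i = \<tau> j"
    then have "N dvd j * n - i * n"
      using that mod_eq_dvd_iff_nat[of "i * n" "j * n" N] by (simp add: \<tau>_def)
    then have "N dvd (j - i) * n" by (simp add: diff_mult_distrib)
    then have "N dvd j - i" using coprime by (simp add: coprime_dvd_mult_left_iff coprime_commute)
    then show False using that by (auto dest: dvd_imp_le)
  qed
  then have "inj_on \<tau> {..<N}" by (intro linorder_inj_onI') auto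
  moreover from this have "\<tau> ` {..<N} = {..<N}" by (intro endo_inj_surj) auto
  ultimately show ?thesis by (simp add: bij_betw_def)
qed

lemma \<tau>E: assumes "j < N" obtains k where "k < N" "j = \<tau> k"
  using bij_betw_imp_surj_on[OF \<tau>_bij] assms by blast

lemma \<sigma>_bij: "bij_betw \<sigma> {..<N} {..<N}"
proof -
  have "\<sigma> ` {..<N} = {..<N}"
  proof
    show "{..<N} \<subseteq> \<sigma> ` {..<N}"
    proof
      fix j assume "j \<in> {..<N}"
      then obtain k where k: "k < N" "j = \<tau> k" by (auto elim: \<tau>E)
      show "j \<in> \<sigma> ` {..<N}"
      proof (cases k)
        case 0
        then have "j = \<sigma> (\<tau> (N - 1))" using k N \<tau>_Suc[of "N - 1"] by simp
        then show ?thesis by simp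
      qed (use k in \<open>simp add: \<tau>_Suc\<close>)
    qed
  qed auto
  then show ?thesis by (simp add: bij_betw_def eq_card_imp_inj_on)
qed

text \<open>The values that a solution of the equation \<open>c (\<sigma> j) = p j + e * c j\<close>
  must take along the cycle when it starts with \<open>x\<close> at 0.\<close>

primrec orbit :: "'k::field \<Rightarrow> (nat \<Rightarrow> 'k) \<Rightarrow> 'k \<Rightarrow> nat \<Rightarrow> 'k" where
  "orbit e p x 0 = x"
| "orbit e p x (Suc k) = p (\<tau> k) + e * orbit e p x k"

text \<open>Running along the cycle determines the solution; the only obstruction is that the
  recursion must return to its start value.\<close>

lemma orbit_solution:
  assumes "orbit e p x N = x"
  obtains c where "\<And>j. j < N \<Longrightarrow> c (\<sigma> j) = p j + e * c j"
proof -
  define c where "c = (\<lambda>j. orbit e p x (inv_into {..<N} \<tau> j))"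
  have c: "c (\<tau> k) = orbit e p x k" if "k < N" for k
    using that \<tau>_bij by (simp add: c_def bij_betw_inv_into_left)
  have "c (\<sigma> j) = p j + e * c j" if j: "j < N" for j
  proof -
    obtain k where k: "k < N" "j = \<tau> k" using \<tau>E[OF j] by metis
    show ?thesis
    proof (cases "Suc k < N")
      case True
      then show ?thesis using k c[of k] c[of "Suc k"] by (simp add: \<tau>_Suc)
    next
      case False
      then have eq: "Suc k = N" using k by simp
      have "c (\<sigma> j) = c 0" using k(2) eq \<tau>_Suc[of k] \<tau>_N by metis
      also have "c 0 = x" using c[of 0] N by simp
      also have "x = p j + e * c j"
        using assms c[OF k(1)] k(2) orbit.simps(2)[of e p x k] unfolding eq by simp
      finally show ?thesis .
    qed
  qed
  then show ?thesis by (rule that)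
qed

lemma solve_sum_zero:
  assumes "(\<Sum>j<N. p j) = 0"
  obtains c :: "nat \<Rightarrow> 'k::field" where "\<And>j. j < N \<Longrightarrow> c (\<sigma> j) = p j + c j"
proof -
  have "orbit 1 p 0 k = (\<Sum>i<k. p (\<tau> i))" for k by (induction k) simp_all
  then have "orbit 1 p 0 N = 0" using assms sum.reindex_bij_betw[OF \<tau>_bij, of p] by simp
  from orbit_solution[OF this] show ?thesis using that by auto
qed

lemma orbit_shift: "orbit (- 1) p x k = orbit (- 1) p 0 k + (- 1) ^ k * x"
  by (induction k) (simp_all add: algebra_simps)

lemma solve_odd:
  assumes "odd N"
  obtains c :: "nat \<Rightarrow> 'k::field_char_0" where "\<And>j. j < N \<Longrightarrow> c j + c (\<sigma> j) = p j"
proof -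
  \<comment> \<open>For odd \<open>N\<close> the start value returns with the opposite sign, so the
    closing condition is a linear equation for \<open>x\<close> with coefficient two.\<close>
  define x where "x = orbit (- 1) p 0 N / 2"
  have "orbit (- 1) p x N = x" using assms orbit_shift[of p x N] by (simp add: x_def field_simps)
  from orbit_solution[OF this] obtain c where "\<And>j. j < N \<Longrightarrow> c (\<sigma> j) = p j + - 1 * c j" by metis
  then have "c j + c (\<sigma> j) = p j" if "j < N" for j using that by simp
  then show ?thesis by (rule that)
qed

text \<open>An even \<open>N\<close> is coprime only to an odd \<open>n\<close>, and reduction
  modulo an even number preserves parity.\<close>

lemma parity:
  assumes "even N"
  shows "odd n" "even (\<tau> k) \<longleftrightarrow> even k" "even (\<sigma> j) \<longleftrightarrow> odd j"
proof -
  show o: "odd n" using assms coprime by (metis coprime_common_divisor odd_one)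
  have "even (a mod N) \<longleftrightarrow> even a" for a using assms by (simp add: dvd_mod_iff)
  then show "even (\<tau> k) \<longleftrightarrow> even k" "even (\<sigma> j) \<longleftrightarrow> odd j" using o by (auto simp: \<tau>_def \<sigma>_def)
qed

text \<open>For even \<open>N\<close> the start value returns unchanged and cannot be adjusted. The
  recursion closes because, from start value zero, it ends with minus the alternating sum.\<close>

lemma solve_even:
  assumes "even N" "(\<Sum>j<N. (- 1) ^ j * p j) = 0"
  obtains c :: "nat \<Rightarrow> 'k::field_char_0" where "\<And>j. j < N \<Longrightarrow> c j + c (\<sigma> j) = p j"
proof -
  \<comment> \<open>\<open>\<tau>\<close> preserves parity, so signs counted along the orbit agree
    with those in the hypothesis.\<close>
  have pw: "(- 1) ^ \<tau> i = ((- 1) ^ i :: 'k)" for i using parity(2)[OF assms(1), of i] by (simp add: minus_one_power_iff)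
  have "(- 1) ^ k * orbit (- 1) p 0 k = - (\<Sum>i<k. (- 1) ^ i * p (\<tau> i))" for k
    by (induction k) (simp_all add: algebra_simps)
  then have "orbit (- 1) p 0 N = - (\<Sum>i<N. (- 1) ^ \<tau> i * p (\<tau> i))"
    using assms(1) unfolding pw by (metis minus_one_power_iff mult_1)
  also have "\<dots> = 0"
    using assms(2) sum.reindex_bij_betw[OF \<tau>_bij, of "\<lambda>j. (- 1) ^ j * p j"] by simp
  finally have "orbit (- 1) p 0 N = 0" .
  from orbit_solution[OF this] obtain c where "\<And>j. j < N \<Longrightarrow> c (\<sigma> j) = p j + - 1 * c j" by metis
  then have "c j + c (\<sigma> j) = p j" if "j < N" for j using that by simp
  then show ?thesis by (rule that)
qed

text \<open>\<open>\<sigma>\<close> flips parity, so reindexing the sum over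
  \<open>c (\<sigma> j)\<close> turns it into the negative of the sum over
  \<open>c j\<close>.\<close>

lemma alternating_sum_zero:
  assumes "even N"
  shows "(\<Sum>j<N. (- 1) ^ j * (c j + c (\<sigma> j))) = (0 :: 'k::field_char_0)"
proof -
  have "(\<Sum>j<N. (- 1) ^ j * c (\<sigma> j)) = - (\<Sum>j<N. (- 1) ^ \<sigma> j * c (\<sigma> j))"
    unfolding sum_negf[symmetric]
    by (rule sum.cong) (use parity(3)[OF assms] in \<open>auto simp: minus_one_power_iff\<close>)
  also have "\<dots> = - (\<Sum>j<N. (- 1) ^ j * c j)"
    using sum.reindex_bij_betw[OF \<sigma>_bij, of "\<lambda>j. (- 1) ^ j * c j"] by simp
  finally show ?thesis by (simp add: distrib_left sum.distrib)
qed

lemma orbit_power: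
  assumes "\<And>j. j < N \<Longrightarrow> c (\<sigma> j) = e * c j"
  shows "c (\<tau> k) = e ^ k * (c 0 :: 'k::field)"
  by (induction k) (simp_all add: \<tau>_Suc assms)

lemma cycle_constant:
  assumes "\<And>j. j < N \<Longrightarrow> c (\<sigma> j) = (c j :: 'k::field)" and j: "j < N"
  shows "c j = c 0"
proof -
  obtain k where "j = \<tau> k" using \<tau>E[OF j] by metis
  then show ?thesis using orbit_power[of c 1 k] assms(1) by simp
qed

text \<open>One turn around the cycle multiplies \<open>c 0\<close> by the \<open>N\<close>-th power
  of -1.\<close>

lemma cycle_alternating:
  assumes c: "\<And>j. j < N \<Longrightarrow> c j + c (\<sigma> j) = (0 :: 'k::field_char_0)" and z: "odd N \<or> c 0 = 0" and j: "j < N"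
  shows "c j = 0"
proof -
  have *: "c (\<tau> k) = (- 1) ^ k * c 0" for k
    by (rule orbit_power) (use c in \<open>simp add: eq_neg_iff_add_eq_0 add.commute\<close>)
  have "c 0 = 0" using z *[of N] by auto
  then show ?thesis using j * by (auto elim: \<tau>E)
qed

end

text \<open>Serves twice: to extend a potential along the arrows x, and to build a 1-cochain with
  given curvature.\<close>

lemma periodic_extension:
  fixes w :: "nat \<Rightarrow> 'k::field"
  assumes "p > 0"
  obtains f where "\<And>x. f x = (if x \<le> d then w x else f (x - p) + g x)"
proof -
  have "\<exists>f. \<forall>x. f x = (if x \<le> d then w x else f (x - p) + g x)"
    by (rule dependent_wellorder_choice) (use assms in auto)
  then show ?thesis using that by blast
qed

lemma sum_lessThan_add: "(\<Sum>i<p + q. g i) = (\<Sum>i<p. g i) + (\<Sum>i<q. g (p + i))" for g :: "nat \<Rightarrow> 'k::field" and p q :: nat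
  by (induction q) (simp_all add: add.assoc)

context down_up
begin

section \<open>The cochain complex in coordinates\<close>

abbreviation "N \<equiv> n + m"

sublocale C: cycle n N
proof
  show "coprime n N" using coprime by (simp add: coprime_iff_gcd_eq_1)
qed (use nm in simp)

lemma \<sigma>_split: "j < m \<Longrightarrow> C.\<sigma> j = j + n" "m \<le> j \<Longrightarrow> j < N \<Longrightarrow> C.\<sigma> j = j - m"
  by (auto simp: C.\<sigma>_def mod_if)

lemma coord_zero: "t \<in> T k \<Longrightarrow> lf \<xi> \<Longrightarrow> f (u k t) = \<zero>\<^bsub>B\<^esub> \<Longrightarrow> coord \<xi> k t f = 0"
proof -
  assume t: "t \<in> T k" "lf \<xi>" "f (u k t) = \<zero>\<^bsub>B\<^esub>"
  have z: "\<xi> 0 = 0" using t(2) unfolding lf_def by (metis add_cancel_right_right)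
  have "(0 :: gen free_monoid \<Rightarrow>\<^sub>0 'k) \<in> I" using I.zero_closed by simp
  then have "f (u k t) = Mu (sr t) (tg k t) 0" using t(3) Mu_I by simp
  then have "coord \<xi> k t f = \<xi> 0" using coord_val[of f k t 0 \<xi>] t(1,2) by blast
  then show ?thesis using z by simp
qed

text \<open>Comparing two cochains at a generator reduces to comparing coordinates, for any family
  of functionals that separates the classes of the relevant degree.\<close>

lemma Hom_eq_iff:
  assumes f: "f \<in> Hom k" and g: "g \<in> Hom k" and t: "t \<in> T k"
    and \<xi>: "\<And>\<xi>. \<xi> \<in> \<Xi> \<Longrightarrow> lf \<xi>"
    and nf: "\<And>h h'. hom (len k t) h \<Longrightarrow> hom (len k t) h' \<Longrightarrow> \<forall>\<xi>\<in>\<Xi>. \<xi> h = \<xi> h' \<Longrightarrow>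
      Mu (sr t) (tg k t) h = Mu (sr t) (tg k t) h'"
  shows "f (u k t) = g (u k t) \<longleftrightarrow> (\<forall>\<xi>\<in>\<Xi>. coord \<xi> k t f = coord \<xi> k t g)"
proof
  assume "f (u k t) = g (u k t)"
  then show "\<forall>\<xi>\<in>\<Xi>. coord \<xi> k t f = coord \<xi> k t g" by (simp add: coord_def)
next
  assume *: "\<forall>\<xi>\<in>\<Xi>. coord \<xi> k t f = coord \<xi> k t g"
  obtain h where h: "hom (len k t) h" "f (u k t) = Mu (sr t) (tg k t) h" using hom_val[OF f t] by metis
  obtain h' where h': "hom (len k t) h'" "g (u k t) = Mu (sr t) (tg k t) h'" using hom_val[OF g t] by metis
  have "\<forall>\<xi>\<in>\<Xi>. \<xi> h = \<xi> h'"
    using * coord_val[of f k t h] coord_val[of g k t h'] h(2) h'(2) t \<xi> by metis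
  then show "f (u k t) = g (u k t)" using nf[OF h(1) h'(1)] h(2) h'(2) by simp
qed

lemma Hom1_eq_iff:
  assumes f: "f \<in> Hom 1" and g: "g \<in> Hom 1" and v: "valid i (i + wl a)"
  shows "f (ua a i) = g (ua a i) \<longleftrightarrow> c1 a i f = c1 a i g"
proof -
  have "f (u 1 (ax a i)) = g (u 1 (ax a i)) \<longleftrightarrow>
    (\<forall>\<xi>\<in>{\<lambda>h. co h [a]}. coord \<xi> 1 (ax a i) f = coord \<xi> 1 (ax a i) g)"
  proof (rule Hom_eq_iff[OF f g])
    fix h h' :: "gen free_monoid \<Rightarrow>\<^sub>0 'k"
    assume "hom (len 1 (ax a i)) h" "hom (len 1 (ax a i)) h'" "\<forall>\<xi>\<in>{\<lambda>h. co h [a]}. \<xi> h = \<xi> h'"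
    then show "Mu (sr (ax a i)) (tg 1 (ax a i)) h = Mu (sr (ax a i)) (tg 1 (ax a i)) h'"
      using hom_letter[of a h] hom_letter[of a h'] by (simp add: len_simps)
  qed (use v T_iff in \<open>auto intro: lf_co\<close>)
  then show ?thesis by (simp add: ua_def c1_def)
qed

definition pc where "pc b i = coord (qa b) 2 (rx b i)"
definition qc where "qc b i = coord (qb b) 2 (rx b i)"
definition ec where "ec i = coord qe 2 (rx False i)"

lemma Hom2_eq_iff:
  assumes f: "f \<in> Hom 2" and g: "g \<in> Hom 2" and v: "valid i (i + rw b)"
  shows "f (u 2 (rx b i)) = g (u 2 (rx b i)) \<longleftrightarrow>
    pc b i f = pc b i g \<and> qc b i f = qc b i g \<and> (\<not> b \<and> n = 2 \<longrightarrow> ec i f = ec i g)"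
proof -
  let ?\<Xi> = "{qa b, qb b} \<union> (if \<not> b \<and> n = 2 then {qe} else {})"
  have "f (u 2 (rx b i)) = g (u 2 (rx b i)) \<longleftrightarrow> (\<forall>\<xi>\<in>?\<Xi>. coord \<xi> 2 (rx b i) f = coord \<xi> 2 (rx b i) g)"
  proof (rule Hom_eq_iff[OF f g])
    fix h h' :: "gen free_monoid \<Rightarrow>\<^sub>0 'k"
    assume h: "hom (len 2 (rx b i)) h" "hom (len 2 (rx b i)) h'" and *: "\<forall>\<xi>\<in>?\<Xi>. \<xi> h = \<xi> h'"
    have "nf b (qa b h) (qb b h) (qe h) = nf b (qa b h') (qb b h') (qe h')"
      unfolding nf_def using * by (cases b; cases "n = 2") (simp_all del: replicate_Suc)
    then show "Mu (sr (rx b i)) (tg 2 (rx b i)) h = Mu (sr (rx b i)) (tg 2 (rx b i)) h'"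
      using Mu_nf[of b h] Mu_nf[of b h'] h by (simp add: len_simps)
  qed (use v T_iff lf_q in \<open>auto split: if_splits\<close>)
  then show ?thesis unfolding pc_def qc_def ec_def by (cases b; cases "n = 2") auto
qed

text \<open>The square with lowest corner \<open>j + 1\<close>: the path that takes x first, minus
  the path that takes y first. The shift matches residues starting at 0 with vertices starting at
  1.\<close>

definition cv where "cv f j = c1 X (j + 1) f + c1 Y (j + 1 + n) f - c1 Y (j + 1) f - c1 X (j + 1 + m) f"

lemma coords_\<delta>1:
  assumes f: "f \<in> Hom 1" and v: "valid s (s + rw b)"
  defines "g \<equiv> \<lambda>x. f (\<delta> 1 x)"
  shows "pc b s g = \<beta> * (if b then S f s X X Y - S f s Y X X else S f s X Y Y - S f s Y Y X)"
    "qc b s g = \<alpha> * (if b then S f s X X Y - S f s X Y X else S f s X Y Y - S f s Y X Y)"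
    "\<not> b \<Longrightarrow> ec s g = 0"
proof -
  define h where "h = (if b then
      wd [X, X, Y] (S f s X X Y) - wd [Y, X, X] (\<beta> * S f s Y X X) - wd [X, Y, X] (\<alpha> * S f s X Y X)
    else wd [X, Y, Y] (S f s X Y Y) - wd [Y, Y, X] (\<beta> * S f s Y Y X) - wd [Y, X, Y] (\<alpha> * S f s Y X Y))"
  have g: "g (u 2 (rx b s)) = Mu (sr (rx b s)) (tg 2 (rx b s)) h"
    using Hom1_\<delta>[OF f v] by (simp add: g_def h_def)
  have t: "rx b s \<in> T 2" using v by (simp add: T_iff)
  show "pc b s g = \<beta> * (if b then S f s X X Y - S f s Y X X else S f s X Y Y - S f s Y Y X)"
    unfolding pc_def coord_val[of g 2 "rx b s" h, OF g t lf_q(1)] by (cases b) (simp_all add: qa_def h_def lookup_minus co_wd right_diff_distrib)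
  show "qc b s g = \<alpha> * (if b then S f s X X Y - S f s X Y X else S f s X Y Y - S f s Y X Y)"
    unfolding qc_def coord_val[of g 2 "rx b s" h, OF g t lf_q(2)] by (cases b) (simp_all add: qb_def h_def lookup_minus co_wd right_diff_distrib)
  show "ec s g = 0" if "\<not> b"
    using that Xp_ne coord_val[of g 2 "rx b s" h, OF g t lf_q(3)] by (simp add: ec_def qe_def h_def lookup_minus co_wd del: replicate_Suc)
qed

text \<open>The relations are numbered along the cycle \<open>j \<mapsto> j + n\<close> modulo \<open>n + m\<close>: number \<open>j < m\<close> is the
  cubic relation \<open>xxy\<close> and number \<open>j \<ge> m\<close> the relation \<open>xyy\<close>.  With this numbering both kinds of
  relations give the same equation for the curvature \<^const>\<open>cv\<close>.\<close>

definition st where "st j = (if j < m then j + 1 else j - m + 1)"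
definition pj where "pj j = pc (j < m) (st j)"
definition qj where "qj j = qc (j < m) (st j)"

lemma st_valid: "j < N \<Longrightarrow> valid (st j) (st j + rw (j < m))"
  by (auto simp: st_def valid_def rw_def \<L>_def)

lemma rel_index: "valid i (i + rw b) \<longleftrightarrow> (\<exists>j<N. b = (j < m) \<and> i = st j)"
proof
  assume v: "valid i (i + rw b)"
  show "\<exists>j<N. b = (j < m) \<and> i = st j"
    by (rule exI[of _ "if b then i - 1 else i - 1 + m"])
      (use v in \<open>auto simp: st_def valid_def rw_def \<L>_def split: if_splits\<close>)
qed (auto intro: st_valid)

text \<open>Passing from xxy to yxx moves y across two letters x, from xyy to yyx moves x across two
  letters y; either way two squares are crossed, and their numbers are \<open>j\<close> and
  \<open>C.\<sigma> j\<close>. The third word of the relation is reached from the leading one by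
  crossing the square \<open>j\<close> alone, which explains the second formula.\<close>

lemma \<delta>1_coords:
  assumes f: "f \<in> Hom 1" and j: "j < N"
  shows "pj j (\<lambda>x. f (\<delta> 1 x)) = - \<beta> * (cv f j + cv f (C.\<sigma> j))" "qj j (\<lambda>x. f (\<delta> 1 x)) = - \<alpha> * cv f j"
proof -
  note * = coords_\<delta>1[OF f st_valid[OF j]]
  have D: "(if j < m then S f (st j) X X Y - S f (st j) Y X X else S f (st j) X Y Y - S f (st j) Y Y X) = - (cv f j + cv f (C.\<sigma> j))" (is ?A)
    "(if j < m then S f (st j) X X Y - S f (st j) X Y X else S f (st j) X Y Y - S f (st j) Y X Y) = - cv f j" (is ?B)
  proof -
    have "?A \<and> ?B"
    proof (cases "j < m")
      case True
      show ?thesis unfolding S_def cv_def st_def \<sigma>_split(1)[OF True] using True by (simp add: algebra_simps)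
    next
      case False
      then obtain d where d: "j = d + m" by (metis le_add_diff_inverse2 not_less)
      have "C.\<sigma> j = d" using \<sigma>_split(2)[of j] d j by simp
      then show ?thesis unfolding S_def cv_def st_def by (simp add: d algebra_simps)
    qed
    then show ?A ?B by simp_all
  qed
  show "pj j (\<lambda>x. f (\<delta> 1 x)) = - \<beta> * (cv f j + cv f (C.\<sigma> j))" "qj j (\<lambda>x. f (\<delta> 1 x)) = - \<alpha> * cv f j"
    unfolding pj_def qj_def * D by (simp_all add: right_diff_distrib distrib_left)
qed

lemma ec_\<delta>1: "f \<in> Hom 1 \<Longrightarrow> valid i (i + rw False) \<Longrightarrow> ec i (\<lambda>x. f (\<delta> 1 x)) = 0"
  by (rule coords_\<delta>1(3)[of f i False]) auto

lemma \<delta>1_comp: "f \<in> Hom 1 \<Longrightarrow> (\<lambda>x. f (\<delta> 1 x)) \<in> Hom 2"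
  using module_hom_comp[OF \<delta>_hom[of 1]] by (simp add: Suc_simps)

lemma \<delta>0_comp: "f \<in> Hom 0 \<Longrightarrow> (\<lambda>x. f (\<delta> 0 x)) \<in> Hom 1"
  using module_hom_comp[OF \<delta>_hom[of 0]] by (simp add: Suc_simps)

lemma c1_\<delta>0:
  assumes "f \<in> Hom 0" "valid i (i + wl a)"
  shows "c1 a i (\<lambda>x. f (\<delta> 0 x)) = c0 i f - c0 (i + wl a) f"
proof -
  have "(\<lambda>x. f (\<delta> 0 x)) (u 1 (ax a i)) = Mu (sr (ax a i)) (tg 1 (ax a i)) (wd [a] (c0 i f - c0 (i + wl a) f))"
    using Hom0_\<delta>[OF assms] by (simp add: ua_def)
  from coord_val[where f = "\<lambda>x. f (\<delta> 0 x)", OF this] show ?thesis using assms(2) by (simp add: c1_def T_iff lf_co co_wd)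
qed

lemma mk_coord:
  assumes "\<And>t. t \<in> T k \<Longrightarrow> hom (len k t) (\<eta> t)" "t \<in> T k" "lf \<xi>"
  shows "coord \<xi> k t (mk k \<eta>) = \<xi> (\<eta> t)"
  by (rule coord_val[of "mk k \<eta>"]) (use assms mk(3) in auto)

lemma ex_Hom0:
  obtains f where "f \<in> Hom 0" "f \<in> extensional (carrier (Pr 0))" "\<And>v. valid v v \<Longrightarrow> c0 v f = w v"
proof -
  let ?\<eta> = "\<lambda>t. wd [] (w (t div 2))"
  have h: "hom (len 0 t) (?\<eta> t)" for t by (simp add: len_simps hom_wd)
  show ?thesis
    by (rule that[OF mk(1,2)[of 0 ?\<eta>]])
      (use h in \<open>auto simp: c0_def mk_coord T_iff lf_co co_wd\<close>)
qed

lemma ex_Hom1: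
  obtains f where "f \<in> Hom 1" "f \<in> extensional (carrier (Pr 1))" "\<And>a i. valid i (i + wl a) \<Longrightarrow> c1 a i f = w a i"
proof -
  let ?\<eta> = "\<lambda>t. if even t then wd [X] (w X (t div 2)) else wd [Y] (w Y (t div 2))"
  have h: "hom (len 1 t) (?\<eta> t)" for t by (auto simp: len_def intro!: hom_wd)
  have c: "c1 a i (mk 1 ?\<eta>) = w a i" if "valid i (i + wl a)" for a i
  proof -
    have "c1 a i (mk 1 ?\<eta>) = co (?\<eta> (ax a i)) [a]"
      unfolding c1_def by (rule mk_coord[OF h]) (use that in \<open>simp_all add: T_iff lf_co\<close>)
    then show ?thesis by (cases a) (simp_all add: ax_def co_wd)
  qed
  show ?thesis by (rule that[OF mk(1,2)[of 1 ?\<eta>] c]) (use h in auto)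
qed

lemma ex_Hom2:
  obtains f where "f \<in> Hom 2" "f \<in> extensional (carrier (Pr 2))"
    "\<And>j. j < N \<Longrightarrow> pj j f = p j" "\<And>j. j < N \<Longrightarrow> qj j f = q j"
    "\<And>i. n = 2 \<Longrightarrow> valid i (i + rw False) \<Longrightarrow> ec i f = r i"
proof -
  \<comment> \<open>Inverts the numbering of relations: recovers \<open>j\<close> from the index of
    the generator.\<close>
  let ?j = "\<lambda>t. if even t then t div 2 - 1 else t div 2 - 1 + m"
  let ?\<eta> = "\<lambda>t. nf (even t) (p (?j t)) (q (?j t)) (r (t div 2))"
  have h: "hom (len 2 t) (?\<eta> t)" for t
    using hom_nf[of "even t"] by (simp add: len_def rw_def)
  have t: "rx (j < m) (st j) \<in> T 2" "?j (rx (j < m) (st j)) = j" "even (rx (j < m) (st j)) \<longleftrightarrow> j < m" if "j < N" for j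
    using st_valid[OF that] by (simp add: T_iff, auto simp: rx_def st_def)
  show ?thesis
  proof (rule that[OF mk(1,2)[of 2 ?\<eta>]])
    show "pj j (mk 2 ?\<eta>) = p j" if "j < N" for j
      unfolding pj_def pc_def using mk_coord[OF h t(1)[OF that] lf_q(1)] t(2,3)[OF that] by (simp add: q_nf)
    show "qj j (mk 2 ?\<eta>) = q j" if "j < N" for j
      unfolding qj_def qc_def using mk_coord[OF h t(1)[OF that] lf_q(2)] t(2,3)[OF that] by (simp add: q_nf)
    show "ec i (mk 2 ?\<eta>) = r i" if "n = 2" "valid i (i + rw False)" for i
    proof -
      have t: "rx False i \<in> T 2" by (rule T_iff(4)[THEN iffD2, OF that(2)])
      have e: "even (rx False i) = False" "rx False i div 2 = i" by (simp_all add: rx_def)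
      show ?thesis unfolding ec_def mk_coord[OF h t lf_q(3)] e by (rule q_nf(3)[OF that(1)])
    qed
  qed (use h in auto)
qed


lemma cocycleD: "f \<in> hom_cocycles E.R Pr \<delta> E.M k \<Longrightarrow> f \<in> Hom k \<and> f \<in> extensional (carrier (Pr k))"
  by (simp add: hom_cocycles_iff)

lemma all_less_1: "(\<forall>j<1. \<Phi> j) \<longleftrightarrow> \<Phi> (0::nat)"
  by (simp add: One_nat_def)

lemma ball_T1: "(\<forall>t\<in>T 1. \<Phi> t) \<longleftrightarrow> (\<forall>a i. valid i (i + wl a) \<longrightarrow> \<Phi> (ax a i))"
  by (auto simp: T_iff elim!: T_1E)

lemma ball_T2: "(\<forall>t\<in>T 2. \<Phi> t) \<longleftrightarrow> (\<forall>j<N. \<Phi> (rx (j < m) (st j)))"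
proof
  assume *: "\<forall>j<N. \<Phi> (rx (j < m) (st j))"
  show "\<forall>t\<in>T 2. \<Phi> t"
  proof
    fix t assume "t \<in> T 2"
    then obtain b i where "t = rx b i" "valid i (i + rw b)" by (rule T_2E)
    then show "\<Phi> t" using * unfolding rel_index by auto
  qed
qed (simp add: T_iff(4) st_valid)

lemma zero_coords:
  "valid i (i + wl a) \<Longrightarrow> c1 a i (\<lambda>x. \<zero>\<^bsub>B\<^esub>) = 0" "j < N \<Longrightarrow> pj j (\<lambda>x. \<zero>\<^bsub>B\<^esub>) = 0"
  "j < N \<Longrightarrow> qj j (\<lambda>x. \<zero>\<^bsub>B\<^esub>) = 0" "valid i (i + rw False) \<Longrightarrow> ec i (\<lambda>x. \<zero>\<^bsub>B\<^esub>) = 0"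
  unfolding c1_def pj_def qj_def pc_def qc_def ec_def
  by (rule coord_zero; simp add: T_iff lf_co lf_q st_valid)+

lemma c0_lin:
  assumes "valid v v" "f \<in> Hom 0"
  shows "g \<in> Hom 0 \<Longrightarrow> c0 v (f \<oplus>\<^bsub>HS 0\<^esub> g) = c0 v f + c0 v g" "c0 v (c \<odot>\<^bsub>HS 0\<^esub> f) = c * c0 v f"
  unfolding c0_def using assms by (simp_all add: coord_add coord_smult T_iff lf_co)

lemma c1_lin:
  assumes "valid i (i + wl a)" "f \<in> Hom 1"
  shows "g \<in> Hom 1 \<Longrightarrow> c1 a i (f \<oplus>\<^bsub>HS 1\<^esub> g) = c1 a i f + c1 a i g" "c1 a i (c \<odot>\<^bsub>HS 1\<^esub> f) = c * c1 a i f"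
  unfolding c1_def using assms by (simp_all add: coord_add coord_smult T_iff lf_co)

lemma arrow_valid: "valid i (i + n) \<longleftrightarrow> 1 \<le> i \<and> i \<le> N + m" "valid i (i + m) \<longleftrightarrow> 1 \<le> i \<and> i \<le> N + n"
  "valid v v \<longleftrightarrow> 1 \<le> v \<and> v \<le> 2 * N"
  by (auto simp: valid_def \<L>_def)

lemma c1_lin':
  assumes "f \<in> Hom 1" "1 \<le> i"
  shows "i \<le> N + m \<Longrightarrow> g \<in> Hom 1 \<Longrightarrow> c1 X i (f \<oplus>\<^bsub>HS 1\<^esub> g) = c1 X i f + c1 X i g"
    "i \<le> N + m \<Longrightarrow> c1 X i (c \<odot>\<^bsub>HS 1\<^esub> f) = c * c1 X i f"
    "i \<le> N + n \<Longrightarrow> g \<in> Hom 1 \<Longrightarrow> c1 Y i (f \<oplus>\<^bsub>HS 1\<^esub> g) = c1 Y i f + c1 Y i g"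
    "i \<le> N + n \<Longrightarrow> c1 Y i (c \<odot>\<^bsub>HS 1\<^esub> f) = c * c1 Y i f"
  using assms by (simp_all add: c1_lin arrow_valid)

lemma cv_lin:
  assumes "j < N" "f \<in> Hom 1"
  shows "g \<in> Hom 1 \<Longrightarrow> cv (f \<oplus>\<^bsub>HS 1\<^esub> g) j = cv f j + cv g j" "cv (c \<odot>\<^bsub>HS 1\<^esub> f) j = c * cv f j"
  using assms by (simp_all add: cv_def c1_lin' algebra_simps)

text \<open>The holonomy of a 1-cochain once around the cycle \<open>i \<mapsto> i + n\<close> modulo \<open>n + m\<close>: the step from
  \<open>i \<le> m\<close> is an arrow \<open>x\<close>, the step from \<open>i + m\<close> to \<open>i\<close> is an arrow \<open>y\<close> traversed backwards.\<close>

definition hs where "hs f = (\<Sum>i<m. c1 X (i + 1) f) - (\<Sum>i<n. c1 Y (i + 1) f)"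

lemma hs_lin:
  assumes "f \<in> Hom 1"
  shows "g \<in> Hom 1 \<Longrightarrow> hs (f \<oplus>\<^bsub>HS 1\<^esub> g) = hs f + hs g" "hs (c \<odot>\<^bsub>HS 1\<^esub> f) = c * hs f"
  using assms by (simp_all add: hs_def c1_lin' sum.distrib sum_distrib_left right_diff_distrib)

lemma rel_lin:
  assumes "j < N" "f \<in> Hom 2"
  shows "g \<in> Hom 2 \<Longrightarrow> pj j (f \<oplus>\<^bsub>HS 2\<^esub> g) = pj j f + pj j g" "pj j (c \<odot>\<^bsub>HS 2\<^esub> f) = c * pj j f"
    "g \<in> Hom 2 \<Longrightarrow> qj j (f \<oplus>\<^bsub>HS 2\<^esub> g) = qj j f + qj j g" "qj j (c \<odot>\<^bsub>HS 2\<^esub> f) = c * qj j f"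
  unfolding pj_def qj_def pc_def qc_def using assms by (simp_all add: coord_add coord_smult T_iff lf_q st_valid)

lemma ec_lin:
  assumes "valid i (i + rw False)" "f \<in> Hom 2"
  shows "g \<in> Hom 2 \<Longrightarrow> ec i (f \<oplus>\<^bsub>HS 2\<^esub> g) = ec i f + ec i g" "ec i (c \<odot>\<^bsub>HS 2\<^esub> f) = c * ec i f"
  unfolding ec_def using assms by (simp_all add: coord_add coord_smult T_iff lf_q)

section \<open>Degree zero\<close>

lemma cocycle0:
  assumes f: "f \<in> Hom 0" "f \<in> extensional (carrier (Pr 0))"
  shows "f \<in> hom_cocycles E.R Pr \<delta> E.M 0 \<longleftrightarrow> (\<forall>a i. valid i (i + wl a) \<longrightarrow> c0 i f = c0 (i + wl a) f)"
proof -
  have "f (\<delta> 0 (ua a i)) = \<zero>\<^bsub>B\<^esub> \<longleftrightarrow> c0 i f = c0 (i + wl a) f" if "valid i (i + wl a)" for a i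
    using Hom1_eq_iff[OF \<delta>0_comp[OF f(1)] zero_Hom that] that by (simp add: c1_\<delta>0 f zero_coords)
  then show ?thesis unfolding cocycle_iff[OF f] Suc_simps ball_T1 by (auto simp: ua_def)
qed

text \<open>On the first \<open>N\<close> vertices each step of \<open>C.\<sigma>\<close> is an
  arrow x or a reversed arrow y, so the single cycle connects them all. Every later vertex is
  reached from a lower one by an arrow x.\<close>

lemma vertex_constant:
  fixes c :: "nat \<Rightarrow> 'k"
  assumes c: "\<And>a i. valid i (i + wl a) \<Longrightarrow> c i = c (i + wl a)" and v: "valid v v"
  shows "c v = c 1"
proof -
  have a: "c (i + n) = c i" if "1 \<le> i" "i \<le> N + m" for i using c[of i X] that by (simp add: arrow_valid)
  have b: "c (i + m) = c i" if "1 \<le> i" "i \<le> N + n" for i using c[of i Y] that by (simp add: arrow_valid)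
  have "c (C.\<sigma> j + 1) = c (j + 1)" if j: "j < N" for j
  proof (cases "j < m")
    case True
    then show ?thesis unfolding \<sigma>_split(1)[OF True] using a[of "j + 1"] by (simp add: add_ac)
  next
    case False
    then obtain d where "j = d + m" by (metis le_add_diff_inverse2 not_less)
    then show ?thesis using b[of "d + 1"] j \<sigma>_split(2)[of j] by (simp add: add_ac)
  qed
  from C.cycle_constant[of "\<lambda>j. c (j + 1)", OF this] have low: "c i = c 1" if "1 \<le> i" "i \<le> N" for i
    using that by (metis Suc_eq_plus1 Suc_pred' add_0 less_eq_Suc_le One_nat_def Suc_le_lessD)
  have *: "c v = c 1" if "1 \<le> v" "v \<le> 2 * N" for v
    using that
  proof (induction v rule: less_induct)
    case (less v)
    show ?case
    proof (cases "v \<le> N")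
      case False
      then have "c v = c (v - n)" using a[of "v - n"] less.prems by simp
      also have "\<dots> = c 1" by (rule less.IH) (use False less.prems nm in linarith)+
      finally show ?thesis .
    qed (use low[OF less.prems(1)] in simp)
  qed
  show ?thesis by (rule *) (use v in \<open>simp_all add: arrow_valid\<close>)
qed

lemma HH0: "has_dim (HH 0 B) 1"
proof (rule coordsI[where \<psi> = "\<lambda>_. c0 1" and k = 0])
  have v: "valid 1 1" using nm by (simp add: arrow_valid)
  show "c0 1 (f \<oplus>\<^bsub>HS 0\<^esub> g) = c0 1 f + c0 1 g" if "f \<in> Hom 0" "g \<in> Hom 0" for f g
    using v that by (simp add: c0_lin)
  show "c0 1 (c \<odot>\<^bsub>HS 0\<^esub> f) = c * c0 1 f" if "f \<in> Hom 0" for f c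
    using v that by (simp add: c0_lin)
  show "\<exists>f\<in>hom_cocycles E.R Pr \<delta> E.M 0. \<forall>j<(1::nat). c0 1 f = w j" for w :: "nat \<Rightarrow> 'k"
  proof -
    obtain f where f: "f \<in> Hom 0" "f \<in> extensional (carrier (Pr 0))" "\<And>v. valid v v \<Longrightarrow> c0 v f = w 0"
      using ex_Hom0[of "\<lambda>_. w 0"] by metis
    have "c0 i f = c0 (i + wl a) f" if "valid i (i + wl a)" for a i
    proof -
      have "valid i i" "valid (i + wl a) (i + wl a)" using that by (auto simp: valid_def)
      then show ?thesis by (simp only: f(3))
    qed
    then have "f \<in> hom_cocycles E.R Pr \<delta> E.M 0" unfolding cocycle0[OF f(1,2)] by blast
    then show ?thesis using f(3)[OF v] by (intro bexI[of _ f]) auto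
  qed
  fix f assume f: "f \<in> hom_cocycles E.R Pr \<delta> E.M 0"
  note f' = cocycleD[OF f]
  have "f = (\<lambda>x\<in>carrier (Pr 0). \<zero>\<^bsub>B\<^esub>)" if "c0 1 f = 0"
  proof (rule extensionalityI)
    fix x assume x: "x \<in> carrier (Pr 0)"
    have "f (u 0 t) = \<zero>\<^bsub>B\<^esub>" if t: "t \<in> T 0" for t
    proof -
      obtain v where v: "t = 2 * v" "valid v v" using t by (rule T_0E)
      have "c0 v f = 0" using vertex_constant[of "\<lambda>v. c0 v f", OF _ v(2)] f f' \<open>c0 1 f = 0\<close> by (simp add: cocycle0)
      then show ?thesis using Hom0_val[of f v] f' v Mu_I[OF I.zero_closed] by (simp add: vx_def)
    qed
    then show "f x = (\<lambda>x\<in>carrier (Pr 0). \<zero>\<^bsub>B\<^esub>) x" using Hom_eqI[OF _ zero_Hom _ x] f' x by auto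
  qed (use f' in auto)
  moreover have "c0 1 (\<lambda>x\<in>carrier (Pr 0). \<zero>\<^bsub>B\<^esub>) = 0"
    unfolding c0_def using u_closed[of 0] by (intro coord_zero T_iff(1)[THEN iffD2, OF v] lf_co) simp_all
  ultimately show "(\<forall>j<(1::nat). c0 1 f = 0) \<longleftrightarrow> f \<in> hom_coboundaries E.R Pr \<delta> E.M 0"
    unfolding all_less_1 by (auto simp: hom_coboundaries_0)
qed

section \<open>Degree one\<close>

lemma cocycle1:
  assumes f: "f \<in> Hom 1" "f \<in> extensional (carrier (Pr 1))"
  shows "f \<in> hom_cocycles E.R Pr \<delta> E.M 1 \<longleftrightarrow> (\<forall>j<N. cv f j + cv f (C.\<sigma> j) = 0 \<and> \<alpha> * cv f j = 0)"
proof -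
  have "f (\<delta> 1 (u 2 (rx (j < m) (st j)))) = \<zero>\<^bsub>B\<^esub> \<longleftrightarrow> cv f j + cv f (C.\<sigma> j) = 0 \<and> \<alpha> * cv f j = 0" if j: "j < N" for j
  proof -
    have "pj j (\<lambda>x. f (\<delta> 1 x)) = pj j (\<lambda>x. \<zero>\<^bsub>B\<^esub>) \<longleftrightarrow> cv f j + cv f (C.\<sigma> j) = 0"
      "qj j (\<lambda>x. f (\<delta> 1 x)) = qj j (\<lambda>x. \<zero>\<^bsub>B\<^esub>) \<longleftrightarrow> \<alpha> * cv f j = 0"
      using \<beta> by (simp_all only: \<delta>1_coords[OF f(1) j] zero_coords(2,3)[OF j] minus_mult_left[symmetric] neg_equal_0_iff_equal mult_eq_0_iff simp_thms)
    moreover have "ec (st j) (\<lambda>x. f (\<delta> 1 x)) = ec (st j) (\<lambda>x. \<zero>\<^bsub>B\<^esub>)" if "\<not> j < m"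
      using st_valid[OF j] that by (simp add: ec_\<delta>1[OF f(1)] zero_coords(4))
    ultimately show ?thesis
      using Hom2_eq_iff[OF \<delta>1_comp[OF f(1)] zero_Hom st_valid[OF j]] unfolding pj_def qj_def by blast
  qed
  then show ?thesis unfolding cocycle_iff[OF f] Suc_simps ball_T2 by auto
qed

lemma coboundary1:
  assumes f: "f \<in> Hom 1" "f \<in> extensional (carrier (Pr 1))"
  shows "f \<in> hom_coboundaries E.R Pr \<delta> E.M 1 \<longleftrightarrow>
    (\<exists>w. \<forall>a i. valid i (i + wl a) \<longrightarrow> c1 a i f = w i - w (i + wl a))"
proof -
  have eq: "f (ua a i) = h (\<delta> 0 (ua a i)) \<longleftrightarrow> c1 a i f = c0 i h - c0 (i + wl a) h"
    if "h \<in> Hom 0" "valid i (i + wl a)" for h a i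
    using Hom1_eq_iff[OF f(1) \<delta>0_comp[OF that(1)] that(2)] that by (simp add: c1_\<delta>0)
  have "f \<in> hom_coboundaries E.R Pr \<delta> E.M 1 \<longleftrightarrow>
    (\<exists>h\<in>Hom 0. \<forall>a i. valid i (i + wl a) \<longrightarrow> f (ua a i) = h (\<delta> 0 (ua a i)))"
    using coboundary_iff[of f 0] f unfolding Suc_simps ball_T1 ua_def by blast
  also have "\<dots> \<longleftrightarrow> (\<exists>h\<in>Hom 0. \<forall>a i. valid i (i + wl a) \<longrightarrow> c1 a i f = c0 i h - c0 (i + wl a) h)"
    using eq by (intro bex_cong refl) blast
  also have "\<dots> \<longleftrightarrow> (\<exists>w. \<forall>a i. valid i (i + wl a) \<longrightarrow> c1 a i f = w i - w (i + wl a))"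
  proof
    assume "\<exists>w. \<forall>a i. valid i (i + wl a) \<longrightarrow> c1 a i f = w i - w (i + wl a)"
    then obtain w where w: "\<And>a i. valid i (i + wl a) \<Longrightarrow> c1 a i f = w i - w (i + wl a)" by auto
    obtain h where h: "h \<in> Hom 0" "\<And>v. valid v v \<Longrightarrow> c0 v h = w v" using ex_Hom0[of w] by metis
    have "valid i i \<and> valid (i + wl a) (i + wl a)" if "valid i (i + wl a)" for a i
      using that by (auto simp: valid_def)
    then show "\<exists>h\<in>Hom 0. \<forall>a i. valid i (i + wl a) \<longrightarrow> c1 a i f = c0 i h - c0 (i + wl a) h"
      using w h by (intro bexI[of _ h]) simp_all
  qed auto
  finally show ?thesis .
qed

lemma all_gen: "(\<forall>a i. valid i (i + wl a) \<longrightarrow> \<Phi> a i) \<longleftrightarrow>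
    (\<forall>i. 1 \<le> i \<and> i \<le> N + m \<longrightarrow> \<Phi> X i) \<and> (\<forall>i. 1 \<le> i \<and> i \<le> N + n \<longrightarrow> \<Phi> Y i)"
proof -
  have "(\<forall>a. \<Psi> a) \<longleftrightarrow> \<Psi> X \<and> \<Psi> Y" for \<Psi> by (metis gen.exhaust)
  then show ?thesis by (simp add: arrow_valid)
qed

lemma potential:
  fixes a b :: "nat \<Rightarrow> 'k"
  assumes flat: "\<And>i. 1 \<le> i \<Longrightarrow> i \<le> N \<Longrightarrow> a i + b (i + n) - b i - a (i + m) = 0"
    and hol: "(\<Sum>i<m. a (i + 1)) = (\<Sum>i<n. b (i + 1))"
  shows "\<exists>w. (\<forall>i. 1 \<le> i \<and> i \<le> N + m \<longrightarrow> a i = w i - w (i + n)) \<and> (\<forall>i. 1 \<le> i \<and> i \<le> N + n \<longrightarrow> b i = w i - w (i + m))"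
proof -
  \<comment> \<open>The increment of the potential along one step of the cycle: minus the scalar of
    an arrow x, or plus that of an arrow y traversed backwards.\<close>
  define g where "g j = (if j < m then - a (j + 1) else b (j + 1 - m))" for j
  have "(\<Sum>j<m + n. g j) = (\<Sum>i<m. g i) + (\<Sum>i<n. g (m + i))" by (rule sum_lessThan_add)
  also have "\<dots> = 0" by (simp add: g_def sum_negf flip: hol)
  finally have "(\<Sum>j<N. g j) = 0" by (simp add: add.commute)
  then obtain z where z: "\<And>j. j < N \<Longrightarrow> z (C.\<sigma> j) = g j + z j" by (metis C.solve_sum_zero)
  \<comment> \<open>On the first \<open>N\<close> vertices this is \<open>z\<close> shifted by one,
    since vertices start at 1.\<close>
  obtain w where w: "\<And>x. w x = (if x \<le> N then z (x - 1) else w (x - n) + - a (x - n))"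
    using periodic_extension[of n N "\<lambda>x. z (x - 1)" "\<lambda>x. - a (x - n)"] nm by auto
  have low: "w x = z (x - 1)" if "x \<le> N" for x using w[of x] that by simp
  have A: "a i = w i - w (i + n)" if i: "1 \<le> i" "i \<le> N + m" for i
  proof (cases "i \<le> m")
    case True
    have j: "i - 1 < m" "i - 1 < N" "i - 1 + 1 = i" "i - 1 + n = i + n - 1" using True i by linarith+
    have "z (i + n - 1) = - a i + z (i - 1)"
      using z[OF j(2)] unfolding g_def if_P[OF j(1)] \<sigma>_split(1)[OF j(1)] j(3,4) .
    then show ?thesis using low[of i] low[of "i + n"] True by simp
  next
    case False
    then show ?thesis using w[of "i + n"] by simp
  qed
  have Bn: "b i = w i - w (i + m)" if i: "1 \<le> i" "i \<le> n" for i
  proof -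
    have j: "\<not> i + m - 1 < m" "i + m - 1 < N" "m \<le> i + m - 1" "i + m - 1 + 1 - m = i" "i + m - 1 - m = i - 1"
      using i nm by linarith+
    have "z (i - 1) = b i + z (i + m - 1)"
      using z[OF j(2)] unfolding g_def if_not_P[OF j(1)] \<sigma>_split(2)[OF j(3,2)] j(4,5) .
    then show ?thesis using low[of i] low[of "i + m"] i by simp
  qed
  \<comment> \<open>Flatness of the square at \<open>i - n\<close> carries the formula from
    \<open>i - n\<close> to \<open>i\<close>.\<close>
  have Bb: "b i = w i - w (i + m)" if "1 \<le> i" "i \<le> N + n" for i
    using that
  proof (induction i rule: less_induct)
    case (less i)
    show ?case
    proof (cases "i \<le> n")
      case False
      define d where "d = i - n"
      have d: "i = d + n" "1 \<le> d" "d \<le> N" "d < i" using False less.prems nm by (auto simp: d_def)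
      have "b d = w d - w (d + m)" using less.IH[of d] d by simp
      moreover have "a d = w d - w (d + n)" "a (d + m) = w (d + m) - w (d + m + n)" using A[of d] A[of "d + m"] d by simp_all
      moreover have "b (d + n) = b d + a (d + m) - a d" using flat[OF d(2,3)] by (simp add: algebra_simps)
      ultimately have "b (d + n) = (w d - w (d + m)) + (w (d + m) - w (d + m + n)) - (w d - w (d + n))" by simp
      then show ?thesis unfolding d(1) by (simp add: algebra_simps)
    qed (use Bn less in auto)
  qed
  show ?thesis using A Bb by (intro exI[of _ w]) auto
qed

lemma coboundary1_iff:
  assumes f: "f \<in> Hom 1" "f \<in> extensional (carrier (Pr 1))"
  shows "f \<in> hom_coboundaries E.R Pr \<delta> E.M 1 \<longleftrightarrow> (\<forall>j<N. cv f j = 0) \<and> hs f = 0"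
  unfolding coboundary1[OF f] all_gen gen.case
proof
  assume "\<exists>w. (\<forall>i. 1 \<le> i \<and> i \<le> N + m \<longrightarrow> c1 X i f = w i - w (i + n)) \<and> (\<forall>i. 1 \<le> i \<and> i \<le> N + n \<longrightarrow> c1 Y i f = w i - w (i + m))"
  then obtain w where w: "\<And>i. 1 \<le> i \<Longrightarrow> i \<le> N + m \<Longrightarrow> c1 X i f = w i - w (i + n)"
    "\<And>i. 1 \<le> i \<Longrightarrow> i \<le> N + n \<Longrightarrow> c1 Y i f = w i - w (i + m)" by auto
  have "cv f j = 0" if "j < N" for j using that by (simp add: cv_def w) (simp add: add_ac)
  moreover have "hs f = 0"
  proof -
    let ?w = "\<lambda>i. w (i + 1)"
    have "hs f = (\<Sum>i<m. ?w i) - (\<Sum>i<m. ?w (n + i)) - ((\<Sum>i<n. ?w i) - (\<Sum>i<n. ?w (m + i)))"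
      by (simp add: hs_def w sum_subtractf add_ac)
    moreover have "p - q - (r - s) = 0" if "r + q = p + s" for p q r s :: 'k using that by (simp add: algebra_simps)
    ultimately show ?thesis
      using sum_lessThan_add[of ?w n m] sum_lessThan_add[of ?w m n] unfolding add.commute[of n m] by metis
  qed
  ultimately show "(\<forall>j<N. cv f j = 0) \<and> hs f = 0" by simp
next
  assume *: "(\<forall>j<N. cv f j = 0) \<and> hs f = 0"
  show "\<exists>w. (\<forall>i. 1 \<le> i \<and> i \<le> N + m \<longrightarrow> c1 X i f = w i - w (i + n)) \<and> (\<forall>i. 1 \<le> i \<and> i \<le> N + n \<longrightarrow> c1 Y i f = w i - w (i + m))"
  proof (rule potential)
    fix i assume i: "1 \<le> i" "i \<le> N"
    then have "i = i - 1 + 1" "i - 1 < N" by simp_all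
    then show "c1 X i f + c1 Y (i + n) f - c1 Y i f - c1 X (i + m) f = 0" using * cv_def[of f "i - 1"] by metis
  qed (use * in \<open>simp add: hs_def\<close>)
qed

text \<open>The witness vanishes on arrows y and is a constant plus an alternating term on arrows x.
  The constant governs the holonomy, the alternating term the curvature.\<close>

lemma ex_cocycle1:
  assumes "y = 0 \<or> \<alpha> = 0 \<and> even N"
  shows "\<exists>f\<in>hom_cocycles E.R Pr \<delta> E.M 1. hs f = x \<and> cv f 0 = y"
proof -
  \<comment> \<open>For odd \<open>m\<close> the alternating term has curvature
    \<open>- (2 * l * (- 1) ^ j)\<close>, which equals \<open>y\<close> at 0.\<close>
  define l where "l = - y / 2"
  \<comment> \<open>When \<open>l\<close> is nonzero, \<open>m\<close> is odd and the alternating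
    term contributes \<open>- l\<close> to the holonomy; in all cases the sum over \<open>m\<close>
    arrows becomes \<open>x\<close>.\<close>
  define \<mu> where "\<mu> = (x + l) / of_nat m"
  obtain f where f: "f \<in> Hom 1" "f \<in> extensional (carrier (Pr 1))"
    "\<And>a i. valid i (i + wl a) \<Longrightarrow> c1 a i f = (case a of X \<Rightarrow> \<mu> + l * (- 1) ^ i | Y \<Rightarrow> 0)"
    using ex_Hom1[of "\<lambda>a i. case a of X \<Rightarrow> \<mu> + l * (- 1) ^ i | Y \<Rightarrow> 0"] by metis
  have fX: "c1 X i f = \<mu> + l * (- 1) ^ i" if "1 \<le> i" "i \<le> N + m" for i using f(3)[of i X] that by (simp add: arrow_valid)
  have fY: "c1 Y i f = 0" if "1 \<le> i" "i \<le> N + n" for i using f(3)[of i Y] that by (simp add: arrow_valid)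
  have l: "l = 0 \<or> \<alpha> = 0 \<and> even N \<and> odd m" using assms C.parity(1) by (auto simp: l_def)
  have cv: "cv f j = - (2 * l * (- 1) ^ j)" if "j < N" for j
    using l that by (auto simp: cv_def fX fY power_add)
  have "cv f j + cv f (C.\<sigma> j) = 0" if "j < N" for j
    using l that C.parity(3)[of j] by (auto simp: cv minus_one_power_iff)
  moreover have "\<alpha> * cv f j = 0" if "j < N" for j using l that by (auto simp: cv)
  ultimately have "f \<in> hom_cocycles E.R Pr \<delta> E.M 1" by (simp add: cocycle1[OF f(1,2)])
  moreover have "hs f = x"
  proof -
    have s: "(\<Sum>i<k. (- 1) ^ (i + 1)) = (if odd k then - 1 else 0 :: 'k)" for k
      by (induction k) (auto simp: minus_one_power_iff)
    have "hs f = (\<Sum>i<m. \<mu> + l * (- 1) ^ (i + 1))" by (simp add: hs_def fX fY)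
    also have "\<dots> = of_nat m * \<mu> + l * (\<Sum>i<m. (- 1) ^ (i + 1))" by (simp only: sum.distrib sum_distrib_left sum_constant card_lessThan)
    also have "\<dots> = of_nat m * \<mu> - l" unfolding s using l by auto
    also have "\<dots> = x" using nm by (simp add: \<mu>_def)
    finally show ?thesis .
  qed
  moreover have "cv f 0 = y" using cv[of 0] nm by (simp add: l_def)
  ultimately show ?thesis by blast
qed

text \<open>Either \<alpha> or the parity of the cycle forces the curvature of a cocycle to vanish,
  and only the holonomy remains.\<close>

lemma HH1_one:
  assumes "odd N \<or> \<alpha> \<noteq> 0"
  shows "has_dim (HH 1 B) 1"
proof (rule coordsI[where \<psi> = "\<lambda>_. hs" and k = 1])
  show "\<exists>f\<in>hom_cocycles E.R Pr \<delta> E.M 1. \<forall>j<(1::nat). hs f = v j" for v :: "nat \<Rightarrow> 'k"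
    using ex_cocycle1[of 0 "v 0"] by auto
  fix f assume f: "f \<in> hom_cocycles E.R Pr \<delta> E.M 1"
  note f' = cocycleD[OF f, THEN conjunct1] cocycleD[OF f, THEN conjunct2]
  have z: "cv f j + cv f (C.\<sigma> j) = 0" "\<alpha> * cv f j = 0" if "j < N" for j
    using f that unfolding cocycle1[OF f'] by blast+
  have "cv f j = 0" if j: "j < N" for j
  proof (cases "\<alpha> = 0")
    case True
    then show ?thesis using C.cycle_alternating[of "cv f", OF z(1) _ j] assms by blast
  qed (use z(2)[OF j] in simp)
  then show "(\<forall>j<(1::nat). hs f = 0) \<longleftrightarrow> f \<in> hom_coboundaries E.R Pr \<delta> E.M 1"
    unfolding all_less_1 by (auto simp: coboundary1_iff[OF f'])
qed (simp_all add: hs_lin)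

text \<open>The curvature of a cocycle may now be any multiple of the alternating function, so its
  value at 0 is a second coordinate next to the holonomy.\<close>

lemma HH1_two:
  assumes N: "even N" and \<alpha>: "\<alpha> = 0"
  shows "has_dim (HH 1 B) 2"
proof (rule coordsI[where \<psi> = "\<lambda>j f. if j = 0 then hs f else cv f 0" and k = 1])
  show "\<exists>f\<in>hom_cocycles E.R Pr \<delta> E.M 1. \<forall>j<2. (if j = 0 then hs f else cv f 0) = v j" for v :: "nat \<Rightarrow> 'k"
  proof -
    obtain f where "f \<in> hom_cocycles E.R Pr \<delta> E.M 1" "hs f = v 0" "cv f 0 = v 1"
      using ex_cocycle1[of "v 1" "v 0"] N \<alpha> by blast
    then show ?thesis by (intro bexI[of _ f]) (auto simp: less_Suc_eq numeral_2_eq_2 One_nat_def)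
  qed
  fix f assume f: "f \<in> hom_cocycles E.R Pr \<delta> E.M 1"
  note f' = cocycleD[OF f, THEN conjunct1] cocycleD[OF f, THEN conjunct2]
  have "cv f j + cv f (C.\<sigma> j) = 0" if "j < N" for j using f that by (simp add: cocycle1[OF f'])
  then have "cv f 0 = 0 \<longleftrightarrow> (\<forall>j<N. cv f j = 0)" using C.cycle_alternating[of "cv f"] C.N by blast
  then show "(\<forall>j<(2::nat). (if j = 0 then hs f else cv f 0) = 0) \<longleftrightarrow> f \<in> hom_coboundaries E.R Pr \<delta> E.M 1"
    by (auto simp: coboundary1_iff[OF f'] less_2_cases_iff)
qed (use C.N in \<open>auto simp: hs_lin cv_lin\<close>)

section \<open>Degree two and higher\<close>

text \<open>Every function is a curvature: with zero on the arrows y, the condition becomes a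
  recursion of step \<open>m\<close> for the scalars of the arrows x.\<close>

lemma ex_cv:
  fixes c :: "nat \<Rightarrow> 'k"
  obtains h where "h \<in> Hom 1" "\<And>j. j < N \<Longrightarrow> cv h j = c j"
proof -
  obtain a where a: "\<And>x. a x = (if x \<le> m then 0 else a (x - m) + - c (x - m - 1))"
    using periodic_extension[of m m "\<lambda>x. 0" "\<lambda>x. - c (x - m - 1)"] nm by auto
  obtain h where h: "h \<in> Hom 1" "\<And>b i. valid i (i + wl b) \<Longrightarrow> c1 b i h = (case b of X \<Rightarrow> a i | Y \<Rightarrow> 0)"
    using ex_Hom1[of "\<lambda>b i. case b of X \<Rightarrow> a i | Y \<Rightarrow> 0"] by metis
  have hX: "c1 X i h = a i" if "1 \<le> i" "i \<le> N + m" for i using h(2)[of i X] that by (simp add: arrow_valid)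
  have hY: "c1 Y i h = 0" if "1 \<le> i" "i \<le> N + n" for i using h(2)[of i Y] that by (simp add: arrow_valid)
  have "cv h j = c j" if "j < N" for j
    using that a[of "j + 1 + m"] by (simp add: cv_def hX hY)
  then show ?thesis using that h(1) by blast
qed

lemma coboundary2:
  assumes f: "f \<in> Hom 2" "f \<in> extensional (carrier (Pr 2))"
  shows "f \<in> hom_coboundaries E.R Pr \<delta> E.M 2 \<longleftrightarrow>
    (\<exists>c. \<forall>j<N. pj j f = - \<beta> * (c j + c (C.\<sigma> j)) \<and> qj j f = - \<alpha> * c j) \<and>
    (n = 2 \<longrightarrow> ec 1 f = 0 \<and> ec 2 f = 0)" (is "_ \<longleftrightarrow> ?P \<and> ?E")
proof -
  have eq: "f (u 2 (rx (j < m) (st j))) = h (\<delta> 1 (u 2 (rx (j < m) (st j)))) \<longleftrightarrow>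
      pj j f = - \<beta> * (cv h j + cv h (C.\<sigma> j)) \<and> qj j f = - \<alpha> * cv h j \<and> (\<not> j < m \<and> n = 2 \<longrightarrow> ec (st j) f = 0)"
    if h: "h \<in> Hom 1" and j: "j < N" for h j
  proof -
    have "ec (st j) (\<lambda>x. h (\<delta> 1 x)) = 0" if "\<not> j < m" using st_valid[OF j] that by (simp add: ec_\<delta>1[OF h])
    then show ?thesis
      using Hom2_eq_iff[OF f(1) \<delta>1_comp[OF h] st_valid[OF j]] \<delta>1_coords[OF h j] unfolding pj_def qj_def by auto
  qed
  \<comment> \<open>There are \<open>n\<close> relations of degree n + 2m; for \<open>n = 2\<close>
    they start at the vertices 1 and 2.\<close>
  have E: "(\<forall>j<N. \<not> j < m \<and> n = 2 \<longrightarrow> ec (st j) f = 0) \<longleftrightarrow> ?E"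
  proof -
    have "(\<forall>j<N. \<not> j < m \<longrightarrow> ec (st j) f = 0) \<longleftrightarrow> ec 1 f = 0 \<and> ec 2 f = 0" if n: "n = 2"
    proof -
      have "j = m \<or> j = m + 1" if "j < N" "\<not> j < m" for j using that n by linarith
      moreover have "st m = 1" "st (m + 1) = 2" "m < N" "m + 1 < N" using n by (simp_all add: st_def)
      ultimately show ?thesis by (metis not_add_less1 less_irrefl)
    qed
    then show ?thesis by blast
  qed
  have "f \<in> hom_coboundaries E.R Pr \<delta> E.M 2 \<longleftrightarrow>
    (\<exists>h\<in>Hom 1. \<forall>j<N. f (u 2 (rx (j < m) (st j))) = h (\<delta> 1 (u 2 (rx (j < m) (st j)))))"
    using coboundary_iff[of f 1] f unfolding Suc_simps ball_T2 by blast
  also have "\<dots> \<longleftrightarrow> (\<exists>h\<in>Hom 1. \<forall>j<N. pj j f = - \<beta> * (cv h j + cv h (C.\<sigma> j)) \<and> qj j f = - \<alpha> * cv h j) \<and> ?E"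
    unfolding E[symmetric] using eq by blast
  also have "(\<exists>h\<in>Hom 1. \<forall>j<N. pj j f = - \<beta> * (cv h j + cv h (C.\<sigma> j)) \<and> qj j f = - \<alpha> * cv h j) \<longleftrightarrow> ?P"
  proof
    assume ?P
    then obtain c where c: "\<And>j. j < N \<Longrightarrow> pj j f = - \<beta> * (c j + c (C.\<sigma> j)) \<and> qj j f = - \<alpha> * c j" by auto
    obtain h where h: "h \<in> Hom 1" "\<And>j. j < N \<Longrightarrow> cv h j = c j" using ex_cv by metis
    then show "\<exists>h\<in>Hom 1. \<forall>j<N. pj j f = - \<beta> * (cv h j + cv h (C.\<sigma> j)) \<and> qj j f = - \<alpha> * cv h j"
      using c by (intro bexI[of _ h]) simp_all
  qed blast
  finally show ?thesis .
qed

text \<open>The obstruction left after eliminating the curvature. For nonzero \<alpha> the value of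
  \<open>qj\<close> determines the curvature and this is the defect in the other equation; for
  \<alpha> = 0 no coboundary reaches \<open>qj\<close>.\<close>

definition rj where
  "rj j f = (if \<alpha> = 0 then qj j f else pj j f - \<beta> / \<alpha> * (qj j f + qj (C.\<sigma> j) f))"

lemma rj_lin:
  assumes "j < N" "f \<in> Hom 2"
  shows "g \<in> Hom 2 \<Longrightarrow> rj j (f \<oplus>\<^bsub>HS 2\<^esub> g) = rj j f + rj j g" "rj j (c \<odot>\<^bsub>HS 2\<^esub> f) = c * rj j f"
proof -
  note lin = rel_lin[OF assms] rel_lin[OF C.\<sigma>_less[of j] assms(2)]
  define \<kappa> where "\<kappa> = \<beta> / \<alpha>"
  show "g \<in> Hom 2 \<Longrightarrow> rj j (f \<oplus>\<^bsub>HS 2\<^esub> g) = rj j f + rj j g" "rj j (c \<odot>\<^bsub>HS 2\<^esub> f) = c * rj j f"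
    unfolding rj_def \<kappa>_def[symmetric] using lin by (auto simp: algebra_simps)
qed

text \<open>The pairing with the alternating function, which for even \<open>N\<close> detects the
  cokernel of one plus \<open>C.\<sigma>\<close>.\<close>

definition alt where "alt f = (\<Sum>j<N. (- 1) ^ j * pj j f)"

lemma alt_lin:
  assumes "f \<in> Hom 2"
  shows "g \<in> Hom 2 \<Longrightarrow> alt (f \<oplus>\<^bsub>HS 2\<^esub> g) = alt f + alt g" "alt (c \<odot>\<^bsub>HS 2\<^esub> f) = c * alt f"
  unfolding alt_def using assms
  by (simp_all add: rel_lin sum.distrib sum_distrib_left distrib_left mult.left_commute)

text \<open>For nonzero \<alpha> the second equation determines \<open>c\<close>, and substituting
  it into the first leaves \<open>rj\<close>. For \<alpha> = 0 the first equation remains to be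
  solved on the cycle; for odd \<open>N\<close> this always succeeds, for even \<open>N\<close>
  exactly when the alternating sum vanishes.\<close>

lemma solvable:
  "(\<exists>c. \<forall>j<N. pj j f = - \<beta> * (c j + c (C.\<sigma> j)) \<and> qj j f = - \<alpha> * c j) \<longleftrightarrow>
    (\<forall>j<N. rj j f = 0) \<and> (\<alpha> = 0 \<and> even N \<longrightarrow> alt f = 0)" (is "?L \<longleftrightarrow> ?R")
proof (cases "\<alpha> = 0")
  case False
  show ?thesis
  proof
    assume ?L
    then obtain c where c: "\<And>j. j < N \<Longrightarrow> pj j f = - \<beta> * (c j + c (C.\<sigma> j))"
      "\<And>j. j < N \<Longrightarrow> qj j f = - \<alpha> * c j" by auto
    have "rj j f = 0" if "j < N" for j
      unfolding rj_def c(1)[OF that] c(2)[OF that] c(2)[OF C.\<sigma>_less] using False by (simp add: field_simps)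
    then show ?R using False by simp
  next
    assume ?R
    then show ?L using False by (intro exI[of _ "\<lambda>j. - qj j f / \<alpha>"]) (simp add: rj_def field_simps)
  qed
next
  case True
  show ?thesis
  proof
    assume ?L
    then obtain c where c: "\<And>j. j < N \<Longrightarrow> pj j f = - \<beta> * (c j + c (C.\<sigma> j)) \<and> qj j f = - \<alpha> * c j" by auto
    have "alt f = - \<beta> * (\<Sum>j<N. (- 1) ^ j * (c j + c (C.\<sigma> j)))"
      unfolding alt_def sum_distrib_left by (rule sum.cong) (simp_all add: c mult_ac)
    then have "even N \<longrightarrow> alt f = 0" using C.alternating_sum_zero[of c] by simp
    moreover have "rj j f = 0" if "j < N" for j unfolding rj_def using c[OF that] True by simp
    ultimately show ?R by blast
  next
    assume R: ?R
    have "(\<Sum>j<N. (- 1) ^ j * (pj j f / - \<beta>)) = alt f / - \<beta>"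
      unfolding alt_def sum_divide_distrib by (rule sum.cong) simp_all
    then have "\<exists>c. \<forall>j<N. c j + c (C.\<sigma> j) = pj j f / - \<beta>"
      using R True C.solve_odd[of "\<lambda>j. pj j f / - \<beta>"] C.solve_even[of "\<lambda>j. pj j f / - \<beta>"] by (cases "even N") (simp, metis)+
    then obtain c where "\<And>j. j < N \<Longrightarrow> c j + c (C.\<sigma> j) = pj j f / - \<beta>" by auto
    moreover have "qj j f = 0" if "j < N" for j using R True that unfolding rj_def by simp
    ultimately show ?L using True \<beta> by (intro exI[of _ c]) simp
  qed
qed

text \<open>There are no 3-cochains, so every 2-cochain is a cocycle. The coordinates are the
  \<open>N\<close> obstructions \<open>rj\<close>, followed by the coefficients at x^(m+1) or by the
  alternating sum.\<close>

lemma HH2: "has_dim (HH 2 B) (N + (if n = 2 then 2 else if \<alpha> = 0 \<and> even N then 1 else 0))"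
proof (rule coordsI[where \<psi> = "\<lambda>j f. if j < N then rj j f else if n = 2 then ec (j - N + 1) f else alt f" and k = 2])
  let ?D = "N + (if n = 2 then 2 else if \<alpha> = 0 \<and> even N then 1 else 0)"
  let ?\<psi> = "\<lambda>j f. if j < N then rj j f else if n = 2 then ec (j - N + 1) f else alt f"
  \<comment> \<open>The surplus indices \<open>N\<close> and \<open>N + 1\<close> stand for the
    relations starting at the vertices 1 and 2, hence the shift by one.\<close>
  have ev: "valid (j - N + 1) (j - N + 1 + rw False)" if "j < ?D" "\<not> j < N" "n = 2" for j
    unfolding valid_def \<L>_def rw_def using that by auto
  show "?\<psi> j (f \<oplus>\<^bsub>HS 2\<^esub> g) = ?\<psi> j f + ?\<psi> j g" if "j < ?D" "f \<in> Hom 2" "g \<in> Hom 2" for j f g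
    using that ec_lin(1)[OF ev[OF that(1)] that(2,3)]
    by (simp add: rj_lin alt_lin)
  show "?\<psi> j (c \<odot>\<^bsub>HS 2\<^esub> f) = c * ?\<psi> j f" if "j < ?D" "f \<in> Hom 2" for j f c
    using that ec_lin(2)[OF ev[OF that(1)] that(2)]
    by (simp add: rj_lin alt_lin)
  \<comment> \<open>This keeps the alternating sum and the coefficients at x^(m+1) from being
    required together.\<close>
  have odd: "odd N" if "n = 2" using C.parity(1) that by auto
  show "\<exists>f\<in>hom_cocycles E.R Pr \<delta> E.M 2. \<forall>j<?D. ?\<psi> j f = v j" for v :: "nat \<Rightarrow> 'k"
  proof -
    \<comment> \<open>For \<alpha> = 0 the values are placed in \<open>qj\<close>, and one entry of
      \<open>pj\<close> at index 0, where the sign is plus, produces the alternating sum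
      \<open>v N\<close>. Otherwise they are placed in \<open>pj\<close>, and \<open>qj\<close> is
      zero.\<close>
    obtain f where f: "f \<in> Hom 2" "f \<in> extensional (carrier (Pr 2))"
      "\<And>j. j < N \<Longrightarrow> pj j f = (if \<alpha> = 0 then if j = 0 then v N else 0 else v j)"
      "\<And>j. j < N \<Longrightarrow> qj j f = (if \<alpha> = 0 then v j else 0)"
      "\<And>i. n = 2 \<Longrightarrow> valid i (i + rw False) \<Longrightarrow> ec i f = v (N + i - 1)"
      by (rule ex_Hom2[where p = "\<lambda>j. if \<alpha> = 0 then if j = 0 then v N else 0 else v j" and
        q = "\<lambda>j. if \<alpha> = 0 then v j else 0" and r = "\<lambda>i. v (N + i - 1)"]; rule that; blast)
    have Z: "f \<in> hom_cocycles E.R Pr \<delta> E.M 2" using cocycle_iff[OF f(1,2)] by (simp add: T_empty)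
    have alt: "alt f = v N" if "\<alpha> = 0"
    proof -
      have "alt f = (\<Sum>j<N. if j = 0 then v N else 0)" unfolding alt_def by (rule sum.cong) (use that f(3) in auto)
      then show ?thesis using C.N by simp
    qed
    have rj: "rj j f = v j" if "j < N" for j
      unfolding rj_def f(3,4)[OF that] f(4)[OF C.\<sigma>_less] by simp
    have ec: "ec (j - N + 1) f = v j" if "j < ?D" "\<not> j < N" "n = 2" for j
      using f(5)[OF that(3) ev[OF that]] that by simp
    have jN: "j = N \<and> \<alpha> = 0" if "j < ?D" "\<not> j < N" "n \<noteq> 2" for j using that by (auto split: if_splits)
    have "?\<psi> j f = v j" if j: "j < ?D" for j
    proof (cases "j < N")
      case False
      then show ?thesis using ec[OF j False] jN[OF j False] alt by (cases "n = 2") simp_all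
    qed (simp add: rj)
    then show ?thesis using Z by blast
  qed
  fix f assume f: "f \<in> hom_cocycles E.R Pr \<delta> E.M 2"
  note f' = cocycleD[OF f, THEN conjunct1] cocycleD[OF f, THEN conjunct2]
  have "(\<forall>j<N + d. ?\<psi> j f = 0) \<longleftrightarrow> (\<forall>j<N. rj j f = 0) \<and> (\<forall>i<d. if n = 2 then ec (i + 1) f = 0 else alt f = 0)" for d
  proof
    assume *: "\<forall>j<N + d. ?\<psi> j f = 0"
    have "if n = 2 then ec (i + 1) f = 0 else alt f = 0" if "i < d" for i
      using *[rule_format, of "N + i"] that by auto
    moreover have "rj j f = 0" if "j < N" for j using *[rule_format, of j] that by auto
    ultimately show "(\<forall>j<N. rj j f = 0) \<and> (\<forall>i<d. if n = 2 then ec (i + 1) f = 0 else alt f = 0)" by blast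
  next
    assume *: "(\<forall>j<N. rj j f = 0) \<and> (\<forall>i<d. if n = 2 then ec (i + 1) f = 0 else alt f = 0)"
    show "\<forall>j<N + d. ?\<psi> j f = 0"
    proof (intro allI impI)
      fix j assume "j < N + d"
      then have "j < N \<or> j - N < d" by linarith
      then show "?\<psi> j f = 0" using * by auto
    qed
  qed
  then have "(\<forall>j<?D. ?\<psi> j f = 0) \<longleftrightarrow> (\<forall>j<N. rj j f = 0) \<and>
    (\<forall>i<(if n = 2 then 2 else if \<alpha> = 0 \<and> even N then 1 else 0). if n = 2 then ec (i + 1) f = 0 else alt f = 0)" .
  also have "(\<forall>i<(if n = 2 then 2 else if \<alpha> = 0 \<and> even N then 1 else 0). if n = 2 then ec (i + 1) f = 0 else alt f = 0) \<longleftrightarrow>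
    (\<alpha> = 0 \<and> even N \<longrightarrow> alt f = 0) \<and> (n = 2 \<longrightarrow> ec 1 f = 0 \<and> ec 2 f = 0)"
  proof (cases "n = 2")
    case True
    have "(\<forall>i<2. ec (i + 1) f = 0) \<longleftrightarrow> ec 1 f = 0 \<and> ec 2 f = 0"
      by (auto simp: less_Suc_eq numeral_2_eq_2 One_nat_def)
    then show ?thesis using True odd by simp
  qed auto
  finally show "(\<forall>j<?D. ?\<psi> j f = 0) \<longleftrightarrow> f \<in> hom_coboundaries E.R Pr \<delta> E.M 2"
    unfolding coboundary2[OF f'] solvable by blast
qed

text \<open>The resolution has no generators above degree two, so there are no nonzero
  cochains.\<close>

lemma HH_higher:
  assumes "r \<ge> 3"
  shows "has_dim (HH r B) 0"
proof (rule coordsI[where \<psi> = "\<lambda>_ _. 0" and k = r])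
  have T: "T r = {}" "T (Suc r) = {}" using assms by (simp_all add: T_empty)
  show "\<exists>f\<in>hom_cocycles E.R Pr \<delta> E.M r. \<forall>j<0. 0 = v j" for v :: "nat \<Rightarrow> 'k"
    using cocycle_iff[OF mk(1,2)[of r "\<lambda>_. 0"]] T by auto
  fix f assume f: "f \<in> hom_cocycles E.R Pr \<delta> E.M r"
  obtain k where k: "r = Suc k" using assms by (cases r) auto
  show "(\<forall>j<(0::nat). 0 = (0 :: 'k)) \<longleftrightarrow> f \<in> hom_coboundaries E.R Pr \<delta> E.M r"
    using coboundary_iff[of f k] cocycleD[OF f] T zero_Hom unfolding k by auto
qed auto

end

theorem theorem3p9:
  fixes \<alpha> \<beta> :: "'k :: {alg_closed_field, field_char_0}" and n m :: nat
  assumes "\<beta> \<noteq> 0" and "n > 1" and "m \<ge> n" and "gcd n m = 1"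
  shows "let B = down_up_beilinson \<alpha> \<beta> n m in
    has_dim (HH 0 B) 1 \<and>
    (even (n + m) \<and> \<alpha> = 0 \<longrightarrow> has_dim (HH 1 B) 2) \<and>
    (odd (n + m) \<or> \<alpha> \<noteq> 0 \<longrightarrow> has_dim (HH 1 B) 1) \<and>
    (n = 2 \<and> even (n + m) \<and> \<alpha> = 0 \<longrightarrow> has_dim (HH 2 B) (m + 5)) \<and>
    (n = 2 \<and> (odd (n + m) \<or> \<alpha> \<noteq> 0) \<longrightarrow> has_dim (HH 2 B) (m + 4)) \<and>
    (n \<ge> 3 \<and> even (n + m) \<and> \<alpha> = 0 \<longrightarrow> has_dim (HH 2 B) (n + m + 1)) \<and>
    (n \<ge> 3 \<and> (odd (n + m) \<or> \<alpha> \<noteq> 0) \<longrightarrow> has_dim (HH 2 B) (n + m)) \<and>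
    (\<forall>r\<ge>3. has_dim (HH r B) 0)"
proof -
  interpret down_up \<alpha> \<beta> n m using assms by unfold_locales
  \<comment> \<open>Oddness is carried along because the claim with \<open>m + 5\<close> assumes an
    even sum, which coprimality excludes when \<open>n = 2\<close>.\<close>
  have "has_dim (HH 2 B) (m + 4) \<and> odd (n + m)" if n: "n = 2"
  proof -
    have "n + m + (if n = 2 then 2 else if \<alpha> = 0 \<and> even (n + m) then 1 else 0) = m + 4" using n by simp
    from HH2[unfolded this] show ?thesis using C.parity(1) n by auto
  qed
  moreover have "has_dim (HH 2 B) (n + m + (if \<alpha> = 0 \<and> even (n + m) then 1 else 0))" if "n \<ge> 3"
    using HH2 that by auto
  ultimately show ?thesis
    unfolding Let_def B_def[symmetric] using HH0 HH1_one HH1_two HH_higher by auto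
qed

end
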